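(* Let $K$ be an uncountable algebraically closed field of characteristic $p>0$ and let $R$ be a finitely generated $K$-algebra which is equidimensional. Let $\operatorname{Sing}(R)\subset\operatorname{Max}(R)$ denote the singular locus. Then the function $\operatorname{e}_{HK}:\operatorname{Max}(R)\to\mathbb{R}$ is dense upper semi-continuous on each irreducible component of $\operatorname{Max}(R)$. In particular, $\operatorname{e}_{HK}:\operatorname{Max}(R)\to\mathbb{R}$ is dense upper semi-continuous on each irreducible component of $\operatorname{Sing}(R)$.
   Context: $\operatorname{Max}(R)$ carries the Zariski topology. For a $d$-dimensional Noetherian local ring $(A,\mathfrak m)$ of characteristic $p>0$ and an $\mathfrak m$-primary ideal $I$, $I^{[q]}=(i^q:i\in I)$ for $q=p^e$, and the Hilbert-Kunz multiplicity is $\operatorname{e}_{HK}(I,A)=\lim_{q\to\infty}\lambda(A/I^{[q]})/q^d$, where $\lambda$ is length; $\operatorname{e}_{HK}(A):=\operatorname{e}_{HK}(\mathfrak m,A)$. For a prime $P$ of $R$, $\operatorname{e}_{HK}(P):=\operatorname{e}_{HK}(PR_P,R_P)$. A function $f:T\to\mathbb{R}$ on a topological space $T$ is called dense upper semi-continuous if for every $x\in T$ there is a dense subset $U\subseteq T$ containing $x$ such that $f(y)\le f(x)$ for all $y\in U$. *)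

theory Defs
  imports Complex_Main "HOL-Library.Countable_Set" "HOL-Algebra.Algebraic_Closure"
    "HOL-Algebra.Generated_Rings" "HOL-Algebra.QuotRing"
begin

definition loc_rel :: "('a, 'b) ring_scheme \<Rightarrow> 'a set \<Rightarrow> (('a \<times> 'a) \<times> ('a \<times> 'a)) set" where
  "loc_rel R P = {((a, s), (b, t)). a \<in> carrier R \<and> b \<in> carrier R \<and>
      s \<in> carrier R - P \<and> t \<in> carrier R - P \<and>
      (\<exists>u \<in> carrier R - P. u \<otimes>\<^bsub>R\<^esub> ((a \<otimes>\<^bsub>R\<^esub> t) \<ominus>\<^bsub>R\<^esub> (b \<otimes>\<^bsub>R\<^esub> s)) = \<zero>\<^bsub>R\<^esub>)}"

definition loc_class :: "('a, 'b) ring_scheme \<Rightarrow> 'a set \<Rightarrow> 'a \<Rightarrow> 'a \<Rightarrow> ('a \<times> 'a) set" where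
  "loc_class R P a s = loc_rel R P `` {(a, s)}"

definition loc_mult :: "('a, 'b) ring_scheme \<Rightarrow> 'a set \<Rightarrow> ('a \<times> 'a) set \<Rightarrow> ('a \<times> 'a) set \<Rightarrow> ('a \<times> 'a) set" where
  "loc_mult R P U1 U2 = (let a = fst (SOME x. x \<in> U1); s = snd (SOME x. x \<in> U1);
         b = fst (SOME y. y \<in> U2); t = snd (SOME y. y \<in> U2)
     in loc_class R P (a \<otimes>\<^bsub>R\<^esub> b) (s \<otimes>\<^bsub>R\<^esub> t))"

definition loc_add :: "('a, 'b) ring_scheme \<Rightarrow> 'a set \<Rightarrow> ('a \<times> 'a) set \<Rightarrow> ('a \<times> 'a) set \<Rightarrow> ('a \<times> 'a) set" where
  "loc_add R P U1 U2 = (let a = fst (SOME x. x \<in> U1); s = snd (SOME x. x \<in> U1);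
         b = fst (SOME y. y \<in> U2); t = snd (SOME y. y \<in> U2)
     in loc_class R P ((a \<otimes>\<^bsub>R\<^esub> t) \<oplus>\<^bsub>R\<^esub> (b \<otimes>\<^bsub>R\<^esub> s)) (s \<otimes>\<^bsub>R\<^esub> t))"

definition localization :: "('a, 'b) ring_scheme \<Rightarrow> 'a set \<Rightarrow> (('a \<times> 'a) set) ring" where
  "localization R P =
     \<lparr> carrier = (carrier R \<times> (carrier R - P)) // loc_rel R P,
       monoid.mult = loc_mult R P,
       one = loc_class R P \<one>\<^bsub>R\<^esub> \<one>\<^bsub>R\<^esub>,
       zero = loc_class R P \<zero>\<^bsub>R\<^esub> \<one>\<^bsub>R\<^esub>,
       add = loc_add R P \<rparr>"

definition loc_ext :: "('a, 'b) ring_scheme \<Rightarrow> 'a set \<Rightarrow> 'a set \<Rightarrow> ('a \<times> 'a) set set" where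
  "loc_ext R P I = genideal (localization R P) ((\<lambda>a. loc_class R P a \<one>\<^bsub>R\<^esub>) ` I)"

definition krull_dim :: "('a, 'b) ring_scheme \<Rightarrow> nat" where
  "krull_dim A = Sup {n. \<exists>c :: nat \<Rightarrow> 'a set.
      (\<forall>i\<le>n. primeideal (c i) A) \<and> (\<forall>i<n. c i \<subset> c (Suc i))}"

text \<open>Length of the A-module A/J: supremum of lengths of strict chains of
  submodules of A/J, i.e. of ideals of A between J and A.\<close>
definition quot_length :: "('a, 'b) ring_scheme \<Rightarrow> 'a set \<Rightarrow> nat" where
  "quot_length A J = Sup {n. \<exists>c :: nat \<Rightarrow> 'a set.
      c 0 = J \<and> c n = carrier A \<and> (\<forall>i\<le>n. ideal (c i) A) \<and> (\<forall>i<n. c i \<subset> c (Suc i))}"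

definition frob_power :: "('a, 'b) ring_scheme \<Rightarrow> 'a set \<Rightarrow> nat \<Rightarrow> 'a set" where
  "frob_power A I q = genideal A ((\<lambda>i. i [^]\<^bsub>A\<^esub> q) ` I)"

definition hk_mult :: "('a, 'b) ring_scheme \<Rightarrow> 'a set \<Rightarrow> nat \<Rightarrow> real" where
  "hk_mult A I p = lim (\<lambda>e. real (quot_length A (frob_power A I (p ^ e)))
                             / (real (p ^ e)) ^ krull_dim A)"

definition ehk_at :: "('a, 'b) ring_scheme \<Rightarrow> nat \<Rightarrow> 'a set \<Rightarrow> real" where
  "ehk_at R p P = hk_mult (localization R P) (loc_ext R P P) p"

definition finite_type_alg :: "('k, 'c) ring_scheme \<Rightarrow> ('a, 'b) ring_scheme \<Rightarrow> ('k \<Rightarrow> 'a) \<Rightarrow> bool" where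
  "finite_type_alg K R \<phi> \<longleftrightarrow> \<phi> \<in> ring_hom K R \<and>
     (\<exists>S. finite S \<and> S \<subseteq> carrier R \<and> generate_ring R (\<phi> ` carrier K \<union> S) = carrier R)"

definition minimal_prime :: "('a, 'b) ring_scheme \<Rightarrow> 'a set \<Rightarrow> bool" where
  "minimal_prime R P \<longleftrightarrow> primeideal P R \<and> (\<forall>Q. primeideal Q R \<and> Q \<subseteq> P \<longrightarrow> Q = P)"

definition equidimensional :: "('a, 'b) ring_scheme \<Rightarrow> bool" where
  "equidimensional R \<longleftrightarrow> (\<forall>P Q. minimal_prime R P \<and> minimal_prime R Q \<longrightarrow>
      krull_dim (R Quot P) = krull_dim (R Quot Q))"

definition regular_local :: "('a, 'b) ring_scheme \<Rightarrow> 'a set \<Rightarrow> bool" where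
  "regular_local A M \<longleftrightarrow> (\<exists>S. finite S \<and> S \<subseteq> carrier A \<and> card S \<le> krull_dim A \<and> genideal A S = M)"

definition MaxSpec :: "('a, 'b) ring_scheme \<Rightarrow> 'a set set" where
  "MaxSpec R = {m. maximalideal m R}"

definition Sing :: "('a, 'b) ring_scheme \<Rightarrow> 'a set set" where
  "Sing R = {m \<in> MaxSpec R. \<not> regular_local (localization R m) (loc_ext R m m)}"

definition zclosed :: "('a, 'b) ring_scheme \<Rightarrow> 'a set set \<Rightarrow> bool" where
  "zclosed R Z \<longleftrightarrow> (\<exists>I. I \<subseteq> carrier R \<and> Z = {m \<in> MaxSpec R. I \<subseteq> m})"

definition irreducible_set :: "('x set \<Rightarrow> bool) \<Rightarrow> 'x set \<Rightarrow> bool" where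
  "irreducible_set cl W \<longleftrightarrow> W \<noteq> {} \<and>
     (\<forall>Z1 Z2. cl Z1 \<and> cl Z2 \<and> W \<subseteq> Z1 \<union> Z2 \<longrightarrow> W \<subseteq> Z1 \<or> W \<subseteq> Z2)"

definition irr_component :: "('x set \<Rightarrow> bool) \<Rightarrow> 'x set \<Rightarrow> 'x set \<Rightarrow> bool" where
  "irr_component cl S W \<longleftrightarrow> W \<subseteq> S \<and> irreducible_set cl W \<and>
     (\<forall>W'. W' \<subseteq> S \<and> irreducible_set cl W' \<and> W \<subseteq> W' \<longrightarrow> W' = W)"

definition dense_in :: "('x set \<Rightarrow> bool) \<Rightarrow> 'x set \<Rightarrow> 'x set \<Rightarrow> bool" where
  "dense_in cl W U \<longleftrightarrow> U \<subseteq> W \<and> (\<forall>Z. cl Z \<and> U \<subseteq> Z \<longrightarrow> W \<subseteq> Z)"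

definition dense_usc_on :: "('x set \<Rightarrow> bool) \<Rightarrow> 'x set \<Rightarrow> ('x \<Rightarrow> real) \<Rightarrow> bool" where
  "dense_usc_on cl T f \<longleftrightarrow> (\<forall>x \<in> T. \<exists>U. dense_in cl T U \<and> x \<in> U \<and> (\<forall>y \<in> U. f y \<le> f x))"

end

theory Submission
  imports Defs "HOL-Computational_Algebra.Primes"
begin

text \<open>
  For a closed point \<open>m\<close> the length of \<open>A / m\<^sup>[\<^sup>q\<^sup>]A\<close>, where \<open>A\<close> is the local ring at \<open>m\<close>, is the
  \<open>k\<close>-dimension of \<open>R / m\<^sup>[\<^sup>q\<^sup>]\<close>. This is the fibre dimension at \<open>m\<close> of \<open>R\<close> as a finite module over
  its subring of \<open>q\<close>-th powers, so by Nakayama's lemma it is upper semi-continuous for each fixed \<open>q\<close>.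
  By equidimensionality all the local rings have the same dimension, and dividing by the same power of
  \<open>q\<close> and passing to the limit, the multiplicity at \<open>y\<close> is at most that at \<open>x\<close> whenever \<open>y\<close> avoids
  countably many hypersurfaces not passing through \<open>x\<close>. Over an uncountable field such points are dense
  in every irreducible closed set containing \<open>x\<close>. This covers the components of the singular locus as
  well, since it is closed by the Jacobian criterion: a local system of parameters at one point can be
  taken among the coordinate functions, and these still generate the maximal ideals of nearby points.

  The limit exists because, after a fixed Frobenius power, \<open>R\<close> is generically a direct sum of free
  modules over its residue domains at the minimal primes. The colength at \<open>pq\<close> is therefore at most
  \<open>p\<^sup>d\<close> times the colength at \<open>q\<close>, up to an error of order \<open>q\<^sup>d\<^sup>-\<^sup>1\<close>.
\<close>

section \<open>Frobenius powers\<close>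

text \<open>The obstacle is dimension theory. That chains of primes above a minimal prime can be
  found inside any maximal ideal containing it, and that a residue domain of dimension d has rank at
  most \<open>p^d\<close> over its p-th powers, usually comes from Noether normalization and
  transcendence bases. Here both come from counting. Along the powers m^[q] an ideal I has colength
  at most \<open>C * q^(h-1)\<close> when all chains of primes between I and m have length below h,
  while a chain of length h above a prime P in m forces colength at least \<open>q^h\<close>.
  Comparing the two makes chains local, and towers of Frobenius maps turn the upper bound into the
  rank bound. Fraction fields are never formed: linear algebra takes place in R itself, modulo a
  submodule T and after multiplication by scalars outside a prime Z. One exchange lemma then serves
  dimensions over k as well as ranks over rings of q-th powers. Uncountability enters a second time,
  in the Nullstellensatz: all residue fields equal k, which is why lengths are k-dimensions.\<close>

lemma (in cring) binomial_finsum: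
  assumes x: "x \<in> carrier R" and y: "y \<in> carrier R"
  shows "(x \<oplus> y) [^] (n::nat) = (\<Oplus>i\<in>{..n}. [(n choose i)] \<cdot> (x [^] i \<otimes> y [^] (n - i)))"
proof (induction n)
  case 0
  then show ?case using x y by simp
next
  case (Suc n)
  define t where "t m i = [(m choose i)] \<cdot> (x [^] i \<otimes> y [^] (m - i))" for m i :: nat
  have tc: "t m i \<in> carrier R" for m i using x y by (simp add: t_def)
  \<comment> \<open>\<open>a\<close> and \<open>b\<close> are the two halves of Pascal's rule;
    padding with \<zero> lets both be summed over the same range.\<close>
  define a where "a i = (if i = 0 then \<zero> else x \<otimes> t n (i - 1))" for i
  define b where "b i = (if i \<le> n then y \<otimes> t n i else \<zero>)" for i
  have ac: "a i \<in> carrier R" and bc: "b i \<in> carrier R" for i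
    using tc x y by (auto simp: a_def b_def)
  have ta: "t (Suc n) i = a i \<oplus> b i" if "i \<le> Suc n" for i
  proof (cases i)
    case 0
    then show ?thesis using x y
      by (simp add: t_def a_def b_def m_comm nat_pow_Suc)
  next
    case (Suc j)
    have A: "x \<otimes> t n j = [(n choose j)] \<cdot> (x [^] Suc j \<otimes> y [^] (n - j))"
      using x y by (simp add: t_def add_pow_rdistr m_assoc m_comm[of x] m_lcomm)
    show ?thesis
    proof (cases "i \<le> n")
      case True
      have e: "n - j = Suc (n - Suc j)" using True Suc by simp
      have B: "y \<otimes> t n (Suc j) = [(n choose Suc j)] \<cdot> (x [^] Suc j \<otimes> y [^] (n - j))"
        unfolding e using x y by (simp add: t_def add_pow_rdistr m_assoc m_comm[of y] m_lcomm)
      show ?thesis using True Suc A B x y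
        by (simp add: a_def b_def t_def add.nat_pow_mult[symmetric] add.m_comm)
    next
      case False
      then have "i = Suc n" "j = n" using that Suc by auto
      then show ?thesis using A x y by (simp add: a_def b_def t_def)
    qed
  qed
  have "(x \<oplus> y) [^] Suc n = (x \<oplus> y) \<otimes> (\<Oplus>i\<in>{..n}. t n i)"
    using Suc x y by (simp add: t_def m_comm)
  also have "\<dots> = (\<Oplus>i\<in>{..n}. x \<otimes> t n i) \<oplus> (\<Oplus>i\<in>{..n}. y \<otimes> t n i)"
    using x y tc by (simp add: l_distr finsum_rdistr Pi_def)
  also have "(\<Oplus>i\<in>{..n}. x \<otimes> t n i) = (\<Oplus>i\<in>{..Suc n}. a i)"
  proof -
    have "(\<Oplus>i\<in>{..Suc n}. a i) = (\<Oplus>i\<in>{..n}. a (Suc i)) \<oplus> a 0"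
      by (rule finsum_Suc2) (use ac in auto)
    moreover have "(\<Oplus>i\<in>{..n}. a (Suc i)) = (\<Oplus>i\<in>{..n}. x \<otimes> t n i)"
      by (rule finsum_cong') (use x tc in \<open>auto simp: a_def\<close>)
    ultimately show ?thesis using x tc by (simp add: a_def Pi_def)
  qed
  also have "(\<Oplus>i\<in>{..n}. y \<otimes> t n i) = (\<Oplus>i\<in>{..Suc n}. b i)"
  proof -
    have "(\<Oplus>i\<in>{..Suc n}. b i) = b (Suc n) \<oplus> (\<Oplus>i\<in>{..n}. b i)"
      by (rule finsum_Suc) (use bc in auto)
    moreover have "(\<Oplus>i\<in>{..n}. b i) = (\<Oplus>i\<in>{..n}. y \<otimes> t n i)"
      by (rule finsum_cong') (use y tc in \<open>auto simp: b_def\<close>)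
    ultimately show ?thesis using y tc by (simp add: b_def Pi_def)
  qed
  also have "(\<Oplus>i\<in>{..Suc n}. a i) \<oplus> (\<Oplus>i\<in>{..Suc n}. b i) = (\<Oplus>i\<in>{..Suc n}. a i \<oplus> b i)"
    by (rule finsum_addf[symmetric]) (use ac bc in auto)
  also have "\<dots> = (\<Oplus>i\<in>{..Suc n}. t (Suc n) i)"
    by (rule finsum_cong') (use ta tc in auto)
  finally show ?case by (simp add: t_def)
qed

text \<open>The absorption identity shows that p divides i * (p choose i), and p cannot divide i
  because 0 < i < p.\<close>

lemma prime_dvd_choose:
  fixes p :: nat
  assumes "Factorial_Ring.prime p" "0 < i" "i < p" shows "p dvd (p choose i)"
proof -
  have "i * (p choose i) = p * ((p - 1) choose (i - 1))"
    using assms times_binomial_minus1_eq by blast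
  then have "p dvd i * (p choose i)" by simp
  moreover have "\<not> p dvd i" using assms by (auto dest: dvd_imp_le)
  ultimately show ?thesis using assms(1) by (simp add: prime_dvd_mult_iff)
qed

locale char_ring = cring R for R (structure) +
  fixes p :: nat
  assumes prime_p: "Factorial_Ring.prime p"
    and char_p: "[p] \<cdot> \<one> = \<zero>"
begin

lemma p_gt_1: "p > 1" using prime_p by (rule prime_gt_1_nat)

lemma p_pos: "p > 0" using p_gt_1 by simp

lemma char_zero: assumes "x \<in> carrier R" "p dvd n" shows "[n] \<cdot> x = \<zero>"
proof -
  obtain m where m: "n = p * m" using assms by auto
  have "[p] \<cdot> x = [p] \<cdot> (\<one> \<otimes> x)" using assms by simp
  also have "\<dots> = [p] \<cdot> \<one> \<otimes> x" using assms by (subst add_pow_ldistr) auto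
  finally have "[p] \<cdot> x = \<zero>" using assms char_p by simp
  then show ?thesis using m assms by (simp add: add.nat_pow_pow[symmetric])
qed

lemma frobenius_add1:
  assumes x: "x \<in> carrier R" and y: "y \<in> carrier R"
  shows "(x \<oplus> y) [^] p = x [^] p \<oplus> y [^] p"
proof -
  let ?t = "\<lambda>i. [(p choose i)] \<cdot> (x [^] i \<otimes> y [^] (p - i))"
  \<comment> \<open>Two successors are split off so that both the term i = p and the term i = 0 can
    be peeled from the sum.\<close>
  obtain r where r: "p = Suc (Suc r)" using p_gt_1 less_imp_Suc_add[of 1 p] by auto
  have z: "?t i = \<zero>" if "0 < i" "i < p" for i
    using x y that prime_p by (intro char_zero prime_dvd_choose) auto
  have tc: "?t i \<in> carrier R" for i using x y by simp
  have "(x \<oplus> y) [^] p = (\<Oplus>i\<in>{..p}. ?t i)" by (rule binomial_finsum[OF x y])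
  also have "\<dots> = ?t p \<oplus> (\<Oplus>i\<in>{..Suc r}. ?t i)"
  proof -
    have "?t \<in> {..Suc (Suc r)} \<rightarrow> carrier R" using tc by blast
    from finsum_Suc[OF this] show ?thesis by (simp only: r[symmetric])
  qed
  also have "(\<Oplus>i\<in>{..Suc r}. ?t i) = (\<Oplus>i\<in>{..r}. ?t (Suc i)) \<oplus> ?t 0"
    by (rule finsum_Suc2) (use tc in blast)
  also have "(\<Oplus>i\<in>{..r}. ?t (Suc i)) = (\<Oplus>i\<in>{..r}. \<zero>)"
  proof (rule finsum_cong')
    show "?t (Suc i) = \<zero>" if "i \<in> {..r}" for i by (rule z) (use that r in simp_all)
  qed auto
  finally show ?thesis using x y by simp
qed

definition fr :: "nat \<Rightarrow> 'a \<Rightarrow> 'a" where "fr e x = x [^] (p ^ e)"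

lemma fr_closed [simp, intro]: "x \<in> carrier R \<Longrightarrow> fr e x \<in> carrier R" by (simp add: fr_def)

lemma fr_0 [simp]: "x \<in> carrier R \<Longrightarrow> fr 0 x = x" by (simp add: fr_def)

lemma fr_fr: "x \<in> carrier R \<Longrightarrow> fr a (fr b x) = fr (a + b) x"
  by (simp add: fr_def nat_pow_pow power_add mult.commute)

lemma fr_one [simp]: "fr e \<one> = \<one>" by (simp add: fr_def)

lemma fr_zero [simp]: "fr e \<zero> = \<zero>" using p_pos by (simp add: fr_def nat_pow_zero)

lemma fr_mult: "x \<in> carrier R \<Longrightarrow> y \<in> carrier R \<Longrightarrow> fr e (x \<otimes> y) = fr e x \<otimes> fr e y"
  by (simp add: fr_def nat_pow_distrib)

lemma fr_add: "x \<in> carrier R \<Longrightarrow> y \<in> carrier R \<Longrightarrow> fr e (x \<oplus> y) = fr e x \<oplus> fr e y"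
proof (induction e)
  case (Suc e)
  have "fr (Suc e) z = fr e z [^] p" if "z \<in> carrier R" for z
    using that by (simp add: fr_def nat_pow_pow mult.commute)
  then show ?case using Suc by (simp add: frobenius_add1)
qed simp

lemma fr_uminus: "x \<in> carrier R \<Longrightarrow> fr e (\<ominus> x) = \<ominus> fr e x"
  using fr_add[of x "\<ominus> x" e] by (simp add: r_neg minus_equality sum_zero_eq_neg add.m_comm)

lemma fr_minus: "x \<in> carrier R \<Longrightarrow> y \<in> carrier R \<Longrightarrow> fr e (x \<ominus> y) = fr e x \<ominus> fr e y"
  by (simp add: a_minus_def fr_add fr_uminus)

lemma fr_finsum: "finite A \<Longrightarrow> f \<in> A \<rightarrow> carrier R \<Longrightarrow> fr e (\<Oplus>x\<in>A. f x) = (\<Oplus>x\<in>A. fr e (f x))"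
  by (induction A rule: finite_induct) (auto simp: fr_add Pi_def)

lemma fr_prime: "primeideal P R \<Longrightarrow> x \<in> carrier R \<Longrightarrow> fr e x \<in> P \<longleftrightarrow> x \<in> P"
proof
  assume P: "primeideal P R" and x: "x \<in> carrier R"
  interpret primeideal P R by fact
  have gen: "x [^] n \<in> P \<Longrightarrow> n > 0 \<Longrightarrow> x \<in> P" for n :: nat
  proof (induction n)
    case (Suc n)
    then have "x [^] n \<in> P \<or> x \<in> P" using I_prime x by simp
    then show ?case using Suc I_notcarr one_imp_carrier by (cases n) auto
  qed simp
  show "fr e x \<in> P \<Longrightarrow> x \<in> P" using gen p_pos by (auto simp: fr_def)
  assume "x \<in> P"
  moreover obtain n where "p ^ e = Suc n" using p_pos by (metis gr0_implies_Suc zero_less_power)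
  ultimately show "fr e x \<in> P" using x by (simp add: fr_def I_l_closed)
qed

end

section \<open>Linear algebra up to torsion\<close>

text \<open>Both coefficients and vectors range over arbitrary sets, so the same notion covers
  k-spans, spans over q-th powers, generated ideals, products of ideals and combinations with
  coefficients of bounded degree.\<close>

inductive_set lspan :: "('a, 'b) ring_scheme \<Rightarrow> 'a set \<Rightarrow> 'a set \<Rightarrow> 'a set"
  for R (structure) and L and W where
  lspan_zero: "\<zero> \<in> lspan R L W"
| lspan_step: "\<lbrakk>s \<in> lspan R L W; l \<in> L; x \<in> W\<rbrakk> \<Longrightarrow> s \<oplus> l \<otimes> x \<in> lspan R L W"

text \<open>Collecting coefficients uses only sums in L. This generality matters when L is the set
  of q-th powers of a maximal ideal, which is not a subring with \<one>.\<close>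

lemma (in cring) lspan_repr_family:
  assumes J: "finite J" "c \<in> J \<rightarrow> carrier R" "B \<subseteq> c ` J" and u: "u \<in> lspan R L B"
    and L: "L \<subseteq> carrier R" "\<zero> \<in> L" "\<And>a b. a \<in> L \<Longrightarrow> b \<in> L \<Longrightarrow> a \<oplus> b \<in> L"
  shows "\<exists>a. a \<in> J \<rightarrow> L \<and> u = (\<Oplus>j\<in>J. a j \<otimes> c j)"
  using u
proof (induction u rule: lspan.induct)
  case lspan_zero
  have "(\<Oplus>j\<in>J. \<zero> \<otimes> c j) = (\<Oplus>j\<in>J. \<zero>)" by (rule finsum_cong') (use J(2) in \<open>auto simp: Pi_def\<close>)
  then show ?case using L(2) by (intro exI[of _ "\<lambda>j. \<zero>"]) simp
next
  case (lspan_step s l y)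
  then obtain a where a: "a \<in> J \<rightarrow> L" "s = (\<Oplus>j\<in>J. a j \<otimes> c j)" by blast
  obtain i where i: "i \<in> J" "y = c i" using lspan_step J(3) by blast
  have ac: "a j \<in> L" "a j \<in> carrier R" if "j \<in> J" for j using funcset_mem[OF a(1) that] L(1) by auto
  have lc: "l \<in> carrier R" using lspan_step(2) L(1) by blast
  have cc: "c j \<in> carrier R" if "j \<in> J" for j using funcset_mem[OF J(2) that] .
  let ?d = "\<lambda>j. if j = i then a i \<oplus> l else a j"
  have "(\<Oplus>j\<in>J. ?d j \<otimes> c j) = (\<Oplus>j\<in>J. a j \<otimes> c j \<oplus> (if i = j then l \<otimes> c j else \<zero>))"
    by (rule finsum_cong') (use ac cc lc in \<open>auto simp: l_distr\<close>)
  also have "\<dots> = s \<oplus> (\<Oplus>j\<in>J. if i = j then l \<otimes> c j else \<zero>)"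
    unfolding a(2) by (rule finsum_addf) (use ac cc lc in auto)
  also have "(\<Oplus>j\<in>J. if i = j then l \<otimes> c j else \<zero>) = l \<otimes> c i"
    using add.finprod_singleton[OF i(1) J(1), of "\<lambda>j. l \<otimes> c j"] cc lc by auto
  finally show ?case using i ac lspan_step(2) L(3) by (intro exI[of _ ?d]) auto
qed

locale scalars = cring R for R (structure) +
  fixes L :: "'a set"
  assumes L_carrier: "L \<subseteq> carrier R"
    and L_one [simp]: "\<one> \<in> L"
    and L_add [simp]: "\<lbrakk>a \<in> L; b \<in> L\<rbrakk> \<Longrightarrow> a \<oplus> b \<in> L"
    and L_uminus [simp]: "a \<in> L \<Longrightarrow> \<ominus> a \<in> L"
    and L_mult [simp]: "\<lbrakk>a \<in> L; b \<in> L\<rbrakk> \<Longrightarrow> a \<otimes> b \<in> L"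
begin

lemma LD [simp]: "a \<in> L \<Longrightarrow> a \<in> carrier R" using L_carrier by auto

lemma L_zero [simp]: "\<zero> \<in> L" using L_add[of \<one> "\<ominus> \<one>"] by (simp add: r_neg)

lemma lspan_carrier: "s \<in> lspan R L W \<Longrightarrow> W \<subseteq> carrier R \<Longrightarrow> s \<in> carrier R"
  by (induction rule: lspan.induct) auto

lemma lspan_add: "t \<in> lspan R L W \<Longrightarrow> s \<in> lspan R L W \<Longrightarrow> W \<subseteq> carrier R \<Longrightarrow> s \<oplus> t \<in> lspan R L W"
proof (induction t rule: lspan.induct)
  case lspan_zero
  then show ?case by (simp add: lspan_carrier)
next
  case (lspan_step t l x)
  have "s \<oplus> (t \<oplus> l \<otimes> x) = (s \<oplus> t) \<oplus> l \<otimes> x"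
    using lspan_step lspan_carrier[of s W] lspan_carrier[of t W] by (subst a_assoc) auto
  then show ?case using lspan_step by (simp add: lspan.lspan_step)
qed

lemma lspan_scal: "s \<in> lspan R L W \<Longrightarrow> W \<subseteq> carrier R \<Longrightarrow> l \<in> L \<Longrightarrow> l \<otimes> s \<in> lspan R L W"
proof (induction s rule: lspan.induct)
  case (lspan_step s l' x)
  have "l \<otimes> (s \<oplus> l' \<otimes> x) = l \<otimes> s \<oplus> (l \<otimes> l') \<otimes> x"
    using lspan_step lspan_carrier[of s W] by (auto simp: r_distr m_assoc subset_iff)
  then show ?case using lspan_step by (simp add: lspan.lspan_step)
qed (simp add: lspan.lspan_zero)

lemma lspan_incl: "W \<subseteq> carrier R \<Longrightarrow> x \<in> W \<Longrightarrow> x \<in> lspan R L W"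
  using lspan.lspan_step[OF lspan.lspan_zero, of \<one> L x W R] by auto

lemma lspan_mono: "s \<in> lspan R L W \<Longrightarrow> W \<subseteq> Y \<Longrightarrow> s \<in> lspan R L Y"
  by (induction rule: lspan.induct) (auto intro: lspan.intros)

lemma lspan_uminus: "W \<subseteq> carrier R \<Longrightarrow> s \<in> lspan R L W \<Longrightarrow> \<ominus> s \<in> lspan R L W"
  using lspan_scal[of s W "\<ominus> \<one>"] lspan_carrier[of s W] by (simp add: l_minus)

lemma lspan_finsum: "finite A \<Longrightarrow> W \<subseteq> carrier R \<Longrightarrow> (\<And>i. i \<in> A \<Longrightarrow> f i \<in> lspan R L W)
   \<Longrightarrow> (\<Oplus>i\<in>A. f i) \<in> lspan R L W"
proof (induction A rule: finite_induct)
  case (insert i A)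
  then have "f j \<in> carrier R" if "j \<in> insert i A" for j using that lspan_carrier by blast
  then have "(\<Oplus>i\<in>insert i A. f i) = f i \<oplus> (\<Oplus>i\<in>A. f i)" using insert by (subst finsum_insert) auto
  then show ?case using insert by (simp add: lspan_add)
qed (simp add: lspan.lspan_zero)

lemma lspan_repr:
  assumes "finite W" "W \<subseteq> carrier R" "s \<in> lspan R L W"
  shows "\<exists>c. c \<in> W \<rightarrow> L \<and> s = (\<Oplus>x\<in>W. c x \<otimes> x)"
  using lspan_repr_family[OF assms(1) _ _ assms(3) L_carrier, of "\<lambda>x. x"] assms(2) by auto

lemma lspan_sum_in: "finite W \<Longrightarrow> W \<subseteq> carrier R \<Longrightarrow> c \<in> W \<rightarrow> L \<Longrightarrow> (\<Oplus>x\<in>W. c x \<otimes> x) \<in> lspan R L W"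
  by (rule lspan_finsum, assumption, assumption) (rule lspan_scal, auto intro: lspan_incl)

end

text \<open>Z plays the role of a prime ideal of the subring L, and R modulo T that of a
  torsion-free module over the domain L modulo Z: \<open>Z_T\<close> lets the action factor,
  \<open>T_sat\<close> is torsion-freeness. The instances are k with Z = {\<zero>}, and the q-th
  powers with the q-th powers of a prime.\<close>

locale lin_ctx = scalars R L for R (structure) and L +
  fixes Z T :: "'a set"
  assumes Z_sub: "Z \<subseteq> L" and Z_one: "\<one> \<notin> Z" and Z_zero: "\<zero> \<in> Z"
    and Z_prime: "\<lbrakk>a \<in> L; b \<in> L; a \<otimes> b \<in> Z\<rbrakk> \<Longrightarrow> a \<in> Z \<or> b \<in> Z"
    and T_carrier: "T \<subseteq> carrier R" and T_zero [simp]: "\<zero> \<in> T"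
    and T_add [simp]: "\<lbrakk>s \<in> T; t \<in> T\<rbrakk> \<Longrightarrow> s \<oplus> t \<in> T"
    and T_scal [simp]: "\<lbrakk>l \<in> L; t \<in> T\<rbrakk> \<Longrightarrow> l \<otimes> t \<in> T"
    and Z_T: "\<lbrakk>z \<in> Z; x \<in> carrier R\<rbrakk> \<Longrightarrow> z \<otimes> x \<in> T"
    and T_sat: "\<lbrakk>l \<in> L; l \<notin> Z; x \<in> carrier R; l \<otimes> x \<in> T\<rbrakk> \<Longrightarrow> x \<in> T"
begin

text \<open>The span of W modulo T over the fraction field of L modulo Z, with the denominator l
  kept on the left.\<close>

definition cl :: "'a set \<Rightarrow> 'a set" where
  "cl W = {x \<in> carrier R. \<exists>l \<in> L - Z. \<exists>s \<in> lspan R L W. \<exists>t \<in> T. l \<otimes> x = s \<oplus> t}"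

definition indep :: "'a set \<Rightarrow> bool" where
  "indep W \<longleftrightarrow> finite W \<and> W \<subseteq> carrier R \<and>
     (\<forall>c. c \<in> W \<rightarrow> L \<longrightarrow> (\<Oplus>x\<in>W. c x \<otimes> x) \<in> T \<longrightarrow> (\<forall>x\<in>W. c x \<in> Z))"

lemma TD [simp]: "t \<in> T \<Longrightarrow> t \<in> carrier R" using T_carrier by auto

lemma T_uminus [simp]: "t \<in> T \<Longrightarrow> \<ominus> t \<in> T"
  using T_scal[of "\<ominus> \<one>" t] by (simp add: l_minus)

lemma T_finsum: "finite A \<Longrightarrow> (\<And>i. i \<in> A \<Longrightarrow> f i \<in> T) \<Longrightarrow> (\<Oplus>i\<in>A. f i) \<in> T"
proof (induction A rule: finite_induct)
  case (insert i A)
  then have "(\<Oplus>i\<in>insert i A. f i) = f i \<oplus> (\<Oplus>i\<in>A. f i)" by (subst finsum_insert) auto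
  then show ?case using insert by simp
qed simp

lemma L_Z_mult: "l \<in> L - Z \<Longrightarrow> l' \<in> L - Z \<Longrightarrow> l \<otimes> l' \<in> L - Z"
  using Z_prime by auto

lemma cl_mono: "W \<subseteq> Y \<Longrightarrow> cl W \<subseteq> cl Y"
  unfolding cl_def by (auto 0 3 dest: lspan_mono[of _ W Y])

lemma cl_incl: "W \<subseteq> carrier R \<Longrightarrow> W \<subseteq> cl W"
proof
  fix x assume "W \<subseteq> carrier R" "x \<in> W"
  then have "\<one> \<otimes> x = x \<oplus> \<zero>" "x \<in> lspan R L W" "x \<in> carrier R" using lspan_incl by auto
  then show "x \<in> cl W" unfolding cl_def using Z_one L_one T_zero by blast
qed

lemma indep_empty: "indep {}" by (simp add: indep_def)

lemma indep_subset:
  assumes "indep Y" "W \<subseteq> Y" shows "indep W"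
  unfolding indep_def
proof (intro conjI allI impI)
  show f: "finite W" and "W \<subseteq> carrier R" using assms by (auto simp: indep_def finite_subset)
  fix c assume c: "c \<in> W \<rightarrow> L" and s: "(\<Oplus>x\<in>W. c x \<otimes> x) \<in> T"
  let ?d = "\<lambda>x. if x \<in> W then c x else \<zero>"
  have Y: "finite Y" "Y \<subseteq> carrier R" using assms by (auto simp: indep_def)
  have "(\<Oplus>x\<in>Y. ?d x \<otimes> x) = (\<Oplus>x\<in>W. c x \<otimes> x)"
    by (rule add.finprod_mono_neutral_cong_right) (use Y assms(2) c in \<open>auto simp: subset_iff Pi_def\<close>)
  then have "\<forall>x\<in>Y. ?d x \<in> Z" using assms(1) s c unfolding indep_def
    by (elim conjE allE[of _ ?d]) (auto simp: Pi_def)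
  then show "\<forall>x\<in>W. c x \<in> Z" using assms(2) by (auto split: if_splits)
qed

lemma indep_not_cl:
  assumes "indep W" "x \<in> W" shows "x \<notin> cl (W - {x})"
proof
  assume "x \<in> cl (W - {x})"
  then obtain l s t where l: "l \<in> L" "l \<notin> Z" and s: "s \<in> lspan R L (W - {x})" and t: "t \<in> T"
    and e: "l \<otimes> x = s \<oplus> t" unfolding cl_def by auto
  have W: "finite W" "W \<subseteq> carrier R" using assms by (auto simp: indep_def)
  obtain c where c: "c \<in> (W - {x}) \<rightarrow> L" "s = (\<Oplus>y\<in>W - {x}. c y \<otimes> y)"
    using lspan_repr[of "W - {x}" s] W s by auto
  have cc: "\<And>y. y \<in> W \<Longrightarrow> y \<noteq> x \<Longrightarrow> c y \<in> L" using c by auto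
  have sc: "s \<in> carrier R" using lspan_carrier[OF s] W by auto
  have xc: "x \<in> carrier R" using W assms(2) by auto
  let ?d = "\<lambda>y. if y = x then \<ominus> l else c y"
  have "(\<Oplus>y\<in>W. ?d y \<otimes> y) = (\<Oplus>y\<in>insert x (W - {x}). ?d y \<otimes> y)"
    using assms(2) by (simp add: insert_absorb)
  also have "\<dots> = ?d x \<otimes> x \<oplus> (\<Oplus>y\<in>W - {x}. ?d y \<otimes> y)"
    by (rule finsum_insert) (use W cc l xc in \<open>auto simp: subset_iff\<close>)
  also have "(\<Oplus>y\<in>W - {x}. ?d y \<otimes> y) = s" unfolding c(2)
    by (rule finsum_cong') (use W cc in \<open>auto simp: subset_iff\<close>)
  finally have "(\<Oplus>y\<in>W. ?d y \<otimes> y) = \<ominus> (l \<otimes> x) \<oplus> s" using xc l by (simp add: l_minus)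
  also have "\<dots> = \<ominus> t" unfolding e using sc t by (simp add: minus_add r_neg1 r_neg2 add.m_comm add.m_assoc l_neg)
  finally have "(\<Oplus>y\<in>W. ?d y \<otimes> y) \<in> T" using t by simp
  moreover have "?d \<in> W \<rightarrow> L" using cc l by auto
  ultimately have "\<forall>y\<in>W. ?d y \<in> Z" using assms(1) unfolding indep_def by blast
  then have "\<ominus> l \<in> Z" using assms(2) by auto
  \<comment> \<open>Closure of Z under negation is not among the axioms. Primality moves the minus
    sign to \<ominus> \<one>; if that is in Z then all of R lies in T, in particular x, and the
    relation with coefficient \<one> at x contradicts independence.\<close>
  moreover have "\<ominus> l = \<ominus> \<one> \<otimes> l" using l by (simp add: l_minus)
  ultimately have "\<ominus> \<one> \<in> Z" using Z_prime[of "\<ominus> \<one>" l] l by simp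
  then have "\<ominus> \<one> \<otimes> \<ominus> \<one> \<otimes> x \<in> T" using Z_T[of "\<ominus> \<one>" "\<ominus> x"] xc by (simp add: l_minus)
  then have "x \<in> T" using xc by (simp add: l_minus)
  let ?g = "\<lambda>y. if y = x then \<one> else \<zero>"
  have "(\<Oplus>y\<in>W. ?g y \<otimes> y) \<in> T"
    by (rule T_finsum) (use W xc \<open>x \<in> T\<close> in \<open>auto simp: subset_iff\<close>)
  then have "\<forall>y\<in>W. ?g y \<in> Z" using assms(1) unfolding indep_def
    by (elim conjE allE[of _ ?g]) auto
  then show False using assms(2) Z_one by auto
qed

lemma indep_insert:
  assumes "indep W" "y \<in> carrier R" "y \<notin> cl W" shows "indep (insert y W)"
  unfolding indep_def
proof (intro conjI allI impI)
  have W: "finite W" "W \<subseteq> carrier R" using assms by (auto simp: indep_def)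
  then show "finite (insert y W)" "insert y W \<subseteq> carrier R" using assms by auto
  have "y \<notin> W" using assms(3) cl_incl W by auto
  fix c assume c: "c \<in> insert y W \<rightarrow> L" and s: "(\<Oplus>x\<in>insert y W. c x \<otimes> x) \<in> T"
  have cL: "\<And>x. x \<in> insert y W \<Longrightarrow> c x \<in> L" using c by auto
  let ?s = "\<Oplus>x\<in>W. c x \<otimes> x"
  have sc: "?s \<in> lspan R L W" using lspan_sum_in W cL by auto
  have scc: "?s \<in> carrier R" using sc W lspan_carrier by auto
  have e: "(\<Oplus>x\<in>insert y W. c x \<otimes> x) = c y \<otimes> y \<oplus> ?s"
    by (rule finsum_insert) (use W cL \<open>y \<notin> W\<close> assms in \<open>auto simp: subset_iff\<close>)
  have yZ: "c y \<in> Z"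
  proof (rule ccontr)
    assume "c y \<notin> Z"
    have "c y \<otimes> y = \<ominus> ?s \<oplus> (c y \<otimes> y \<oplus> ?s)"
      using scc cL[of y] assms(2) by (simp add: add.m_comm[of "c y \<otimes> y"] r_neg1)
    moreover have "\<ominus> ?s \<in> lspan R L W" using lspan_uminus sc W by auto
    moreover have "c y \<in> L - Z" using \<open>c y \<notin> Z\<close> cL by simp
    moreover have "c y \<otimes> y \<oplus> ?s \<in> T" using s e by simp
    ultimately have "y \<in> cl W" unfolding cl_def using assms(2) by blast
    then show False using assms by simp
  qed
  then have "c y \<otimes> y \<in> T" using Z_T assms(2) by simp
  then have "\<ominus> (c y \<otimes> y) \<oplus> (c y \<otimes> y \<oplus> ?s) \<in> T" using s e by simp
  then have "?s \<in> T" using scc cL assms(2) by (simp add: r_neg1)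
  then have "\<forall>x\<in>W. c x \<in> Z" using assms(1) cL unfolding indep_def by auto
  then show "\<forall>x\<in>insert y W. c x \<in> Z" using yZ by simp
qed

text \<open>A common denominator: the product of the individual ones stays outside Z because Z is
  prime.\<close>

lemma cl_common:
  assumes "finite G" "G \<subseteq> cl B" "B \<subseteq> carrier R"
  shows "\<exists>l\<in>L - Z. \<forall>g\<in>G. \<exists>s\<in>lspan R L B. \<exists>t\<in>T. l \<otimes> g = s \<oplus> t"
  using assms
proof (induction G rule: finite_induct)
  case empty
  then show ?case using Z_one by (intro bexI[of _ \<one>]) auto
next
  case (insert g G)
  then obtain l where l: "l \<in> L - Z" and lG: "\<forall>g\<in>G. \<exists>s\<in>lspan R L B. \<exists>t\<in>T. l \<otimes> g = s \<oplus> t" by auto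
  obtain l' where l': "l' \<in> L - Z" and l'g: "\<exists>s\<in>lspan R L B. \<exists>t\<in>T. l' \<otimes> g = s \<oplus> t" and gc: "g \<in> carrier R"
    using insert(4) unfolding cl_def by auto
  have Gc: "G \<subseteq> carrier R" using insert unfolding cl_def by auto
  have scal: "\<exists>s\<in>lspan R L B. \<exists>t\<in>T. (m \<otimes> n) \<otimes> x = s \<oplus> t"
    if mn: "m \<in> L" "n \<in> L" "x \<in> carrier R" "\<exists>s\<in>lspan R L B. \<exists>t\<in>T. n \<otimes> x = s \<oplus> t" for m n x
  proof -
    obtain s t where st: "s\<in>lspan R L B" "t\<in>T" "n \<otimes> x = s \<oplus> t" using mn(4) by blast
    have "(m \<otimes> n) \<otimes> x = m \<otimes> s \<oplus> m \<otimes> t" using mn st lspan_carrier[OF st(1) insert(5)]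
      by (simp add: m_assoc r_distr)
    moreover have "m \<otimes> s \<in> lspan R L B" "m \<otimes> t \<in> T" using st mn lspan_scal insert(5) by auto
    ultimately show ?thesis by blast
  qed
  have "\<exists>s\<in>lspan R L B. \<exists>t\<in>T. (l \<otimes> l') \<otimes> x = s \<oplus> t" if "x \<in> insert g G" for x
  proof (cases "x = g")
    case True
    then show ?thesis using scal[of l l' g] l l' l'g gc by auto
  next
    case False
    then have "x \<in> G" using that by auto
    then have "\<exists>s\<in>lspan R L B. \<exists>t\<in>T. (l' \<otimes> l) \<otimes> x = s \<oplus> t" using scal[of l' l x] l l' lG Gc by auto
    then show ?thesis using l l' by (simp add: m_comm[of l l'])
  qed
  then show ?case using L_Z_mult[OF l l'] by blast
qed

lemma cl_trans:
  assumes "finite Y" "Y \<subseteq> cl W" "W \<subseteq> carrier R" "x \<in> cl Y" shows "x \<in> cl W"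
proof -
  \<comment> \<open>One denominator for all of Y, fixed before substituting, so that whole
    combinations of Y can be rewritten by induction.\<close>
  obtain m where m: "m\<in>L - Z" and mY: "\<forall>g\<in>Y. \<exists>s\<in>lspan R L W. \<exists>t\<in>T. m \<otimes> g = s \<oplus> t"
    using cl_common[OF assms(1-3)] by blast
  have Yc: "Y \<subseteq> carrier R" using assms unfolding cl_def by auto
  have *: "\<exists>s'\<in>lspan R L W. \<exists>t\<in>T. m \<otimes> s = s' \<oplus> t" if "s \<in> lspan R L Y" for s
    using that
  proof (induction s rule: lspan.induct)
    case lspan_zero
    then show ?case using m by (intro bexI[of _ \<zero>] bexI[of _ "\<zero>"]) (auto intro: lspan.lspan_zero)
  next
    case (lspan_step s l y)
    then obtain s' t where 1: "s' \<in> lspan R L W" "t \<in> T" "m \<otimes> s = s' \<oplus> t" by auto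
    obtain u v where 2: "u \<in> lspan R L W" "v \<in> T" "m \<otimes> y = u \<oplus> v" using mY lspan_step by auto
    have c: "s \<in> carrier R" "y \<in> carrier R" "s' \<in> carrier R" "u \<in> carrier R" "m \<in> carrier R" "l \<in> carrier R"
      "t \<in> carrier R" "v \<in> carrier R"
      using lspan_step Yc lspan_carrier 1 2 assms(3) m by auto
    have "m \<otimes> (s \<oplus> l \<otimes> y) = m \<otimes> s \<oplus> l \<otimes> (m \<otimes> y)" using c by (simp add: r_distr m_lcomm)
    also have "\<dots> = (s' \<oplus> l \<otimes> u) \<oplus> (t \<oplus> l \<otimes> v)" unfolding 1 2 using c by (simp add: r_distr a_ac)
    finally have "m \<otimes> (s \<oplus> l \<otimes> y) = (s' \<oplus> l \<otimes> u) \<oplus> (t \<oplus> l \<otimes> v)" .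
    moreover have "s' \<oplus> l \<otimes> u \<in> lspan R L W" "t \<oplus> l \<otimes> v \<in> T"
      using 1 2 lspan_step assms(3) lspan_add lspan_scal by auto
    ultimately show ?case by blast
  qed
  obtain l s t where l: "l \<in> L - Z" "s \<in> lspan R L Y" "t \<in> T" "l \<otimes> x = s \<oplus> t" and xc: "x \<in> carrier R"
    using assms(4) unfolding cl_def by auto
  obtain s' t' where s': "s' \<in> lspan R L W" "t' \<in> T" "m \<otimes> s = s' \<oplus> t'" using *[OF l(2)] by blast
  have c: "s \<in> carrier R" "s' \<in> carrier R" using l s' lspan_carrier Yc assms(3) by auto
  have "(m \<otimes> l) \<otimes> x = s' \<oplus> (t' \<oplus> m \<otimes> t)" using m l s' c xc
    by (simp add: m_assoc r_distr a_assoc)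
  moreover have "t' \<oplus> m \<otimes> t \<in> T" using s' l m by auto
  ultimately show ?thesis unfolding cl_def using L_Z_mult[OF m l(1)] s'(1) xc by blast
qed

text \<open>Exchange: some b in B - C is replaced by a c in C outside the closure of B - {b}. Such a
  c exists, since otherwise C, and with it b, would lie in that closure. The number of elements
  outside C drops.\<close>

lemma steinitz:
  assumes "indep B" "finite C" "C \<subseteq> carrier R" "B \<subseteq> cl C"
  shows "card B \<le> card C"
  using assms
proof (induction "card (B - C)" arbitrary: B)
  case 0
  then have "B \<subseteq> C" by (auto simp: indep_def)
  then show ?case using 0 by (simp add: card_mono)
next
  case (Suc n)
  have fB: "finite B" "B \<subseteq> carrier R" using Suc by (auto simp: indep_def)
  have "B - C \<noteq> {}" using Suc(2) by force
  then obtain b where b: "b \<in> B" "b \<notin> C" by auto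
  have "\<not> C \<subseteq> cl (B - {b})"
  proof
    assume "C \<subseteq> cl (B - {b})"
    then have "b \<in> cl (B - {b})" using cl_trans[of C "B - {b}" b] Suc.prems fB b by blast
    then show False using indep_not_cl Suc(3) b by blast
  qed
  then obtain c where c: "c \<in> C" "c \<notin> cl (B - {b})" by auto
  let ?B = "insert c (B - {b})"
  have i: "indep ?B"
    by (rule indep_insert[OF indep_subset[OF Suc.prems(1)]]) (use Suc.prems(3) b c in auto)
  have "c \<notin> B - {b}" using c(2) cl_incl[of "B - {b}"] fB by auto
  then have cd: "card ?B = card B" using card_Suc_Diff1[OF fB(1) b(1)] fB by (simp del: card_Diff_insert card_Diff_singleton)
  have "?B - C = (B - C) - {b}" using c by auto
  then have "n = card (?B - C)" using Suc(2) b fB by simp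
  moreover have "?B \<subseteq> cl C" using Suc.prems(3,4) c cl_incl[of C] by blast
  ultimately have "card ?B \<le> card C" using Suc(1)[OF _ i Suc.prems(2,3)] by blast
  then show ?case using cd by simp
qed

lemma basis_exists:
  assumes "finite G" "G \<subseteq> carrier R"
  shows "\<exists>B\<subseteq>G. indep B \<and> G \<subseteq> cl B"
  using assms
proof (induction G rule: finite_induct)
  case empty
  then show ?case using indep_empty by auto
next
  case (insert g G)
  then obtain B where B: "B \<subseteq> G" "indep B" "G \<subseteq> cl B" by auto
  show ?case
  proof (cases "g \<in> cl B")
    case True
    then show ?thesis using B by (intro exI[of _ B]) auto
  next
    case False
    have "indep (insert g B)" using False B insert indep_insert by auto
    moreover have "insert g G \<subseteq> cl (insert g B)"
      using B cl_mono[of B "insert g B"] cl_incl[of "insert g B"] insert by auto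
    ultimately show ?thesis using B by (intro exI[of _ "insert g B"]) auto
  qed
qed

text \<open>For counting, independence is needed for families: a repeated vector would give a
  relation with coefficients \<one> and \<ominus> \<one>, so the family is injective and its image
  has the size of the index set.\<close>

lemma card_indep_image:
  assumes "finite I" "b \<in> I \<rightarrow> carrier R"
    and ind: "\<And>c. c \<in> I \<rightarrow> L \<Longrightarrow> (\<Oplus>i\<in>I. c i \<otimes> b i) \<in> T \<Longrightarrow> \<forall>i\<in>I. c i \<in> Z"
  shows "indep (b ` I)" "inj_on b I"
proof -
  show inj: "inj_on b I"
  proof (rule inj_onI, rule ccontr)
    fix i j assume ij: "i \<in> I" "j \<in> I" "b i = b j" "i \<noteq> j"
    let ?c = "\<lambda>x. if x = i then \<one> else if x = j then \<ominus> \<one> else \<zero>"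
    have "(\<Oplus>x\<in>I. ?c x \<otimes> b x) = (\<Oplus>x\<in>{i,j}. ?c x \<otimes> b x)"
      by (rule add.finprod_mono_neutral_cong_right) (use assms(1,2) ij in \<open>auto simp: Pi_def\<close>)
    also have "\<dots> = \<one> \<otimes> b i \<oplus> \<ominus> \<one> \<otimes> b j"
      using ij assms(1,2) by (subst finsum_insert) (auto simp: Pi_def)
    also have "\<dots> = \<zero>" using ij funcset_mem[OF assms(2), of j] by (simp add: l_minus r_neg)
    finally have "(\<Oplus>x\<in>I. ?c x \<otimes> b x) \<in> T" by simp
    then have "\<forall>x\<in>I. ?c x \<in> Z" by (intro ind) auto
    then show False using ij Z_one by auto
  qed
  show "indep (b ` I)" unfolding indep_def
  proof (intro conjI allI impI)
    fix c assume c: "c \<in> b ` I \<rightarrow> L" and s: "(\<Oplus>x\<in>b ` I. c x \<otimes> x) \<in> T"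
    have "(\<Oplus>x\<in>b ` I. c x \<otimes> x) = (\<Oplus>i\<in>I. c (b i) \<otimes> b i)"
      by (rule finsum_reindex) (use c assms(1,2) inj in \<open>auto simp: Pi_def\<close>)
    then have "\<forall>i\<in>I. c (b i) \<in> Z" using ind[of "\<lambda>i. c (b i)"] s c by (auto simp: Pi_def)
    then show "\<forall>x\<in>b ` I. c x \<in> Z" by auto
  qed (use assms(1,2) in auto)
qed

end

section \<open>Ideals\<close>

lemma (in cring) lspan_add_gen: "t \<in> lspan R A W \<Longrightarrow> s \<in> lspan R A W \<Longrightarrow> A \<subseteq> carrier R \<Longrightarrow> W \<subseteq> carrier R
   \<Longrightarrow> s \<oplus> t \<in> lspan R A W \<and> t \<in> carrier R \<and> s \<in> carrier R"
proof (induction t rule: lspan.induct)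
  case lspan_zero
  have "s \<in> carrier R" using lspan_zero by (induction s rule: lspan.induct) auto
  then show ?case using lspan_zero by simp
next
  case (lspan_step t l x)
  then have c: "s \<in> carrier R" "t \<in> carrier R" "l \<in> carrier R" "x \<in> carrier R" and "s \<oplus> t \<in> lspan R A W" by auto
  then have "(s \<oplus> t) \<oplus> l \<otimes> x \<in> lspan R A W" using lspan_step by (simp add: lspan.lspan_step)
  then show ?case using c by (simp add: a_assoc)
qed

lemma (in cring) lspan_carrier_gen: "t \<in> lspan R A W \<Longrightarrow> A \<subseteq> carrier R \<Longrightarrow> W \<subseteq> carrier R \<Longrightarrow> t \<in> carrier R"
  using lspan_add_gen by blast

lemma (in cring) ideal_lspan:
  assumes "A \<subseteq> carrier R" shows "ideal (lspan R A (carrier R)) R"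
proof -
  have mult: "r \<otimes> s \<in> lspan R A (carrier R)" if "s \<in> lspan R A (carrier R)" "r \<in> carrier R" for r s
    using that
  proof (induction s rule: lspan.induct)
    case (lspan_step s l x)
    then have "s \<in> carrier R" "l \<in> carrier R" using assms lspan_carrier_gen[of s A] by auto
    then have "r \<otimes> (s \<oplus> l \<otimes> x) = r \<otimes> s \<oplus> l \<otimes> (r \<otimes> x)" using lspan_step by (simp add: r_distr m_lcomm)
    then show ?case using lspan_step by (simp add: lspan.lspan_step)
  qed (simp add: lspan.lspan_zero)
  have c: "s \<in> carrier R" if "s \<in> lspan R A (carrier R)" for s using that assms lspan_carrier_gen by auto
  have inv: "\<ominus> s \<in> lspan R A (carrier R)" if "s \<in> lspan R A (carrier R)" for s
    using mult[of s "\<ominus> \<one>"] that c by (simp add: l_minus)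
  show ?thesis
  proof (rule idealI[OF ring_axioms])
    show "subgroup (lspan R A (carrier R)) (add_monoid R)"
      by (rule subgroup.intro) (use c inv lspan_add_gen assms lspan.lspan_zero in \<open>auto simp: a_inv_def[symmetric]\<close>)
  next
    show "x \<otimes> a \<in> lspan R A (carrier R)" "a \<otimes> x \<in> lspan R A (carrier R)"
      if "a \<in> lspan R A (carrier R)" "x \<in> carrier R" for a x
      using mult that c by (auto simp: m_comm)
  qed
qed

text \<open>The generators occupy the coefficient slot and the ring elements the vector slot. In
  this order the ring elements can later be cut down to finitely many monomials.\<close>

lemma (in cring) Idl_lspan:
  assumes "A \<subseteq> carrier R" shows "Idl A = lspan R A (carrier R)"
proof
  show "Idl A \<subseteq> lspan R A (carrier R)"
  proof (rule genideal_minimal[OF ideal_lspan[OF assms]], rule subsetI)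
    fix a assume "a \<in> A"
    then show "a \<in> lspan R A (carrier R)"
      using lspan.lspan_step[OF lspan.lspan_zero, of a A \<one> "carrier R" R] assms by auto
  qed
  interpret I: ideal "Idl A" R by (rule genideal_ideal[OF assms])
  show "lspan R A (carrier R) \<subseteq> Idl A"
  proof
    fix s assume "s \<in> lspan R A (carrier R)"
    then show "s \<in> Idl A"
      by (induction s rule: lspan.induct) (use genideal_self[OF assms] I.I_r_closed in auto)
  qed
qed

definition idl_ins :: "('a, 'b) ring_scheme \<Rightarrow> 'a set \<Rightarrow> 'a \<Rightarrow> 'a set" where
  "idl_ins R Q a = {q \<oplus>\<^bsub>R\<^esub> a \<otimes>\<^bsub>R\<^esub> r | q r. q \<in> Q \<and> r \<in> carrier R}"

lemma idl_insI: "q \<in> Q \<Longrightarrow> r \<in> carrier R \<Longrightarrow> x = q \<oplus>\<^bsub>R\<^esub> a \<otimes>\<^bsub>R\<^esub> r \<Longrightarrow> x \<in> idl_ins R Q a"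
  by (auto simp: idl_ins_def)

lemma (in ring) ideal_uminus: "ideal I R \<Longrightarrow> x \<in> I \<Longrightarrow> \<ominus> x \<in> I"
  by (simp add: additive_subgroup.a_inv_closed ideal.axioms(1))

lemma (in ring) ideal_minus: "ideal I R \<Longrightarrow> x \<in> I \<Longrightarrow> y \<in> I \<Longrightarrow> x \<ominus> y \<in> I"
  by (simp add: a_minus_def additive_subgroup.a_closed ideal.axioms(1) ideal_uminus)

lemma (in ring) ideal_add: "ideal I R \<Longrightarrow> x \<in> I \<Longrightarrow> y \<in> I \<Longrightarrow> x \<oplus> y \<in> I"
  by (simp add: additive_subgroup.a_closed ideal.axioms(1))

lemma (in ring) ideal_zero: "ideal I R \<Longrightarrow> \<zero> \<in> I"
  by (simp add: additive_subgroup.zero_closed ideal.axioms(1))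

lemma (in ring) idealD: "ideal I R \<Longrightarrow> x \<in> I \<Longrightarrow> x \<in> carrier R"
  using ideal.Icarr by fast

lemma (in ring) ideal_finsum: "ideal I R \<Longrightarrow> finite A \<Longrightarrow> (\<And>i. i \<in> A \<Longrightarrow> f i \<in> I) \<Longrightarrow> (\<Oplus>i\<in>A. f i) \<in> I"
proof (rotate_tac 1, induction A rule: finite_induct)
  case (insert i A)
  then have "(\<Oplus>i\<in>insert i A. f i) = f i \<oplus> (\<Oplus>i\<in>A. f i)" by (subst finsum_insert) (auto intro: idealD)
  then show ?case using insert by (simp add: ideal_add)
qed (simp add: ideal_zero)

lemma (in cring) ideal_setI:
  assumes "I \<subseteq> carrier R" "\<zero> \<in> I" "\<And>x y. x \<in> I \<Longrightarrow> y \<in> I \<Longrightarrow> x \<oplus> y \<in> I"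
    "\<And>x r. x \<in> I \<Longrightarrow> r \<in> carrier R \<Longrightarrow> r \<otimes> x \<in> I"
  shows "ideal I R"
proof (rule idealI[OF ring_axioms])
  have inv: "\<ominus> s \<in> I" if "s \<in> I" for s
    using assms(4)[of s "\<ominus> \<one>"] that assms(1) by (auto simp: l_minus)
  show "subgroup I (add_monoid R)"
    by (rule subgroup.intro) (use assms inv in \<open>auto simp: a_inv_def[symmetric]\<close>)
  show "x \<otimes> a \<in> I" "a \<otimes> x \<in> I" if "a \<in> I" "x \<in> carrier R" for a x
    using that assms by (auto simp: m_comm[of a x] subset_iff)
qed

lemma (in cring) idl_ins:
  assumes Q: "ideal Q R" and a: "a \<in> carrier R"
  shows "ideal (idl_ins R Q a) R" "Q \<subseteq> idl_ins R Q a" "a \<in> idl_ins R Q a"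
proof -
  interpret ideal Q R by fact
  show "ideal (idl_ins R Q a) R"
  proof (rule ideal_setI)
    show "idl_ins R Q a \<subseteq> carrier R" using a Icarr by (auto simp: idl_ins_def)
    show "\<zero> \<in> idl_ins R Q a" by (rule idl_insI[of \<zero> _ \<zero>]) (use a in auto)
  next
    fix x y assume "x \<in> idl_ins R Q a" "y \<in> idl_ins R Q a"
    then obtain q r q' r' where e: "x = q \<oplus> a \<otimes> r" "y = q' \<oplus> a \<otimes> r'" "q \<in> Q" "q' \<in> Q" "r \<in> carrier R" "r' \<in> carrier R"
      unfolding idl_ins_def by auto
    have "x \<oplus> y = (q \<oplus> q') \<oplus> a \<otimes> (r \<oplus> r')" unfolding e using e a Icarr by (simp add: r_distr a_ac)
    then show "x \<oplus> y \<in> idl_ins R Q a" by (rule idl_insI[rotated 2]) (use e in auto)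
  next
    fix x s assume "x \<in> idl_ins R Q a" "s \<in> carrier R"
    then obtain q r where e: "x = q \<oplus> a \<otimes> r" "q \<in> Q" "r \<in> carrier R" unfolding idl_ins_def by auto
    have "s \<otimes> x = s \<otimes> q \<oplus> a \<otimes> (s \<otimes> r)" unfolding e using e a Icarr \<open>s \<in> carrier R\<close> by (simp add: r_distr m_lcomm)
    then show "s \<otimes> x \<in> idl_ins R Q a" by (rule idl_insI[rotated 2]) (use e \<open>s \<in> carrier R\<close> I_l_closed in auto)
  qed
  show "Q \<subseteq> idl_ins R Q a"
  proof
    fix q assume "q \<in> Q"
    then show "q \<in> idl_ins R Q a" by (intro idl_insI[of q _ \<zero>]) (use a Icarr in auto)
  qed
  show "a \<in> idl_ins R Q a" by (rule idl_insI[of \<zero> _ \<one>]) (use a in auto)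
qed

lemma (in cring) idl_ins_minimal:
  assumes "ideal I R" "Q \<subseteq> I" "a \<in> I" shows "idl_ins R Q a \<subseteq> I"
  using assms ideal.I_r_closed[OF assms(1)] by (auto simp: idl_ins_def intro!: ideal_add)

section \<open>Affine algebras\<close>

primrec horner :: "('a, 'b) ring_scheme \<Rightarrow> 'a list \<Rightarrow> 'a \<Rightarrow> 'a" where
  "horner R [] x = \<zero>\<^bsub>R\<^esub>"
| "horner R (a # as) x = a \<oplus>\<^bsub>R\<^esub> x \<otimes>\<^bsub>R\<^esub> horner R as x"

text \<open>The coefficient list of (X - c) * as + b, constant term first: the inverse of synthetic
  division by X - c.\<close>

primrec horner_mul :: "('a, 'b) ring_scheme \<Rightarrow> 'a \<Rightarrow> 'a \<Rightarrow> 'a list \<Rightarrow> 'a list" where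
  "horner_mul R c b [] = [b]"
| "horner_mul R c b (a # as) = (b \<ominus>\<^bsub>R\<^esub> c \<otimes>\<^bsub>R\<^esub> a) # horner_mul R c a as"

text \<open>Here k is a subset of R rather than a separate field. Algebraic closedness is stated
  through values only: a polynomial over k has a root in k or is a nonzero constant as a function on
  R. This avoids degrees and leading coefficients.\<close>

locale affine_alg = char_ring R p + k: scalars R k for R (structure) and p k +
  fixes S :: "'a set"
  assumes one_neq_zero: "\<one> \<noteq> \<zero>"
    and k_inv: "\<lbrakk>c \<in> k; c \<noteq> \<zero>\<rbrakk> \<Longrightarrow> \<exists>d\<in>k. c \<otimes> d = \<one>"
    and k_closed: "set as \<subseteq> k \<Longrightarrow> (\<exists>d\<in>k. horner R as d = \<zero>) \<or>
          (\<exists>a\<in>k. a \<noteq> \<zero> \<and> (\<forall>y\<in>carrier R. horner R as y = a))"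
    and k_uncountable: "uncountable k"
    and S_finite [simp]: "finite S" and S_carrier: "S \<subseteq> carrier R"
    and S_gen: "generate_ring R (k \<union> S) = carrier R"
begin

lemma SD [simp]: "x \<in> S \<Longrightarrow> x \<in> carrier R" using S_carrier by auto

lemma horner_closed [simp]: "set as \<subseteq> carrier R \<Longrightarrow> y \<in> carrier R \<Longrightarrow> horner R as y \<in> carrier R"
  by (induction as) auto

lemma k_carrier: "k \<subseteq> carrier R" by (rule k.L_carrier)

lemma k_notin_prime:
  assumes "primeideal Q R" "c \<in> k" "c \<in> Q" shows "c = \<zero>"
proof (rule ccontr)
  interpret Q: primeideal Q R by fact
  assume "c \<noteq> \<zero>"
  then obtain d where "d \<in> k" "c \<otimes> d = \<one>" using k_inv assms by auto
  then have "\<one> \<in> Q" using Q.I_r_closed[OF assms(3), of d] by simp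
  then show False using Q.one_imp_carrier Q.I_notcarr by simp
qed

lemma horner_mul:
  assumes "set as \<subseteq> carrier R" "c \<in> carrier R" "b \<in> carrier R" "y \<in> carrier R"
  shows "horner R (horner_mul R c b as) y = (y \<ominus> c) \<otimes> horner R as y \<oplus> b"
  using assms
proof (induction as arbitrary: b)
  case (Cons a as)
  let ?h = "horner R as y"
  have h: "?h \<in> carrier R" using Cons by simp
  have "horner R (horner_mul R c b (a # as)) y = (b \<ominus> c \<otimes> a) \<oplus> y \<otimes> ((y \<ominus> c) \<otimes> ?h \<oplus> a)"
    using Cons by simp
  also have "\<dots> = (y \<ominus> c) \<otimes> (a \<oplus> y \<otimes> ?h) \<oplus> b"
  proof -
    have "a \<in> carrier R" "b \<in> carrier R" "c \<in> carrier R" "y \<in> carrier R" using Cons by auto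
    then show ?thesis using h by algebra
  qed
  finally show ?case by simp
qed simp

lemma horner_mul_set: "set as \<subseteq> k \<Longrightarrow> c \<in> k \<Longrightarrow> b \<in> k \<Longrightarrow> set (horner_mul R c b as) \<subseteq> k"
  by (induction as arbitrary: b) (auto simp: a_minus_def)

text \<open>Synthetic division from the leading coefficient downwards: if a is the remainder for the
  tail, the next remainder is b + c * a. The bound on the length drives inductions that split off
  roots.\<close>

lemma horner_mul_exists:
  assumes "set bs \<subseteq> k" "bs \<noteq> []" "c \<in> k"
  shows "\<exists>as b. set as \<subseteq> k \<and> b \<in> k \<and> bs = horner_mul R c b as \<and> length as < length bs"
  using assms
proof (induction bs)
  case (Cons b bs)
  show ?case
  proof (cases "bs = []")
    case True
    then show ?thesis using Cons by (intro exI[of _ "[]"] exI[of _ b]) auto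
  next
    case False
    then obtain as a where *: "set as \<subseteq> k" "a \<in> k" "bs = horner_mul R c a as" "length as < length bs" using Cons by auto
    have "a \<in> carrier R" "b \<in> carrier R" "c \<in> carrier R" using Cons.prems * by auto
    then have "(b \<oplus> c \<otimes> a) \<ominus> c \<otimes> a = b" by algebra
    then have "b # bs = horner_mul R c (b \<oplus> c \<otimes> a) (a # as)" using * by simp
    then show ?thesis using * Cons by (intro exI[of _ "a # as"] exI[of _ "b \<oplus> c \<otimes> a"]) simp
  qed
qed simp

text \<open>If x is congruent to no constant modulo Q, it is transcendental there. A root r in k
  splits off a factor X - r; since x - r is outside the prime Q, the cofactor has its value in Q as
  well, and induction on the length applies.\<close>

lemma prime_horner:
  assumes Q: "primeideal Q R" and x: "x \<in> carrier R" and nc: "\<And>c. c \<in> k \<Longrightarrow> x \<ominus> c \<notin> Q"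
  shows "set as \<subseteq> k \<Longrightarrow> horner R as x \<in> Q \<Longrightarrow> d \<in> k \<Longrightarrow> horner R as d = \<zero>"
proof (induction "length as" arbitrary: as d rule: less_induct)
  case less
  interpret Q: primeideal Q R by fact
  consider (r) r where "r \<in> k" "horner R as r = \<zero>" | (c) a where "a \<in> k" "a \<noteq> \<zero>" "\<And>y. y \<in> carrier R \<Longrightarrow> horner R as y = a"
    using k_closed[OF less(2)] by blast
  then show ?case
  proof cases
    case c
    then show ?thesis using less x k_notin_prime[OF Q] by metis
  next
    case r
    show ?thesis
    proof (cases "as = []")
      case False
      obtain bs b where bs: "set bs \<subseteq> k" "b \<in> k" "as = horner_mul R r b bs" "length bs < length as"
        using horner_mul_exists[OF less(2) False r(1)] by auto
      have bc: "set bs \<subseteq> carrier R" using bs k_carrier by auto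
      have h: "horner R as y = (y \<ominus> r) \<otimes> horner R bs y \<oplus> b" if "y \<in> carrier R" for y
        using horner_mul[OF bc] bs r that by simp
      have "(r \<ominus> r) \<otimes> horner R bs r \<oplus> b = \<zero>" using h[of r] r by simp
      moreover have "r \<ominus> r = \<zero>" using r(1) by (simp add: a_minus_def r_neg)
      ultimately have "b = \<zero>" using r bs bc by simp
      then have "(x \<ominus> r) \<otimes> horner R bs x \<in> Q" using h[OF x] less(3) x r bc by simp
      then have "horner R bs x \<in> Q" using Q.I_prime[of "x \<ominus> r" "horner R bs x"] nc[OF r(1)] x r bc by auto
      then have "horner R bs d = \<zero>" using less(1)[OF bs(4) bs(1)] less(4) by simp
      then show ?thesis using h[of d] less(4) \<open>b = \<zero>\<close> r by simp
    qed simp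
  qed
qed

section \<open>Filtration of R by degree in the generators\<close>

definition mon :: "('a \<Rightarrow> nat) \<Rightarrow> 'a" where "mon \<alpha> = (\<Otimes>x\<in>S. x [^] \<alpha> x)"

lemma mon_closed [simp, intro]: "mon \<alpha> \<in> carrier R" unfolding mon_def by (rule finprod_closed) auto

lemma mon_add: "mon (\<lambda>x. \<alpha> x + \<beta> x) = mon \<alpha> \<otimes> mon \<beta>"
proof -
  have "mon \<alpha> \<otimes> mon \<beta> = (\<Otimes>x\<in>S. x [^] \<alpha> x \<otimes> x [^] \<beta> x)"
    unfolding mon_def by (rule finprod_multf[symmetric]) auto
  also have "\<dots> = mon (\<lambda>x. \<alpha> x + \<beta> x)" unfolding mon_def
    by (rule finprod_cong') (auto simp: nat_pow_mult)
  finally show ?thesis by simp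
qed

lemma mon_pow: "mon (\<lambda>x. n * \<alpha> x) = mon \<alpha> [^] n"
proof (induction n)
  case 0
  then show ?case by (simp add: mon_def finprod_one_eqI)
next
  case (Suc n)
  have "mon (\<lambda>x. Suc n * \<alpha> x) = mon (\<lambda>x. n * \<alpha> x + \<alpha> x)" by (simp add: add.commute)
  then show ?case using Suc by (simp only: mon_add nat_pow_Suc)
qed

lemma mon_fr: "mon (\<lambda>x. p ^ e * \<alpha> x) = fr e (mon \<alpha>)"
  by (simp add: mon_pow fr_def)

lemma mon_0 [simp]: "mon (\<lambda>x. 0) = \<one>" by (simp add: mon_def finprod_one_eqI)

lemma mon_single: assumes "x \<in> S" shows "mon (\<lambda>y. if y = x then 1 else 0) = x"
proof -
  have "mon (\<lambda>y. if y = x then 1 else 0) = (\<Otimes>y\<in>S. if x = y then y else \<one>)"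
    unfolding mon_def by (rule finprod_cong') auto
  also have "\<dots> = x" using assms finprod_singleton[of x S "\<lambda>y. y"] by auto
  finally show ?thesis .
qed

lemma mon_cong: "(\<And>x. x \<in> S \<Longrightarrow> \<alpha> x = \<beta> x) \<Longrightarrow> mon \<alpha> = mon \<beta>"
  unfolding mon_def by (rule finprod_cong') auto

definition deg :: "('a \<Rightarrow> nat) \<Rightarrow> nat" where "deg \<alpha> = (\<Sum>x\<in>S. \<alpha> x)"

definition Mon :: "nat \<Rightarrow> 'a set" where "Mon n = {mon \<alpha> | \<alpha>. deg \<alpha> \<le> n}"

text \<open>These are finitely spanned over k, multiplicative in n, and exhaust R. They give R
  countable dimension and serve to measure growth.\<close>

definition V :: "nat \<Rightarrow> 'a set" where "V n = lspan R k (Mon n)"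

lemma Mon_carrier: "Mon n \<subseteq> carrier R" by (auto simp: Mon_def)

lemma finite_Mon: "finite (Mon n)"
proof -
  have "Mon n \<subseteq> mon ` (S \<rightarrow>\<^sub>E {..n})"
  proof
    fix y assume "y \<in> Mon n"
    then obtain \<alpha> where \<alpha>: "y = mon \<alpha>" "deg \<alpha> \<le> n" by (auto simp: Mon_def)
    have "\<alpha> x \<le> n" if "x \<in> S" for x
      using member_le_sum[of x S \<alpha>] that \<alpha>(2) by (simp add: deg_def)
    then have "restrict \<alpha> S \<in> S \<rightarrow>\<^sub>E {..n}" by auto
    moreover have "y = mon (restrict \<alpha> S)" unfolding \<alpha> by (rule mon_cong) simp
    ultimately show "y \<in> mon ` (S \<rightarrow>\<^sub>E {..n})" by blast
  qed
  then show ?thesis by (rule finite_subset) (simp add: finite_PiE)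
qed

lemma V_carrier: "x \<in> V n \<Longrightarrow> x \<in> carrier R" unfolding V_def using k.lspan_carrier Mon_carrier by auto

lemma V_mono: "x \<in> V m \<Longrightarrow> m \<le> n \<Longrightarrow> x \<in> V n"
  unfolding V_def by (rule k.lspan_mono) (auto simp: Mon_def)

lemma V_add: "x \<in> V n \<Longrightarrow> y \<in> V n \<Longrightarrow> x \<oplus> y \<in> V n"
  unfolding V_def using k.lspan_add Mon_carrier by auto

lemma V_uminus: "x \<in> V n \<Longrightarrow> \<ominus> x \<in> V n"
  unfolding V_def using k.lspan_uminus Mon_carrier by auto

lemma V_k: "c \<in> k \<Longrightarrow> c \<in> V 0"
proof -
  assume c: "c \<in> k"
  have "\<one> \<in> Mon 0" unfolding Mon_def using mon_0 by (auto intro!: exI[of _ "\<lambda>x. 0"] simp: deg_def)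
  then have "\<zero> \<oplus> c \<otimes> \<one> \<in> V 0" unfolding V_def using c by (intro lspan.lspan_step lspan.lspan_zero) auto
  then show ?thesis using c by simp
qed

lemma V_S: "x \<in> S \<Longrightarrow> x \<in> V 1"
proof -
  assume x: "x \<in> S"
  have "x \<in> Mon 1" unfolding Mon_def using mon_single[OF x] x
    by (auto intro!: exI[of _ "\<lambda>y. if y = x then 1 else 0"] simp: deg_def)
  then show ?thesis unfolding V_def using Mon_carrier k.lspan_incl by auto
qed

lemma V_mult: "x \<in> V m \<Longrightarrow> y \<in> V n \<Longrightarrow> x \<otimes> y \<in> V (m + n)"
  unfolding V_def
proof (induction x rule: lspan.induct)
  case lspan_zero
  then show ?case using k.lspan_carrier Mon_carrier by (simp add: lspan.lspan_zero)
next
  case (lspan_step s l x)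
  have *: "x \<otimes> y \<in> lspan R k (Mon (m + n))" using lspan_step(5)
  proof (induction y rule: lspan.induct)
    case lspan_zero
    have "x \<in> carrier R" using \<open>x \<in> Mon m\<close> Mon_carrier by auto
    then show ?case by (simp add: lspan.lspan_zero)
  next
    case (lspan_step t l' z)
    have xz: "x \<otimes> z \<in> Mon (m + n)"
    proof -
      obtain \<alpha> \<beta> where "x = mon \<alpha>" "deg \<alpha> \<le> m" "z = mon \<beta>" "deg \<beta> \<le> n"
        using \<open>x \<in> Mon m\<close> lspan_step by (auto simp: Mon_def)
      then show ?thesis unfolding Mon_def
        by (auto intro!: exI[of _ "\<lambda>x. \<alpha> x + \<beta> x"] simp: mon_add deg_def sum.distrib)
    qed
    have "x \<in> carrier R" "t \<in> carrier R" "z \<in> carrier R"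
      using \<open>x \<in> Mon m\<close> lspan_step Mon_carrier k.lspan_carrier by auto
    then have "x \<otimes> (t \<oplus> l' \<otimes> z) = x \<otimes> t \<oplus> l' \<otimes> (x \<otimes> z)" using lspan_step by (simp add: r_distr m_lcomm)
    then show ?case using lspan_step xz by (simp add: lspan.lspan_step)
  qed
  have "x \<in> carrier R" "s \<in> carrier R" "y \<in> carrier R"
    using lspan_step Mon_carrier k.lspan_carrier by auto
  then have "(s \<oplus> l \<otimes> x) \<otimes> y = s \<otimes> y \<oplus> l \<otimes> (x \<otimes> y)" using lspan_step by (simp add: l_distr m_assoc)
  moreover have "l \<otimes> (x \<otimes> y) \<in> lspan R k (Mon (m + n))" using * lspan_step k.lspan_scal Mon_carrier by auto
  ultimately show ?case using lspan_step k.lspan_add Mon_carrier by auto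
qed

lemma V_exhaust: "x \<in> carrier R \<Longrightarrow> \<exists>n. x \<in> V n"
proof -
  assume "x \<in> carrier R"
  then have "x \<in> generate_ring R (k \<union> S)" using S_gen by simp
  then show ?thesis
  proof (induction x rule: generate_ring.induct)
    case one
    then show ?case using V_k k.L_one by blast
  next
    case (incl h)
    then show ?case using V_k V_S by blast
  next
    case (a_inv h)
    then show ?case using V_uminus by blast
  next
    case (eng_add a b)
    then obtain m n where "a \<in> V m" "b \<in> V n" by auto
    then have "a \<in> V (m + n)" "b \<in> V (m + n)" using V_mono by auto
    then show ?case using V_add by blast
  next
    case (eng_mult a b)
    then show ?case using V_mult by blast
  qed
qed

lemma affine_induct [consumes 1, case_names k S add uminus mult]:
  assumes "x \<in> carrier R" "\<And>c. c \<in> k \<Longrightarrow> P c" "\<And>x. x \<in> S \<Longrightarrow> P x"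
    "\<And>x y. x \<in> carrier R \<Longrightarrow> y \<in> carrier R \<Longrightarrow> P x \<Longrightarrow> P y \<Longrightarrow> P (x \<oplus> y)"
    "\<And>x. x \<in> carrier R \<Longrightarrow> P x \<Longrightarrow> P (\<ominus> x)"
    "\<And>x y. x \<in> carrier R \<Longrightarrow> y \<in> carrier R \<Longrightarrow> P x \<Longrightarrow> P y \<Longrightarrow> P (x \<otimes> y)"
  shows "P x"
proof -
  have "x \<in> generate_ring R (k \<union> S)" using S_gen assms by simp
  then show ?thesis
    by (induction x rule: generate_ring.induct) (use assms S_gen in auto)
qed

lemma k_ctx:
  assumes "T \<subseteq> carrier R" "\<zero> \<in> T" "\<And>s t. s \<in> T \<Longrightarrow> t \<in> T \<Longrightarrow> s \<oplus> t \<in> T" "\<And>c t. c \<in> k \<Longrightarrow> t \<in> T \<Longrightarrow> c \<otimes> t \<in> T"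
  shows "lin_ctx R k {\<zero>} T"
proof
  show "\<one> \<notin> {\<zero>}" using one_neq_zero by simp
  show "a \<in> {\<zero>} \<or> b \<in> {\<zero>}" if that': "a \<in> k" "b \<in> k" "a \<otimes> b \<in> {\<zero>}" for a b
  proof (rule ccontr)
    assume *: "\<not> (a \<in> {\<zero>} \<or> b \<in> {\<zero>})"
    then obtain d where d: "d \<in> k" "a \<otimes> d = \<one>" using k_inv that' by auto
    have "b = (a \<otimes> d) \<otimes> b" using d that by simp
    also have "\<dots> = d \<otimes> (a \<otimes> b)" using k.LD[OF d(1)] k.LD[OF that'(1)] k.LD[OF that'(2)] by algebra
    finally show False using that' * d by simp
  qed
  show "x \<in> T" if that': "l \<in> k" "l \<notin> {\<zero>}" "x \<in> carrier R" "l \<otimes> x \<in> T" for l x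
  proof -
    obtain d where d: "d \<in> k" "l \<otimes> d = \<one>" using k_inv that' by auto
    have "x = (l \<otimes> d) \<otimes> x" using d that by simp
    also have "\<dots> = d \<otimes> (l \<otimes> x)" using d(1) that by (simp add: m_ac)
    finally show ?thesis using assms(4) d that by metis
  qed
qed (use assms in auto)

lemma k_ctx_ideal: "ideal T R \<Longrightarrow> lin_ctx R k {\<zero>} T"
  by (rule k_ctx) (auto intro: idealD ideal_zero ideal_add ideal.I_l_closed)

text \<open>The reciprocals \<open>1 / (x - c)\<close> form an uncountable independent family, while \<open>R\<close> has countable
  dimension over \<open>k\<close>: this is what makes every residue field at a maximal ideal equal to \<open>k\<close>.\<close>

lemma reciprocals_indep:
  assumes Q: "primeideal Q R" and x: "x \<in> carrier R" and nc: "\<And>c. c \<in> k \<Longrightarrow> x \<ominus> c \<notin> Q"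
    and y: "y \<in> \<Gamma> \<rightarrow> carrier R" and w: "w \<in> carrier R" "w \<notin> Q"
    and xy: "\<And>c. c \<in> \<Gamma> \<Longrightarrow> (x \<ominus> c) \<otimes> y c \<ominus> w \<in> Q" and "finite \<Gamma>" "\<Gamma> \<subseteq> k"
  shows "\<kappa> \<in> \<Gamma> \<rightarrow> k \<Longrightarrow> set f \<subseteq> k \<Longrightarrow> w \<otimes> horner R f x \<oplus> (\<Oplus>c\<in>\<Gamma>. \<kappa> c \<otimes> y c) \<in> Q \<Longrightarrow> \<forall>c\<in>\<Gamma>. \<kappa> c = \<zero>"
  using assms(8,9) y xy
proof (induction \<Gamma> arbitrary: \<kappa> f rule: finite_induct)
  case (insert c0 \<Gamma>)
  interpret Q: primeideal Q R by fact
  have fc: "set f \<subseteq> carrier R" using insert k_carrier by auto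
  have kc: "\<And>c. c \<in> insert c0 \<Gamma> \<Longrightarrow> \<kappa> c \<in> k" using insert.prems(1) by auto
  have ck: "\<And>c. c \<in> insert c0 \<Gamma> \<Longrightarrow> c \<in> k" using insert by auto
  have yc: "\<And>c. c \<in> insert c0 \<Gamma> \<Longrightarrow> y c \<in> carrier R" using insert by auto
  let ?s = "\<Oplus>c\<in>\<Gamma>. \<kappa> c" and ?h = "horner R f x"
  let ?t = "\<Oplus>c\<in>\<Gamma>. \<kappa> c \<otimes> y c" and ?u = "\<Oplus>c\<in>\<Gamma>. (\<kappa> c \<otimes> (c \<ominus> c0)) \<otimes> y c"
  let ?d = "x \<ominus> c0"
  have h: "?h \<in> carrier R" using fc x by simp
  have k1: "(\<Oplus>c\<in>A. \<kappa> c) \<in> k" if "A \<subseteq> insert c0 \<Gamma>" "finite A" for A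
    using that(2,1)
  proof (induction A rule: finite_induct)
    case (insert i A)
    then show ?case using kc by (subst finsum_insert) (auto simp: Pi_def)
  qed simp
  have s: "?s \<in> k" using k1[of \<Gamma>] insert by auto
  have t: "?t \<in> carrier R" and u: "?u \<in> carrier R"
    using kc yc ck by (auto intro!: finsum_closed simp: Pi_def)
  have sum: "(\<Oplus>c\<in>insert c0 \<Gamma>. \<kappa> c \<otimes> y c) = \<kappa> c0 \<otimes> y c0 \<oplus> ?t"
    by (rule finsum_insert) (use insert kc yc in auto)
  \<comment> \<open>Modulo Q, multiplying \<open>y c\<close> by x - c0 gives (c - c0) *
    \<open>y c\<close> + w. The c0-term loses its reciprocal, the other coefficients are only
    rescaled, and the multiples of w are absorbed into the polynomial part.\<close>
  have tu: "?d \<otimes> ?t \<ominus> (?u \<oplus> w \<otimes> ?s) \<in> Q"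
  proof -
    have "?d \<otimes> ?t = (\<Oplus>c\<in>\<Gamma>. ?d \<otimes> (\<kappa> c \<otimes> y c))"
      using x ck kc yc insert by (simp add: finsum_rdistr Pi_def)
    also have "\<dots> = (\<Oplus>c\<in>\<Gamma>. ((\<kappa> c \<otimes> (c \<ominus> c0)) \<otimes> y c \<oplus> w \<otimes> \<kappa> c) \<oplus> \<kappa> c \<otimes> ((x \<ominus> c) \<otimes> y c \<ominus> w))"
    proof (rule finsum_cong')
      fix c assume "c \<in> \<Gamma>"
      then have "c \<in> carrier R" "\<kappa> c \<in> carrier R" "y c \<in> carrier R" "c0 \<in> carrier R" using ck kc yc by auto
      then show "?d \<otimes> (\<kappa> c \<otimes> y c) = ((\<kappa> c \<otimes> (c \<ominus> c0)) \<otimes> y c \<oplus> w \<otimes> \<kappa> c) \<oplus> \<kappa> c \<otimes> ((x \<ominus> c) \<otimes> y c \<ominus> w)"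
        using x w(1) by algebra
    qed (use x ck kc yc w in \<open>auto simp: Pi_def\<close>)
    also have "\<dots> = (\<Oplus>c\<in>\<Gamma>. (\<kappa> c \<otimes> (c \<ominus> c0)) \<otimes> y c \<oplus> w \<otimes> \<kappa> c) \<oplus> (\<Oplus>c\<in>\<Gamma>. \<kappa> c \<otimes> ((x \<ominus> c) \<otimes> y c \<ominus> w))"
      by (rule finsum_addf) (use x ck kc yc w in \<open>auto simp: Pi_def\<close>)
    also have "(\<Oplus>c\<in>\<Gamma>. (\<kappa> c \<otimes> (c \<ominus> c0)) \<otimes> y c \<oplus> w \<otimes> \<kappa> c) = ?u \<oplus> (\<Oplus>c\<in>\<Gamma>. w \<otimes> \<kappa> c)"
      by (rule finsum_addf) (use x ck kc yc w in \<open>auto simp: Pi_def\<close>)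
    also have "(\<Oplus>c\<in>\<Gamma>. w \<otimes> \<kappa> c) = w \<otimes> ?s"
      using w kc insert by (simp add: finsum_rdistr Pi_def)
    finally have e: "?d \<otimes> ?t = ?u \<oplus> w \<otimes> ?s \<oplus> (\<Oplus>c\<in>\<Gamma>. \<kappa> c \<otimes> ((x \<ominus> c) \<otimes> y c \<ominus> w))" (is "_ = _ \<oplus> ?v") .
    have v: "?v \<in> Q" by (rule ideal_finsum[OF Q.is_ideal]) (use insert kc Q.I_l_closed in auto)
    have vc: "?v \<in> carrier R" using v by (rule Q.Icarr)
    have "u \<oplus> v \<ominus> u = v" if "u \<in> carrier R" "v \<in> carrier R" for u v using that by algebra
    then have "?u \<oplus> w \<otimes> ?s \<oplus> ?v \<ominus> (?u \<oplus> w \<otimes> ?s) = ?v"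
      using vc u w(1) k.LD[OF s] by simp
    then show ?thesis unfolding e using v by simp
  qed
  let ?y0 = "(x \<ominus> c0) \<otimes> y c0 \<ominus> w"
  have c0: "c0 \<in> carrier R" "\<kappa> c0 \<in> carrier R" "y c0 \<in> carrier R" using ck kc yc by auto
  \<comment> \<open>The new polynomial part: (X - c0) * f plus the sum of all coefficients. The
    polynomial f is carried along for this step of the induction.\<close>
  let ?g = "horner_mul R c0 (\<kappa> c0 \<oplus> ?s) f"
  have g: "horner R ?g x = ?d \<otimes> ?h \<oplus> (\<kappa> c0 \<oplus> ?s)"
    using horner_mul[OF fc] c0 s x by simp
  have A1: "?d \<otimes> (w \<otimes> ?h \<oplus> (\<kappa> c0 \<otimes> y c0 \<oplus> ?t)) \<in> Q"
    using Q.I_l_closed[OF insert.prems(3), of ?d] unfolding sum using x c0 by simp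
  have A2: "\<kappa> c0 \<otimes> ?y0 \<in> Q" using Q.I_l_closed[OF insert.prems(6)[of c0]] c0 by simp
  note A = ideal_minus[OF Q.is_ideal ideal_minus[OF Q.is_ideal A1 A2] tu]
  have "(x \<ominus> c0) \<otimes> (w \<otimes> h \<oplus> (a \<otimes> y \<oplus> t)) \<ominus> a \<otimes> ((x \<ominus> c0) \<otimes> y \<ominus> w) \<ominus> ((x \<ominus> c0) \<otimes> t \<ominus> (u \<oplus> w \<otimes> s))
     = w \<otimes> ((x \<ominus> c0) \<otimes> h \<oplus> (a \<oplus> s)) \<oplus> u"
    if "h \<in> carrier R" "t \<in> carrier R" "u \<in> carrier R" "s \<in> carrier R" "a \<in> carrier R" "y \<in> carrier R" for h t u s a y
    using c0(1) x w(1) that by algebra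
  note E = this[OF h t u k.LD[OF s] c0(2,3)]
  have "w \<otimes> horner R ?g x \<oplus> ?u \<in> Q" unfolding g by (subst E[symmetric]) (rule A)
  then have "\<forall>c\<in>\<Gamma>. \<kappa> c \<otimes> (c \<ominus> c0) = \<zero>"
    using insert.IH[of "\<lambda>c. \<kappa> c \<otimes> (c \<ominus> c0)" ?g] insert.prems kc ck s
    by (auto simp: horner_mul_set a_minus_def Pi_def)
  moreover have "\<kappa> c = \<zero>" if c: "c \<in> \<Gamma>" "\<kappa> c \<otimes> (c \<ominus> c0) = \<zero>" for c
  proof (rule ccontr)
    assume "\<kappa> c \<noteq> \<zero>"
    interpret K: lin_ctx R k "{\<zero>}" "{\<zero>}" by (rule k_ctx) auto
    have "c \<ominus> c0 = \<zero>" using K.Z_prime[of "\<kappa> c" "c \<ominus> c0"] that \<open>\<kappa> c \<noteq> \<zero>\<close> kc ck by (auto simp: a_minus_def)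
    then have "c = c0" using ck[of c] ck[of c0] that r_right_minus_eq[of c c0] by simp
    then show False using insert that by simp
  qed
  ultimately have z: "\<forall>c\<in>\<Gamma>. \<kappa> c = \<zero>" by blast
  have "?t = (\<Oplus>c\<in>\<Gamma>. \<zero>)" by (rule finsum_cong') (use z yc in auto)
  then have t0: "?t = \<zero>" by simp
  have "(x \<ominus> c0) \<otimes> (w \<otimes> h \<oplus> (a \<otimes> y \<oplus> \<zero>)) \<ominus> a \<otimes> ((x \<ominus> c0) \<otimes> y \<ominus> w) = w \<otimes> ((x \<ominus> c0) \<otimes> h \<oplus> a)"
    if "h \<in> carrier R" "a \<in> carrier R" "y \<in> carrier R" for h a y
    using c0(1) x w(1) that by algebra
  note E = this[OF h c0(2,3)]
  have "w \<otimes> (?d \<otimes> ?h \<oplus> \<kappa> c0) \<in> Q"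
    by (subst E[symmetric]) (rule ideal_minus[OF Q.is_ideal A1[unfolded t0] A2])
  then have "?d \<otimes> ?h \<oplus> \<kappa> c0 \<in> Q" using Q.I_prime[of w "?d \<otimes> ?h \<oplus> \<kappa> c0"] w x c0 h by auto
  then have "horner R (horner_mul R c0 (\<kappa> c0) f) x \<in> Q" using horner_mul[OF fc] c0 x by simp
  \<comment> \<open>With the other coefficients gone, (X - c0) * f + \<open>\<kappa> c0\<close> has
    its value at x in Q, hence vanishes on k; at c0 only \<open>\<kappa> c0\<close> is left.\<close>
  then have "horner R (horner_mul R c0 (\<kappa> c0) f) c0 = \<zero>"
    using prime_horner[OF Q x nc, of "horner_mul R c0 (\<kappa> c0) f" c0] horner_mul_set[OF insert.prems(2), of c0 "\<kappa> c0"]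
      ck[of c0] kc[of c0] by simp
  then have "(c0 \<ominus> c0) \<otimes> horner R f c0 \<oplus> \<kappa> c0 = \<zero>" using horner_mul[OF fc] c0 by simp
  then have "\<kappa> c0 = \<zero>" using c0 fc by (simp add: a_minus_def r_neg)
  then show ?case using z by simp
qed simp

text \<open>M is a countable supply of numerators for reciprocals modulo Q: M = {\<one>} gives the
  Nullstellensatz, larger M the avoidance of countably many hypersurfaces. A residue outside k would
  give uncountably many independent reciprocals.\<close>

lemma residue_field_eq_k:
  assumes Q: "primeideal Q R" and M: "countable M" "M \<subseteq> carrier R" "M \<inter> Q = {}"
    and max: "\<And>x. x \<in> carrier R \<Longrightarrow> x \<notin> Q \<Longrightarrow> \<exists>w\<in>M. \<exists>y\<in>carrier R. x \<otimes> y \<ominus> w \<in> Q"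
    and x: "x \<in> carrier R"
  shows "\<exists>c\<in>k. x \<ominus> c \<in> Q"
proof (rule ccontr)
  interpret Q: primeideal Q R by fact
  assume "\<not> (\<exists>c\<in>k. x \<ominus> c \<in> Q)"
  then have nc: "\<And>c. c \<in> k \<Longrightarrow> x \<ominus> c \<notin> Q" by auto
  then have "\<forall>c\<in>k. \<exists>w y. w \<in> M \<and> y \<in> carrier R \<and> (x \<ominus> c) \<otimes> y \<ominus> w \<in> Q"
    using max x by (metis k.LD minus_closed)
  then obtain s y where sy: "\<And>c. c \<in> k \<Longrightarrow> s c \<in> M \<and> y c \<in> carrier R \<and> (x \<ominus> c) \<otimes> y c \<ominus> s c \<in> Q" by metis
  then have "\<forall>c\<in>k. \<exists>n. y c \<in> V n" using V_exhaust by blast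
  then obtain n where n: "\<And>c. c \<in> k \<Longrightarrow> y c \<in> V (n c)" by metis
  \<comment> \<open>Pigeonhole on the pair of numerator and degree bound: uncountably many c share
    one pair, so more independent reciprocals than monomials fit into one space of bounded
    degree.\<close>
  have "countable ((\<lambda>c. (s c, n c)) ` k)"
    by (rule countable_subset[of _ "M \<times> UNIV"]) (use sy M in auto)
  moreover have "\<not> (\<forall>z \<in> (\<lambda>c. (s c, n c)) ` k. countable {c \<in> k. (s c, n c) = z})"
  proof
    assume *: "\<forall>z \<in> (\<lambda>c. (s c, n c)) ` k. countable {c \<in> k. (s c, n c) = z}"
    have "k = (\<Union>z \<in> (\<lambda>c. (s c, n c)) ` k. {c \<in> k. (s c, n c) = z})" by auto
    moreover have "countable \<dots>" using * \<open>countable ((\<lambda>c. (s c, n c)) ` k)\<close> by (intro countable_UN) auto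
    ultimately show False using k_uncountable by simp
  qed
  ultimately obtain z where "uncountable {c \<in> k. (s c, n c) = z}" by auto
  then have "infinite {c \<in> k. (s c, n c) = z}" using countable_finite by blast
  then obtain \<Gamma> where G: "finite \<Gamma>" "card \<Gamma> = Suc (card (Mon (snd z)))" "\<Gamma> \<subseteq> {c \<in> k. (s c, n c) = z}"
    using infinite_arbitrarily_large by meson
  have "\<Gamma> \<noteq> {}" using G by auto
  then have w: "fst z \<in> M" using G sy by auto
  interpret K: lin_ctx R k "{\<zero>}" Q by (rule k_ctx_ideal[OF Q.is_ideal])
  have yG: "\<And>c. c \<in> \<Gamma> \<Longrightarrow> y c \<in> carrier R" using G sy by auto
  have ind: "\<forall>c\<in>\<Gamma>. \<kappa> c \<in> {\<zero>}" if "\<kappa> \<in> \<Gamma> \<rightarrow> k" "(\<Oplus>c\<in>\<Gamma>. \<kappa> c \<otimes> y c) \<in> Q" for \<kappa>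
  proof -
    have sc: "fst z \<otimes> horner R [] x \<oplus> (\<Oplus>c\<in>\<Gamma>. \<kappa> c \<otimes> y c) \<in> Q"
      using that(2) K.TD[OF that(2)] M w by (auto simp: subset_iff)
    have "\<forall>c\<in>\<Gamma>. \<kappa> c = \<zero>"
    proof (rule reciprocals_indep[OF Q x nc, where \<Gamma>=\<Gamma> and y=y and w="fst z" and f="[]"])
      show "(x \<ominus> c) \<otimes> y c \<ominus> fst z \<in> Q" if "c \<in> \<Gamma>" for c using that G sy by force
    qed (use that G sy yG M w sc in auto)
    then show ?thesis by simp
  qed
  have "K.indep (y ` \<Gamma>)" "inj_on y \<Gamma>"
    using K.card_indep_image[of \<Gamma> y] G yG ind by auto
  moreover have "y ` \<Gamma> \<subseteq> K.cl (Mon (snd z))"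
  proof
    fix v assume "v \<in> y ` \<Gamma>"
    then have v: "v \<in> lspan R k (Mon (snd z))" "v \<in> carrier R" using G n yG unfolding V_def by auto
    then have "\<one> \<otimes> v = v \<oplus> \<zero>" by simp
    then show "v \<in> K.cl (Mon (snd z))" unfolding K.cl_def using v K.Z_one K.T_zero k.L_one by blast
  qed
  ultimately have "card (y ` \<Gamma>) \<le> card (Mon (snd z))"
    using K.steinitz finite_Mon Mon_carrier by blast
  then show False using G \<open>inj_on y \<Gamma>\<close> by (simp add: card_image)
qed

text \<open>The Nullstellensatz over an uncountable field: outside a maximal ideal everything is
  invertible modulo it, so the only numerator required is \<one>.\<close>

lemma maximal_residue:
  assumes m: "maximalideal m R" and x: "x \<in> carrier R"
  shows "\<exists>c\<in>k. x \<ominus> c \<in> m"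
proof (rule residue_field_eq_k[of m "{\<one>}"])
  interpret m: maximalideal m R by fact
  show "primeideal m R" using maximalideal_prime[OF m] .
  show "{\<one>} \<inter> m = {}" using m.one_imp_carrier m.I_notcarr by auto
  fix z assume z: "z \<in> carrier R" "z \<notin> m"
  have "idl_ins R m z = carrier R"
    using m.I_maximal[OF idl_ins(1)[OF m.is_ideal z(1)] idl_ins(2)[OF m.is_ideal z(1)]] z
      idl_ins(3)[OF m.is_ideal z(1)] idealD[OF idl_ins(1)[OF m.is_ideal z(1)]] by auto
  then obtain q r where q: "q \<in> m" "r \<in> carrier R" "\<one> = q \<oplus> z \<otimes> r" unfolding idl_ins_def by blast
  have qc: "q \<in> carrier R" using q m.Icarr by simp
  have "z \<otimes> r \<ominus> (q \<oplus> z \<otimes> r) = \<ominus> q" using qc q(2) z(1) by algebra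
  then have "z \<otimes> r \<ominus> \<one> \<in> m" using q ideal_uminus[OF m.is_ideal] by simp
  then show "\<exists>w\<in>{\<one>}. \<exists>y\<in>carrier R. z \<otimes> y \<ominus> w \<in> m" using q by auto
qed (use x in auto)

text \<open>A countable family of nonvanishing conditions on an irreducible closed set has a common
  solution: this is where uncountability of the field enters.\<close>

lemma maximal_avoiding:
  assumes P: "primeideal P R" and A: "countable A" "A \<subseteq> carrier R" "A \<inter> P = {}"
  shows "\<exists>m. maximalideal m R \<and> P \<subseteq> m \<and> A \<inter> m = {}"
proof -
  interpret P: primeideal P R by fact
  \<comment> \<open>The multiplicative set generated by A: finite products of elements of A, still
    countable.\<close>
  define M where "M = (\<lambda>l. foldr (\<otimes>) l \<one>) ` lists A"
  have foldc: "foldr (\<otimes>) l \<one> \<in> carrier R" if "l \<in> lists A" for l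
    using that A by (induction l) auto
  have Mc: "M \<subseteq> carrier R" using foldc by (auto simp: M_def)
  have cM: "countable M" using A by (auto simp: M_def)
  have M1: "\<one> \<in> M" unfolding M_def by (rule image_eqI[of _ _ "[]"]) auto
  have AM: "A \<subseteq> M"
  proof
    fix a assume "a \<in> A"
    then show "a \<in> M" unfolding M_def using A by (intro image_eqI[of _ _ "[a]"]) auto
  qed
  have Mmult: "a \<otimes> b \<in> M" if ab: "a \<in> M" "b \<in> M" for a b
  proof -
    obtain l l' where l: "l \<in> lists A" "l' \<in> lists A" "a = foldr (\<otimes>) l \<one>" "b = foldr (\<otimes>) l' \<one>"
      using ab by (auto simp: M_def)
    have "foldr (\<otimes>) (l @ l') \<one> = foldr (\<otimes>) l \<one> \<otimes> foldr (\<otimes>) l' \<one>"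
      using l(1)
    proof (induction l)
      case (Cons x l)
      have "foldr (\<otimes>) l \<one> \<in> carrier R" "foldr (\<otimes>) l' \<one> \<in> carrier R" "x \<in> carrier R"
        using Cons l foldc A by auto
      then show ?case using Cons by (simp add: m_assoc)
    qed (use l foldc in simp)
    then show ?thesis unfolding M_def using l by (intro image_eqI[of _ _ "l @ l'"]) auto
  qed
  have MP: "M \<inter> P = {}"
  proof -
    have "foldr (\<otimes>) l \<one> \<notin> P" if "l \<in> lists A" for l
      using that
    proof (induction l)
      case Nil
      then show ?case using P.one_imp_carrier P.I_notcarr by auto
    next
      case (Cons a l)
      then have "a \<in> carrier R" "a \<notin> P" "foldr (\<otimes>) l \<one> \<in> carrier R" using A foldc by auto
      then show ?case using Cons P.I_prime[of a "foldr (\<otimes>) l \<one>"] by auto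
    qed
    then show ?thesis by (auto simp: M_def)
  qed
  \<comment> \<open>A maximal member Q of this family is prime as usual. That it is even a maximal
    ideal of R comes from its residue domain being k.\<close>
  let ?C = "{I. ideal I R \<and> P \<subseteq> I \<and> M \<inter> I = {}}"
  have "\<exists>Q\<in>?C. \<forall>J\<in>?C. Q \<subseteq> J \<longrightarrow> J = Q"
  proof (rule subset_Zorn_nonempty)
    show "?C \<noteq> {}" using P.is_ideal MP by auto
    fix \<C> assume c: "\<C> \<noteq> {}" "subset.chain ?C \<C>"
    then have "subset.chain {I. ideal I R} \<C>" by (auto simp: subset.chain_def)
    then have "ideal (\<Union>\<C>) R" using chain_Union_is_ideal[of \<C>] c by simp
    moreover have C: "\<C> \<subseteq> ?C" using c by (auto simp: subset.chain_def)
    then have "P \<subseteq> \<Union>\<C>" using c(1) by blast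
    moreover have "M \<inter> \<Union>\<C> = {}" using C by blast
    ultimately show "\<Union>\<C> \<in> ?C" by simp
  qed
  then obtain Q where Q0: "Q \<in> ?C" and Q1: "\<forall>J\<in>?C. Q \<subseteq> J \<longrightarrow> J = Q" by (elim bexE)
  then have Q: "ideal Q R" "P \<subseteq> Q" "M \<inter> Q = {}" by simp_all
  have Qmax: "J = Q" if "ideal J R" "P \<subseteq> J" "M \<inter> J = {}" "Q \<subseteq> J" for J
    using bspec[OF Q1, of J] that by simp
  have meet: "\<exists>w\<in>M. \<exists>y\<in>carrier R. x \<otimes> y \<ominus> w \<in> Q" if x: "x \<in> carrier R" "x \<notin> Q" for x
  proof -
    note J = idl_ins[OF Q(1) x(1)]
    have "M \<inter> idl_ins R Q x \<noteq> {}" using Qmax[OF J(1)] J(2,3) Q(2) x(2) by blast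
    then obtain q r where q: "q \<in> Q" "r \<in> carrier R" "q \<oplus> x \<otimes> r \<in> M" unfolding idl_ins_def by blast
    have qc: "q \<in> carrier R" using q Q idealD by blast
    have "x \<otimes> r \<ominus> (q \<oplus> x \<otimes> r) = \<ominus> q" using qc q(2) x(1) by algebra
    then have "x \<otimes> r \<ominus> (q \<oplus> x \<otimes> r) \<in> Q" using q ideal_uminus[OF Q(1)] by simp
    then show ?thesis using q(2,3) by blast
  qed
  interpret Q: ideal Q R by fact
  have Qn: "\<one> \<notin> Q" using Q M1 by auto
  have Qp: "primeideal Q R"
  proof (rule primeidealI[OF Q(1) cring_axioms])
    show "carrier R \<noteq> Q" using Qn by auto
    fix a b assume ab: "a \<in> carrier R" "b \<in> carrier R" "a \<otimes> b \<in> Q"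
    show "a \<in> Q \<or> b \<in> Q"
    proof (rule ccontr)
      assume "\<not> (a \<in> Q \<or> b \<in> Q)"
      then obtain s y t z where st: "s \<in> M" "y \<in> carrier R" "a \<otimes> y \<ominus> s \<in> Q" "t \<in> M" "z \<in> carrier R" "b \<otimes> z \<ominus> t \<in> Q"
        using meet ab by metis
      have c: "s \<in> carrier R" "t \<in> carrier R" using st Mc by auto
      have "(a \<otimes> b) \<otimes> (y \<otimes> z) \<ominus> (a \<otimes> y \<ominus> s) \<otimes> (b \<otimes> z) \<ominus> s \<otimes> (b \<otimes> z \<ominus> t) \<in> Q"
        by (rule ideal_minus[OF Q(1) ideal_minus[OF Q(1) Q.I_r_closed[OF ab(3)] Q.I_r_closed[OF st(3)]] Q.I_l_closed[OF st(6)]])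
          (use st(2,5) ab(1,2) c in auto)
      moreover have "(a \<otimes> b) \<otimes> (y \<otimes> z) \<ominus> (a \<otimes> y \<ominus> s) \<otimes> (b \<otimes> z) \<ominus> s \<otimes> (b \<otimes> z \<ominus> t) = s \<otimes> t"
        using st(2,5) ab(1,2) c by algebra
      ultimately show False using Mmult st Q by auto
    qed
  qed
  \<comment> \<open>An element j outside Q is congruent modulo Q to a nonzero constant, so every
    larger ideal contains a unit.\<close>
  have "maximalideal Q R"
  proof (rule maximalidealI[OF Q(1)])
    show "carrier R \<noteq> Q" using Qn by auto
    fix J assume J: "ideal J R" "Q \<subseteq> J" "J \<subseteq> carrier R"
    show "J = Q \<or> J = carrier R"
    proof (cases "J = Q")
      case False
      then obtain j where j: "j \<in> J" "j \<notin> Q" using J by auto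
      obtain c where c: "c \<in> k" "j \<ominus> c \<in> Q"
        using residue_field_eq_k[OF Qp cM Mc Q(3) meet] j J by blast
      have jc: "j \<in> carrier R" using j J by auto
      have "c \<noteq> \<zero>" using c j jc by (auto simp: a_minus_def)
      have "j \<ominus> (j \<ominus> c) \<in> J" using ideal_minus[OF J(1) j(1) subsetD[OF J(2) c(2)]] .
      moreover have "j \<ominus> (j \<ominus> c) = c" using jc k.LD[OF c(1)] by algebra
      ultimately have "c \<in> J" by simp
      moreover obtain d where "d \<in> k" "c \<otimes> d = \<one>" using k_inv c \<open>c \<noteq> \<zero>\<close> by auto
      ultimately have "\<one> \<in> J" using ideal.I_r_closed[OF J(1), of c d] by simp
      then show ?thesis using ideal.one_imp_carrier[OF J(1)] by simp
    qed simp
  qed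
  then show ?thesis using Q AM by auto
qed

end

text \<open>The product of the individual witnesses stays outside P and, being a multiple of each,
  satisfies every condition.\<close>

lemma (in cring) prime_common:
  assumes P: "primeideal P R" and "finite Y"
    and "\<And>y. y \<in> Y \<Longrightarrow> \<exists>s\<in>carrier R - P. Pr s y"
    and scal: "\<And>s t y. \<lbrakk>y \<in> Y; s \<in> carrier R; t \<in> carrier R; Pr s y\<rbrakk> \<Longrightarrow> Pr (t \<otimes> s) y"
  shows "\<exists>s\<in>carrier R - P. \<forall>y\<in>Y. Pr s y"
  using assms(2-)
proof (induction Y rule: finite_induct)
  case empty
  interpret primeideal P R by fact
  show ?case using one_imp_carrier I_notcarr by auto
next
  case (insert y Y)
  interpret primeideal P R by fact
  obtain s where s: "s \<in> carrier R - P" "\<forall>y\<in>Y. Pr s y"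
    using insert.IH[OF insert.prems(1) insert.prems(2)] by auto
  obtain t where t: "t \<in> carrier R - P" "Pr t y" using insert.prems(1)[of y] by auto
  have "t \<otimes> s \<in> carrier R - P" using s t I_prime[of t s] by auto
  moreover have "Pr (s \<otimes> t) y" using insert.prems(2)[of y t s] s t by auto
  moreover have "Pr (t \<otimes> s) z" if "z \<in> Y" for z using insert.prems(2)[of z s t] s t that by auto
  ultimately show ?case using s t by (intro bexI[of _ "t \<otimes> s"]) (auto simp: m_comm)
qed

text \<open>A form of Nakayama's lemma in coordinates: a matrix that is diagonal and invertible modulo a
  prime \<open>m\<close> can be inverted after multiplication by an element outside \<open>m\<close>.\<close>

lemma (in cring) nakayama_coordinates:
  assumes m: "primeideal m R" and "finite Y"
    and N: "\<And>v w. v \<in> N \<Longrightarrow> w \<in> N \<Longrightarrow> (\<lambda>i. v i \<oplus> w i) \<in> N"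
      "\<And>v a. v \<in> N \<Longrightarrow> a \<in> carrier R \<Longrightarrow> (\<lambda>i. a \<otimes> v i) \<in> N"
      "\<And>v i. v \<in> N \<Longrightarrow> v i \<in> carrier R"
    and rows: "\<And>y. y \<in> Y \<Longrightarrow> \<exists>v\<in>N. v y \<notin> m \<and> (\<forall>y'\<in>Y - {y}. v y' \<in> m) \<and> (\<forall>y'. y' \<notin> Y \<longrightarrow> v y' = \<zero>)"
    and y: "y \<in> Y"
  shows "\<exists>s\<in>carrier R - m. (\<lambda>i. if i = y then s else \<zero>) \<in> N"
  using assms(2) rows y
proof (induction "card Y" arbitrary: Y)
  case (Suc n)
  interpret m: primeideal m R by fact
  show ?case
  proof (cases "Y = {y}")
    case True
    obtain v where v: "v \<in> N" "v y \<notin> m" "\<forall>y'. y' \<notin> Y \<longrightarrow> v y' = \<zero>" using Suc.prems(2)[of y] True by auto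
    then have "(\<lambda>i. if i = y then v y else \<zero>) = v" using True by auto
    then show ?thesis using v N(3)[OF v(1), of y] by (intro bexI[of _ "v y"]) auto
  next
    case False
    then obtain z where z: "z \<in> Y" "z \<noteq> y" using Suc.prems(3) by auto
    obtain u where u: "u \<in> N" "u z \<notin> m" "\<forall>y'\<in>Y - {z}. u y' \<in> m" "\<forall>y'. y' \<notin> Y \<longrightarrow> u y' = \<zero>"
      using Suc.prems(2)[OF z(1)] by auto
    have "\<exists>s\<in>carrier R - m. (\<lambda>i. if i = y then s else \<zero>) \<in> N"
    proof (rule Suc.hyps(1))
      show "n = card (Y - {z})" using Suc z by simp
      show "finite (Y - {z})" "y \<in> Y - {z}" using Suc z by auto
      fix x assume x: "x \<in> Y - {z}"
      then obtain v where v: "v \<in> N" "v x \<notin> m" "\<forall>y'\<in>Y - {x}. v y' \<in> m" "\<forall>y'. y' \<notin> Y \<longrightarrow> v y' = \<zero>"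
        using Suc.prems(2)[of x] by auto
      note c = N(3)[OF u(1)] N(3)[OF v(1)]
      \<comment> \<open>Gaussian elimination of column z. The diagonal entry
        \<open>u z * v x\<close> stays outside m by primality; the corrections come from
        off-diagonal entries, which lie in m.\<close>
      let ?w = "\<lambda>i. u z \<otimes> v i \<oplus> (\<ominus> v z) \<otimes> u i"
      have "?w \<in> N" using N(1)[OF N(2)[OF v(1) c(1)[of z]] N(2)[OF u(1), of "\<ominus> v z"]] c by simp
      moreover have "?w x \<notin> m"
      proof
        assume *: "?w x \<in> m"
        have "v z \<otimes> u x \<in> m" using u(3) x m.I_l_closed c by auto
        then have "?w x \<oplus> v z \<otimes> u x \<in> m" using * by simp
        moreover have "a \<otimes> b \<oplus> (\<ominus> c) \<otimes> d \<oplus> c \<otimes> d = a \<otimes> b"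
          if "a \<in> carrier R" "b \<in> carrier R" "c \<in> carrier R" "d \<in> carrier R" for a b c d using that by algebra
        ultimately have "u z \<otimes> v x \<in> m" using c by simp
        then show False using m.I_prime[of "u z" "v x"] c u(2) v(2) by auto
      qed
      moreover have "?w y' \<in> m" if "y' \<in> (Y - {z}) - {x}" for y'
        using that u(3) v(3) c m.I_l_closed[of "v y'" "u z"] m.I_l_closed[of "u y'" "\<ominus> v z"] by simp
      moreover have "?w y' = \<zero>" if "y' \<notin> Y - {z}" for y'
      proof (cases "y' = z")
        case True
        have "a \<otimes> b \<oplus> (\<ominus> b) \<otimes> a = \<zero>" if "a \<in> carrier R" "b \<in> carrier R" for a b using that by algebra
        then show ?thesis using True c by simp
      next
        case False
        then show ?thesis using that u(4) v(4) c by simp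
      qed
      ultimately show "\<exists>v\<in>N. v x \<notin> m \<and> (\<forall>y'\<in>Y - {z} - {x}. v y' \<in> m) \<and> (\<forall>y'. y' \<notin> Y - {z} \<longrightarrow> v y' = \<zero>)"
        by (intro bexI[of _ ?w]) auto
    qed
    then show ?thesis .
  qed
qed auto

context affine_alg
begin

section \<open>Codimension of subspaces\<close>

definition spans :: "'a set \<Rightarrow> 'a set \<Rightarrow> bool" where
  "spans J Z \<longleftrightarrow> finite Z \<and> Z \<subseteq> carrier R \<and> (\<forall>x\<in>carrier R. \<exists>s\<in>lspan R k Z. \<exists>j\<in>J. x = s \<oplus> j)"

text \<open>The k-dimension of R modulo J, as the least size of a spanning set. Without a finite
  spanning set the value is unspecified, which is why hypotheses \<open>spans J Z\<close> accompany
  it.\<close>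

definition cdim :: "'a set \<Rightarrow> nat" where
  "cdim J = (LEAST n. \<exists>Z. spans J Z \<and> card Z = n)"

lemma cdim_le: "spans J Z \<Longrightarrow> cdim J \<le> card Z"
  unfolding cdim_def by (rule Least_le) auto

lemma cdim_spans: "spans J Z \<Longrightarrow> \<exists>Z'. spans J Z' \<and> card Z' = cdim J"
  unfolding cdim_def by (rule LeastI_ex) auto

lemma spans_mono: "spans J Z \<Longrightarrow> J \<subseteq> J' \<Longrightarrow> spans J' Z"
  unfolding spans_def by blast

lemma cdim_mono: assumes "spans J Z" "J \<subseteq> J'" shows "cdim J' \<le> cdim J"
  using cdim_spans[OF assms(1)] spans_mono[OF _ assms(2)] cdim_le by metis

lemma spans_cl:
  assumes "ideal J R" "finite Z" "Z \<subseteq> carrier R"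
  shows "spans J Z \<longleftrightarrow> carrier R \<subseteq> lin_ctx.cl R k {\<zero>} J Z"
proof -
  interpret K: lin_ctx R k "{\<zero>}" J by (rule k_ctx_ideal[OF assms(1)])
  show ?thesis
  proof
    assume s: "spans J Z"
    show "carrier R \<subseteq> K.cl Z"
    proof
      fix x assume x: "x \<in> carrier R"
      obtain s j where "s \<in> lspan R k Z" "j \<in> J" "x = s \<oplus> j" using s x unfolding spans_def by blast
      then have "\<one> \<otimes> x = s \<oplus> j" "s \<in> lspan R k Z" "j \<in> J" using x by auto
      then show "x \<in> K.cl Z" unfolding K.cl_def using x K.Z_one k.L_one by blast
    qed
  next
    assume c: "carrier R \<subseteq> K.cl Z"
    show "spans J Z" unfolding spans_def
    proof (intro conjI ballI)
      fix x assume x: "x \<in> carrier R"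
      then obtain l s t where l: "l \<in> k" "l \<noteq> \<zero>" "s \<in> lspan R k Z" "t \<in> J" "l \<otimes> x = s \<oplus> t"
        using c unfolding K.cl_def by blast
      obtain d where d: "d \<in> k" "l \<otimes> d = \<one>" using k_inv l by auto
      have sc: "s \<in> carrier R" "t \<in> carrier R" using l k.lspan_carrier assms by auto
      have "x = (l \<otimes> d) \<otimes> x" using d x by simp
      also have "\<dots> = d \<otimes> (l \<otimes> x)" using k.LD[OF d(1)] k.LD[OF l(1)] x by algebra
      finally have "x = d \<otimes> s \<oplus> d \<otimes> t" using l d sc by (simp add: r_distr)
      moreover have "d \<otimes> s \<in> lspan R k Z" "d \<otimes> t \<in> J" using l d k.lspan_scal assms by auto
      ultimately show "\<exists>s\<in>lspan R k Z. \<exists>j\<in>J. x = s \<oplus> j" by metis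
    qed (use assms in auto)
  qed
qed

text \<open>A minimal spanning set Z modulo J still spans modulo J' and contains a basis there. If
  all of Z were independent modulo J', an element of J' - J written in terms of Z would have only
  zero coefficients.\<close>

lemma cdim_strict:
  assumes J: "ideal J R" "ideal J' R" "J \<subset> J'" "spans J Z0"
  shows "cdim J' < cdim J"
proof -
  interpret K: lin_ctx R k "{\<zero>}" J' by (rule k_ctx_ideal[OF J(2)])
  obtain Z where Z: "spans J Z" "card Z = cdim J" using cdim_spans[OF J(4)] by auto
  have Zf: "finite Z" "Z \<subseteq> carrier R" using Z by (auto simp: spans_def)
  have Z': "spans J' Z" using spans_mono[OF Z(1)] J(3) by blast
  obtain B where B: "B \<subseteq> Z" "K.indep B" "Z \<subseteq> K.cl B" using K.basis_exists[OF Zf] by auto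
  have Bf: "finite B" "B \<subseteq> carrier R" using B Zf finite_subset by auto
  have "carrier R \<subseteq> K.cl Z" using Z' spans_cl[OF J(2) Zf] by simp
  then have "carrier R \<subseteq> K.cl B" using K.cl_trans[OF Zf(1) B(3) Bf(2)] by blast
  then have "spans J' B" using spans_cl[OF J(2) Bf] by simp
  then have le: "cdim J' \<le> card B" by (rule cdim_le)
  have "B \<noteq> Z"
  proof
    assume "B = Z"
    obtain y where y: "y \<in> J'" "y \<notin> J" using J by auto
    have yc: "y \<in> carrier R" using y J idealD by blast
    obtain s j where s: "s \<in> lspan R k Z" "j \<in> J" "y = s \<oplus> j" using Z yc unfolding spans_def by blast
    obtain c where c: "c \<in> Z \<rightarrow> k" "s = (\<Oplus>x\<in>Z. c x \<otimes> x)" using k.lspan_repr[OF Zf s(1)] by auto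
    have sc: "s \<in> carrier R" "j \<in> carrier R" using s k.lspan_carrier[OF s(1) Zf(2)] idealD[OF J(1)] by auto
    have "s = y \<ominus> j" using s(3) sc by algebra
    then have "s \<in> J'" using ideal_minus[OF J(2) y(1)] s(2) J(3) by auto
    then have "\<forall>x\<in>Z. c x \<in> {\<zero>}" using B(2) c unfolding \<open>B = Z\<close> K.indep_def by blast
    then have "s = (\<Oplus>x\<in>Z. \<zero>)" unfolding c(2) by (intro finsum_cong') (use Zf in auto)
    then have "y = j" using s sc by simp
    then show False using y s by simp
  qed
  then have "card B < card Z" using B(1) Zf by (simp add: psubset_card_mono psubsetI)
  then show ?thesis using le Z by simp
qed

text \<open>The exact sequence with first map multiplication by a, from R modulo (J : a) to R modulo
  J, and with cokernel R modulo J + aR. Taking J1 and J2 merely inside J + aR and J : a leaves room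
  for sums with Frobenius powers.\<close>

lemma spans_colon:
  assumes J: "ideal J R" and a: "a \<in> carrier R"
    and Z: "spans J1 Z1" "spans J2 Z2" "J1 \<subseteq> idl_ins R J a" "\<And>j. j \<in> J2 \<Longrightarrow> j \<in> carrier R \<and> a \<otimes> j \<in> J"
  shows "spans J (Z1 \<union> (\<lambda>z. a \<otimes> z) ` Z2)"
  unfolding spans_def
proof (intro conjI ballI)
  show f: "finite (Z1 \<union> (\<lambda>z. a \<otimes> z) ` Z2)" and c: "Z1 \<union> (\<lambda>z. a \<otimes> z) ` Z2 \<subseteq> carrier R"
    using Z a by (auto simp: spans_def)
  let ?Z = "Z1 \<union> (\<lambda>z. a \<otimes> z) ` Z2"
  have Zc: "Z1 \<subseteq> carrier R" "Z2 \<subseteq> carrier R" using Z by (auto simp: spans_def)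
  have sc: "a \<otimes> s \<in> lspan R k ?Z" if "s \<in> lspan R k Z2" for s
    using that
  proof (induction s rule: lspan.induct)
    case (lspan_step s l x)
    then have "s \<in> carrier R" "l \<in> carrier R" "x \<in> carrier R" using k.lspan_carrier Zc by auto
    then have "a \<otimes> (s \<oplus> l \<otimes> x) = a \<otimes> s \<oplus> l \<otimes> (a \<otimes> x)" using a by (simp add: r_distr m_lcomm)
    then show ?case using lspan_step by (simp add: lspan.lspan_step)
  qed (use a in \<open>simp add: lspan.lspan_zero\<close>)
  fix x assume x: "x \<in> carrier R"
  obtain s j where s: "s \<in> lspan R k Z1" "j \<in> J1" "x = s \<oplus> j" using Z(1) x unfolding spans_def by blast
  obtain q r where q: "q \<in> J" "r \<in> carrier R" "j = q \<oplus> a \<otimes> r" using s(2) Z(3) unfolding idl_ins_def by auto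
  obtain t i where t: "t \<in> lspan R k Z2" "i \<in> J2" "r = t \<oplus> i" using Z(2) q(2) unfolding spans_def by blast
  have ic: "i \<in> carrier R" "a \<otimes> i \<in> J" using t Z(4) by auto
  have tc: "t \<in> carrier R" "s \<in> carrier R" "q \<in> carrier R" using t s q Zc k.lspan_carrier idealD[OF J] by auto
  have "x = (s \<oplus> a \<otimes> t) \<oplus> (q \<oplus> a \<otimes> i)" unfolding s(3) q(3) t(3) using ic(1) tc a by algebra
  moreover have "s \<oplus> a \<otimes> t \<in> lspan R k ?Z"
    using k.lspan_add[OF sc[OF t(1)] k.lspan_mono[OF s(1)]] c by auto
  moreover have "q \<oplus> a \<otimes> i \<in> J" using ideal_add[OF J q(1) ic(2)] .
  ultimately show "\<exists>s\<in>lspan R k ?Z. \<exists>j\<in>J. x = s \<oplus> j" by metis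
qed

lemma cdim_colon:
  assumes J: "ideal J R" and a: "a \<in> carrier R"
    and Z: "spans J1 Z1" "spans J2 Z2" "J1 \<subseteq> idl_ins R J a" "\<And>j. j \<in> J2 \<Longrightarrow> j \<in> carrier R \<and> a \<otimes> j \<in> J"
  shows "cdim J \<le> cdim J1 + cdim J2"
proof -
  obtain Y1 Y2 where Y: "spans J1 Y1" "card Y1 = cdim J1" "spans J2 Y2" "card Y2 = cdim J2"
    using cdim_spans Z(1,2) by metis
  have "cdim J \<le> card (Y1 \<union> (\<lambda>z. a \<otimes> z) ` Y2)"
    by (rule cdim_le[OF spans_colon[OF J a Y(1,3) Z(3,4)]])
  also have "\<dots> \<le> card Y1 + card ((\<lambda>z. a \<otimes> z) ` Y2)" by (rule card_Un_le)
  also have "\<dots> \<le> card Y1 + card Y2" using card_image_le[of Y2] Y(3) by (simp add: spans_def)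
  finally show ?thesis using Y by simp
qed

section \<open>Frobenius powers of ideals\<close>

lemma k_pow: "c \<in> k \<Longrightarrow> c [^] (n::nat) \<in> k"
  by (induction n) auto

lemma k_fr: "c \<in> k \<Longrightarrow> fr e c \<in> k" by (simp add: fr_def k_pow)

text \<open>The field k is perfect: X^p - c takes different values at \<zero> and \<one>, so it is
  not a constant function and must have a root in k.\<close>

lemma k_root1:
  assumes c: "c \<in> k" shows "\<exists>d\<in>k. d [^] p = c"
proof -
  have h: "horner R (replicate n \<zero> @ [\<one>]) y = y [^] n" if "y \<in> carrier R" for n y
    using that by (induction n) (auto simp: m_comm)
  let ?l = "\<ominus> c # (replicate (p - 1) \<zero> @ [\<one>])"
  have hl: "horner R ?l y = \<ominus> c \<oplus> y [^] p" if "y \<in> carrier R" for y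
  proof -
    have "y \<otimes> y [^] (p - 1) = y [^] Suc (p - 1)" using that by (simp add: m_comm)
    then show ?thesis using h[OF that, of "p - 1"] p_pos by simp
  qed
  have "set ?l \<subseteq> k" using c by auto
  from k_closed[OF this] consider d where "d \<in> k" "horner R ?l d = \<zero>"
    | a where "\<And>y. y \<in> carrier R \<Longrightarrow> horner R ?l y = a" by blast
  then show ?thesis
  proof cases
    case 1
    then have "\<ominus> c \<oplus> d [^] p = \<zero>" using hl[of d] by simp
    then have "d [^] p = c" using c 1(1) k.LD by (metis add.inv_solve_left add.m_comm minus_equality minus_minus nat_pow_closed a_inv_closed)
    then show ?thesis using 1 by auto
  next
    case 2
    have "horner R ?l \<zero> = horner R ?l \<one>" using 2 by simp
    then have "\<ominus> c \<oplus> \<zero> = \<ominus> c \<oplus> \<one>" using hl[of \<zero>] hl[of \<one>] p_pos by (simp add: nat_pow_zero)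
    then have "\<zero> = \<one>" using c by (metis a_inv_closed add.l_cancel k.LD one_closed zero_closed)
    then show ?thesis using one_neq_zero by simp
  qed
qed

lemma k_fr_root: "c \<in> k \<Longrightarrow> \<exists>d\<in>k. fr e d = c"
proof (induction e arbitrary: c)
  case 0
  then show ?case by (intro bexI[of _ c]) auto
next
  case (Suc e)
  obtain d where d: "d \<in> k" "d [^] p = c" using k_root1 Suc by auto
  obtain d' where d': "d' \<in> k" "fr e d' = d" using Suc.IH d by auto
  have "fr (Suc e) d' = fr e d' [^] p" unfolding fr_def using d'(1) by (simp add: nat_pow_pow mult.commute)
  then show ?case using d d' by auto
qed

section \<open>R as a module over its subring of q-th powers\<close>

definition frs :: "nat \<Rightarrow> 'a set" where "frs e = fr e ` carrier R"

lemma frs_scalars: "scalars R (frs e)"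
proof
  show "frs e \<subseteq> carrier R" by (auto simp: frs_def)
  show "\<one> \<in> frs e" unfolding frs_def by (rule image_eqI[of _ _ \<one>]) auto
  show "a \<oplus> b \<in> frs e" "a \<otimes> b \<in> frs e" if "a \<in> frs e" "b \<in> frs e" for a b
    using that unfolding frs_def by (auto simp: fr_add[symmetric] fr_mult[symmetric])
  show "\<ominus> a \<in> frs e" if "a \<in> frs e" for a
    using that unfolding frs_def by (auto simp: fr_uminus[symmetric])
qed

lemma frsI: "a \<in> carrier R \<Longrightarrow> fr e a \<in> frs e" by (auto simp: frs_def)

lemma k_frs: "k \<subseteq> frs e"
proof
  fix c assume "c \<in> k"
  then obtain d where "d \<in> k" "fr e d = c" using k_fr_root by blast
  then show "c \<in> frs e" using frsI[of d e] by simp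
qed

text \<open>The scalars are the q-th powers of R modulo those of P, a copy of the domain R modulo P.
  It is used with T = P, and with T the kernel of localization at a minimal prime.\<close>

lemma fr_ctx:
  assumes P: "primeideal P R" and T: "ideal T R" and PT: "\<And>a. a \<in> P \<Longrightarrow> fr e a \<in> T"
    and sat: "\<And>u x. \<lbrakk>u \<in> carrier R; u \<notin> P; x \<in> carrier R; u \<otimes> x \<in> T\<rbrakk> \<Longrightarrow> x \<in> T"
  shows "lin_ctx R (frs e) (fr e ` P) T"
proof -
  interpret scalars R "frs e" by (rule frs_scalars)
  interpret P: primeideal P R by fact
  interpret T: ideal T R by fact
  have iff: "fr e a \<in> fr e ` P \<longleftrightarrow> a \<in> P" if "a \<in> carrier R" for a
  proof
    assume "fr e a \<in> fr e ` P"
    then obtain b where "b \<in> P" "fr e a = fr e b" by auto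
    then have "fr e a \<in> P" using fr_prime[OF P, of b] by simp
    then show "a \<in> P" using fr_prime[OF P that] by simp
  qed auto
  show ?thesis
  proof
    show "fr e ` P \<subseteq> frs e" unfolding frs_def by auto
    show "\<one> \<notin> fr e ` P" using iff[of \<one>] P.one_imp_carrier P.I_notcarr by auto
    show "\<zero> \<in> fr e ` P" using iff[of \<zero>] by simp
    show "a \<in> fr e ` P \<or> b \<in> fr e ` P" if ab0: "a \<in> frs e" "b \<in> frs e" "a \<otimes> b \<in> fr e ` P" for a b
    proof -
      obtain a' b' where ab: "a = fr e a'" "b = fr e b'" "a' \<in> carrier R" "b' \<in> carrier R" using ab0(1,2) by (auto simp: frs_def)
      then have "a' \<otimes> b' \<in> P" using ab0 iff[of "a' \<otimes> b'"] by (simp add: fr_mult)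
      then show ?thesis using P.I_prime[of a' b'] ab by auto
    qed
    show "z \<otimes> x \<in> T" if "z \<in> fr e ` P" "x \<in> carrier R" for z x
      using that PT T.I_r_closed by auto
    show "x \<in> T" if l0: "l \<in> frs e" "l \<notin> fr e ` P" "x \<in> carrier R" "l \<otimes> x \<in> T" for l x
    proof -
      obtain a where a: "l = fr e a" "a \<in> carrier R" using l0(1) by (auto simp: frs_def)
      then have "l \<notin> P" using l0 iff[of a] fr_prime[OF P, of a] by auto
      then show ?thesis using sat[of l x] a l0 by simp
    qed
  qed (use T.I_l_closed frs_def in auto)
qed

lemma fr_ctx_prime: "primeideal P R \<Longrightarrow> lin_ctx R (frs e) (fr e ` P) P"
proof (rule fr_ctx)
  assume P: "primeideal P R"
  then interpret primeideal P R .
  show "ideal P R" by (rule is_ideal)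
  show "fr e a \<in> P" if "a \<in> P" for a using fr_prime[OF P] that Icarr by auto
  show "x \<in> P" if "u \<in> carrier R" "u \<notin> P" "x \<in> carrier R" "u \<otimes> x \<in> P" for u x using I_prime[of u x] that by auto
qed

text \<open>Monomials with all exponents below q. Dividing exponents by q with remainder shows that
  they generate R over its q-th powers, as the constants of k are themselves q-th powers.\<close>

definition MonL :: "nat \<Rightarrow> 'a set" where "MonL e = {mon \<gamma> | \<gamma>. \<forall>x. \<gamma> x < p ^ e}"

lemma MonL_carrier: "MonL e \<subseteq> carrier R" by (auto simp: MonL_def)

lemma card_MonL: "finite (MonL e)" "card (MonL e) \<le> (p ^ e) ^ card S"
proof -
  have s: "MonL e \<subseteq> mon ` (S \<rightarrow>\<^sub>E {..<p ^ e})"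
  proof
    fix y assume "y \<in> MonL e"
    then obtain \<alpha> where \<alpha>: "y = mon \<alpha>" "\<forall>x. \<alpha> x < p ^ e" by (auto simp: MonL_def)
    then have "restrict \<alpha> S \<in> S \<rightarrow>\<^sub>E {..<p ^ e}" by auto
    moreover have "y = mon (restrict \<alpha> S)" unfolding \<alpha> by (rule mon_cong) simp
    ultimately show "y \<in> mon ` (S \<rightarrow>\<^sub>E {..<p ^ e})" by blast
  qed
  have f: "finite (S \<rightarrow>\<^sub>E {..<p ^ e})" by (simp add: finite_PiE)
  then show "finite (MonL e)" using s finite_subset by blast
  have "card (MonL e) \<le> card (mon ` (S \<rightarrow>\<^sub>E {..<p ^ e}))" using s f by (simp add: card_mono)
  also have "\<dots> \<le> card (S \<rightarrow>\<^sub>E {..<p ^ e})" using f by (rule card_image_le)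
  finally show "card (MonL e) \<le> (p ^ e) ^ card S" by (simp add: card_PiE)
qed

lemma mon_divmod: "\<exists>\<gamma>. (\<forall>x. \<gamma> x < p ^ e) \<and> mon \<alpha> = fr e (mon (\<lambda>x. \<alpha> x div p ^ e)) \<otimes> mon \<gamma>"
proof -
  have "mon \<alpha> = mon (\<lambda>x. p ^ e * (\<alpha> x div p ^ e) + \<alpha> x mod p ^ e)" by (simp add: mult.commute)
  then have "mon \<alpha> = fr e (mon (\<lambda>x. \<alpha> x div p ^ e)) \<otimes> mon (\<lambda>x. \<alpha> x mod p ^ e)"
    by (simp only: mon_add mon_fr)
  then show ?thesis using p_pos by (intro exI[of _ "\<lambda>x. \<alpha> x mod p ^ e"]) auto
qed

lemma lspan_MonL: "x \<in> carrier R \<Longrightarrow> x \<in> lspan R (frs e) (MonL e)"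
proof -
  interpret F: scalars R "frs e" by (rule frs_scalars)
  assume "x \<in> carrier R"
  then obtain n where "x \<in> V n" using V_exhaust by auto
  then show ?thesis unfolding V_def
  proof (induction x rule: lspan.induct)
    case (lspan_step s l y)
    then obtain \<alpha> where y: "y = mon \<alpha>" by (auto simp: Mon_def)
    obtain \<gamma> where g: "\<forall>x. \<gamma> x < p ^ e" "mon \<alpha> = fr e (mon (\<lambda>x. \<alpha> x div p ^ e)) \<otimes> mon \<gamma>" using mon_divmod by blast
    have "l \<otimes> y = (l \<otimes> fr e (mon (\<lambda>x. \<alpha> x div p ^ e))) \<otimes> mon \<gamma>" unfolding y g(2) using lspan_step by (simp add: m_assoc)
    moreover have "l \<otimes> fr e (mon (\<lambda>x. \<alpha> x div p ^ e)) \<in> frs e" using k_frs lspan_step(2) frsI[of "mon (\<lambda>x. \<alpha> x div p ^ e)"] by (intro F.L_mult) auto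
    moreover have "mon \<gamma> \<in> MonL e" using g by (auto simp: MonL_def)
    ultimately show ?case using lspan_step.IH by (simp add: lspan.lspan_step)
  qed (rule lspan.lspan_zero)
qed

definition fp :: "nat \<Rightarrow> 'a set \<Rightarrow> 'a set" where "fp e m = Idl (fr e ` m)"

lemma fp_sub: "ideal m R \<Longrightarrow> fr e ` m \<subseteq> carrier R"
  using idealD[of m] by auto

lemma fp_ideal: "ideal m R \<Longrightarrow> ideal (fp e m) R"
  unfolding fp_def by (rule genideal_ideal[OF fp_sub])

lemma fr_fp: "ideal m R \<Longrightarrow> a \<in> m \<Longrightarrow> fr e a \<in> fp e m"
  unfolding fp_def using genideal_self[OF fp_sub] by blast

lemma fp_lspan: "ideal m R \<Longrightarrow> fp e m = lspan R (fr e ` m) (carrier R)"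
  unfolding fp_def by (rule Idl_lspan[OF fp_sub])

text \<open>A ring factor is expanded in \<open>MonL e\<close>, and its q-th power coefficients
  merge with the q-th powers of elements of m. This gives coordinates in m, as Nakayama's lemma
  wants them.\<close>

lemma fp_lspan_MonL:
  assumes m: "ideal m R" and w: "w \<in> fp e m" shows "w \<in> lspan R (fr e ` m) (MonL e)"
proof -
  have add: "s \<oplus> t \<in> lspan R (fr e ` m) (MonL e)" if "s \<in> lspan R (fr e ` m) (MonL e)" "t \<in> lspan R (fr e ` m) (MonL e)" for s t
    using lspan_add_gen[OF that(2,1) fp_sub[OF m] MonL_carrier] by simp
  have mult: "fr e \<mu> \<otimes> r \<in> lspan R (fr e ` m) (MonL e)" if "r \<in> lspan R (frs e) (MonL e)" "\<mu> \<in> m" for \<mu> r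
    using that
  proof (induction r rule: lspan.induct)
    case lspan_zero
    then show ?case using idealD[OF m] by (simp add: lspan.lspan_zero)
  next
    case (lspan_step s l x)
    obtain a where a: "l = fr e a" "a \<in> carrier R" using lspan_step by (auto simp: frs_def)
    have mc: "\<mu> \<in> carrier R" using lspan_step idealD[OF m] by auto
    interpret F: scalars R "frs e" by (rule frs_scalars)
    have "s \<in> carrier R" "x \<in> carrier R" using lspan_step F.lspan_carrier MonL_carrier by auto
    then have "fr e \<mu> \<otimes> (s \<oplus> l \<otimes> x) = fr e \<mu> \<otimes> s \<oplus> fr e (\<mu> \<otimes> a) \<otimes> x"
      using a mc by (simp add: fr_mult r_distr m_assoc)
    moreover have "\<mu> \<otimes> a \<in> m" using ideal.I_r_closed[OF m] lspan_step a by auto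
    ultimately show ?case using lspan_step by (auto intro!: lspan.lspan_step)
  qed
  show ?thesis using w unfolding fp_lspan[OF m]
  proof (induction w rule: lspan.induct)
    case (lspan_step s l x)
    then show ?case using add mult lspan_MonL by auto
  qed (rule lspan.lspan_zero)
qed

text \<open>Modulo m^[q] a coefficient a^q equals c^q, where c in k is the residue of a. So
  generators over the q-th powers span over k.\<close>

lemma fp_spans:
  assumes "maximalideal m R" shows "spans (fp e m) (MonL e)"
  unfolding spans_def
proof (intro conjI ballI)
  interpret m: maximalideal m R by fact
  show "finite (MonL e)" "MonL e \<subseteq> carrier R" using card_MonL MonL_carrier by auto
  fix x assume "x \<in> carrier R"
  then have "x \<in> lspan R (frs e) (MonL e)" by (rule lspan_MonL)
  then show "\<exists>s\<in>lspan R k (MonL e). \<exists>j\<in>fp e m. x = s \<oplus> j"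
  proof (induction x rule: lspan.induct)
    case lspan_zero
    show ?case by (rule bexI[of _ \<zero>], rule bexI[of _ \<zero>]) (use ideal_zero[OF fp_ideal[OF m.is_ideal]] lspan.lspan_zero in auto)
  next
    case (lspan_step s l x)
    then obtain t j where tj: "t \<in> lspan R k (MonL e)" "j \<in> fp e m" "s = t \<oplus> j" by blast
    obtain a where a: "l = fr e a" "a \<in> carrier R" using lspan_step by (auto simp: frs_def)
    obtain c where c: "c \<in> k" "a \<ominus> c \<in> m" using maximal_residue[OF assms a(2)] by auto
    have "a = c \<oplus> (a \<ominus> c)" using a(2) k.LD[OF c(1)] by algebra
    then have l: "l = fr e c \<oplus> fr e (a \<ominus> c)" using a c by (metis fr_add k.LD minus_closed)
    have cc: "fr e c \<in> carrier R" "fr e (a \<ominus> c) \<in> carrier R" "x \<in> carrier R" "t \<in> carrier R" "j \<in> carrier R"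
      using c a lspan_step MonL_carrier k.lspan_carrier[OF tj(1) MonL_carrier] idealD[OF fp_ideal[OF m.is_ideal] tj(2)] by auto
    have "s \<oplus> l \<otimes> x = (t \<oplus> fr e c \<otimes> x) \<oplus> (j \<oplus> fr e (a \<ominus> c) \<otimes> x)"
      unfolding l tj(3) using cc by (simp add: l_distr a_ac)
    moreover have "t \<oplus> fr e c \<otimes> x \<in> lspan R k (MonL e)" using tj lspan_step k_fr[OF c(1)] by (simp add: lspan.lspan_step)
    moreover have "j \<oplus> fr e (a \<ominus> c) \<otimes> x \<in> fp e m"
      using ideal_add[OF fp_ideal[OF m.is_ideal] tj(2)] ideal.I_r_closed[OF fp_ideal[OF m.is_ideal] fr_fp[OF m.is_ideal c(2)]] cc by simp
    ultimately show ?case by metis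
  qed
qed

text \<open>If s * d is \<one> modulo m, raising to the q-th power shows that s is invertible modulo
  m^[q]. Hence localizing at m does not change the quotient by m^[q].\<close>

lemma fp_unit:
  assumes m: "maximalideal m R" and s: "s \<in> carrier R" "s \<notin> m"
  shows "\<exists>t\<in>carrier R. s \<otimes> t \<ominus> \<one> \<in> fp e m"
proof -
  interpret m: maximalideal m R by fact
  obtain c where c: "c \<in> k" "s \<ominus> c \<in> m" using maximal_residue[OF m s(1)] by auto
  have "c \<noteq> \<zero>" using c s by (auto simp: a_minus_def)
  then obtain d where d: "d \<in> k" "c \<otimes> d = \<one>" using k_inv c by auto
  have "(s \<ominus> c) \<otimes> d \<in> m" using c d m.I_r_closed by simp
  moreover have "(s \<ominus> c) \<otimes> d = s \<otimes> d \<ominus> c \<otimes> d" using s(1) k.LD[OF c(1)] k.LD[OF d(1)] by algebra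
  ultimately have "s \<otimes> d \<ominus> \<one> \<in> m" using d by simp
  then have "fr e (s \<otimes> d \<ominus> \<one>) \<in> fp e m" by (rule fr_fp[OF m.is_ideal])
  then have *: "fr e s \<otimes> fr e d \<ominus> \<one> \<in> fp e m" using s d by (simp add: fr_minus fr_mult)
  obtain n where "p ^ e = Suc n" using p_pos by (metis gr0_implies_Suc zero_less_power)
  then have "fr e s = s \<otimes> s [^] n" using s by (simp add: fr_def m_comm)
  then have "s \<otimes> (s [^] n \<otimes> fr e d) \<ominus> \<one> \<in> fp e m" using * s d by (simp add: m_assoc)
  then show ?thesis using s d by (intro bexI[of _ "s [^] n \<otimes> fr e d"]) auto
qed

section \<open>Semicontinuity\<close>

text \<open>Z spans the fibre at m of R modulo I over the ring of q-th powers, so by Nakayama's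
  lemma it generates after inverting the q-th power of some s outside m. A general I lets this also
  bound ranks of residue domains.\<close>

lemma semicontinuity:
  assumes m: "maximalideal m R" and I: "ideal I R" and Z: "spans (I <+>\<^bsub>R\<^esub> fp e m) Z"
  shows "\<exists>s\<in>carrier R - m. \<forall>x\<in>carrier R. \<exists>u\<in>lspan R (frs e) Z. \<exists>i\<in>I. fr e s \<otimes> x = u \<oplus> i"
proof -
  interpret m: maximalideal m R by fact
  interpret F: scalars R "frs e" by (rule frs_scalars)
  have mp: "primeideal m R" by (rule maximalideal_prime[OF m])
  have Zf: "finite Z" "Z \<subseteq> carrier R" using Z by (auto simp: spans_def)
  let ?Y = "MonL e"
  have Yf: "finite ?Y" "?Y \<subseteq> carrier R" using card_MonL MonL_carrier by auto
  let ?G = "\<lambda>x. \<exists>u\<in>lspan R (frs e) Z. \<exists>i\<in>I. x = u \<oplus> i"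
  have G_add: "?G (x \<oplus> y)" if g: "?G x" "?G y" for x y
  proof -
    obtain u i v j where e: "u\<in>lspan R (frs e) Z" "i \<in> I" "x = u \<oplus> i" "v\<in>lspan R (frs e) Z" "j \<in> I" "y = v \<oplus> j" using g by blast
    have c: "u \<in> carrier R" "v \<in> carrier R" "i \<in> carrier R" "j \<in> carrier R"
      using e F.lspan_carrier Zf idealD[OF I] by auto
    have "x \<oplus> y = (u \<oplus> v) \<oplus> (i \<oplus> j)" unfolding e using c by algebra
    moreover have "u \<oplus> v \<in> lspan R (frs e) Z" "i \<oplus> j \<in> I" using e F.lspan_add Zf ideal_add[OF I] by auto
    ultimately show ?thesis by metis
  qed
  have G_scal: "?G (fr e a \<otimes> x)" if g: "?G x" and a: "a \<in> carrier R" for a x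
  proof -
    obtain u i where e: "u\<in>lspan R (frs e) Z" "i \<in> I" "x = u \<oplus> i" using g by blast
    have c: "u \<in> carrier R" "i \<in> carrier R" using e F.lspan_carrier Zf idealD[OF I] by auto
    have "fr e a \<otimes> x = fr e a \<otimes> u \<oplus> fr e a \<otimes> i" unfolding e using c a by (simp add: r_distr)
    moreover have "fr e a \<otimes> u \<in> lspan R (frs e) Z" "fr e a \<otimes> i \<in> I"
      using e F.lspan_scal Zf frsI a ideal.I_l_closed[OF I] by auto
    ultimately show ?thesis by metis
  qed
  \<comment> \<open>Coordinate vectors, with respect to the monomials in \<open>MonL e\<close>, of
    elements already generated by Z modulo I. The entries are q-th roots of the actual coefficients,
    so that N is a module over R.\<close>
  define N where "N = {v. (\<forall>y. v y \<in> carrier R) \<and> ?G (\<Oplus>y\<in>?Y. fr e (v y) \<otimes> y)}"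
  have one: "\<exists>s\<in>carrier R - m. (\<lambda>i. if i = y then s else \<zero>) \<in> N" if y: "y \<in> ?Y" for y
  proof (rule nakayama_coordinates[OF mp Yf(1) _ _ _ _ y])
    fix v w assume v: "v \<in> N" "w \<in> N"
    have "(\<Oplus>y\<in>?Y. fr e (v y \<oplus> w y) \<otimes> y) = (\<Oplus>y\<in>?Y. fr e (v y) \<otimes> y \<oplus> fr e (w y) \<otimes> y)"
      by (rule finsum_cong') (use v Yf in \<open>auto simp: N_def fr_add l_distr\<close>)
    also have "\<dots> = (\<Oplus>y\<in>?Y. fr e (v y) \<otimes> y) \<oplus> (\<Oplus>y\<in>?Y. fr e (w y) \<otimes> y)"
      by (rule finsum_addf) (use v Yf in \<open>auto simp: N_def\<close>)
    finally have "?G (\<Oplus>y\<in>?Y. fr e (v y \<oplus> w y) \<otimes> y)" using v G_add unfolding N_def by simp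
    then show "(\<lambda>i. v i \<oplus> w i) \<in> N" using v unfolding N_def by simp
  next
    fix v a assume v: "v \<in> N" "a \<in> carrier R"
    have "(\<Oplus>y\<in>?Y. fr e (a \<otimes> v y) \<otimes> y) = (\<Oplus>y\<in>?Y. fr e a \<otimes> (fr e (v y) \<otimes> y))"
      by (rule finsum_cong') (use v Yf in \<open>auto simp: N_def fr_mult m_assoc\<close>)
    also have "\<dots> = fr e a \<otimes> (\<Oplus>y\<in>?Y. fr e (v y) \<otimes> y)"
      by (rule finsum_rdistr[symmetric]) (use v Yf in \<open>auto simp: N_def\<close>)
    finally have "?G (\<Oplus>y\<in>?Y. fr e (a \<otimes> v y) \<otimes> y)" using v G_scal unfolding N_def by simp
    then show "(\<lambda>i. a \<otimes> v i) \<in> N" using v unfolding N_def by simp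
  next
    fix v i assume "v \<in> N" then show "v i \<in> carrier R" unfolding N_def by simp
  next
    fix y assume y: "y \<in> ?Y"
    then have yc: "y \<in> carrier R" using Yf by auto
    obtain s j where s: "s \<in> lspan R k Z" "j \<in> I <+>\<^bsub>R\<^esub> fp e m" "y = s \<oplus> j" using Z yc unfolding spans_def by blast
    obtain i w where w: "i \<in> I" "w \<in> fp e m" "j = i \<oplus> w" using s(2) unfolding set_add_def' by blast
    have "\<exists>c. c \<in> ?Y \<rightarrow> fr e ` m \<and> w = (\<Oplus>x\<in>?Y. c x \<otimes> x)"
    proof (rule lspan_repr_family[OF Yf(1) _ _ fp_lspan_MonL[OF m.is_ideal w(2)] fp_sub[OF m.is_ideal], of "\<lambda>x. x"])
      show "\<zero> \<in> fr e ` m" by (rule image_eqI[of _ _ \<zero>]) auto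
      fix a b assume "a \<in> fr e ` m" "b \<in> fr e ` m"
      then obtain a' b' where "a' \<in> m" "b' \<in> m" "a = fr e a'" "b = fr e b'" by auto
      then show "a \<oplus> b \<in> fr e ` m" by (intro image_eqI[of _ _ "a' \<oplus> b'"]) (auto simp: fr_add)
    qed (use Yf in auto)
    then obtain c where c: "c \<in> ?Y \<rightarrow> fr e ` m" "w = (\<Oplus>x\<in>?Y. c x \<otimes> x)" by auto
    then have "\<forall>x\<in>?Y. \<exists>\<mu>\<in>m. c x = fr e \<mu>" by auto
    then obtain \<mu> where \<mu>: "\<And>x. x \<in> ?Y \<Longrightarrow> \<mu> x \<in> m \<and> c x = fr e (\<mu> x)" by metis
    have \<mu>c: "\<And>x. x \<in> ?Y \<Longrightarrow> \<mu> x \<in> carrier R" using \<mu> m.Icarr by auto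
    \<comment> \<open>The unit vector at y minus the coordinates of w, where y = s + i + w with w in
      m^[q]. It represents s + i, hence lies in N, and it is the unit vector modulo m.\<close>
    let ?v = "\<lambda>x. if x \<in> ?Y then (if x = y then \<one> else \<zero>) \<ominus> \<mu> x else \<zero>"
    have "(\<Oplus>x\<in>?Y. fr e (?v x) \<otimes> x) = (\<Oplus>x\<in>?Y. (if y = x then x else \<zero>) \<oplus> \<ominus> (c x \<otimes> x))"
    proof (rule finsum_cong')
      fix x assume x: "x \<in> ?Y"
      have "c x \<in> carrier R" "x \<in> carrier R" using \<mu>[OF x] \<mu>c[OF x] Yf x by auto
      moreover have "fr e (?v x) = (if x = y then \<one> else \<zero>) \<ominus> c x" using x \<mu>[OF x] \<mu>c[OF x] by (auto simp: fr_minus)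
      ultimately show "fr e (?v x) \<otimes> x = (if y = x then x else \<zero>) \<oplus> \<ominus> (c x \<otimes> x)"
        by (auto simp: a_minus_def l_distr l_minus)
    qed (use \<mu> \<mu>c Yf in auto)
    also have "\<dots> = (\<Oplus>x\<in>?Y. if y = x then x else \<zero>) \<oplus> (\<Oplus>x\<in>?Y. \<ominus> (c x \<otimes> x))"
      by (rule finsum_addf) (use \<mu> \<mu>c Yf in auto)
    also have "(\<Oplus>x\<in>?Y. if y = x then x else \<zero>) = y"
      using add.finprod_singleton[of y ?Y "\<lambda>x. x"] y Yf by auto
    also have "(\<Oplus>x\<in>?Y. \<ominus> (c x \<otimes> x)) = (\<Oplus>x\<in>?Y. (\<ominus> \<one>) \<otimes> (c x \<otimes> x))"
      by (rule finsum_cong') (use \<mu> \<mu>c Yf in \<open>auto simp: l_minus\<close>)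
    also have "\<dots> = (\<ominus> \<one>) \<otimes> (\<Oplus>x\<in>?Y. c x \<otimes> x)"
      by (rule finsum_rdistr[symmetric]) (use \<mu> \<mu>c Yf in auto)
    also have "\<dots> = (\<ominus> \<one>) \<otimes> w" using c by simp
    finally have e: "(\<Oplus>x\<in>?Y. fr e (?v x) \<otimes> x) = y \<oplus> (\<ominus> \<one>) \<otimes> w" .
    have cc: "s \<in> carrier R" "i \<in> carrier R" "w \<in> carrier R"
      using s(1) w k.lspan_carrier Zf idealD[OF I] idealD[OF fp_ideal[OF m.is_ideal]] by auto
    have "s \<oplus> (i \<oplus> w) \<oplus> (\<ominus> \<one>) \<otimes> w = s \<oplus> i" using cc by algebra
    then have "(\<Oplus>x\<in>?Y. fr e (?v x) \<otimes> x) = s \<oplus> i" unfolding e using s(3) w(3) by simp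
    moreover have "s \<in> lspan R (frs e) Z" using s(1)
      by (induction s rule: lspan.induct) (use k_frs in \<open>auto intro!: lspan.intros\<close>)
    ultimately have "?G (\<Oplus>x\<in>?Y. fr e (?v x) \<otimes> x)" using w by blast
    then have "?v \<in> N" unfolding N_def using \<mu>c by simp
    moreover have "?v y \<notin> m"
    proof
      assume "?v y \<in> m"
      then have "\<one> \<ominus> \<mu> y \<oplus> \<mu> y \<in> m" using y \<mu> by simp
      moreover have "\<one> \<ominus> \<mu> y \<oplus> \<mu> y = \<one>" using \<mu>c[OF y] by algebra
      ultimately show False using m.one_imp_carrier m.I_notcarr by simp
    qed
    moreover have "?v y' \<in> m" if "y' \<in> ?Y - {y}" for y' using that \<mu> \<mu>c ideal_uminus[OF m.is_ideal] by (simp add: a_minus_def)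
    ultimately show "\<exists>v\<in>N. v y \<notin> m \<and> (\<forall>y'\<in>?Y - {y}. v y' \<in> m) \<and> (\<forall>y'. y' \<notin> ?Y \<longrightarrow> v y' = \<zero>)"
      by (intro bexI[of _ ?v]) auto
  qed
  have "\<exists>s\<in>carrier R - m. ?G (fr e s \<otimes> y)" if y: "y \<in> ?Y" for y
  proof -
    obtain s where s: "s \<in> carrier R - m" "(\<lambda>i. if i = y then s else \<zero>) \<in> N" using one[OF y] by auto
    have "(\<Oplus>x\<in>?Y. fr e (if x = y then s else \<zero>) \<otimes> x) = (\<Oplus>x\<in>?Y. if y = x then fr e s \<otimes> x else \<zero>)"
      by (rule finsum_cong') (use s Yf in auto)
    also have "\<dots> = fr e s \<otimes> y"
      using add.finprod_singleton[of y ?Y "\<lambda>x. fr e s \<otimes> x"] y Yf s by auto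
    finally show ?thesis using s unfolding N_def by auto
  qed
  then have "\<exists>s\<in>carrier R - m. \<forall>y\<in>?Y. ?G (fr e s \<otimes> y)"
  proof (rule prime_common[OF mp Yf(1)])
    fix s t y assume a: "y \<in> ?Y" "s \<in> carrier R" "t \<in> carrier R" "?G (fr e s \<otimes> y)"
    have "fr e (t \<otimes> s) \<otimes> y = fr e t \<otimes> (fr e s \<otimes> y)" using a Yf by (auto simp: fr_mult m_assoc)
    then show "?G (fr e (t \<otimes> s) \<otimes> y)" using G_scal[OF a(4,3)] by simp
  qed
  then obtain s where s: "s \<in> carrier R - m" "\<And>y. y \<in> ?Y \<Longrightarrow> ?G (fr e s \<otimes> y)" by blast
  have "?G (fr e s \<otimes> x)" if "x \<in> lspan R (frs e) ?Y" for x
    using that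
  proof (induction x rule: lspan.induct)
    case lspan_zero
    have "fr e s \<otimes> \<zero> = \<zero> \<oplus> \<zero>" using s by simp
    then show ?case using ideal_zero[OF I] lspan.lspan_zero by metis
  next
    case (lspan_step t l y)
    obtain a where a: "l = fr e a" "a \<in> carrier R" using lspan_step by (auto simp: frs_def)
    have c: "t \<in> carrier R" "y \<in> carrier R" "fr e s \<in> carrier R" "fr e a \<in> carrier R"
      using lspan_step F.lspan_carrier Yf s a by auto
    have "fr e s \<otimes> (t \<oplus> l \<otimes> y) = fr e s \<otimes> t \<oplus> fr e a \<otimes> (fr e s \<otimes> y)" unfolding a using c by (simp add: r_distr m_lcomm)
    then show ?case using G_add[OF lspan_step.IH G_scal[OF s(2)[OF lspan_step(3)] a(2)]] by simp
  qed
  then show ?thesis using s(1) lspan_MonL by blast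
qed

end

section \<open>Noetherian induction\<close>

text \<open>Ideals of a subring B of R, as subsets of R. Finite generation is phrased relative to B
  too, so Hilbert's basis theorem can climb from k to R one generator at a time without changing the
  ambient ring.\<close>

definition bidl :: "('a, 'b) ring_scheme \<Rightarrow> 'a set \<Rightarrow> 'a set \<Rightarrow> bool" where
  "bidl R B I \<longleftrightarrow> I \<subseteq> B \<and> \<zero>\<^bsub>R\<^esub> \<in> I \<and> (\<forall>x\<in>I. \<forall>y\<in>I. x \<oplus>\<^bsub>R\<^esub> y \<in> I) \<and> (\<forall>b\<in>B. \<forall>x\<in>I. b \<otimes>\<^bsub>R\<^esub> x \<in> I)"

definition bnoeth :: "('a, 'b) ring_scheme \<Rightarrow> 'a set \<Rightarrow> bool" where
  "bnoeth R B \<longleftrightarrow> (\<forall>I. bidl R B I \<longrightarrow> (\<exists>A. finite A \<and> A \<subseteq> I \<and> (\<forall>J. bidl R B J \<and> A \<subseteq> J \<longrightarrow> I \<subseteq> J)))"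

lemma bnoethD: "bnoeth R B \<Longrightarrow> bidl R B I \<Longrightarrow> \<exists>A. finite A \<and> A \<subseteq> I \<and> (\<forall>J. bidl R B J \<and> A \<subseteq> J \<longrightarrow> I \<subseteq> J)"
  by (simp add: bnoeth_def)

section \<open>Hilbert's basis theorem for adjoining one element of R\<close>

context scalars
begin

definition W :: "'a \<Rightarrow> nat \<Rightarrow> 'a set" where "W x d = lspan R L {x [^] i | i. i < d}"

definition adj :: "'a \<Rightarrow> 'a set" where "adj x = lspan R L {x [^] i | i :: nat. True}"

context
  fixes x :: 'a
  assumes x: "x \<in> carrier R"
begin

lemma powset: "{x [^] i | i. i < (d::nat)} \<subseteq> carrier R" "{x [^] i | i :: nat. True} \<subseteq> carrier R"
  using x by auto

lemma W_carrier: "w \<in> W x d \<Longrightarrow> w \<in> carrier R"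
  unfolding W_def using lspan_carrier powset by blast

lemma W_adj: "w \<in> W x d \<Longrightarrow> w \<in> adj x"
  unfolding W_def adj_def by (rule lspan_mono) auto

lemma W_mono: "w \<in> W x d \<Longrightarrow> d \<le> d' \<Longrightarrow> w \<in> W x d'"
  unfolding W_def by (rule lspan_mono) auto

lemma W_add: "v \<in> W x d \<Longrightarrow> w \<in> W x d \<Longrightarrow> v \<oplus> w \<in> W x d"
  unfolding W_def using lspan_add powset(1) by blast

lemma W_scal: "w \<in> W x d \<Longrightarrow> l \<in> L \<Longrightarrow> l \<otimes> w \<in> W x d"
  unfolding W_def using lspan_scal powset(1) by blast

lemma W_minus: "v \<in> W x d \<Longrightarrow> w \<in> W x d \<Longrightarrow> v \<ominus> w \<in> W x d"
  unfolding a_minus_def by (rule W_add) (auto simp: W_def intro: lspan_uminus[OF powset(1)])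

lemma W_pow: "w \<in> W x d \<Longrightarrow> x [^] (n::nat) \<otimes> w \<in> W x (n + d)"
  unfolding W_def
proof (induction w rule: lspan.induct)
  case (lspan_step s l y)
  then obtain i where i: "y = x [^] i" "i < d" by auto
  have "s \<in> carrier R" using lspan_step lspan_carrier powset(1) by blast
  then have "x [^] n \<otimes> (s \<oplus> l \<otimes> y) = x [^] n \<otimes> s \<oplus> l \<otimes> x [^] (n + i)"
    using i x lspan_step by (simp add: r_distr m_lcomm nat_pow_mult)
  moreover have "x [^] (n + i) \<in> {x [^] i | i. i < n + d}" using i by auto
  ultimately show ?case using lspan_step by (simp add: lspan.lspan_step)
qed (use x in \<open>simp add: lspan.lspan_zero\<close>)

lemma W_0: "w \<in> W x 0 \<Longrightarrow> w = \<zero>"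
  unfolding W_def by (induction w rule: lspan.induct) auto

lemma W_Suc: "w \<in> W x (Suc d) \<Longrightarrow> \<exists>b\<in>L. \<exists>v\<in>W x d. w = b \<otimes> x [^] d \<oplus> v"
  unfolding W_def
proof (induction w rule: lspan.induct)
  case lspan_zero
  then show ?case using x by (intro bexI[of _ \<zero>] bexI[of _ "\<zero>"]) (auto simp: lspan.lspan_zero)
next
  case (lspan_step s l y)
  then obtain b v where b: "b \<in> L" "v \<in> lspan R L {x [^] i | i. i < d}" "s = b \<otimes> x [^] d \<oplus> v" by blast
  obtain i where i: "y = x [^] i" "i < Suc d" using lspan_step by auto
  have vc: "v \<in> carrier R" using b lspan_carrier powset(1) by blast
  have c: "b \<in> carrier R" "l \<in> carrier R" "x [^] d \<in> carrier R" "x [^] i \<in> carrier R" using b x lspan_step by auto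
  show ?case
  proof (cases "i = d")
    case True
    have "s \<oplus> l \<otimes> y = (b \<oplus> l) \<otimes> x [^] d \<oplus> v" unfolding b(3) i True using vc c by (simp add: l_distr a_ac)
    then show ?thesis using b lspan_step by (intro bexI[of _ "b \<oplus> l"] bexI[of _ v]) auto
  next
    case False
    then have "i < d" using i by simp
    have "s \<oplus> l \<otimes> y = b \<otimes> x [^] d \<oplus> (v \<oplus> l \<otimes> x [^] i)" unfolding b(3) i using vc c by (simp add: a_ac)
    moreover have "v \<oplus> l \<otimes> x [^] i \<in> lspan R L {x [^] i | i. i < d}"
      using b \<open>i < d\<close> lspan_step by (intro lspan.lspan_step) auto
    ultimately show ?thesis using b by blast
  qed
qed

lemma adj_W: "w \<in> adj x \<Longrightarrow> \<exists>d. w \<in> W x d"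
  unfolding adj_def
proof (induction w rule: lspan.induct)
  case lspan_zero
  then show ?case unfolding W_def using lspan.lspan_zero by blast
next
  case (lspan_step s l y)
  then obtain d i where d: "s \<in> W x d" "y = x [^] (i::nat)" by auto
  then have "s \<in> W x (Suc (d + i))" using W_mono by simp
  then have "s \<oplus> l \<otimes> y \<in> W x (Suc (d + i))" unfolding W_def d(2) using lspan_step by (intro lspan.lspan_step) auto
  then show ?case by blast
qed

lemma adj_carrier: "w \<in> adj x \<Longrightarrow> w \<in> carrier R"
  using adj_W W_carrier by blast

lemma adj_add: "v \<in> adj x \<Longrightarrow> w \<in> adj x \<Longrightarrow> v \<oplus> w \<in> adj x"
  unfolding adj_def using lspan_add powset(2) by blast

lemma adj_scal: "w \<in> adj x \<Longrightarrow> l \<in> L \<Longrightarrow> l \<otimes> w \<in> adj x"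
  unfolding adj_def using lspan_scal powset(2) by blast

lemma adj_pow: "x [^] (n::nat) \<in> adj x"
  unfolding adj_def using lspan_incl powset(2) by blast

lemma adj_L: "l \<in> L \<Longrightarrow> l \<in> adj x"
  using adj_scal[OF adj_pow[of 0], of l] by simp

lemma adj_mult: "v \<in> adj x \<Longrightarrow> w \<in> adj x \<Longrightarrow> v \<otimes> w \<in> adj x"
proof -
  assume v: "v \<in> adj x" and w: "w \<in> adj x"
  have wc: "w \<in> carrier R" using w adj_carrier by blast
  show "v \<otimes> w \<in> adj x" using v unfolding adj_def[of x]
  proof (induction v rule: lspan.induct)
    case lspan_zero
    then show ?case using wc by (simp add: lspan.lspan_zero)
  next
    case (lspan_step s l y)
    then obtain i where i: "y = x [^] (i::nat)" by auto
    have sc: "s \<in> carrier R" using lspan_step lspan_carrier powset(2) by blast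
    obtain d where "w \<in> W x d" using adj_W w by blast
    then have "x [^] i \<otimes> w \<in> adj x" using W_pow W_adj by blast
    then have "l \<otimes> (x [^] i \<otimes> w) \<in> adj x" using adj_scal lspan_step by blast
    moreover have "(s \<oplus> l \<otimes> y) \<otimes> w = s \<otimes> w \<oplus> l \<otimes> (x [^] i \<otimes> w)"
      unfolding i using sc wc x lspan_step by (simp add: l_distr m_assoc)
    ultimately show ?case using lspan_step.IH adj_add unfolding adj_def by simp
  qed
qed

lemma adj_scalars: "scalars R (adj x)"
proof
  show "adj x \<subseteq> carrier R" using adj_carrier by blast
  show "\<ominus> a \<in> adj x" if "a \<in> adj x" for a using that lspan_uminus powset(2) unfolding adj_def by blast
qed (use adj_add adj_mult adj_L in auto)

text \<open>The argument with leading coefficients, run on representations instead of polynomials: x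
  may satisfy equations over L, so an element can have many leading terms.\<close>

lemma hilbert_basis:
  assumes noeth: "bnoeth R L" shows "bnoeth R (adj x)"
  unfolding bnoeth_def
proof (intro allI impI)
  fix I assume I: "bidl R (adj x) I"
  interpret A: scalars R "adj x" by (rule adj_scalars)
  have xA: "x \<in> adj x" using adj_pow[of 1] x by simp
  \<comment> \<open>All coefficients b for which J contains some b * x^d plus lower terms.
    Multiplication by x makes these increase with d, and they are ideals of L.\<close>
  define D where "D J d = {b \<in> L. \<exists>f\<in>J. \<exists>w\<in>W x d. f = b \<otimes> x [^] d \<oplus> w}" for J and d :: nat
  have DI: "b \<in> D J d" if "f = b \<otimes> x [^] d \<oplus> w" "b \<in> L" "f \<in> J" "w \<in> W x d" for b J d f w
    unfolding D_def using that by blast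
  have D_bidl: "bidl R L (D J d)" if J: "bidl R (adj x) J" for J d
    unfolding bidl_def
  proof (intro conjI ballI)
    show "D J d \<subseteq> L" by (auto simp: D_def)
    have "\<zero> \<in> J" using J by (auto simp: bidl_def)
    then show "\<zero> \<in> D J d" unfolding D_def using x by (auto simp: W_def intro!: bexI[of _ \<zero>] lspan.lspan_zero)
  next
    fix b b' assume "b \<in> D J d" "b' \<in> D J d"
    then obtain f f' w w' where e: "b \<in> L" "b' \<in> L" "f \<in> J" "f' \<in> J" "w \<in> W x d" "w' \<in> W x d"
      "f = b \<otimes> x [^] d \<oplus> w" "f' = b' \<otimes> x [^] d \<oplus> w'" unfolding D_def by blast
    have c: "w \<in> carrier R" "w' \<in> carrier R" using e W_carrier by auto
    have "f \<oplus> f' = (b \<oplus> b') \<otimes> x [^] d \<oplus> (w \<oplus> w')" unfolding e using c x e(1,2) by (simp add: l_distr a_ac)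
    then show "b \<oplus> b' \<in> D J d"
      by (rule DI) (use J e(1-4) W_add[OF e(5,6)] in \<open>auto simp: bidl_def\<close>)
  next
    fix l b assume l: "l \<in> L" "b \<in> D J d"
    then obtain f w where e: "b \<in> L" "f \<in> J" "w \<in> W x d" "f = b \<otimes> x [^] d \<oplus> w" unfolding D_def by blast
    have c: "w \<in> carrier R" using e W_carrier by auto
    have "l \<otimes> f = (l \<otimes> b) \<otimes> x [^] d \<oplus> l \<otimes> w" unfolding e using c x e(1) l by (simp add: r_distr m_assoc)
    then show "l \<otimes> b \<in> D J d"
      by (rule DI) (use J e(1,2) adj_L[OF l(1)] l(1) W_scal[OF e(3) l(1)] in \<open>auto simp: bidl_def\<close>)
  qed
  have D_step: "D I d \<subseteq> D I (n + d)" for d n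
  proof
    fix b assume "b \<in> D I d"
    then obtain f w where e: "b \<in> L" "f \<in> I" "w \<in> W x d" "f = b \<otimes> x [^] d \<oplus> w" unfolding D_def by blast
    have c: "w \<in> carrier R" using e W_carrier by auto
    have "x [^] n \<otimes> f = b \<otimes> x [^] (n + d) \<oplus> x [^] n \<otimes> w" unfolding e using c x e(1)
      by (simp add: r_distr m_lcomm nat_pow_mult)
    then show "b \<in> D I (n + d)"
      by (rule DI) (use I e(1,2) adj_pow[of n] W_pow[OF e(3)] in \<open>auto simp: bidl_def\<close>)
  qed
  have D_mono: "D I d \<subseteq> D I d'" if "d \<le> d'" for d d'
    using D_step[of d "d' - d"] that by simp
  have "bidl R L (\<Union>d. D I d)"
    unfolding bidl_def
  proof (intro conjI ballI)
    show "(\<Union>d. D I d) \<subseteq> L" by (auto simp: D_def)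
    show "\<zero> \<in> (\<Union>d. D I d)" using D_bidl[OF I] by (auto simp: bidl_def)
    fix a b assume "a \<in> (\<Union>d. D I d)" "b \<in> (\<Union>d. D I d)"
    then obtain d d' where "a \<in> D I d" "b \<in> D I d'" by auto
    then have "a \<in> D I (max d d')" "b \<in> D I (max d d')" using D_mono[of d "max d d'"] D_mono[of d' "max d d'"] by auto
    then have "a \<oplus> b \<in> D I (max d d')" using D_bidl[OF I, of "max d d'"] unfolding bidl_def by simp
    then show "a \<oplus> b \<in> (\<Union>d. D I d)" by blast
  next
    fix l b assume l: "l \<in> L" "b \<in> (\<Union>d. D I d)"
    then obtain d where "b \<in> D I d" by auto
    then have "l \<otimes> b \<in> D I d" using D_bidl[OF I, of d] l(1) unfolding bidl_def by simp
    then show "l \<otimes> b \<in> (\<Union>d. D I d)" by blast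
  qed
  from bnoethD[OF noeth this] obtain A0 where A0: "finite A0" "A0 \<subseteq> (\<Union>d. D I d)"
    "\<forall>J. bidl R L J \<and> A0 \<subseteq> J \<longrightarrow> (\<Union>d. D I d) \<subseteq> J" by (elim exE conjE)
  have "\<exists>N. A0 \<subseteq> D I N" using A0(1,2)
  proof (induction A0 rule: finite_induct)
    case (insert a A)
    then obtain N n where "A \<subseteq> D I N" "a \<in> D I n" by auto
    then show ?case using D_mono[of N "max N n"] D_mono[of n "max N n"] by (intro exI[of _ "max N n"]) auto
  qed simp
  then obtain N where "A0 \<subseteq> D I N" by auto
  then have DN: "D I d \<subseteq> D I N" for d
    using A0(3)[rule_format, of "D I N"] D_bidl[OF I, of N] by blast
  have "\<forall>d. \<exists>A. finite A \<and> A \<subseteq> D I d \<and> (\<forall>J. bidl R L J \<and> A \<subseteq> J \<longrightarrow> D I d \<subseteq> J)"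
    using bnoethD[OF noeth D_bidl[OF I]] by (intro allI)
  from choice[OF this] obtain A where A0: "\<forall>d. finite (A d) \<and> A d \<subseteq> D I d \<and> (\<forall>J. bidl R L J \<and> A d \<subseteq> J \<longrightarrow> D I d \<subseteq> J)"
    by (elim exE)
  then have A: "\<And>d. finite (A d)" "\<And>d. A d \<subseteq> D I d" "\<And>d J. bidl R L J \<Longrightarrow> A d \<subseteq> J \<Longrightarrow> D I d \<subseteq> J" by simp_all
  have "\<forall>d. \<forall>a\<in>A d. \<exists>f. f \<in> I \<and> (\<exists>w\<in>W x d. f = a \<otimes> x [^] d \<oplus> w)"
  proof (intro allI ballI)
    fix d a assume "a \<in> A d"
    then have "a \<in> D I d" using A(2) by blast
    then show "\<exists>f. f \<in> I \<and> (\<exists>w\<in>W x d. f = a \<otimes> x [^] d \<oplus> w)" unfolding D_def by blast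
  qed
  then obtain F where F: "\<And>d a. a \<in> A d \<Longrightarrow> F d a \<in> I \<and> (\<exists>w\<in>W x d. F d a = a \<otimes> x [^] d \<oplus> w)" by metis
  \<comment> \<open>The leading ideals are constant from degree N on, so elements realizing
    generators of the first N + 1 of them suffice.\<close>
  let ?A = "\<Union>d\<in>{..N}. F d ` A d"
  show "\<exists>A. finite A \<and> A \<subseteq> I \<and> (\<forall>J. bidl R (adj x) J \<and> A \<subseteq> J \<longrightarrow> I \<subseteq> J)"
  proof (intro exI[of _ ?A] conjI allI impI)
    show "finite ?A" using A(1) by auto
    show "?A \<subseteq> I" using F by auto
    fix J assume J: "bidl R (adj x) J \<and> ?A \<subseteq> J"
    have IJ: "bidl R (adj x) (I \<inter> J)" using I J by (auto simp: bidl_def)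
    have "\<forall>f. f \<in> I \<and> f \<in> W x d \<longrightarrow> f \<in> J" for d
    proof (induction d)
      case 0
      then show ?case using W_0 J by (auto simp: bidl_def)
    next
      case (Suc d)
      show ?case
      proof (intro allI impI)
        fix f assume f: "f \<in> I \<and> f \<in> W x (Suc d)"
        then obtain b v where b: "b \<in> L" "v \<in> W x d" "f = b \<otimes> x [^] d \<oplus> v" using W_Suc by blast
        then have bD: "b \<in> D I d" using f by (intro DI) auto
        \<comment> \<open>Above degree N the leading coefficient is already that of an element of
          degree N, which is then shifted up by a power of x.\<close>
        define d' where "d' = min d N"
        have "b \<in> D I d'" using bD DN[of d] by (auto simp: d'_def min_def)
        moreover have "A d' \<subseteq> D (I \<inter> J) d'"
        proof
          fix a assume a: "a \<in> A d'"
          moreover have "d' \<in> {..N}" by (simp add: d'_def)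
          ultimately have "F d' a \<in> J" using J by blast
          moreover have "a \<in> L" using a A(2)[of d'] unfolding D_def by blast
          moreover obtain w where "w \<in> W x d'" "F d' a = a \<otimes> x [^] d' \<oplus> w" "F d' a \<in> I" using F[OF a] by blast
          ultimately show "a \<in> D (I \<inter> J) d'" by (intro DI) auto
        qed
        ultimately have "b \<in> D (I \<inter> J) d'" using A(3)[OF D_bidl[OF IJ]] by blast
        then obtain g w where g: "g \<in> I" "g \<in> J" "w \<in> W x d'" "g = b \<otimes> x [^] d' \<oplus> w" unfolding D_def by blast
        let ?n = "d - d'"
        have nd: "?n + d' = d" by (simp add: d'_def)
        have wc: "w \<in> carrier R" "v \<in> carrier R" using g b W_carrier by auto
        have xg: "x [^] ?n \<otimes> g = b \<otimes> x [^] d \<oplus> x [^] ?n \<otimes> w" unfolding g(4) using wc x b(1)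
          by (simp add: r_distr m_lcomm nat_pow_mult nd)
        have xw: "x [^] ?n \<otimes> w \<in> W x d" using W_pow[OF g(3), of ?n] nd by simp
        have Im: "\<And>b y. b \<in> adj x \<Longrightarrow> y \<in> I \<Longrightarrow> b \<otimes> y \<in> I" and Ia: "\<And>a b. a \<in> I \<Longrightarrow> b \<in> I \<Longrightarrow> a \<oplus> b \<in> I"
          and Ic: "\<And>y. y \<in> I \<Longrightarrow> y \<in> carrier R"
          using I A.LD by (auto simp: bidl_def)
        have Jm: "\<And>b y. b \<in> adj x \<Longrightarrow> y \<in> J \<Longrightarrow> b \<otimes> y \<in> J" and Ja: "\<And>a b. a \<in> J \<Longrightarrow> b \<in> J \<Longrightarrow> a \<oplus> b \<in> J"
          using J by (auto simp: bidl_def)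
        have xgI: "x [^] ?n \<otimes> g \<in> I" "x [^] ?n \<otimes> g \<in> J"
          by (rule Im[OF adj_pow g(1)], rule Jm[OF adj_pow g(2)])
        have mI: "\<ominus> (x [^] ?n \<otimes> g) \<in> I"
          using Im[OF A.L_uminus[OF A.L_one] xgI(1)] Ic[OF xgI(1)] by (simp add: l_minus)
        have "f \<oplus> \<ominus> (x [^] ?n \<otimes> g) \<in> I" using Ia[OF _ mI] f by simp
        moreover have "b1 \<oplus> v \<oplus> \<ominus> (b1 \<oplus> w1) = v \<ominus> w1" if "b1 \<in> carrier R" "w1 \<in> carrier R" for b1 w1
          using that wc by algebra
        then have e: "f \<oplus> \<ominus> (x [^] ?n \<otimes> g) = v \<ominus> x [^] ?n \<otimes> w" unfolding xg b(3) using wc x b(1) by simp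
        moreover have "v \<ominus> x [^] ?n \<otimes> w \<in> W x d" using W_minus b xw by blast
        ultimately have "f \<oplus> \<ominus> (x [^] ?n \<otimes> g) \<in> J" using Suc by simp
        then have "f \<oplus> \<ominus> (x [^] ?n \<otimes> g) \<oplus> x [^] ?n \<otimes> g \<in> J" by (rule Ja[OF _ xgI(2)])
        moreover have "f \<in> carrier R" "x [^] ?n \<otimes> g \<in> carrier R" using Ic f xgI(1) by simp_all
        then have "f \<oplus> \<ominus> (x [^] ?n \<otimes> g) \<oplus> x [^] ?n \<otimes> g = f" by (simp add: a_assoc l_neg)
        ultimately show "f \<in> J" by simp
      qed
    qed
    moreover have "\<exists>d. f \<in> W x d" if "f \<in> I" for f
      using that I adj_W[of f] by (auto simp: bidl_def)
    ultimately show "I \<subseteq> J" by (intro subsetI) metis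
  qed
qed

end

end

context affine_alg
begin

lemma bnoeth_k: "bnoeth R k"
  unfolding bnoeth_def
proof (intro allI impI)
  fix I assume I: "bidl R k I"
  show "\<exists>A. finite A \<and> A \<subseteq> I \<and> (\<forall>J. bidl R k J \<and> A \<subseteq> J \<longrightarrow> I \<subseteq> J)"
  proof (cases "I = {\<zero>}")
    case True
    then show ?thesis by (intro exI[of _ "{}"]) (auto simp: bidl_def)
  next
    case False
    then obtain c where c: "c \<in> I" "c \<noteq> \<zero>" using I unfolding bidl_def by blast
    then have "c \<in> k" using I unfolding bidl_def by blast
    obtain d where d: "d \<in> k" "c \<otimes> d = \<one>" using k_inv[OF \<open>c \<in> k\<close> c(2)] by blast
    have "I \<subseteq> J" if J: "bidl R k J" "c \<in> J" for J
    proof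
      fix y assume "y \<in> I"
      then have y: "y \<in> k" using I unfolding bidl_def by blast
      have "(y \<otimes> d) \<otimes> c \<in> J" using J y d unfolding bidl_def by simp
      moreover have "(y \<otimes> d) \<otimes> c = y \<otimes> (c \<otimes> d)" using k.LD[OF y] k.LD[OF d(1)] k.LD[OF \<open>c \<in> k\<close>] by algebra
      ultimately show "y \<in> J" using d y by simp
    qed
    then show ?thesis using c by (intro exI[of _ "{c}"]) auto
  qed
qed

lemma bnoeth_R: "bnoeth R (carrier R)"
proof -
  have "\<exists>B. scalars R B \<and> bnoeth R B \<and> k \<subseteq> B \<and> A \<subseteq> B" if "finite A" "A \<subseteq> S" for A
    using that
  proof (induction A rule: finite_induct)
    case empty
    then show ?case using k.scalars_axioms bnoeth_k by (intro exI[of _ k]) auto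
  next
    case (insert x A)
    then obtain B where B: "scalars R B" "bnoeth R B" "k \<subseteq> B" "A \<subseteq> B" by auto
    interpret B: scalars R B by (rule B)
    have x: "x \<in> carrier R" using insert by auto
    have "x \<in> B.adj x" using B.adj_pow[OF x, of 1] x by simp
    moreover have "B \<subseteq> B.adj x" using B.adj_L[OF x] by blast
    ultimately show ?case using B B.adj_scalars[OF x] B.hilbert_basis[OF x B(2)]
      by (intro exI[of _ "B.adj x"]) auto
  qed
  from this[OF S_finite] obtain B where B: "scalars R B" "bnoeth R B" "k \<subseteq> B" "S \<subseteq> B" by auto
  interpret B: scalars R B by (rule B)
  have "y \<in> B" if "y \<in> carrier R" for y
    using that by (induction y rule: affine_induct) (use B in auto)
  then have "B = carrier R" using B.L_carrier by auto
  then show ?thesis using B by simp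
qed

lemma noetherian: "noetherian_ring R"
proof (rule noetherian_ringI)
  fix I assume I: "ideal I R"
  have bi: "bidl R (carrier R) J \<longleftrightarrow> ideal J R" for J
  proof
    show "bidl R (carrier R) J \<Longrightarrow> ideal J R" by (rule ideal_setI) (auto simp: bidl_def)
    assume J: "ideal J R"
    interpret ideal J R by (rule J)
    show "bidl R (carrier R) J" using I_l_closed Icarr by (auto simp: bidl_def)
  qed
  from bnoethD[OF bnoeth_R, of I, unfolded bi, OF I]
  obtain A where A: "finite A" "A \<subseteq> I" and A': "\<forall>J. ideal J R \<and> A \<subseteq> J \<longrightarrow> I \<subseteq> J" by (elim exE conjE)
  have Ac: "A \<subseteq> carrier R" using A(2) idealD[OF I] by auto
  have "I = Idl A"
    using A'[rule_format, of "Idl A"] genideal_ideal[OF Ac] genideal_self[OF Ac] genideal_minimal[OF I A(2)] by blast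
  then show "\<exists>A\<subseteq>carrier R. finite A \<and> I = Idl A" using A(1) Ac by blast
qed

lemma noeth_induct [consumes 1]:
  assumes I: "ideal I R"
    and step: "\<And>I. ideal I R \<Longrightarrow> (\<And>J. ideal J R \<Longrightarrow> I \<subset> J \<Longrightarrow> Q J) \<Longrightarrow> Q I"
  shows "Q I"
proof (rule ccontr)
  interpret noetherian_ring R by (rule noetherian)
  assume "\<not> Q I"
  let ?C = "{I. ideal I R \<and> \<not> Q I}"
  have "\<exists>M\<in>?C. \<forall>J\<in>?C. M \<subseteq> J \<longrightarrow> J = M"
  proof (rule subset_Zorn_nonempty)
    show "?C \<noteq> {}" using I \<open>\<not> Q I\<close> by auto
    fix C assume c: "C \<noteq> {}" "subset.chain ?C C"
    then have "subset.chain {I. ideal I R} C" by (auto simp: subset.chain_def)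
    then have "\<Union>C \<in> C" using ideal_chain_is_trivial c by auto
    then show "\<Union>C \<in> ?C" using c unfolding subset.chain_def by blast
  qed
  then obtain M where M: "ideal M R" "\<not> Q M" "\<forall>J\<in>?C. M \<subseteq> J \<longrightarrow> J = M" by auto
  have "Q J" if "ideal J R" "M \<subset> J" for J
    using bspec[OF M(3), of J] that by auto
  then show False using step[OF M(1)] M(2) by blast
qed

lemma idl_quot:
  assumes I: "ideal I R" and a: "a \<in> carrier R"
  shows "ideal {r \<in> carrier R. a \<otimes> r \<in> I} R" "I \<subseteq> {r \<in> carrier R. a \<otimes> r \<in> I}"
proof -
  interpret ideal I R by (rule I)
  show "ideal {r \<in> carrier R. a \<otimes> r \<in> I} R"
  proof (rule ideal_setI)
    show "x \<oplus> y \<in> {r \<in> carrier R. a \<otimes> r \<in> I}" if "x \<in> {r \<in> carrier R. a \<otimes> r \<in> I}" "y \<in> {r \<in> carrier R. a \<otimes> r \<in> I}" for x y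
      using that a by (auto simp: r_distr)
    show "r \<otimes> x \<in> {r \<in> carrier R. a \<otimes> r \<in> I}" if "x \<in> {r \<in> carrier R. a \<otimes> r \<in> I}" "r \<in> carrier R" for x r
      using that a I_l_closed[of "a \<otimes> x" r] by (auto simp: m_lcomm)
  qed (use a in auto)
  show "I \<subseteq> {r \<in> carrier R. a \<otimes> r \<in> I}" using I_l_closed a Icarr by auto
qed

lemma not_prime_witness:
  assumes I: "ideal I R" and "I \<noteq> carrier R" and "\<not> primeideal I R"
  shows "\<exists>a\<in>carrier R. \<exists>b\<in>carrier R. a \<otimes> b \<in> I \<and> a \<notin> I \<and> b \<notin> I"
proof (rule ccontr)
  assume *: "\<not> ?thesis"
  have "primeideal I R"
    by (rule primeidealI[OF I cring_axioms]) (use assms(2) * in blast)+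
  then show False using assms by simp
qed

text \<open>If a * b lies in I with neither factor in I, a prime over I contains I + aR or I + bR,
  and the product of these two ideals lies in I. So the lists of primes are joined and the
  nilpotency exponents added.\<close>

lemma prime_cover:
  assumes "ideal I R"
  shows "\<exists>\<P> n. finite \<P> \<and> (\<forall>P\<in>\<P>. primeideal P R \<and> I \<subseteq> P) \<and> (\<forall>Q. primeideal Q R \<and> I \<subseteq> Q \<longrightarrow> (\<exists>P\<in>\<P>. P \<subseteq> Q))
    \<and> (\<forall>x\<in>carrier R. (\<forall>P\<in>\<P>. x \<in> P) \<longrightarrow> x [^] (n::nat) \<in> I)"
  using assms
proof (induction I rule: noeth_induct)
  case (1 I)
  consider (c) "I = carrier R" | (p) "primeideal I R" | (n) "I \<noteq> carrier R" "\<not> primeideal I R" by blast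
  then show ?case
  proof cases
    case c
    then have "\<not> (primeideal Q R \<and> I \<subseteq> Q)" for Q
      using primeideal.I_notcarr[of Q R] ideal.Icarr[of Q R] primeideal.axioms(1)[of Q R] by blast
    then show ?thesis using c by (intro exI[of _ "{}"] exI[of _ 0]) auto
  next
    case p
    then show ?thesis by (intro exI[of _ "{I}"] exI[of _ 1]) auto
  next
    case n
    obtain a b where ab: "a \<in> carrier R" "b \<in> carrier R" "a \<otimes> b \<in> I" "a \<notin> I" "b \<notin> I"
      using not_prime_witness[OF 1(1) n] by blast
    note A = idl_ins[OF 1(1) ab(1)] and B = idl_ins[OF 1(1) ab(2)]
    obtain \<P> m where P: "finite \<P>" "\<forall>P\<in>\<P>. primeideal P R \<and> idl_ins R I a \<subseteq> P"
      "\<forall>Q. primeideal Q R \<and> idl_ins R I a \<subseteq> Q \<longrightarrow> (\<exists>P\<in>\<P>. P \<subseteq> Q)"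
      "\<forall>x\<in>carrier R. (\<forall>P\<in>\<P>. x \<in> P) \<longrightarrow> x [^] (m::nat) \<in> idl_ins R I a"
      using 1(2)[OF A(1)] A ab by blast
    obtain \<P>' m' where P': "finite \<P>'" "\<forall>P\<in>\<P>'. primeideal P R \<and> idl_ins R I b \<subseteq> P"
      "\<forall>Q. primeideal Q R \<and> idl_ins R I b \<subseteq> Q \<longrightarrow> (\<exists>P\<in>\<P>'. P \<subseteq> Q)"
      "\<forall>x\<in>carrier R. (\<forall>P\<in>\<P>'. x \<in> P) \<longrightarrow> x [^] (m'::nat) \<in> idl_ins R I b"
      using 1(2)[OF B(1)] B ab by blast
    show ?thesis
    proof (intro exI[of _ "\<P> \<union> \<P>'"] exI[of _ "m + m'"] conjI allI impI ballI)
      show "finite (\<P> \<union> \<P>')" using P P' by simp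
      show "primeideal Q R" "I \<subseteq> Q" if "Q \<in> \<P> \<union> \<P>'" for Q using that P(2) P'(2) A(2) B(2) by blast+
      show "\<exists>P\<in>\<P> \<union> \<P>'. P \<subseteq> Q" if Q: "primeideal Q R \<and> I \<subseteq> Q" for Q
      proof -
        have Qi: "ideal Q R" using Q primeideal.axioms(1) by blast
        have "a \<in> Q \<or> b \<in> Q" using primeideal.I_prime[of Q R a b] Q ab by blast
        then have "idl_ins R I a \<subseteq> Q \<or> idl_ins R I b \<subseteq> Q" using idl_ins_minimal[OF Qi] Q by blast
        then show ?thesis using P(3)[rule_format, of Q] P'(3)[rule_format, of Q] Q by auto
      qed
      fix x assume x: "x \<in> carrier R" "\<forall>P\<in>\<P> \<union> \<P>'. x \<in> P"
      then have "x [^] m \<in> idl_ins R I a" "x [^] m' \<in> idl_ins R I b" using P(4) P'(4) by auto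
      then obtain q r q' r' where q: "q \<in> I" "r \<in> carrier R" "q' \<in> I" "r' \<in> carrier R"
        "x [^] m = q \<oplus> a \<otimes> r" "x [^] m' = q' \<oplus> b \<otimes> r'" unfolding idl_ins_def by blast
      interpret ideal I R by (rule 1(1))
      have qc: "q \<in> carrier R" "q' \<in> carrier R" using q Icarr by auto
      have "x [^] (m + m') = (q \<oplus> a \<otimes> r) \<otimes> (q' \<oplus> b \<otimes> r')" using x q by (simp add: nat_pow_mult[symmetric])
      also have "\<dots> = q \<otimes> (q' \<oplus> b \<otimes> r') \<oplus> (a \<otimes> r) \<otimes> q' \<oplus> (a \<otimes> b) \<otimes> (r \<otimes> r')"
        using q(2,4) qc ab(1,2) by algebra
      also have "\<dots> \<in> I"
        by (intro a_closed I_r_closed[OF q(1)] I_l_closed[OF q(3)] I_r_closed[OF ab(3)]) (use q(2,4) qc ab(1,2) in auto)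
      finally show "x [^] (m + m') \<in> I" .
    qed
  qed
qed

section \<open>Upper bound for the growth of Frobenius colengths\<close>

text \<open>Length n means n + 1 primes. M = \<open>carrier R\<close> measures the dimension of R
  modulo I; M a maximal ideal measures it at that point.\<close>

definition pchain :: "'a set \<Rightarrow> 'a set \<Rightarrow> nat \<Rightarrow> bool" where
  "pchain I M n \<longleftrightarrow> (\<exists>c::nat \<Rightarrow> 'a set. (\<forall>i\<le>n. primeideal (c i) R) \<and> (\<forall>i<n. c i \<subset> c (Suc i)) \<and> I \<subseteq> c 0 \<and> c n \<subseteq> M)"

text \<open>The Hilbert-Kunz function of R modulo I at m, before normalization.\<close>

definition lam :: "nat \<Rightarrow> 'a set \<Rightarrow> 'a set \<Rightarrow> nat" where "lam e I m = cdim (I <+>\<^bsub>R\<^esub> fp e m)"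

lemma pchain_mono: "pchain J M n \<Longrightarrow> I \<subseteq> J \<Longrightarrow> M \<subseteq> M' \<Longrightarrow> pchain I M' n"
proof -
  assume a: "pchain J M n" "I \<subseteq> J" "M \<subseteq> M'"
  then obtain c where "\<forall>i\<le>n. primeideal (c i) R" "\<forall>i<n. c i \<subset> c (Suc i)" "J \<subseteq> c 0" "c n \<subseteq> M"
    unfolding pchain_def by blast
  then show ?thesis unfolding pchain_def using a(2,3) by (intro exI[of _ c]) auto
qed

lemma pchain_0: "primeideal P R \<Longrightarrow> I \<subseteq> P \<Longrightarrow> P \<subseteq> M \<Longrightarrow> pchain I M 0"
  unfolding pchain_def by (rule exI[of _ "\<lambda>_. P"]) auto

lemma pchain_Suc:
  assumes "primeideal P R" "P \<subset> J" "pchain J M n" shows "pchain P M (Suc n)"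
proof -
  obtain c where c: "\<forall>i\<le>n. primeideal (c i) R" "\<forall>i<n. c i \<subset> c (Suc i)" "J \<subseteq> c 0" "c n \<subseteq> M"
    using assms unfolding pchain_def by blast
  let ?c = "\<lambda>i. if i = 0 then P else c (i - 1)"
  have "\<forall>i<Suc n. ?c i \<subset> ?c (Suc i)"
  proof (intro allI impI)
    fix i assume i: "i < Suc n"
    show "?c i \<subset> ?c (Suc i)"
    proof (cases i)
      case 0
      then show ?thesis using assms(2) c(3) by auto
    next
      case (Suc j)
      then show ?thesis using c(2) i by auto
    qed
  qed
  then show ?thesis unfolding pchain_def
    using assms c by (intro exI[of _ ?c]) auto
qed

lemma setaddI: "i \<in> I \<Longrightarrow> j \<in> J \<Longrightarrow> x = i \<oplus> j \<Longrightarrow> x \<in> I <+>\<^bsub>R\<^esub> J"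
  unfolding set_add_def' by blast

lemma setaddE: "x \<in> I <+>\<^bsub>R\<^esub> J \<Longrightarrow> (\<And>i j. i \<in> I \<Longrightarrow> j \<in> J \<Longrightarrow> x = i \<oplus> j \<Longrightarrow> thesis) \<Longrightarrow> thesis"
  unfolding set_add_def' by blast

lemma lam_spans:
  assumes "maximalideal m R" "ideal I R" shows "spans (I <+>\<^bsub>R\<^esub> fp e m) (MonL e)"
proof (rule spans_mono[OF fp_spans[OF assms(1)]])
  have mi: "ideal m R" using assms(1) maximalideal.axioms(1) by blast
  show "fp e m \<subseteq> I <+>\<^bsub>R\<^esub> fp e m"
  proof
    fix x assume x: "x \<in> fp e m"
    then show "x \<in> I <+>\<^bsub>R\<^esub> fp e m"
      by (intro setaddI[of \<zero> _ x]) (use ideal_zero[OF assms(2)] idealD[OF fp_ideal[OF mi]] in auto)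
  qed
qed

lemma idl_ins_setadd:
  assumes "ideal I R" "ideal J R" "a \<in> carrier R"
  shows "idl_ins R I a <+>\<^bsub>R\<^esub> J \<subseteq> idl_ins R (I <+>\<^bsub>R\<^esub> J) a"
proof
  fix x assume "x \<in> idl_ins R I a <+>\<^bsub>R\<^esub> J"
  then obtain q r j where q: "q \<in> I" "r \<in> carrier R" "j \<in> J" "x = (q \<oplus> a \<otimes> r) \<oplus> j"
    by (elim setaddE) (auto simp: idl_ins_def)
  have "q \<in> carrier R" "j \<in> carrier R" using q idealD assms by blast+
  then have "x = (q \<oplus> j) \<oplus> a \<otimes> r" using q assms by (simp add: a_ac)
  then show "x \<in> idl_ins R (I <+>\<^bsub>R\<^esub> J) a" using q by (intro idl_insI[of "q \<oplus> j"] setaddI[of q _ j]) auto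
qed

text \<open>Filter by J + x^i R: each of the n layers is a quotient of R modulo J + xR.\<close>

lemma cdim_power:
  assumes J: "ideal J R" "spans J Z" and x: "x \<in> carrier R" and xq: "x [^] (n::nat) \<in> J"
  shows "cdim J \<le> n * cdim (idl_ins R J x)"
proof -
  have sp: "spans (idl_ins R J y) Z" if "y \<in> carrier R" for y
    using spans_mono[OF J(2) idl_ins(2)[OF J(1) that]] .
  have "cdim (idl_ins R J (x [^] i)) \<le> i * cdim (idl_ins R J x)" for i :: nat
  proof (induction i)
    case 0
    have "\<one> \<in> idl_ins R J \<one>" by (rule idl_ins(3)[OF J(1)]) simp
    then have e: "idl_ins R J \<one> = carrier R" using ideal.one_imp_carrier[OF idl_ins(1)[OF J(1)]] by simp
    have "\<exists>s\<in>lspan R k {}. \<exists>j\<in>carrier R. y = s \<oplus> j" if "y \<in> carrier R" for y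
      using that by (intro bexI[of _ \<zero>] bexI[of _ y]) (auto intro: lspan.lspan_zero)
    then have "spans (carrier R) {}" unfolding spans_def by simp
    then have "cdim (carrier R) = 0" using cdim_le[of "carrier R" "{}"] by simp
    then show ?case using e by simp
  next
    case (Suc i)
    have xi: "x [^] i \<in> carrier R" "x [^] Suc i \<in> carrier R" using x by auto
    have "cdim (idl_ins R J (x [^] Suc i)) \<le> cdim (idl_ins R J (x [^] i)) + cdim (idl_ins R J x)"
    proof (rule cdim_colon[OF idl_ins(1)[OF J(1) xi(2)] xi(1) sp[OF xi(1)] sp[OF x]])
      have "J \<subseteq> idl_ins R (idl_ins R J (x [^] Suc i)) (x [^] i)"
        using idl_ins(2)[OF J(1) xi(2)] idl_ins(2)[OF idl_ins(1)[OF J(1) xi(2)] xi(1)] by blast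
      then show "idl_ins R J (x [^] i) \<subseteq> idl_ins R (idl_ins R J (x [^] Suc i)) (x [^] i)"
        using idl_ins[OF idl_ins(1)[OF J(1) xi(2)] xi(1)] by (intro idl_ins_minimal) auto
      fix j assume "j \<in> idl_ins R J x"
      then obtain q r where q: "q \<in> J" "r \<in> carrier R" "j = q \<oplus> x \<otimes> r" unfolding idl_ins_def by auto
      have qc: "q \<in> carrier R" using q idealD[OF J(1)] by blast
      have "x [^] i \<otimes> j = x [^] i \<otimes> q \<oplus> x [^] Suc i \<otimes> r" unfolding q(3) using qc q x by (simp add: r_distr m_assoc)
      moreover have "x [^] i \<otimes> q \<in> J" using ideal.I_l_closed[OF J(1)] q x by auto
      ultimately have "x [^] i \<otimes> j \<in> idl_ins R J (x [^] Suc i)" using q by (intro idl_insI) auto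
      then show "j \<in> carrier R \<and> x [^] i \<otimes> j \<in> idl_ins R J (x [^] Suc i)" using q qc x by simp
    qed
    then show ?case using Suc by simp
  qed
  moreover have "idl_ins R J (x [^] n) = J"
    using idl_ins_minimal[OF J(1) subset_refl xq] idl_ins(2)[OF J(1), of "x [^] n"] x by auto
  ultimately show ?thesis by metis
qed

text \<open>The bound is colength at most C * q^(h-1), multiplied by q so that h = 0 is meaningful.
  Noetherian induction reduces a non-prime ideal to two larger ones; at a prime, adding one element
  of m shortens chains and costs a factor q.\<close>

lemma lam_bound:
  assumes m: "maximalideal m R" and "ideal I R"
  shows "(\<And>n. pchain I m n \<Longrightarrow> n < h) \<Longrightarrow> \<exists>C. \<forall>e. p ^ e * lam e I m \<le> C * (p ^ e) ^ h"
  using assms(2)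
proof (induction I arbitrary: h rule: noeth_induct)
  case (1 I)
  interpret m: maximalideal m R by (rule m)
  have mi: "ideal m R" by (rule m.is_ideal)
  have mp: "primeideal m R" by (rule maximalideal_prime[OF m])
  note fpi = fp_ideal[OF mi]
  consider (a) "\<not> I \<subseteq> m" | (b) "I = m" | (c) "I \<subseteq> m" "I \<noteq> m" "primeideal I R" | (d) "I \<subseteq> m" "\<not> primeideal I R" by blast
  then show ?case
  proof cases
    case a
    have "lam e I m = 0" for e
    proof -
      \<comment> \<open>An element of I outside m is a unit modulo m^[q], so the quotient is
        zero.\<close>
      obtain s where s: "s \<in> I" "s \<notin> m" using a by auto
      have sc: "s \<in> carrier R" using s idealD[OF 1(1)] by blast
      obtain t where t: "t \<in> carrier R" "s \<otimes> t \<ominus> \<one> \<in> fp e m" using fp_unit[OF m sc s(2)] by blast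
      have "\<one> = s \<otimes> t \<oplus> \<ominus> (s \<otimes> t \<ominus> \<one>)" using sc t(1) by algebra
      then have "\<one> \<in> I <+>\<^bsub>R\<^esub> fp e m"
        using ideal.I_r_closed[OF 1(1) s(1) t(1)] ideal_uminus[OF fpi t(2)] by (intro setaddI) auto
      then have e: "I <+>\<^bsub>R\<^esub> fp e m = carrier R"
        using ideal.one_imp_carrier[OF add_ideals[OF 1(1) fpi]] by simp
      have "\<exists>s\<in>lspan R k {}. \<exists>j\<in>carrier R. y = s \<oplus> j" if "y \<in> carrier R" for y
        using that by (intro bexI[of _ \<zero>] bexI[of _ y]) (auto intro: lspan.lspan_zero)
      then have "spans (carrier R) {}" unfolding spans_def by simp
      then show ?thesis unfolding lam_def e using cdim_le[of "carrier R" "{}"] by simp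
    qed
    then show ?thesis by auto
  next
    case b
    have "h > 0" using 1(3)[OF pchain_0[OF mp]] b by auto
    have "lam e I m \<le> 1" for e
    proof -
      have "spans (I <+>\<^bsub>R\<^esub> fp e m) {\<one>}" unfolding spans_def
      proof (intro conjI ballI)
        fix x assume x: "x \<in> carrier R"
        obtain c where c: "c \<in> k" "x \<ominus> c \<in> m" using maximal_residue[OF m x] by auto
        have xc: "x \<ominus> c \<in> carrier R" using c x by auto
        have "x = c \<oplus> (x \<ominus> c)" using x k.LD[OF c(1)] by algebra
        moreover have "x \<ominus> c \<in> I <+>\<^bsub>R\<^esub> fp e m"
          using b c xc ideal_zero[OF fpi] by (intro setaddI[of "x \<ominus> c" _ \<zero>]) auto
        moreover have "\<zero> \<oplus> c \<otimes> \<one> \<in> lspan R k {\<one>}" using c by (intro lspan.intros) auto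
        ultimately show "\<exists>s\<in>lspan R k {\<one>}. \<exists>j\<in>I <+>\<^bsub>R\<^esub> fp e m. x = s \<oplus> j" using c(1) by (simp, metis)
      qed auto
      then show ?thesis unfolding lam_def using cdim_le by fastforce
    qed
    moreover have "p ^ e \<le> (p ^ e) ^ h" for e
      using \<open>h > 0\<close> p_pos by (simp add: self_le_power)
    ultimately have "p ^ e * lam e I m \<le> 1 * (p ^ e) ^ h" for e
      by (metis mult.commute mult_le_mono)
    then show ?thesis by blast
  next
    case c
    \<comment> \<open>The power x^q lies in m^[q], so \<open>cdim_power\<close> applies with
      exponent q. As I is prime, every chain above I + xR extends downwards by I itself.\<close>
    obtain x where x: "x \<in> m" "x \<notin> I" using c by blast
    have xc: "x \<in> carrier R" using x m.Icarr by blast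
    note J = idl_ins[OF 1(1) xc]
    have h: "h > 0" using 1(3)[OF pchain_0[OF c(3) subset_refl c(1)]] by simp
    have "\<exists>C. \<forall>e. p ^ e * lam e (idl_ins R I x) m \<le> C * (p ^ e) ^ (h - 1)"
    proof (rule 1(2)[OF J(1)])
      show "I \<subset> idl_ins R I x" using J x by blast
      then show "n < h - 1" if "pchain (idl_ins R I x) m n" for n
        using 1(3)[OF pchain_Suc[OF c(3) _ that]] by auto
    qed
    then obtain C where C: "\<And>e. p ^ e * lam e (idl_ins R I x) m \<le> C * (p ^ e) ^ (h - 1)" by blast
    have "p ^ e * lam e I m \<le> C * (p ^ e) ^ h" for e
    proof -
      have "fr e x \<in> I <+>\<^bsub>R\<^esub> fp e m"
        using fr_fp[OF mi x(1)] ideal_zero[OF 1(1)] xc by (intro setaddI[of \<zero> _ "fr e x"]) auto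
      then have "lam e I m \<le> p ^ e * cdim (idl_ins R (I <+>\<^bsub>R\<^esub> fp e m) x)"
        unfolding lam_def fr_def by (rule cdim_power[OF add_ideals[OF 1(1) fpi] lam_spans[OF m 1(1)] xc])
      moreover have "cdim (idl_ins R (I <+>\<^bsub>R\<^esub> fp e m) x) \<le> lam e (idl_ins R I x) m"
        unfolding lam_def by (rule cdim_mono[OF lam_spans[OF m J(1)] idl_ins_setadd[OF 1(1) fpi xc]])
      ultimately have "lam e I m \<le> p ^ e * lam e (idl_ins R I x) m"
        by (meson le_trans mult_le_mono2)
      then have "p ^ e * lam e I m \<le> p ^ e * (p ^ e * lam e (idl_ins R I x) m)" by simp
      also have "\<dots> \<le> p ^ e * (C * (p ^ e) ^ (h - 1))" using C[of e] by simp
      also have "\<dots> = C * (p ^ e) ^ h" using h by (cases h) auto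
      finally show ?thesis .
    qed
    then show ?thesis by blast
  next
    case d
    have "I \<noteq> carrier R" using d m.I_notcarr m.a_subset by blast
    \<comment> \<open>Both I + aR and I : a are strictly larger than I, the latter because it
      contains b, and the colength at I is at most the sum of theirs.\<close>
    then obtain a b where ab: "a \<in> carrier R" "b \<in> carrier R" "a \<otimes> b \<in> I" "a \<notin> I" "b \<notin> I"
      using not_prime_witness[OF 1(1) _ d(2)] by blast
    note A = idl_ins[OF 1(1) ab(1)] and B = idl_quot[OF 1(1) ab(1)]
    let ?B = "{r \<in> carrier R. a \<otimes> r \<in> I}"
    have "\<exists>C. \<forall>e. p ^ e * lam e (idl_ins R I a) m \<le> C * (p ^ e) ^ h"
      by (rule 1(2)[OF A(1)]) (use A ab 1(3) pchain_mono in blast)+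
    then obtain C1 where C1: "\<And>e. p ^ e * lam e (idl_ins R I a) m \<le> C1 * (p ^ e) ^ h" by blast
    have "\<exists>C. \<forall>e. p ^ e * lam e ?B m \<le> C * (p ^ e) ^ h"
      by (rule 1(2)[OF B(1)]) (use B ab 1(3) pchain_mono in blast)+
    then obtain C2 where C2: "\<And>e. p ^ e * lam e ?B m \<le> C2 * (p ^ e) ^ h" by blast
    have "p ^ e * lam e I m \<le> (C1 + C2) * (p ^ e) ^ h" for e
    proof -
      have "lam e I m \<le> lam e (idl_ins R I a) m + lam e ?B m"
        unfolding lam_def
      proof (rule cdim_colon[OF add_ideals[OF 1(1) fpi] ab(1) lam_spans[OF m A(1)] lam_spans[OF m B(1)] idl_ins_setadd[OF 1(1) fpi ab(1)]])
        fix j assume "j \<in> ?B <+>\<^bsub>R\<^esub> fp e m"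
        then obtain r w where r: "r \<in> carrier R" "a \<otimes> r \<in> I" "w \<in> fp e m" "j = r \<oplus> w" by (elim setaddE) auto
        have wc: "w \<in> carrier R" using r idealD[OF fpi] by blast
        have "a \<otimes> j = a \<otimes> r \<oplus> a \<otimes> w" unfolding r(4) using r wc ab by (simp add: r_distr)
        then show "j \<in> carrier R \<and> a \<otimes> j \<in> I <+>\<^bsub>R\<^esub> fp e m"
          using r wc setaddI[OF r(2) ideal.I_l_closed[OF fpi r(3) ab(1)]] by auto
      qed
      then have "p ^ e * lam e I m \<le> p ^ e * (lam e (idl_ins R I a) m + lam e ?B m)" by simp
      also have "\<dots> \<le> C1 * (p ^ e) ^ h + C2 * (p ^ e) ^ h" using C1[of e] C2[of e] by (simp add: algebra_simps)
      finally show ?thesis by (simp add: algebra_simps)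
    qed
    then show ?thesis by blast
  qed
qed

end

text \<open>A constant factor is invisible to exponential growth. This turns asymptotic estimates
  into the exact bounds q^h and p^d.\<close>

lemma nat_power_growth:
  fixes a r C :: nat
  assumes "\<And>j. a ^ j \<le> C * r ^ j" shows "a \<le> r"
proof (rule ccontr)
  assume "\<not> a \<le> r"
  then have ar: "r < a" by simp
  show False
  proof (cases "r = 0")
    case True
    then show False using assms[of 1] ar by simp
  next
    case False
    then have "1 < real a / real r" using ar by simp
    then obtain n where n: "real C < (real a / real r) ^ n" using real_arch_pow by blast
    then have "real C * real r ^ n < real a ^ n" using False by (simp add: power_divide field_simps)
    moreover have "real (a ^ n) \<le> real (C * r ^ n)" using assms[of n] by (simp only: of_nat_le_iff)
    ultimately show False by simp
  qed
qed

lemma chain_increasing: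
  fixes c :: "nat \<Rightarrow> 'a set"
  assumes "\<forall>i<n. c i \<subset> c (Suc i)" "i \<le> n" shows "c 0 \<subseteq> c i"
  using assms(2)
proof (induction i)
  case (Suc i)
  then show ?case using assms(1)[rule_format, of i] by auto
qed simp

lemma (in abelian_monoid) finsum_Sigma:
  assumes "finite A" "\<And>a. a \<in> A \<Longrightarrow> finite (B a)" "\<And>a b. a \<in> A \<Longrightarrow> b \<in> B a \<Longrightarrow> f a b \<in> carrier G"
  shows "(\<Oplus>z\<in>Sigma A B. f (fst z) (snd z)) = (\<Oplus>a\<in>A. \<Oplus>b\<in>B a. f a b)"
  using assms
proof (induction A rule: finite_induct)
  case (insert a A)
  have c: "\<And>b. b \<in> B a \<Longrightarrow> f a b \<in> carrier G" "\<And>a b. a \<in> A \<Longrightarrow> b \<in> B a \<Longrightarrow> f a b \<in> carrier G"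
    and fin: "finite (B a)" "\<And>a. a \<in> A \<Longrightarrow> finite (B a)"
    using insert.prems by auto
  have e: "Sigma (insert a A) B = (Pair a ` B a) \<union> (Sigma A B)" by auto
  have "(\<Oplus>z\<in>Sigma (insert a A) B. f (fst z) (snd z))
      = (\<Oplus>z\<in>Pair a ` B a. f (fst z) (snd z)) \<oplus> (\<Oplus>z\<in>Sigma A B. f (fst z) (snd z))"
    unfolding e by (rule finsum_Un_disjoint) (use insert.hyps fin c in auto)
  also have "(\<Oplus>z\<in>Pair a ` B a. f (fst z) (snd z)) = (\<Oplus>b\<in>B a. f a b)"
    using finsum_reindex[of "\<lambda>z. f (fst z) (snd z)" "Pair a" "B a"] c by (auto simp: inj_on_def Pi_def)
  also have "(\<Oplus>z\<in>Sigma A B. f (fst z) (snd z)) = (\<Oplus>a\<in>A. \<Oplus>b\<in>B a. f a b)" using insert.IH c fin by simp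
  also have "(\<Oplus>b\<in>B a. f a b) \<oplus> (\<Oplus>a\<in>A. \<Oplus>b\<in>B a. f a b) = (\<Oplus>a\<in>insert a A. \<Oplus>b\<in>B a. f a b)"
    by (rule finsum_insert[symmetric]) (use insert.hyps c in \<open>auto intro!: finsum_closed\<close>)
  finally show ?case .
qed simp

lemma (in lin_ctx) indepD:
  "indep Y \<Longrightarrow> c \<in> Y \<rightarrow> L \<Longrightarrow> (\<Oplus>x\<in>Y. c x \<otimes> x) \<in> T \<Longrightarrow> x \<in> Y \<Longrightarrow> c x \<in> Z"
  unfolding indep_def by simp

context affine_alg
begin

section \<open>Lower bound for the growth\<close>

text \<open>Over the field k denominators can be divided away, so the closure is just span plus
  T.\<close>

lemma kcl:
  assumes T: "ideal T R" and Z: "Z \<subseteq> carrier R" and x: "x \<in> lin_ctx.cl R k {\<zero>} T Z"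
  shows "\<exists>s\<in>lspan R k Z. \<exists>t\<in>T. x = s \<oplus> t"
proof -
  interpret K: lin_ctx R k "{\<zero>}" T by (rule k_ctx_ideal[OF T])
  obtain l s t where l: "l \<in> k" "l \<noteq> \<zero>" "s \<in> lspan R k Z" "t \<in> T" "l \<otimes> x = s \<oplus> t" and xc: "x \<in> carrier R"
    using x unfolding K.cl_def by blast
  obtain d where d: "d \<in> k" "l \<otimes> d = \<one>" using k_inv l by auto
  have sc: "s \<in> carrier R" "t \<in> carrier R" using l k.lspan_carrier Z by auto
  have "x = (l \<otimes> d) \<otimes> x" using d xc by simp
  also have "\<dots> = d \<otimes> (l \<otimes> x)" using k.LD[OF d(1)] k.LD[OF l(1)] xc by algebra
  finally have e: "x = d \<otimes> s \<oplus> d \<otimes> t" using l d sc by (simp add: r_distr)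
  have "d \<otimes> s \<in> lspan R k Z" "d \<otimes> t \<in> T" using l d k.lspan_scal Z by auto
  then show ?thesis by (intro bexI[of _ "d \<otimes> s"] bexI[of _ "d \<otimes> t"] e)
qed

lemma clI: "s \<in> lspan R k Z \<Longrightarrow> t \<in> T \<Longrightarrow> x = s \<oplus> t \<Longrightarrow> x \<in> carrier R \<Longrightarrow> ideal T R \<Longrightarrow> x \<in> lin_ctx.cl R k {\<zero>} T Z"
proof -
  assume a: "s \<in> lspan R k Z" "t \<in> T" "x = s \<oplus> t" "x \<in> carrier R" "ideal T R"
  interpret K: lin_ctx R k "{\<zero>}" T by (rule k_ctx_ideal[OF a(5)])
  have "\<one> \<otimes> x = s \<oplus> t" using a by simp
  moreover have "\<one> \<in> k - {\<zero>}" using one_neq_zero by simp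
  ultimately show ?thesis unfolding K.cl_def using a(1,2,4) by blast
qed

text \<open>In a relation modulo P the terms from x * F vanish modulo P1, which kills the
  coefficients on E; then x, being outside P, can be cancelled and the coefficients on F vanish
  too.\<close>

lemma indep_step:
  assumes P: "primeideal P R" "primeideal P1 R" "P \<subset> P1" and x: "x \<in> P1" "x \<notin> P"
    and E: "lin_ctx.indep R k {\<zero>} P1 E" and F: "lin_ctx.indep R k {\<zero>} P F"
  shows "lin_ctx.indep R k {\<zero>} P (E \<union> (\<lambda>y. x \<otimes> y) ` F)" "card (E \<union> (\<lambda>y. x \<otimes> y) ` F) = card E + card F"
proof -
  interpret P: primeideal P R by (rule P)
  interpret P1: primeideal P1 R by (rule P)
  interpret K: lin_ctx R k "{\<zero>}" P by (rule k_ctx_ideal[OF P.is_ideal])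
  interpret K1: lin_ctx R k "{\<zero>}" P1 by (rule k_ctx_ideal[OF P1.is_ideal])
  have xc: "x \<in> carrier R" using x P1.Icarr by blast
  have Ef: "finite E" "E \<subseteq> carrier R" using E by (auto simp: K1.indep_def)
  have Ff: "finite F" "F \<subseteq> carrier R" using F by (auto simp: K.indep_def)
  let ?I = "Inl ` E \<union> Inr ` F" and ?b = "case_sum (\<lambda>y. y) (\<lambda>y. x \<otimes> y)"
  have img: "?b ` ?I = E \<union> (\<lambda>y. x \<otimes> y) ` F" by force
  have ind: "\<forall>i\<in>?I. c i \<in> {\<zero>}" if c: "c \<in> ?I \<rightarrow> k" and s: "(\<Oplus>i\<in>?I. c i \<otimes> ?b i) \<in> P" for c
  proof -
    have cl: "\<And>y. y \<in> E \<Longrightarrow> c (Inl y) \<in> k" "\<And>y. y \<in> F \<Longrightarrow> c (Inr y) \<in> k" using c by auto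
    have "(\<Oplus>i\<in>?I. c i \<otimes> ?b i) = (\<Oplus>i\<in>Inl ` E. c i \<otimes> ?b i) \<oplus> (\<Oplus>i\<in>Inr ` F. c i \<otimes> ?b i)"
      by (rule finsum_Un_disjoint) (use Ef Ff cl xc in auto)
    also have "(\<Oplus>i\<in>Inl ` E. c i \<otimes> ?b i) = (\<Oplus>y\<in>E. c (Inl y) \<otimes> y)"
      by (subst finsum_reindex) (use Ef cl in auto)
    also have "(\<Oplus>i\<in>Inr ` F. c i \<otimes> ?b i) = (\<Oplus>y\<in>F. c (Inr y) \<otimes> (x \<otimes> y))"
      by (subst finsum_reindex) (use Ff cl xc in auto)
    also have "\<dots> = (\<Oplus>y\<in>F. x \<otimes> (c (Inr y) \<otimes> y))"
      by (rule finsum_cong') (use Ff cl xc in \<open>auto simp: m_lcomm subset_iff\<close>)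
    also have "\<dots> = x \<otimes> (\<Oplus>y\<in>F. c (Inr y) \<otimes> y)"
      by (rule finsum_rdistr[symmetric]) (use Ff cl xc in auto)
    finally have e: "(\<Oplus>i\<in>?I. c i \<otimes> ?b i) = (\<Oplus>y\<in>E. c (Inl y) \<otimes> y) \<oplus> x \<otimes> (\<Oplus>y\<in>F. c (Inr y) \<otimes> y)"
      (is "_ = ?s \<oplus> x \<otimes> ?t") .
    have sc: "?s \<in> carrier R" "?t \<in> carrier R" using Ef Ff cl by (auto intro!: finsum_closed)
    have st: "?s \<oplus> x \<otimes> ?t \<in> P" using s e by simp
    then have "?s \<oplus> x \<otimes> ?t \<ominus> x \<otimes> ?t \<in> P1" using P(3) P1.I_r_closed[OF x(1) sc(2)] ideal_minus[OF P1.is_ideal] by blast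
    moreover have "u \<oplus> v \<ominus> v = u" if "u \<in> carrier R" "v \<in> carrier R" for u v using that by algebra
    ultimately have "?s \<in> P1" using sc xc by simp
    then have zE: "\<forall>y\<in>E. c (Inl y) \<in> {\<zero>}" using K1.indepD[OF E, of "\<lambda>y. c (Inl y)"] cl by blast
    have "?s = (\<Oplus>y\<in>E. \<zero>)" by (rule finsum_cong') (use zE Ef in auto)
    then have "x \<otimes> ?t \<in> P" using st sc xc by simp
    then have "?t \<in> P" using P.I_prime[OF xc sc(2)] x by blast
    then have zF: "\<forall>y\<in>F. c (Inr y) \<in> {\<zero>}" using K.indepD[OF F, of "\<lambda>y. c (Inr y)"] cl by blast
    show ?thesis using zE zF by auto
  qed
  have fI: "finite ?I" "?b \<in> ?I \<rightarrow> carrier R" using Ef Ff xc by auto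
  note C = K.card_indep_image[OF fI ind]
  show "K.indep (E \<union> (\<lambda>y. x \<otimes> y) ` F)" using C(1) img by simp
  have "card (E \<union> (\<lambda>y. x \<otimes> y) ` F) = card ?I" using card_image[OF C(2)] img by simp
  also have "\<dots> = card (Inl ` E :: ('a + 'a) set) + card (Inr ` F :: ('a + 'a) set)"
    by (rule card_Un_disjoint) (use Ef Ff in auto)
  finally show "card (E \<union> (\<lambda>y. x \<otimes> y) ` F) = card E + card F" by (simp add: card_image)
qed

text \<open>A chain of length h yields a Hilbert function growing at least like N^h. With E chosen
  for the next prime of the chain and x in it but not in P, the sets E, x * E, up to the power N - 1
  of x are jointly independent.\<close>

lemma chain_growth:
  assumes "primeideal P R" "pchain P (carrier R) h"
  shows "\<exists>c. \<forall>N. \<exists>E. lin_ctx.indep R k {\<zero>} P E \<and> E \<subseteq> V (c * N) \<and> card E = N ^ h"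
  using assms
proof (induction h arbitrary: P)
  case 0
  interpret P: primeideal P R by (rule 0(1))
  interpret K: lin_ctx R k "{\<zero>}" P by (rule k_ctx_ideal[OF P.is_ideal])
  have "K.indep {\<one>}" unfolding K.indep_def
  proof (intro conjI allI impI ballI)
    fix c y assume c: "c \<in> {\<one>} \<rightarrow> k" "(\<Oplus>x\<in>{\<one>}. c x \<otimes> x) \<in> P" and y: "y \<in> {\<one>}"
    have "c \<one> \<in> k" using c by auto
    then have "c \<one> \<in> P" using c by (simp add: finsum_insert)
    then show "c y \<in> {\<zero>}" using k_notin_prime[OF 0(1) \<open>c \<one> \<in> k\<close>] y by simp
  qed auto
  moreover have "\<one> \<in> V 0" by (rule V_k) simp
  ultimately show ?case by (intro exI[of _ 0] allI exI[of _ "{\<one>}"]) auto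
next
  case (Suc h)
  obtain c where c: "\<forall>i\<le>Suc h. primeideal (c i) R" "\<forall>i<Suc h. c i \<subset> c (Suc i)" "P \<subseteq> c 0" "c (Suc h) \<subseteq> carrier R"
    using Suc.prems(2) unfolding pchain_def by blast
  let ?P1 = "c 1"
  have P1: "primeideal ?P1 R" "P \<subset> ?P1" using c(1,2,3) by auto
  have "pchain ?P1 (carrier R) h" unfolding pchain_def
    by (rule exI[of _ "\<lambda>i. c (Suc i)"]) (use c in auto)
  from Suc.IH[OF P1(1) this] obtain a where
    a: "\<forall>N. \<exists>E. lin_ctx.indep R k {\<zero>} ?P1 E \<and> E \<subseteq> V (a * N) \<and> card E = N ^ h" by (elim exE)
  obtain x where x: "x \<in> ?P1" "x \<notin> P" using P1 by blast
  have xc: "x \<in> carrier R" using x P1(1) idealD[of ?P1] primeideal.axioms(1) by blast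
  obtain D where D: "x \<in> V D" using V_exhaust[OF xc] by blast
  interpret P: primeideal P R by (rule Suc.prems(1))
  interpret K: lin_ctx R k "{\<zero>}" P by (rule k_ctx_ideal[OF P.is_ideal])
  have "\<exists>E. K.indep E \<and> E \<subseteq> V ((a + D) * N) \<and> card E = N ^ Suc h" for N
  proof -
    obtain E where E: "lin_ctx.indep R k {\<zero>} ?P1 E" "E \<subseteq> V (a * N)" "card E = N ^ h" using a by blast
    have "\<exists>F. K.indep F \<and> F \<subseteq> V (a * N + D * l) \<and> card F = l * N ^ h" for l
    proof (induction l)
      case 0
      then show ?case using K.indep_empty by (intro exI[of _ "{}"]) auto
    next
      case (Suc l)
      then obtain F where F: "K.indep F" "F \<subseteq> V (a * N + D * l)" "card F = l * N ^ h" by blast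
      note st = indep_step[OF P.primeideal P1(1) P1(2) x E(1) F(1)]
      have "E \<subseteq> V (a * N + D * Suc l)" using E(2) V_mono[of _ "a * N" "a * N + D * Suc l"] by auto
      moreover have "(\<lambda>y. x \<otimes> y) ` F \<subseteq> V (a * N + D * Suc l)"
      proof
        fix z assume "z \<in> (\<lambda>y. x \<otimes> y) ` F"
        then obtain y where "y \<in> V (a * N + D * l)" "z = x \<otimes> y" using F by blast
        then have "z \<in> V (D + (a * N + D * l))" using V_mult[OF D] by simp
        then show "z \<in> V (a * N + D * Suc l)" by (simp add: algebra_simps)
      qed
      ultimately show ?case using st E(3) F(3) by (intro exI[of _ "E \<union> (\<lambda>y. x \<otimes> y) ` F"]) auto
    qed
    from this[of N] show ?thesis by (simp add: algebra_simps)
  qed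
  then show ?case by (intro exI[of _ "a + D"] allI)
qed

text \<open>One combination involves finitely many coefficients, so the degrees of their q-th roots
  are bounded.\<close>

lemma lspan_frV:
  assumes "u \<in> lspan R (frs e) B" "B \<subseteq> carrier R"
  shows "\<exists>c. u \<in> lspan R (fr e ` V c) B"
  using assms(1)
proof (induction u rule: lspan.induct)
  case lspan_zero
  then show ?case using lspan.lspan_zero by blast
next
  case (lspan_step s l x)
  have mono: "s \<in> lspan R (fr e ` V c') B" if "s \<in> lspan R (fr e ` V c) B" "c \<le> c'" for s c c'
    using that(1)
  proof (induction s rule: lspan.induct)
    case (lspan_step s l x)
    have "l \<in> fr e ` V c'" using lspan_step(2) V_mono[OF _ that(2)] by blast
    then show ?case using lspan_step by (intro lspan.lspan_step) auto
  qed (rule lspan.lspan_zero)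
  obtain c where c: "s \<in> lspan R (fr e ` V c) B" using lspan_step by blast
  obtain a where a: "a \<in> carrier R" "l = fr e a" using lspan_step(2) unfolding frs_def by blast
  obtain d where d: "a \<in> V d" using V_exhaust[OF a(1)] by blast
  have "s \<in> lspan R (fr e ` V (max c d)) B" using mono[OF c] by simp
  moreover have "l \<in> fr e ` V (max c d)" using a d V_mono by auto
  ultimately have "s \<oplus> l \<otimes> x \<in> lspan R (fr e ` V (max c d)) B" using lspan_step(3) by (intro lspan.lspan_step)
  then show ?case by blast
qed

lemma lspan_frV_mono: "s \<in> lspan R (fr e ` V c) B \<Longrightarrow> c \<le> c' \<Longrightarrow> s \<in> lspan R (fr e ` V c') B"
proof (induction s rule: lspan.induct)
  case (lspan_step s l x)
  have "l \<in> fr e ` V c'" using lspan_step(2) V_mono[OF _ lspan_step(5)] by blast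
  then show ?case using lspan_step by (intro lspan.lspan_step) auto
qed (rule lspan.lspan_zero)

lemma lspan_frV_mult:
  assumes B: "B \<subseteq> carrier R" and a: "a \<in> V d" and s: "s \<in> lspan R (fr e ` V c) B"
  shows "fr e a \<otimes> s \<in> lspan R (fr e ` V (d + c)) B"
  using s
proof (induction s rule: lspan.induct)
  case lspan_zero
  then show ?case using V_carrier[OF a] by (simp add: lspan.lspan_zero)
next
  case (lspan_step s l x)
  then obtain v where v: "v \<in> V c" "l = fr e v" by blast
  have c: "a \<in> carrier R" "v \<in> carrier R" "x \<in> carrier R" using V_carrier a v lspan_step B by auto
  have sc: "s \<in> carrier R" using lspan_carrier_gen[OF lspan_step(1) _ B] V_carrier by blast
  have "fr e a \<otimes> (s \<oplus> l \<otimes> x) = fr e a \<otimes> s \<oplus> fr e (a \<otimes> v) \<otimes> x"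
    using v c sc by (simp add: fr_mult r_distr m_assoc)
  moreover have "fr e (a \<otimes> v) \<in> fr e ` V (d + c)" using V_mult[OF a v(1)] by blast
  ultimately show ?case using lspan_step by (simp add: lspan.lspan_step)
qed

text \<open>If B generates R modulo P generically over q-th powers, the Hilbert function satisfies
  g(n) <= |B| * g(n/q + c). Iterated j times from degree a * q^j this bounds g by a constant times
  |B|^j, whereas the chain gives at least (q^h)^j.\<close>

lemma growth_bound:
  assumes P: "primeideal P R" and B: "finite B" "B \<subseteq> carrier R" and f: "f \<in> carrier R" "f \<notin> P"
    and sp: "\<And>x. x \<in> carrier R \<Longrightarrow> \<exists>u\<in>lspan R (frs e) B. \<exists>i\<in>P. fr e f \<otimes> x = u \<oplus> i"
    and e: "e > 0" and h: "pchain P (carrier R) h"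
  shows "(p ^ e) ^ h \<le> card B"
proof -
  interpret P: primeideal P R by (rule P)
  interpret K: lin_ctx R k "{\<zero>}" P by (rule k_ctx_ideal[OF P.is_ideal])
  define q where "q = p ^ e"
  have q2: "q \<ge> 2"
  proof -
    have "p ^ 1 \<le> p ^ e" using e p_gt_1 by (intro power_increasing) auto
    then show ?thesis using p_gt_1 by (simp add: q_def)
  qed
  have "\<forall>n. \<exists>G. G \<subseteq> Mon n \<and> K.indep G \<and> Mon n \<subseteq> K.cl G"
    using K.basis_exists[OF finite_Mon Mon_carrier] by blast
  from choice[OF this] obtain G where G0: "\<forall>n. G n \<subseteq> Mon n \<and> K.indep (G n) \<and> Mon n \<subseteq> K.cl (G n)" by (elim exE)
  then have G: "\<And>n. G n \<subseteq> Mon n" "\<And>n. K.indep (G n)" "\<And>n. Mon n \<subseteq> K.cl (G n)" by simp_all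
  have Gf: "finite (G n)" "G n \<subseteq> carrier R" for n using G(2)[of n] unfolding K.indep_def by simp_all
  \<comment> \<open>The Hilbert function of R modulo P: the dimension of the image of
    \<open>V n\<close>, computed by a basis of monomials.\<close>
  define g where "g n = card (G n)" for n
  have VG: "v \<in> K.cl (G n)" if "v \<in> V n" for v n
  proof (rule K.cl_trans[OF finite_Mon G(3) Gf(2)])
    show "v \<in> K.cl (Mon n)"
      by (rule clI[of v _ \<zero>]) (use that V_carrier P.is_ideal in \<open>auto simp: V_def\<close>)
  qed
  have gmax: "card E \<le> g n" if "K.indep E" "E \<subseteq> V n" for E n
    unfolding g_def by (rule K.steinitz[OF that(1) Gf]) (use that(2) VG in blast)
  have GV: "G n \<subseteq> V n" for n
    using G(1)[of n] k.lspan_incl[OF Mon_carrier] unfolding V_def by blast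
  have gmono: "g m \<le> g n" if "m \<le> n" for m n
  proof -
    have "G m \<subseteq> V n" using GV[of m] V_mono[OF _ that] by blast
    then show ?thesis using gmax[OF G(2)] unfolding g_def[of m] by blast
  qed
  have "\<exists>c. \<forall>y\<in>MonL e. \<exists>u\<in>lspan R (fr e ` V c) B. \<exists>i\<in>P. fr e f \<otimes> y = u \<oplus> i"
  proof -
    have one: "\<exists>c. \<exists>u\<in>lspan R (fr e ` V c) B. \<exists>i\<in>P. fr e f \<otimes> y = u \<oplus> i" if "y \<in> MonL e" for y
    proof -
      have yc: "y \<in> carrier R" using that MonL_carrier by auto
      obtain u i where u: "u\<in>lspan R (frs e) B" "i \<in> P" "fr e f \<otimes> y = u \<oplus> i" using sp[OF yc] by blast
      then show ?thesis using lspan_frV[OF u(1) B(2)] by blast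
    qed
    have "\<exists>c. \<forall>y\<in>A. \<exists>u\<in>lspan R (fr e ` V c) B. \<exists>i\<in>P. fr e f \<otimes> y = u \<oplus> i" if "finite A" "A \<subseteq> MonL e" for A
      using that
    proof (induction A rule: finite_induct)
      case (insert y A)
      obtain c where c: "\<forall>y\<in>A. \<exists>u\<in>lspan R (fr e ` V c) B. \<exists>i\<in>P. fr e f \<otimes> y = u \<oplus> i" using insert by auto
      obtain d where d: "\<exists>u\<in>lspan R (fr e ` V d) B. \<exists>i\<in>P. fr e f \<otimes> y = u \<oplus> i" using one[of y] insert by auto
      have "\<exists>u\<in>lspan R (fr e ` V (max c d)) B. \<exists>i\<in>P. fr e f \<otimes> z = u \<oplus> i" if "z \<in> insert y A" for z
      proof (cases "z = y")
        case True
        then show ?thesis using d lspan_frV_mono[of _ e d B "max c d"] by (metis max.cobounded2)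
      next
        case False
        then have "z \<in> A" using that by simp
        then show ?thesis using c lspan_frV_mono[of _ e c B "max c d"] by (metis max.cobounded1)
      qed
      then show ?case by blast
    qed simp
    from this[OF card_MonL(1) subset_refl] show ?thesis .
  qed
  then obtain c where c: "\<And>y. y \<in> MonL e \<Longrightarrow> \<exists>u\<in>lspan R (fr e ` V c) B. \<exists>i\<in>P. fr e f \<otimes> y = u \<oplus> i" by blast
  \<comment> \<open>A monomial of degree n is a q-th power of degree at most n div q times one from
    \<open>MonL e\<close>. After the factor \<open>fr e f\<close> the latter is a combination of B
    whose coefficients are q-th powers from \<open>V c\<close>.\<close>
  have rec: "g n \<le> card B * g (n div q + c)" for n
  proof -
    define n' where "n' = n div q + c"
    let ?C = "(\<lambda>z. fr e (fst z) \<otimes> snd z) ` (G n' \<times> B)"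
    have Cf: "finite ?C" "?C \<subseteq> carrier R" using Gf[of n'] B by (auto simp: subset_iff)
    have frV: "\<exists>s\<in>lspan R k (fr e ` G n'). \<exists>t\<in>P. fr e v = s \<oplus> t" if v: "v \<in> V n'" for v
    proof -
      obtain s t where s: "s \<in> lspan R k (G n')" "t \<in> P" "v = s \<oplus> t"
        using kcl[OF P.is_ideal Gf(2) VG[OF v]] by blast
      have fs: "fr e s \<in> lspan R k (fr e ` G n')" using s(1)
      proof (induction s rule: lspan.induct)
        case (lspan_step s l x)
        have "s \<in> carrier R" "x \<in> carrier R" using lspan_step k.lspan_carrier[OF _ Gf(2)] Gf(2) by auto
        then have "fr e (s \<oplus> l \<otimes> x) = fr e s \<oplus> fr e l \<otimes> fr e x" using lspan_step by (simp add: fr_add fr_mult)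
        then show ?case using lspan_step k_fr by (auto intro!: lspan.lspan_step)
      qed (simp add: lspan.lspan_zero)
      have sc: "s \<in> carrier R" using k.lspan_carrier[OF s(1) Gf(2)] .
      have "fr e v = fr e s \<oplus> fr e t" unfolding s(3) using sc s(2) by (simp add: fr_add)
      moreover have "fr e t \<in> P" using fr_prime[OF P, of t e] s(2) by simp
      ultimately show ?thesis using fs by blast
    qed
    have mulb: "\<exists>s'\<in>lspan R k ?C. s \<otimes> b = s'" if "s \<in> lspan R k (fr e ` G n')" and b: "b \<in> B" for s b
      using that(1)
    proof (induction s rule: lspan.induct)
      case lspan_zero
      then show ?case using b B by (auto simp: lspan.lspan_zero)
    next
      case (lspan_step s l x)
      then obtain y where y: "y \<in> G n'" "x = fr e y" by blast
      have cc: "s \<in> carrier R" "x \<in> carrier R" "b \<in> carrier R" "l \<in> carrier R"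
        using k.lspan_carrier[OF lspan_step(1)] Gf(2)[of n'] y b B lspan_step(2) by auto
      have "(s \<oplus> l \<otimes> x) \<otimes> b = s \<otimes> b \<oplus> l \<otimes> (x \<otimes> b)" using cc by (simp add: l_distr m_assoc)
      moreover have "x \<otimes> b \<in> ?C" using y b by force
      ultimately show ?case using lspan_step by (auto intro!: lspan.lspan_step)
    qed
    have spanC: "\<exists>s\<in>lspan R k ?C. \<exists>t\<in>P. u = s \<oplus> t" if "u \<in> lspan R (fr e ` V n') B" for u
      using that
    proof (induction u rule: lspan.induct)
      case lspan_zero
      show ?case by (rule bexI[of _ \<zero>], rule bexI[of _ \<zero>]) (auto intro: lspan.lspan_zero)
    next
      case (lspan_step s l b)
      then obtain s' t' where s': "s' \<in> lspan R k ?C" "t' \<in> P" "s = s' \<oplus> t'" by blast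
      obtain v where v: "v \<in> V n'" "l = fr e v" using lspan_step by blast
      obtain w t where w: "w \<in> lspan R k (fr e ` G n')" "t \<in> P" "fr e v = w \<oplus> t" using frV[OF v(1)] by blast
      have wb: "w \<otimes> b \<in> lspan R k ?C" using mulb[OF w(1) lspan_step(3)] by simp
      have "fr e ` G n' \<subseteq> carrier R" using Gf(2)[of n'] by auto
      then have wc: "w \<in> carrier R" using k.lspan_carrier[OF w(1)] by blast
      have cc: "b \<in> carrier R" "s' \<in> carrier R" "t \<in> carrier R" "t' \<in> carrier R"
        using lspan_step B k.lspan_carrier[OF s'(1) Cf(2)] w s' by auto
      have "s \<oplus> l \<otimes> b = (s' \<oplus> w \<otimes> b) \<oplus> (t' \<oplus> t \<otimes> b)" unfolding v(2) w(3) s'(3) using wc cc by algebra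
      moreover have "s' \<oplus> w \<otimes> b \<in> lspan R k ?C" using k.lspan_add[OF wb s'(1) Cf(2)] .
      moreover have "t' \<oplus> t \<otimes> b \<in> P" using s'(2) P.I_r_closed[OF w(2) cc(1)] by simp
      ultimately show ?case by metis
    qed
    have fMon: "fr e f \<otimes> y \<in> K.cl ?C" if "y \<in> Mon n" for y
    proof -
      obtain \<alpha> where \<alpha>: "y = mon \<alpha>" "deg \<alpha> \<le> n" using \<open>y \<in> Mon n\<close> by (auto simp: Mon_def)
      obtain \<gamma> where \<gamma>: "\<forall>x. \<gamma> x < p ^ e" "mon \<alpha> = fr e (mon (\<lambda>x. \<alpha> x div p ^ e)) \<otimes> mon \<gamma>" using mon_divmod by blast
      let ?b = "mon (\<lambda>x. \<alpha> x div p ^ e)"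
      have "mon \<gamma> \<in> MonL e" using \<gamma> by (auto simp: MonL_def)
      then obtain u i where u: "u\<in>lspan R (fr e ` V c) B" "i \<in> P" "fr e f \<otimes> mon \<gamma> = u \<oplus> i" using c by blast
      have dv: "(\<Sum>x\<in>A. \<alpha> x div q) \<le> (\<Sum>x\<in>A. \<alpha> x) div q" if "finite A" for A
        using that
      proof (induction A rule: finite_induct)
        case (insert x A)
        have "\<alpha> x div q + sum \<alpha> A div q \<le> (\<alpha> x + sum \<alpha> A) div q"
          by (subst div_add1_eq[of "\<alpha> x" "sum \<alpha> A" q]) simp
        then show ?case using insert by simp
      qed simp
      have "deg (\<lambda>x. \<alpha> x div p ^ e) \<le> n div q"
        using dv[OF S_finite] \<alpha>(2) div_le_mono[of "deg \<alpha>" n q] unfolding deg_def q_def by linarith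
      then have "?b \<in> Mon (n div q)" unfolding Mon_def by blast
      then have bV: "?b \<in> V (n div q)" unfolding V_def using k.lspan_incl[OF Mon_carrier] by blast
      have uc: "u \<in> carrier R" using lspan_carrier_gen[OF u(1) _ B(2)] V_carrier by blast
      have bu: "fr e ?b \<otimes> u \<in> lspan R (fr e ` V n') B" using lspan_frV_mult[OF B(2) bV u(1)] by (simp add: n'_def)
      then obtain s t where s: "s \<in> lspan R k ?C" "t \<in> P" "fr e ?b \<otimes> u = s \<oplus> t" using spanC by blast
      have sc: "s \<in> carrier R" "t \<in> carrier R" "i \<in> carrier R" using s k.lspan_carrier[OF s(1) Cf(2)] u by auto
      have "fr e f \<otimes> y = fr e ?b \<otimes> (fr e f \<otimes> mon \<gamma>)" unfolding \<alpha>(1) \<gamma>(2) using f by (simp add: m_lcomm)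
      also have "\<dots> = fr e ?b \<otimes> u \<oplus> fr e ?b \<otimes> i" unfolding u(3) using uc sc by (simp add: r_distr)
      also have "\<dots> = s \<oplus> (t \<oplus> fr e ?b \<otimes> i)" unfolding s(3) using sc by (simp add: a_assoc)
      finally have eq: "fr e f \<otimes> y = s \<oplus> (t \<oplus> fr e ?b \<otimes> i)" .
      have "t \<oplus> fr e ?b \<otimes> i \<in> P" using s(2) P.I_l_closed[OF u(2)] by simp
      then show ?thesis using clI[OF s(1) _ eq _ P.is_ideal] f \<alpha> by simp
    qed
    let ?F = "fr e f"
    have Fc: "?F \<in> carrier R" "?F \<notin> P" using f fr_prime[OF P f(1)] by auto
    \<comment> \<open>The factor \<open>fr e f\<close> is outside the prime P, so multiplying by it
      preserves independence and the count.\<close>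
    have ind: "\<forall>y\<in>G n. a y \<in> {\<zero>}" if a: "a \<in> G n \<rightarrow> k" "(\<Oplus>y\<in>G n. a y \<otimes> (?F \<otimes> y)) \<in> P" for a
    proof -
      have ac: "a y \<in> carrier R" if "y \<in> G n" for y using funcset_mem[OF a(1) that] by simp
      have yc: "y \<in> carrier R" if "y \<in> G n" for y using Gf(2) that by auto
      have "(\<Oplus>y\<in>G n. a y \<otimes> (?F \<otimes> y)) = (\<Oplus>y\<in>G n. ?F \<otimes> (a y \<otimes> y))"
        by (rule finsum_cong') (use ac yc Fc in \<open>auto simp: m_lcomm\<close>)
      also have "\<dots> = ?F \<otimes> (\<Oplus>y\<in>G n. a y \<otimes> y)"
        by (rule finsum_rdistr[symmetric]) (use ac yc Fc Gf in auto)
      finally have "?F \<otimes> (\<Oplus>y\<in>G n. a y \<otimes> y) \<in> P" using a(2) by simp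
      moreover have "(\<Oplus>y\<in>G n. a y \<otimes> y) \<in> carrier R" using ac yc by (auto intro!: finsum_closed)
      ultimately have "(\<Oplus>y\<in>G n. a y \<otimes> y) \<in> P" using P.I_prime Fc by blast
      then show ?thesis using G(2)[of n] a(1) unfolding K.indep_def by blast
    qed
    have "(\<lambda>y. ?F \<otimes> y) \<in> G n \<rightarrow> carrier R" using Gf(2)[of n] Fc by auto
    note I = K.card_indep_image[OF Gf(1) this ind]
    have "card ((\<lambda>y. ?F \<otimes> y) ` G n) \<le> card ?C"
      by (rule K.steinitz[OF I(1) Cf]) (use fMon G(1)[of n] in \<open>auto simp: subset_iff\<close>)
    also have "\<dots> \<le> card (G n' \<times> B)" by (rule card_image_le) (use Gf B in simp)
    finally show ?thesis using card_image[OF I(2)] by (simp add: g_def card_cartesian_product n'_def mult.commute)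
  qed
  let ?r = "card B"
  \<comment> \<open>The offset 2 * c + 2 is stable under a step: for q at least 2, dividing it by q
    leaves at most c + 1, the carry adds 1 and the recursion adds c.\<close>
  have iter: "g n \<le> ?r ^ j * g (n div q ^ j + (2 * c + 2))" for n j
  proof (induction j)
    case 0
    then show ?case using gmono[of n "n + (2*c+2)"] by simp
  next
    case (Suc j)
    let ?n = "n div q ^ j + (2 * c + 2)"
    have "?n div q \<le> n div q ^ j div q + (2 * c + 2) div q + 1"
    proof -
      have q0: "q > 0" using q2 by simp
      have "(n div q ^ j) mod q + (2 * c + 2) mod q < 2 * q" using q0
        by (metis add_less_mono mod_less_divisor mult_2)
      then have "((n div q ^ j) mod q + (2 * c + 2) mod q) div q \<le> 1"
        by (metis less_Suc_eq_le less_mult_imp_div_less numeral_2_eq_2 One_nat_def)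
      then show ?thesis using div_add1_eq[of "n div q ^ j" "2 * c + 2" q] by simp
    qed
    moreover have "(2 * c + 2) div q \<le> c + 1"
      using div_le_mono2[of 2 q "2 * c + 2"] q2 by simp
    moreover have "n div q ^ j div q = n div q ^ Suc j" by (simp add: div_mult2_eq[symmetric] mult.commute)
    ultimately have le: "?n div q + c \<le> n div q ^ Suc j + (2 * c + 2)" by simp
    have "g n \<le> ?r ^ j * g ?n" by (rule Suc)
    also have "\<dots> \<le> ?r ^ j * (?r * g (?n div q + c))" by (intro mult_le_mono2 rec)
    also have "\<dots> \<le> ?r ^ j * (?r * g (n div q ^ Suc j + (2 * c + 2)))" by (intro mult_le_mono2 gmono le)
    finally show ?case by (simp add: algebra_simps)
  qed
  obtain a where a: "\<And>N. \<exists>E. K.indep E \<and> E \<subseteq> V (a * N) \<and> card E = N ^ h" using chain_growth[OF P h] by blast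
  have "(q ^ h) ^ j \<le> g (a + (2 * c + 2)) * ?r ^ j" for j
  proof -
    obtain E where E: "K.indep E" "E \<subseteq> V (a * q ^ j)" "card E = (q ^ j) ^ h" using a by blast
    have "(q ^ h) ^ j = card E" using E(3) by (simp add: power_mult[symmetric] mult.commute)
    also have "\<dots> \<le> g (a * q ^ j)" by (rule gmax[OF E(1,2)])
    also have "\<dots> \<le> ?r ^ j * g (a * q ^ j div q ^ j + (2 * c + 2))" by (rule iter)
    finally show ?thesis using q2 by (simp add: mult.commute)
  qed
  then show ?thesis using nat_power_growth unfolding q_def by blast
qed

lemma pchain_less: "pchain I M n \<Longrightarrow> n' \<le> n \<Longrightarrow> pchain I M n'"
proof -
  assume a: "pchain I M n" "n' \<le> n"
  then obtain c where c: "\<forall>i\<le>n. primeideal (c i) R" "\<forall>i<n. c i \<subset> c (Suc i)" "I \<subseteq> c 0" "c n \<subseteq> M"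
    unfolding pchain_def by blast
  have "I \<subseteq> c (n - n')" using chain_increasing[OF c(2), of "n - n'"] c(3) by auto
  then show ?thesis unfolding pchain_def
    using a(2) c by (intro exI[of _ "\<lambda>i. c (n - n' + i)"]) auto
qed

lemma setadd_cdim:
  assumes m: "maximalideal m R" and I: "ideal I R"
  shows "\<exists>Z. spans (I <+>\<^bsub>R\<^esub> fp e m) Z \<and> card Z = lam e I m"
  unfolding lam_def by (rule cdim_spans[OF lam_spans[OF m I]])

text \<open>A basis of the fibre at m generates R modulo P over its q-th powers away from some s, so
  its size is subject to \<open>growth_bound\<close>.\<close>

lemma lam_lower:
  assumes m: "maximalideal m R" and P: "primeideal P R" "P \<subseteq> m" and h: "pchain P (carrier R) h" and e: "e > 0"
  shows "(p ^ e) ^ h \<le> lam e P m"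
proof -
  have Pi: "ideal P R" using P(1) primeideal.axioms(1) by blast
  obtain Z where Z: "spans (P <+>\<^bsub>R\<^esub> fp e m) Z" "card Z = lam e P m" using setadd_cdim[OF m Pi] by blast
  obtain s where s: "s \<in> carrier R - m" "\<forall>x\<in>carrier R. \<exists>u\<in>lspan R (frs e) Z. \<exists>i\<in>P. fr e s \<otimes> x = u \<oplus> i"
    using semicontinuity[OF m Pi Z(1)] by blast
  have "(p ^ e) ^ h \<le> card Z"
    by (rule growth_bound[OF P(1) _ _ _ _ _ e h, of Z s]) (use Z(1) s P(2) in \<open>auto simp: spans_def\<close>)
  then show ?thesis using Z(2) by simp
qed

text \<open>All of \<open>MonL 1\<close> generates over p-th powers, so p^h is at most p^(card
  S).\<close>

lemma pchain_bounded:
  assumes P: "primeideal P R" and h: "pchain P (carrier R) h" shows "h \<le> card S"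
proof -
  interpret P: primeideal P R by (rule P)
  have "(p ^ 1) ^ h \<le> card (MonL 1)"
  proof (rule growth_bound[OF P card_MonL(1) MonL_carrier, of \<one>])
    show "\<one> \<notin> P" using P.one_imp_carrier P.I_notcarr by blast
    show "\<exists>u\<in>lspan R (frs 1) (MonL 1). \<exists>i\<in>P. fr 1 \<one> \<otimes> x = u \<oplus> i" if "x \<in> carrier R" for x
      by (rule bexI[of _ x], rule bexI[of _ \<zero>]) (use that lspan_MonL in auto)
  qed (use h in auto)
  also have "\<dots> \<le> (p ^ 1) ^ card S" by (rule card_MonL)
  finally show ?thesis using p_gt_1 by simp
qed

text \<open>The localization of R modulo P at m has the full dimension. Otherwise
  \<open>lam_bound\<close> would give q * lam <= C * q^h, against lam >= q^h, as soon as q exceeds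
  C.\<close>

lemma local_chain:
  assumes m: "maximalideal m R" and P: "primeideal P R" "P \<subseteq> m" and h: "pchain P (carrier R) h"
  shows "pchain P m h"
proof (rule ccontr)
  assume n: "\<not> pchain P m h"
  have Pi: "ideal P R" using P(1) primeideal.axioms(1) by blast
  have "n < h" if "pchain P m n" for n
    using pchain_less[OF that, of h] n by (meson not_less)
  then obtain C where C: "\<And>e. p ^ e * lam e P m \<le> C * (p ^ e) ^ h" using lam_bound[OF m Pi] by blast
  \<comment> \<open>This exponent makes p^e larger than C.\<close>
  let ?e = "Suc C"
  have pos: "(p ^ ?e) ^ h > 0" using p_pos by simp
  have "p ^ ?e * (p ^ ?e) ^ h \<le> p ^ ?e * lam ?e P m" using lam_lower[OF m P h, of ?e] by (intro mult_le_mono2) simp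
  also have "\<dots> \<le> C * (p ^ ?e) ^ h" by (rule C)
  finally have "p ^ ?e \<le> C" using pos by (simp only: mult_le_cancel2 simp_thms)
  moreover have "2 ^ ?e \<le> p ^ ?e" using p_gt_1 by (intro power_mono) auto
  ultimately show False using less_exp[of ?e] by linarith
qed

text \<open>The tower law: q-th powers of vectors independent over q'-th powers, times vectors
  independent over q-th powers, are independent over qq'-th powers.\<close>

lemma fr_indep_mult:
  assumes P: "primeideal P R"
    and B: "lin_ctx.indep R (frs a) (fr a ` P) P B" and E: "lin_ctx.indep R (frs e) (fr e ` P) P E"
  shows "\<exists>F. lin_ctx.indep R (frs (a + e)) (fr (a + e) ` P) P F \<and> card F = card B * card E"
proof -
  interpret P: primeideal P R by (rule P)
  interpret KB: lin_ctx R "frs a" "fr a ` P" P by (rule fr_ctx_prime[OF P])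
  interpret KE: lin_ctx R "frs e" "fr e ` P" P by (rule fr_ctx_prime[OF P])
  interpret KF: lin_ctx R "frs (a + e)" "fr (a + e) ` P" P by (rule fr_ctx_prime[OF P])
  have Bf: "finite B" "B \<subseteq> carrier R" using B by (auto simp: KB.indep_def)
  have Ef: "finite E" "E \<subseteq> carrier R" using E by (auto simp: KE.indep_def)
  let ?b = "\<lambda>z. fr a (snd z) \<otimes> fst z"
  have ind: "\<forall>z\<in>B \<times> E. c z \<in> fr (a + e) ` P" if c: "c \<in> B \<times> E \<rightarrow> frs (a + e)" "(\<Oplus>z\<in>B \<times> E. c z \<otimes> ?b z) \<in> P" for c
  proof -
    have "\<forall>z\<in>B \<times> E. \<exists>w\<in>carrier R. c z = fr (a + e) w" using c(1) unfolding frs_def by blast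
    then obtain w where w: "\<And>z. z \<in> B \<times> E \<Longrightarrow> w z \<in> carrier R \<and> c z = fr (a + e) (w z)" by metis
    let ?t = "\<lambda>b. \<Oplus>y\<in>E. fr e (w (b, y)) \<otimes> y"
    have tc: "?t b \<in> carrier R" if "b \<in> B" for b using that w Ef by (auto intro!: finsum_closed)
    have cc: "c z \<in> carrier R" if "z \<in> B \<times> E" for z using w that by auto
    have "(\<Oplus>z\<in>B \<times> E. c z \<otimes> ?b z) = (\<Oplus>z\<in>B \<times> E. c (fst z, snd z) \<otimes> (fr a (snd z) \<otimes> fst z))" by simp
    also have "\<dots> = (\<Oplus>b\<in>B. \<Oplus>y\<in>E. c (b, y) \<otimes> (fr a y \<otimes> b))"
      by (rule finsum_Sigma[OF Bf(1)]) (use Bf Ef cc in \<open>simp_all add: subset_iff\<close>)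
    also have "\<dots> = (\<Oplus>b\<in>B. fr a (?t b) \<otimes> b)"
    proof (rule finsum_cong')
      fix b assume b: "b \<in> B"
      then have bc: "b \<in> carrier R" using Bf by auto
      have "fr a (?t b) = (\<Oplus>y\<in>E. fr a (fr e (w (b, y)) \<otimes> y))"
        by (rule fr_finsum) (use Ef w b in auto)
      moreover have "(\<Oplus>y\<in>E. fr a (fr e (w (b, y)) \<otimes> y)) \<otimes> b = (\<Oplus>y\<in>E. fr a (fr e (w (b, y)) \<otimes> y) \<otimes> b)"
        by (rule finsum_ldistr) (use Ef w b bc in auto)
      ultimately have "fr a (?t b) \<otimes> b = (\<Oplus>y\<in>E. fr a (fr e (w (b, y)) \<otimes> y) \<otimes> b)" by simp
      also have "\<dots> = (\<Oplus>y\<in>E. c (b, y) \<otimes> (fr a y \<otimes> b))"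
        by (rule finsum_cong') (use Ef w b bc in \<open>auto simp: fr_mult fr_fr m_assoc\<close>)
      finally show "(\<Oplus>y\<in>E. c (b, y) \<otimes> (fr a y \<otimes> b)) = fr a (?t b) \<otimes> b" by simp
    qed (use tc Bf in auto)
    finally have "(\<Oplus>b\<in>B. fr a (?t b) \<otimes> b) \<in> P" using c(2) by simp
    moreover have "(\<lambda>b. fr a (?t b)) \<in> B \<rightarrow> frs a" using tc frsI by auto
    ultimately have *: "\<forall>b\<in>B. fr a (?t b) \<in> fr a ` P" using KB.indepD[OF B] by blast
    have tP: "?t b \<in> P" if bB: "b \<in> B" for b
    proof -
      obtain z where "z \<in> P" "fr a (?t b) = fr a z" using *[rule_format, OF bB] by blast
      then have "fr a (?t b) \<in> P" using fr_prime[OF P, of z a] by simp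
      then show ?thesis using fr_prime[OF P tc[OF bB]] by simp
    qed
    have fwP: "fr e (w (b, y)) \<in> fr e ` P" if "b \<in> B" "y \<in> E" for b y
    proof -
      have "(\<lambda>y. fr e (w (b, y))) \<in> E \<rightarrow> frs e" using that w frsI by auto
      from KE.indepD[OF E this tP[OF that(1)] that(2)] show ?thesis .
    qed
    then have wP: "w (b, y) \<in> P" if bb: "b \<in> B" "y \<in> E" for b y
    proof -
      obtain z where "z \<in> P" "fr e (w (b, y)) = fr e z" using fwP[OF bb] by blast
      then have "fr e (w (b, y)) \<in> P" using fr_prime[OF P, of z e] by simp
      then show ?thesis using fr_prime[OF P, of "w (b, y)" e] w[of "(b, y)"] bb by simp
    qed
    show ?thesis using w wP by auto
  qed
  have "finite (B \<times> E)" "?b \<in> B \<times> E \<rightarrow> carrier R" using Bf Ef by (auto simp: subset_iff)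
  note I = KF.card_indep_image[OF this ind]
  show ?thesis using I(1) card_image[OF I(2)] by (intro exI[of _ "?b ` (B \<times> E)"]) (simp add: card_cartesian_product)
qed

text \<open>If r is the rank over p-th powers, the tower law gives r^e independent elements over
  p^e-th powers. Their number is at most the colength, hence at most C * (p^d)^e, and letting e grow
  removes C.\<close>

lemma frobenius_rank:
  assumes P: "primeideal P R" and d: "\<And>n. pchain P (carrier R) n \<Longrightarrow> n \<le> d"
  shows "\<exists>B f. finite B \<and> B \<subseteq> carrier R \<and> card B \<le> p ^ d \<and> f \<in> carrier R - P
    \<and> (\<forall>x\<in>carrier R. \<exists>u\<in>lspan R (frs 1) B. \<exists>i\<in>P. fr 1 f \<otimes> x = u \<oplus> i)"
proof -
  interpret P: primeideal P R by (rule P)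
  obtain m where m: "maximalideal m R" "P \<subseteq> m" using maximal_avoiding[OF P, of "{}"] by auto
  interpret K: lin_ctx R "frs 1" "fr 1 ` P" P by (rule fr_ctx_prime[OF P])
  obtain B where B: "B \<subseteq> MonL 1" "K.indep B" "MonL 1 \<subseteq> K.cl B" using K.basis_exists[OF card_MonL(1) MonL_carrier] by blast
  have Bf: "finite B" "B \<subseteq> carrier R" using B(2) unfolding K.indep_def by blast+
  obtain l where l: "l \<in> frs 1 - fr 1 ` P" "\<forall>g\<in>MonL 1. \<exists>s\<in>lspan R (frs 1) B. \<exists>t\<in>P. l \<otimes> g = s \<oplus> t"
    using K.cl_common[OF card_MonL(1) B(3) Bf(2)] by blast
  obtain f where f: "f \<in> carrier R" "l = fr 1 f" using l(1) unfolding frs_def by blast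
  have fP: "f \<notin> P" using l(1) f by blast
  have sp: "\<exists>u\<in>lspan R (frs 1) B. \<exists>i\<in>P. fr 1 f \<otimes> x = u \<oplus> i" if "x \<in> carrier R" for x
    using lspan_MonL[OF that, of 1]
  proof (induction x rule: lspan.induct)
    case lspan_zero
    show ?case by (rule bexI[of _ \<zero>], rule bexI[of _ \<zero>]) (use f in \<open>auto intro: lspan.lspan_zero\<close>)
  next
    case (lspan_step s a y)
    then obtain u i where u: "u \<in> lspan R (frs 1) B" "i \<in> P" "fr 1 f \<otimes> s = u \<oplus> i" by blast
    obtain v j where v: "v \<in> lspan R (frs 1) B" "j \<in> P" "fr 1 f \<otimes> y = v \<oplus> j" using l(2) lspan_step(3) f(2) by blast
    have c: "u \<in> carrier R" "v \<in> carrier R" "i \<in> carrier R" "j \<in> carrier R" "a \<in> carrier R" "s \<in> carrier R" "y \<in> carrier R"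
      using K.lspan_carrier[OF u(1) Bf(2)] K.lspan_carrier[OF v(1) Bf(2)] u v lspan_step(2,3) MonL_carrier[of 1]
        K.lspan_carrier[OF lspan_step(1) MonL_carrier] by auto
    have "fr 1 f \<otimes> (s \<oplus> a \<otimes> y) = fr 1 f \<otimes> s \<oplus> a \<otimes> (fr 1 f \<otimes> y)" using c f by (simp add: r_distr m_lcomm)
    also have "\<dots> = (u \<oplus> a \<otimes> v) \<oplus> (i \<oplus> a \<otimes> j)" unfolding u(3) v(3) using c by algebra
    finally have eq: "fr 1 f \<otimes> (s \<oplus> a \<otimes> y) = (u \<oplus> a \<otimes> v) \<oplus> (i \<oplus> a \<otimes> j)" .
    have "u \<oplus> a \<otimes> v \<in> lspan R (frs 1) B" using K.lspan_add[OF K.lspan_scal[OF v(1) Bf(2) lspan_step(2)] u(1) Bf(2)] .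
    moreover have "i \<oplus> a \<otimes> j \<in> P" using u(2) P.I_l_closed[OF v(2) c(5)] by simp
    ultimately show ?case using eq by blast
  qed
  have E: "\<exists>E. lin_ctx.indep R (frs e) (fr e ` P) P E \<and> card E = card B ^ e" for e
  proof (induction e)
    case 0
    interpret K0: lin_ctx R "frs 0" "fr 0 ` P" P by (rule fr_ctx_prime[OF P])
    have "K0.indep {\<one>}" unfolding K0.indep_def
    proof (intro conjI allI impI ballI)
      fix c y assume c: "c \<in> {\<one>} \<rightarrow> frs 0" "(\<Oplus>x\<in>{\<one>}. c x \<otimes> x) \<in> P" and y: "y \<in> {\<one>}"
      have "c \<one> \<in> carrier R" by (rule K0.LD, rule funcset_mem[OF c(1)]) simp
      then have "c \<one> \<in> P" using c(2) by (simp add: finsum_insert)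
      then show "c y \<in> fr 0 ` P" using y by (intro image_eqI[of _ _ "c \<one>"]) auto
    qed auto
    then show ?case by (intro exI[of _ "{\<one>}"]) auto
  next
    case (Suc e)
    then obtain E where E: "lin_ctx.indep R (frs e) (fr e ` P) P E" "card E = card B ^ e" by blast
    show ?case using fr_indep_mult[OF P B(2) E(1)] E(2) by simp
  qed
  have "n < Suc d" if "pchain P m n" for n
    using d[OF pchain_mono[OF that subset_refl]] maximalideal.axioms(1)[OF m(1)] idealD[of m] by fastforce
  then obtain C where C: "\<And>e. p ^ e * lam e P m \<le> C * (p ^ e) ^ Suc d" using lam_bound[OF m(1) P.is_ideal] by blast
  have "card B ^ e \<le> C * (p ^ d) ^ e" for e
  proof -
    interpret Ke: lin_ctx R "frs e" "fr e ` P" P by (rule fr_ctx_prime[OF P])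
    obtain F where F: "Ke.indep F" "card F = card B ^ e" using E by blast
    obtain Z where Z: "spans (P <+>\<^bsub>R\<^esub> fp e m) Z" "card Z = lam e P m" using setadd_cdim[OF m(1) P.is_ideal] by blast
    obtain s where s: "s \<in> carrier R - m" "\<forall>x\<in>carrier R. \<exists>u\<in>lspan R (frs e) Z. \<exists>i\<in>P. fr e s \<otimes> x = u \<oplus> i"
      using semicontinuity[OF m(1) P.is_ideal Z(1)] by blast
    have Zf: "finite Z" "Z \<subseteq> carrier R" using Z(1) by (auto simp: spans_def)
    have "fr e s \<notin> P" using fr_prime[OF P, of s e] s(1) m(2) by blast
    moreover have "fr e ` P \<subseteq> P"
    proof
      fix y assume "y \<in> fr e ` P"
      then obtain x where x: "x \<in> P" "y = fr e x" by blast
      show "y \<in> P" using fr_prime[OF P P.Icarr[OF x(1)], of e] x by simp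
    qed
    ultimately have fs: "fr e s \<in> frs e - fr e ` P" using frsI[of s e] s(1) by auto
    \<comment> \<open>By semicontinuity a spanning set of the fibre at m generates over q-th powers
      up to the denominator s, so the colength bounds the rank.\<close>
    have "carrier R \<subseteq> Ke.cl Z"
    proof
      fix x assume x: "x \<in> carrier R"
      from s(2)[rule_format, OF x] show "x \<in> Ke.cl Z" unfolding Ke.cl_def using fs x by blast
    qed
    moreover have "F \<subseteq> carrier R" using F(1) by (auto simp: Ke.indep_def)
    ultimately have "F \<subseteq> Ke.cl Z" by blast
    then have "card F \<le> card Z" using Ke.steinitz[OF F(1) Zf] by blast
    then have "p ^ e * card B ^ e \<le> p ^ e * lam e P m" using F(2) Z(2) by simp
    also have "\<dots> \<le> C * (p ^ e) ^ Suc d" by (rule C)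
    also have "\<dots> = p ^ e * (C * (p ^ d) ^ e)" by (simp add: power_mult[symmetric] mult.commute mult.left_commute)
    finally show ?thesis using p_pos by simp
  qed
  then have "card B \<le> p ^ d" by (rule nat_power_growth)
  then show ?thesis using Bf f fP sp by (intro exI[of _ B] exI[of _ f]) auto
qed

end

lemma (in abelian_monoid) finsum_swap:
  assumes "finite A" "finite B" "\<And>a b. a \<in> A \<Longrightarrow> b \<in> B \<Longrightarrow> f a b \<in> carrier G"
  shows "(\<Oplus>a\<in>A. \<Oplus>b\<in>B. f a b) = (\<Oplus>b\<in>B. \<Oplus>a\<in>A. f a b)"
  using assms(1,3)
proof (induction A rule: finite_induct)
  case empty
  then show ?case by simp
next
  case (insert a A)
  have c: "\<And>b. b \<in> B \<Longrightarrow> f a b \<in> carrier G" "\<And>a b. a \<in> A \<Longrightarrow> b \<in> B \<Longrightarrow> f a b \<in> carrier G"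
    using insert.prems by auto
  have "(\<Oplus>a\<in>insert a A. \<Oplus>b\<in>B. f a b) = (\<Oplus>b\<in>B. f a b) \<oplus> (\<Oplus>a\<in>A. \<Oplus>b\<in>B. f a b)"
    by (rule finsum_insert) (use insert.hyps c in \<open>auto intro!: finsum_closed\<close>)
  also have "(\<Oplus>a\<in>A. \<Oplus>b\<in>B. f a b) = (\<Oplus>b\<in>B. \<Oplus>a\<in>A. f a b)" using insert.IH c by simp
  also have "(\<Oplus>b\<in>B. f a b) \<oplus> (\<Oplus>b\<in>B. \<Oplus>a\<in>A. f a b) = (\<Oplus>b\<in>B. f a b \<oplus> (\<Oplus>a\<in>A. f a b))"
    by (rule finsum_addf[symmetric]) (use c in \<open>auto intro!: finsum_closed\<close>)
  also have "\<dots> = (\<Oplus>b\<in>B. \<Oplus>a\<in>insert a A. f a b)"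
  proof (rule finsum_cong')
    fix b assume "b \<in> B"
    then show "f a b \<oplus> (\<Oplus>a\<in>A. f a b) = (\<Oplus>a\<in>insert a A. f a b)"
      using insert.hyps c by (subst finsum_insert) auto
  qed (use insert.prems in \<open>auto intro!: finsum_closed\<close>)
  finally show ?case .
qed

context affine_alg
begin

section \<open>Minimal primes\<close>

abbreviation minp :: "'a set set" where "minp \<equiv> {P. minimal_prime R P}"

lemma minp_prime: "P \<in> minp \<Longrightarrow> primeideal P R" by (simp add: minimal_prime_def)

lemma minimal_primes:
  shows "finite minp" and "primeideal Q R \<Longrightarrow> \<exists>P\<in>minp. P \<subseteq> Q"
    and "\<exists>e. \<forall>x\<in>carrier R. (\<forall>P\<in>minp. x \<in> P) \<longrightarrow> fr e x = \<zero>"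
proof -
  from prime_cover[OF zeroideal] obtain \<P> n where fin: "finite \<P>"
    and pr: "\<forall>P\<in>\<P>. primeideal P R \<and> {\<zero>} \<subseteq> P"
    and cov: "\<forall>Q. primeideal Q R \<and> {\<zero>} \<subseteq> Q \<longrightarrow> (\<exists>P\<in>\<P>. P \<subseteq> Q)"
    and nil: "\<forall>x\<in>carrier R. (\<forall>P\<in>\<P>. x \<in> P) \<longrightarrow> x [^] (n::nat) \<in> {\<zero>}" by (elim exE conjE)
  have z: "{\<zero>} \<subseteq> Q" if "primeideal Q R" for Q using ideal_zero[OF primeideal.axioms(1)[OF that]] by simp
  have sub: "minp \<subseteq> \<P>"
  proof
    fix P assume P: "P \<in> minp"
    then obtain P' where "P' \<in> \<P>" "P' \<subseteq> P" using cov z minp_prime by blast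
    then show "P \<in> \<P>" using P pr unfolding minimal_prime_def by blast
  qed
  then show "finite minp" using fin finite_subset by blast
  have below: "\<exists>P\<in>minp. P \<subseteq> Q" if Q: "primeideal Q R" for Q
  proof -
    obtain P0 where P0: "P0 \<in> \<P>" "P0 \<subseteq> Q" using cov z[OF Q] Q by blast
    obtain P1 where P1: "P1 \<in> \<P>" "P1 \<subseteq> P0" "\<forall>b\<in>\<P>. b \<subseteq> P1 \<longrightarrow> P1 = b"
      using finite_has_minimal2[OF fin P0(1)] by blast
    have "minimal_prime R P1" unfolding minimal_prime_def
    proof (intro conjI allI impI)
      show "primeideal P1 R" using pr P1 by blast
      fix Q' assume Q': "primeideal Q' R \<and> Q' \<subseteq> P1"
      then obtain P' where "P' \<in> \<P>" "P' \<subseteq> Q'" using cov z by blast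
      then show "Q' = P1" using P1(3) Q' by blast
    qed
    then show ?thesis using P0 P1 by blast
  qed
  then show "primeideal Q R \<Longrightarrow> \<exists>P\<in>minp. P \<subseteq> Q" by blast
  show "\<exists>e. \<forall>x\<in>carrier R. (\<forall>P\<in>minp. x \<in> P) \<longrightarrow> fr e x = \<zero>"
  proof (intro exI[of _ n] ballI impI)
    fix x assume x: "x \<in> carrier R" "\<forall>P\<in>minp. x \<in> P"
    have "\<forall>P\<in>\<P>. x \<in> P" using x(2) below pr by blast
    then have "x [^] n = \<zero>" using nil x(1) by blast
    \<comment> \<open>The nilpotency exponent n can thus also be used as the number of Frobenius
      iterations.\<close>
    moreover have "n \<le> p ^ n"
    proof -
      have "2 ^ n \<le> p ^ n" using p_gt_1 by (intro power_mono) auto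
      then show ?thesis using less_exp[of n] by linarith
    qed
    then obtain r where "p ^ n = n + r" using le_Suc_ex by blast
    ultimately show "fr n x = \<zero>" using x(1) by (simp add: fr_def nat_pow_mult[symmetric])
  qed
qed

text \<open>Distinct minimal primes are incomparable, so each other one contains an element outside
  P; a product of such elements lies in all of them.\<close>

lemma minp_separate:
  assumes P: "P \<in> minp"
  shows "\<exists>u\<in>carrier R - P. \<forall>Q\<in>minp - {P}. u \<in> Q"
proof (rule prime_common[OF minp_prime[OF P]])
  show "finite (minp - {P})" using minimal_primes(1) by simp
  show "\<exists>s\<in>carrier R - P. s \<in> Q" if Q: "Q \<in> minp - {P}" for Q
  proof -
    have Qp: "primeideal Q R" using Q minp_prime by blast
    have "\<not> Q \<subseteq> P" using P Q Qp unfolding minimal_prime_def by blast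
    then show ?thesis using idealD[OF primeideal.axioms(1)[OF Qp]] by blast
  qed
  show "t \<otimes> s \<in> Q" if "Q \<in> minp - {P}" "t \<in> carrier R" "s \<in> Q" for s t Q
    using that ideal.I_l_closed[OF primeideal.axioms(1)[OF minp_prime]] by blast
qed

text \<open>Modulo Q every summand but the one at Q vanishes. Choices made separately at the minimal
  primes are thereby combined into a single element outside all of them.\<close>

lemma minp_glue:
  assumes u: "\<And>P. P \<in> minp \<Longrightarrow> u P \<in> carrier R - P \<and> (\<forall>Q\<in>minp - {P}. u P \<in> Q)"
    and h: "\<And>P. P \<in> minp \<Longrightarrow> h P \<in> carrier R - P" and Q: "Q \<in> minp"
  shows "(\<Oplus>P\<in>minp. u P \<otimes> h P) \<ominus> u Q \<otimes> h Q \<in> Q" "(\<Oplus>P\<in>minp. u P \<otimes> h P) \<notin> Q"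
proof -
  interpret Q: primeideal Q R by (rule minp_prime[OF Q])
  have c: "u P \<otimes> h P \<in> carrier R" if "P \<in> minp" for P using u[OF that] h[OF that] by auto
  have e: "minp = insert Q (minp - {Q})" using Q by blast
  have "(\<Oplus>P\<in>insert Q (minp - {Q}). u P \<otimes> h P) = u Q \<otimes> h Q \<oplus> (\<Oplus>P\<in>minp - {Q}. u P \<otimes> h P)"
    by (rule finsum_insert) (use minimal_primes(1) c Q in auto)
  then have s: "(\<Oplus>P\<in>minp. u P \<otimes> h P) = u Q \<otimes> h Q \<oplus> (\<Oplus>P\<in>minp - {Q}. u P \<otimes> h P)"
    by (simp only: e[symmetric])
  have r: "(\<Oplus>P\<in>minp - {Q}. u P \<otimes> h P) \<in> Q"
  proof (rule ideal_finsum[OF Q.is_ideal])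
    show "finite (minp - {Q})" using minimal_primes(1) by simp
    fix P assume P: "P \<in> minp - {Q}"
    then have "u P \<in> Q" using u[of P] Q by blast
    then show "u P \<otimes> h P \<in> Q" using h[of P] P Q.I_r_closed by blast
  qed
  have rc: "(\<Oplus>P\<in>minp - {Q}. u P \<otimes> h P) \<in> carrier R" using r by (rule Q.Icarr)
  have a: "x \<oplus> y \<ominus> x = y" "x \<oplus> y \<ominus> y = x" if "x \<in> carrier R" "y \<in> carrier R" for x y
    using that by algebra+
  show "(\<Oplus>P\<in>minp. u P \<otimes> h P) \<ominus> u Q \<otimes> h Q \<in> Q" unfolding s using a(1)[OF c[OF Q] rc] r by simp
  show "(\<Oplus>P\<in>minp. u P \<otimes> h P) \<notin> Q"
  proof
    assume "(\<Oplus>P\<in>minp. u P \<otimes> h P) \<in> Q"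
    from ideal_minus[OF Q.is_ideal this[unfolded s] r]
    have "u Q \<otimes> h Q \<in> Q" by (simp only: a(2)[OF c[OF Q] rc])
    then show False using Q.I_prime[of "u Q" "h Q"] u[OF Q] h[OF Q] by blast
  qed
qed

section \<open>Generic decomposition\<close>

text \<open>After a sufficiently high Frobenius power the nilradical is invisible, and over that power the
  ring is generically a direct sum of copies of the residue domains at the minimal primes.\<close>

lemma generic_basis:
  assumes P: "P \<in> minp" and e0: "\<forall>x\<in>carrier R. (\<forall>P\<in>minp. x \<in> P) \<longrightarrow> fr e0 x = \<zero>"
    and u: "u \<in> carrier R - P" "\<forall>Q\<in>minp - {P}. u \<in> Q"
  shows "\<exists>B w. finite B \<and> B \<subseteq> carrier R \<and> w \<in> carrier R - P \<and>
     (\<forall>a. a \<in> B \<rightarrow> carrier R \<longrightarrow> (\<Oplus>b\<in>B. fr e0 (a b) \<otimes> b) = \<zero> \<longrightarrow> (\<forall>b\<in>B. a b \<in> P)) \<and>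
     (\<forall>x\<in>carrier R. fr e0 w \<otimes> x \<in> lspan R (frs e0) B)"
proof -
  have Pp: "primeideal P R" by (rule minp_prime[OF P])
  interpret P: primeideal P R by (rule Pp)
  \<comment> \<open>The kernel of localization at P.\<close>
  define T where "T = {x \<in> carrier R. \<exists>v\<in>carrier R - P. v \<otimes> x = \<zero>}"
  have multP: "v \<otimes> v' \<in> carrier R - P" if "v \<in> carrier R - P" "v' \<in> carrier R - P" for v v'
    using that P.I_prime[of v v'] by auto
  have Ti: "ideal T R"
  proof (rule ideal_setI)
    show "T \<subseteq> carrier R" by (auto simp: T_def)
    have "\<one> \<in> carrier R - P" using P.one_imp_carrier P.I_notcarr by auto
    then show "\<zero> \<in> T" unfolding T_def by auto
  next
    fix x y assume "x \<in> T" "y \<in> T"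
    then obtain v v' where v: "x \<in> carrier R" "y \<in> carrier R" "v \<in> carrier R - P" "v' \<in> carrier R - P" "v \<otimes> x = \<zero>" "v' \<otimes> y = \<zero>"
      unfolding T_def by blast
    have vc: "v \<in> carrier R" "v' \<in> carrier R" using v by auto
    have "(v \<otimes> v') \<otimes> (x \<oplus> y) = v' \<otimes> (v \<otimes> x) \<oplus> v \<otimes> (v' \<otimes> y)" using vc v(1,2) by algebra
    then have "(v \<otimes> v') \<otimes> (x \<oplus> y) = \<zero>" using v(5,6) vc by simp
    then show "x \<oplus> y \<in> T" unfolding T_def using multP[OF v(3,4)] v(1,2) by auto
  next
    fix x r assume "x \<in> T" "r \<in> carrier R"
    then obtain v where v: "x \<in> carrier R" "v \<in> carrier R - P" "v \<otimes> x = \<zero>" unfolding T_def by blast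
    have "v \<otimes> (r \<otimes> x) = r \<otimes> (v \<otimes> x)" using v \<open>r \<in> carrier R\<close> by (simp add: m_lcomm)
    then have "v \<otimes> (r \<otimes> x) = \<zero>" using v(3) \<open>r \<in> carrier R\<close> by simp
    then show "r \<otimes> x \<in> T" unfolding T_def using v \<open>r \<in> carrier R\<close> by auto
  qed
  have ctx: "lin_ctx R (frs e0) (fr e0 ` P) T"
  proof (rule fr_ctx[OF Pp Ti])
    fix a assume a: "a \<in> P"
    then have ac: "a \<in> carrier R" by simp
    \<comment> \<open>The factor u carries a into every minimal prime, so \<open>fr e0\<close> kills
      the product. Hence the Frobenius power of P vanishes in the localization, and R becomes a
      module over powers of the domain R modulo P.\<close>
    have "u \<otimes> a \<in> Q" if "Q \<in> minp" for Q
    proof (cases "Q = P")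
      case True
      then show ?thesis using P.I_l_closed[OF a] u by auto
    next
      case False
      then show ?thesis using that u(2) ac ideal.I_r_closed[OF primeideal.axioms(1)[OF minp_prime[OF that]]] by blast
    qed
    then have "fr e0 (u \<otimes> a) = \<zero>" using e0 u ac by blast
    then have "fr e0 u \<otimes> fr e0 a = \<zero>" using fr_mult u ac by simp
    moreover have "fr e0 u \<in> carrier R - P" using fr_prime[OF Pp, of u e0] u by auto
    ultimately show "fr e0 a \<in> T" unfolding T_def using ac by blast
  next
    fix v x assume v: "v \<in> carrier R" "v \<notin> P" "x \<in> carrier R" "v \<otimes> x \<in> T"
    then obtain v' where v': "v' \<in> carrier R - P" "v' \<otimes> (v \<otimes> x) = \<zero>" unfolding T_def by blast
    then have "(v' \<otimes> v) \<otimes> x = \<zero>" using v by (simp add: m_assoc)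
    moreover have "v' \<otimes> v \<in> carrier R - P" using multP v v' by blast
    ultimately show "x \<in> T" unfolding T_def using v(3) by blast
  qed
  interpret K: lin_ctx R "frs e0" "fr e0 ` P" T by (rule ctx)
  obtain B where B: "B \<subseteq> MonL e0" "K.indep B" "MonL e0 \<subseteq> K.cl B" using K.basis_exists[OF card_MonL(1) MonL_carrier] by blast
  have Bf: "finite B" "B \<subseteq> carrier R" using B(2) unfolding K.indep_def by blast+
  obtain l where l: "l \<in> frs e0 - fr e0 ` P" "\<forall>g\<in>MonL e0. \<exists>s\<in>lspan R (frs e0) B. \<exists>t\<in>T. l \<otimes> g = s \<oplus> t"
    using K.cl_common[OF card_MonL(1) B(3) Bf(2)] by blast
  obtain g where g: "g \<in> carrier R" "l = fr e0 g" using l(1) unfolding frs_def by blast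
  have gP: "g \<in> carrier R - P" using l(1) g by blast
  have "\<exists>w\<in>carrier R - P. \<forall>y\<in>MonL e0. fr e0 w \<otimes> y \<in> lspan R (frs e0) B"
  proof (rule prime_common[OF Pp card_MonL(1)])
    fix y assume y: "y \<in> MonL e0"
    then have yc: "y \<in> carrier R" using MonL_carrier by auto
    obtain s t where s: "s \<in> lspan R (frs e0) B" "t \<in> T" "l \<otimes> y = s \<oplus> t" using l(2) y by blast
    obtain v where v: "v \<in> carrier R - P" "v \<otimes> t = \<zero>" using s(2) unfolding T_def by blast
    have c: "s \<in> carrier R" "t \<in> carrier R" using K.lspan_carrier[OF s(1) Bf(2)] s(2) by auto
    \<comment> \<open>The torsion part t is killed by v, hence by its q0-th power, which may be put
      into the denominator w.\<close>
    obtain r where "p ^ e0 = Suc r" using p_pos by (metis gr0_implies_Suc zero_less_power)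
    then have "fr e0 v = v [^] r \<otimes> v" by (simp add: fr_def)
    then have "fr e0 v \<otimes> t = v [^] r \<otimes> (v \<otimes> t)" using v(1) c by (simp add: m_assoc)
    then have vt: "fr e0 v \<otimes> t = \<zero>" using v by simp
    have "fr e0 (v \<otimes> g) \<otimes> y = fr e0 v \<otimes> (l \<otimes> y)" using v(1) g yc by (simp add: fr_mult m_assoc)
    also have "\<dots> = fr e0 v \<otimes> s" unfolding s(3) using c v(1) vt by (simp add: r_distr)
    finally have "fr e0 (v \<otimes> g) \<otimes> y \<in> lspan R (frs e0) B"
      using K.lspan_scal[OF s(1) Bf(2)] frsI v(1) by auto
    then show "\<exists>w\<in>carrier R - P. fr e0 w \<otimes> y \<in> lspan R (frs e0) B" using multP[OF v(1) gP] by blast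
  next
    fix s t y assume a: "y \<in> MonL e0" "s \<in> carrier R" "t \<in> carrier R" "fr e0 s \<otimes> y \<in> lspan R (frs e0) B"
    have "fr e0 (t \<otimes> s) \<otimes> y = fr e0 t \<otimes> (fr e0 s \<otimes> y)" using a subsetD[OF MonL_carrier a(1)] by (simp add: fr_mult m_assoc)
    then show "fr e0 (t \<otimes> s) \<otimes> y \<in> lspan R (frs e0) B" using K.lspan_scal[OF a(4) Bf(2) frsI[OF a(3)]] by simp
  qed
  then obtain w where w: "w \<in> carrier R - P" "\<And>y. y \<in> MonL e0 \<Longrightarrow> fr e0 w \<otimes> y \<in> lspan R (frs e0) B" by blast
  have sp: "fr e0 w \<otimes> x \<in> lspan R (frs e0) B" if "x \<in> carrier R" for x
    using lspan_MonL[OF that, of e0]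
  proof (induction x rule: lspan.induct)
    case lspan_zero
    then show ?case using w(1) by (simp add: lspan.lspan_zero)
  next
    case (lspan_step s a y)
    have c: "s \<in> carrier R" "y \<in> carrier R" "a \<in> carrier R"
      using K.lspan_carrier[OF lspan_step(1) MonL_carrier] lspan_step(2,3) MonL_carrier by auto
    have "fr e0 w \<otimes> (s \<oplus> a \<otimes> y) = fr e0 w \<otimes> s \<oplus> a \<otimes> (fr e0 w \<otimes> y)" using c w(1) by (simp add: r_distr m_lcomm)
    then show ?case
      using K.lspan_add[OF K.lspan_scal[OF w(2)[OF lspan_step(3)] Bf(2) lspan_step(2)] lspan_step(4) Bf(2)] by simp
  qed
  have ind: "\<forall>b\<in>B. a b \<in> P" if a: "a \<in> B \<rightarrow> carrier R" "(\<Oplus>b\<in>B. fr e0 (a b) \<otimes> b) = \<zero>" for a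
  proof
    fix b assume b: "b \<in> B"
    have ac: "a b \<in> carrier R" using funcset_mem[OF a(1) b] .
    have "fr e0 (a b) \<in> fr e0 ` P"
      by (rule K.indepD[OF B(2) _ _ b, of "\<lambda>b. fr e0 (a b)"]) (use a frsI in auto)
    then obtain z where z: "z \<in> P" "fr e0 (a b) = fr e0 z" by blast
    have "fr e0 (a b) \<in> P" using fr_prime[OF Pp P.Icarr[OF z(1)], of e0] z by simp
    then show "a b \<in> P" using fr_prime[OF Pp ac] by simp
  qed
  show ?thesis by (rule exI[of _ B], rule exI[of _ w]) (use Bf w(1) ind sp in blast)
qed

text \<open>With q0 = p^e0: after inverting the q0-th power of f, R is a direct sum of copies of the
  residue domains at minimal primes, as a module over q0-th powers. The conditions say that
  coefficients are unique modulo \<open>Pf i\<close>, that \<open>Pf i\<close> acts as zero on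
  \<open>b i\<close>, and that the family generates.\<close>

definition gdecomp :: "nat \<Rightarrow> 'i set \<Rightarrow> ('i \<Rightarrow> 'a) \<Rightarrow> ('i \<Rightarrow> 'a set) \<Rightarrow> 'a \<Rightarrow> bool" where
  "gdecomp e0 I b Pf f \<longleftrightarrow> finite I \<and> b \<in> I \<rightarrow> carrier R \<and> Pf \<in> I \<rightarrow> minp \<and> f \<in> carrier R \<and> (\<forall>P\<in>minp. f \<notin> P) \<and>
    (\<forall>a. a \<in> I \<rightarrow> carrier R \<longrightarrow> (\<Oplus>i\<in>I. fr e0 (a i) \<otimes> b i) = \<zero> \<longrightarrow> (\<forall>i\<in>I. a i \<in> Pf i)) \<and>
    (\<forall>i\<in>I. \<forall>a\<in>Pf i. fr e0 a \<otimes> b i = \<zero>) \<and>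
    (\<forall>x\<in>carrier R. \<exists>a. a \<in> I \<rightarrow> carrier R \<and> fr e0 f \<otimes> x = (\<Oplus>i\<in>I. fr e0 (a i) \<otimes> b i))"

text \<open>The basis found at P is multiplied by the q0-th power of \<open>u P\<close>, which
  vanishes on the other components, so the blocks for different P do not interact. The denominators
  \<open>w P\<close> are glued into one f by the same elements.\<close>

lemma gdecomp_exists: "\<exists>e0 (I :: ('a set \<times> 'a) set) b Pf f. gdecomp e0 I b Pf f"
proof -
  obtain e0 where e0: "\<forall>x\<in>carrier R. (\<forall>P\<in>minp. x \<in> P) \<longrightarrow> fr e0 x = \<zero>" using minimal_primes(3) by blast
  have "\<forall>P\<in>minp. \<exists>u. u \<in> carrier R - P \<and> (\<forall>Q\<in>minp - {P}. u \<in> Q)"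
    by (intro ballI minp_separate[unfolded Bex_def])
  from bchoice[OF this] obtain u where u0: "\<forall>P\<in>minp. u P \<in> carrier R - P \<and> (\<forall>Q\<in>minp - {P}. u P \<in> Q)" by (elim exE)
  note u = bspec[OF u0]
  have "\<forall>P\<in>minp. \<exists>Bw. finite (fst Bw) \<and> fst Bw \<subseteq> carrier R \<and> snd Bw \<in> carrier R - P \<and>
     (\<forall>a. a \<in> fst Bw \<rightarrow> carrier R \<longrightarrow> (\<Oplus>b\<in>fst Bw. fr e0 (a b) \<otimes> b) = \<zero> \<longrightarrow> (\<forall>b\<in>fst Bw. a b \<in> P)) \<and>
     (\<forall>x\<in>carrier R. fr e0 (snd Bw) \<otimes> x \<in> lspan R (frs e0) (fst Bw))"
  proof
    fix P assume P: "P \<in> minp"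
    from generic_basis[OF P e0 conjunct1[OF u[OF P]] conjunct2[OF u[OF P]]] obtain B w where "finite B \<and> B \<subseteq> carrier R \<and> w \<in> carrier R - P \<and>
     (\<forall>a. a \<in> B \<rightarrow> carrier R \<longrightarrow> (\<Oplus>b\<in>B. fr e0 (a b) \<otimes> b) = \<zero> \<longrightarrow> (\<forall>b\<in>B. a b \<in> P)) \<and>
     (\<forall>x\<in>carrier R. fr e0 w \<otimes> x \<in> lspan R (frs e0) B)" by (elim exE)
    then show "\<exists>Bw. finite (fst Bw) \<and> fst Bw \<subseteq> carrier R \<and> snd Bw \<in> carrier R - P \<and>
     (\<forall>a. a \<in> fst Bw \<rightarrow> carrier R \<longrightarrow> (\<Oplus>b\<in>fst Bw. fr e0 (a b) \<otimes> b) = \<zero> \<longrightarrow> (\<forall>b\<in>fst Bw. a b \<in> P)) \<and>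
     (\<forall>x\<in>carrier R. fr e0 (snd Bw) \<otimes> x \<in> lspan R (frs e0) (fst Bw))"
      by (intro exI[of _ "(B, w)"]) simp
  qed
  from bchoice[OF this] obtain Bw where Bw: "\<forall>P\<in>minp. finite (fst (Bw P)) \<and> fst (Bw P) \<subseteq> carrier R \<and> snd (Bw P) \<in> carrier R - P \<and>
     (\<forall>a. a \<in> fst (Bw P) \<rightarrow> carrier R \<longrightarrow> (\<Oplus>b\<in>fst (Bw P). fr e0 (a b) \<otimes> b) = \<zero> \<longrightarrow> (\<forall>b\<in>fst (Bw P). a b \<in> P)) \<and>
     (\<forall>x\<in>carrier R. fr e0 (snd (Bw P)) \<otimes> x \<in> lspan R (frs e0) (fst (Bw P)))" by (elim exE)
  define B where "B P = fst (Bw P)" for P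
  define w where "w P = snd (Bw P)" for P
  have B: "finite (B P)" "B P \<subseteq> carrier R" "w P \<in> carrier R - P" if "P \<in> minp" for P
    using bspec[OF Bw that] unfolding B_def w_def by simp_all
  have Bind: "\<forall>b\<in>B P. a b \<in> P" if "P \<in> minp" "a \<in> B P \<rightarrow> carrier R" "(\<Oplus>b\<in>B P. fr e0 (a b) \<otimes> b) = \<zero>" for P a
    using bspec[OF Bw that(1)] that(2,3) unfolding B_def w_def by simp
  have Bsp: "fr e0 (w P) \<otimes> x \<in> lspan R (frs e0) (B P)" if "P \<in> minp" "x \<in> carrier R" for P x
    using bspec[OF Bw that(1)] that(2) unfolding B_def w_def by simp
  interpret F: scalars R "frs e0" by (rule frs_scalars)
  let ?I = "Sigma minp B" and ?b = "\<lambda>z. fr e0 (u (fst z)) \<otimes> snd z"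
  let ?f = "\<Oplus>P\<in>minp. u P \<otimes> w P"
  have uc: "u P \<in> carrier R" if "P \<in> minp" for P using u[OF that] by auto
  have Bc: "b \<in> carrier R" if "P \<in> minp" "b \<in> B P" for P b using B(2)[OF that(1)] that(2) by auto
  have kill: "fr e0 (u P) \<otimes> fr e0 a = \<zero>" if "P \<in> minp" "a \<in> P" for P a
  proof -
    have ac: "a \<in> carrier R" using that idealD[OF primeideal.axioms(1)[OF minp_prime]] by blast
    have "u P \<otimes> a \<in> Q" if Q: "Q \<in> minp" for Q
    proof -
      interpret Q: primeideal Q R by (rule minp_prime[OF Q])
      show ?thesis
      proof (cases "Q = P")
        case True
        then show ?thesis using Q.I_l_closed[of a "u P"] \<open>a \<in> P\<close> uc[OF Q] by simp
      next
        case False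
        then show ?thesis using Q.I_r_closed[of "u P" a] u[OF \<open>P \<in> minp\<close>] Q ac by blast
      qed
    qed
    then have "fr e0 (u P \<otimes> a) = \<zero>" using e0 uc[OF that(1)] ac by simp
    then show ?thesis using uc[OF that(1)] ac by (simp add: fr_mult)
  qed
  have "gdecomp e0 ?I ?b fst ?f" unfolding gdecomp_def
  proof (intro conjI allI impI ballI)
    show "finite ?I" using minimal_primes(1) B(1) by blast
    show "?b \<in> ?I \<rightarrow> carrier R" using uc Bc by auto
    show "fst \<in> ?I \<rightarrow> minp" by auto
    show "?f \<in> carrier R" using uc B(3) by (auto intro!: finsum_closed)
    show "?f \<notin> P" if "P \<in> minp" for P using minp_glue(2)[OF u B(3) that] .
  next
    fix a z assume a: "a \<in> ?I \<rightarrow> carrier R" "(\<Oplus>i\<in>?I. fr e0 (a i) \<otimes> ?b i) = \<zero>" and z: "z \<in> ?I"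
    obtain Q \<beta> where Q: "z = (Q, \<beta>)" "Q \<in> minp" "\<beta> \<in> B Q" using z by blast
    interpret Q: primeideal Q R by (rule minp_prime[OF Q(2)])
    have ac: "a (P, b) \<in> carrier R" if "P \<in> minp" "b \<in> B P" for P b using a(1) that by auto
    let ?g = "\<lambda>P b. fr e0 (a (P, b)) \<otimes> (fr e0 (u P) \<otimes> b)"
    have gc: "?g P b \<in> carrier R" if "P \<in> minp" "b \<in> B P" for P b using ac uc Bc that by simp
    have "(\<Oplus>i\<in>?I. fr e0 (a i) \<otimes> ?b i) = (\<Oplus>i\<in>?I. ?g (fst i) (snd i))" by simp
    also have "\<dots> = (\<Oplus>P\<in>minp. \<Oplus>b\<in>B P. ?g P b)"
      by (rule finsum_Sigma) (use minimal_primes(1) B(1) gc in auto)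
    finally have z1: "(\<Oplus>P\<in>minp. \<Oplus>b\<in>B P. ?g P b) = \<zero>" unfolding a(2) by (rule sym)
    \<comment> \<open>Multiplying the relation by the q0-th power of \<open>u Q\<close> isolates
      block Q: \<open>u P * u Q\<close> lies in every minimal prime when P differs from Q.\<close>
    have "fr e0 (u Q) \<otimes> (\<Oplus>P\<in>minp. \<Oplus>b\<in>B P. ?g P b) = \<zero>" unfolding z1 using uc[OF Q(2)] by simp
    moreover have "fr e0 (u Q) \<otimes> (\<Oplus>P\<in>minp. \<Oplus>b\<in>B P. ?g P b) = (\<Oplus>P\<in>minp. fr e0 (u Q) \<otimes> (\<Oplus>b\<in>B P. ?g P b))"
      by (rule finsum_rdistr) (use minimal_primes(1) gc uc Q in \<open>auto intro!: finsum_closed\<close>)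
    moreover have "(\<Oplus>P\<in>minp. fr e0 (u Q) \<otimes> (\<Oplus>b\<in>B P. ?g P b))
        = (\<Oplus>P\<in>minp. if Q = P then fr e0 (u Q) \<otimes> (\<Oplus>b\<in>B P. ?g P b) else \<zero>)"
    proof (rule finsum_cong')
      fix P assume P: "P \<in> minp"
      show "fr e0 (u Q) \<otimes> (\<Oplus>b\<in>B P. ?g P b) = (if Q = P then fr e0 (u Q) \<otimes> (\<Oplus>b\<in>B P. ?g P b) else \<zero>)"
      proof (cases "Q = P")
        case False
        have uQ: "u Q \<in> P" using u[OF Q(2)] P False by blast
        have "fr e0 (u Q) \<otimes> (\<Oplus>b\<in>B P. ?g P b) = (\<Oplus>b\<in>B P. fr e0 (u Q) \<otimes> ?g P b)"
          by (rule finsum_rdistr) (use B(1)[OF P] gc[OF P] uc[OF Q(2)] in auto)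
        also have "\<dots> = (\<Oplus>b\<in>B P. \<zero>)"
        proof (rule finsum_cong')
          fix b assume b: "b \<in> B P"
          have "fr e0 (u Q) \<otimes> ?g P b = fr e0 (a (P, b)) \<otimes> ((fr e0 (u P) \<otimes> fr e0 (u Q)) \<otimes> b)"
            using ac[OF P b] uc[OF P] uc[OF Q(2)] Bc[OF P b] by (simp add: m_ac)
          then show "fr e0 (u Q) \<otimes> ?g P b = \<zero>" using kill[OF P uQ] ac[OF P b] Bc[OF P b] by simp
        qed auto
        finally show ?thesis using False by simp
      qed simp
    qed (use gc uc Q in \<open>auto intro!: finsum_closed\<close>)
    moreover have "\<dots> = fr e0 (u Q) \<otimes> (\<Oplus>b\<in>B Q. ?g Q b)"
      by (rule add.finprod_singleton) (use Q(2) minimal_primes(1) gc uc in \<open>auto intro!: finsum_closed\<close>)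
    ultimately have z0: "fr e0 (u Q) \<otimes> (\<Oplus>b\<in>B Q. ?g Q b) = \<zero>" by simp
    have "fr e0 (u Q) \<otimes> (\<Oplus>b\<in>B Q. ?g Q b) = (\<Oplus>b\<in>B Q. fr e0 (u Q) \<otimes> ?g Q b)"
      by (rule finsum_rdistr) (use B(1)[OF Q(2)] gc[OF Q(2)] uc[OF Q(2)] in auto)
    \<comment> \<open>Both factors \<open>u Q\<close>, from the multiplier and from the basis, go
      into the coefficient. They are outside Q and are cancelled after independence has been
      applied.\<close>
    also have "\<dots> = (\<Oplus>b\<in>B Q. fr e0 (a (Q, b) \<otimes> (u Q \<otimes> u Q)) \<otimes> b)"
      by (rule finsum_cong') (use ac[OF Q(2)] uc[OF Q(2)] Bc[OF Q(2)] in \<open>auto simp: fr_mult m_ac\<close>)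
    finally have "(\<Oplus>b\<in>B Q. fr e0 (a (Q, b) \<otimes> (u Q \<otimes> u Q)) \<otimes> b) = \<zero>" using z0 by simp
    then have "\<forall>b\<in>B Q. a (Q, b) \<otimes> (u Q \<otimes> u Q) \<in> Q"
      by (intro Bind[OF Q(2)]) (use ac[OF Q(2)] uc[OF Q(2)] in auto)
    then have m: "a (Q, \<beta>) \<otimes> (u Q \<otimes> u Q) \<in> Q" using Q(3) by blast
    have "u Q \<otimes> u Q \<notin> Q" using Q.I_prime[of "u Q" "u Q"] u[OF Q(2)] by blast
    then have "a (Q, \<beta>) \<in> Q" using Q.I_prime[OF ac[OF Q(2,3)] _ m] uc[OF Q(2)] by blast
    then show "a z \<in> fst z" using Q(1) by simp
  next
    fix z a assume z: "z \<in> ?I" "a \<in> fst z"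
    have P: "fst z \<in> minp" "snd z \<in> B (fst z)" using z by auto
    have ac: "a \<in> carrier R" using z(2) P idealD[OF primeideal.axioms(1)[OF minp_prime]] by blast
    have "fr e0 a \<otimes> ?b z = (fr e0 (u (fst z)) \<otimes> fr e0 a) \<otimes> snd z"
      using ac uc[OF P(1)] Bc[OF P] by (simp add: m_ac)
    then show "fr e0 a \<otimes> ?b z = \<zero>" using kill[OF P(1) z(2)] Bc[OF P] by simp
  next
    fix x assume x: "x \<in> carrier R"
    have "\<forall>P\<in>minp. \<exists>a. a \<in> B P \<rightarrow> carrier R \<and> fr e0 (w P) \<otimes> x = (\<Oplus>b\<in>B P. fr e0 (a b) \<otimes> b)"
    proof
      fix P assume P: "P \<in> minp"
      obtain c where c: "c \<in> B P \<rightarrow> frs e0" "fr e0 (w P) \<otimes> x = (\<Oplus>b\<in>B P. c b \<otimes> b)"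
        using F.lspan_repr[OF B(1,2)[OF P] Bsp[OF P x]] by blast
      then have "\<forall>b\<in>B P. \<exists>a. a \<in> carrier R \<and> c b = fr e0 a" unfolding frs_def by blast
      from bchoice[OF this] obtain a where a: "\<forall>b\<in>B P. a b \<in> carrier R \<and> c b = fr e0 (a b)" by (elim exE)
      have "(\<Oplus>b\<in>B P. c b \<otimes> b) = (\<Oplus>b\<in>B P. fr e0 (a b) \<otimes> b)"
        by (rule finsum_cong') (use a Bc[OF P] in auto)
      then show "\<exists>a. a \<in> B P \<rightarrow> carrier R \<and> fr e0 (w P) \<otimes> x = (\<Oplus>b\<in>B P. fr e0 (a b) \<otimes> b)"
        using a c by (intro exI[of _ a]) auto
    qed
    from bchoice[OF this] obtain a where a: "\<forall>P\<in>minp. a P \<in> B P \<rightarrow> carrier R \<and> fr e0 (w P) \<otimes> x = (\<Oplus>b\<in>B P. fr e0 (a P b) \<otimes> b)"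
      by (elim exE)
    have ac: "a P b \<in> carrier R" if "P \<in> minp" "b \<in> B P" for P b
      using funcset_mem[OF conjunct1[OF bspec[OF a that(1)]] that(2)] .
    let ?g = "\<lambda>P b. fr e0 (a P b) \<otimes> (fr e0 (u P) \<otimes> b)"
    have "fr e0 ?f \<otimes> x = (\<Oplus>P\<in>minp. fr e0 (u P \<otimes> w P)) \<otimes> x"
      by (subst fr_finsum) (use minimal_primes(1) uc B(3) in auto)
    also have "\<dots> = (\<Oplus>P\<in>minp. fr e0 (u P \<otimes> w P) \<otimes> x)"
      by (rule finsum_ldistr) (use minimal_primes(1) uc B(3) x in auto)
    also have "\<dots> = (\<Oplus>P\<in>minp. \<Oplus>b\<in>B P. ?g P b)"
    proof (rule finsum_cong')
      fix P assume P: "P \<in> minp"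
      have wc: "w P \<in> carrier R" using B(3)[OF P] by auto
      have "fr e0 (u P \<otimes> w P) \<otimes> x = fr e0 (u P) \<otimes> (fr e0 (w P) \<otimes> x)" using uc[OF P] wc x by (simp add: fr_mult m_assoc)
      also have "\<dots> = fr e0 (u P) \<otimes> (\<Oplus>b\<in>B P. fr e0 (a P b) \<otimes> b)" using bspec[OF a P] by simp
      also have "\<dots> = (\<Oplus>b\<in>B P. fr e0 (u P) \<otimes> (fr e0 (a P b) \<otimes> b))"
        by (rule finsum_rdistr) (use B(1)[OF P] uc[OF P] ac[OF P] Bc[OF P] in auto)
      also have "\<dots> = (\<Oplus>b\<in>B P. ?g P b)"
        by (rule finsum_cong') (use uc[OF P] ac[OF P] Bc[OF P] in \<open>auto simp: m_lcomm\<close>)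
      finally show "fr e0 (u P \<otimes> w P) \<otimes> x = (\<Oplus>b\<in>B P. ?g P b)" .
    qed (use uc ac Bc in \<open>auto intro!: finsum_closed\<close>)
    also have "\<dots> = (\<Oplus>i\<in>?I. ?g (fst i) (snd i))"
      by (rule finsum_Sigma[symmetric]) (use minimal_primes(1) B(1) uc ac Bc in auto)
    finally have "fr e0 ?f \<otimes> x = (\<Oplus>i\<in>?I. fr e0 (a (fst i) (snd i)) \<otimes> ?b i)" .
    then show "\<exists>a. a \<in> ?I \<rightarrow> carrier R \<and> fr e0 ?f \<otimes> x = (\<Oplus>i\<in>?I. fr e0 (a i) \<otimes> ?b i)"
      using ac by (intro exI[of _ "\<lambda>i. a (fst i) (snd i)"]) auto
  qed
  then show ?thesis by blast
qed

end

context affine_alg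
begin

section \<open>Existence of the Hilbert--Kunz limit\<close>

text \<open>R modulo J is an extension of R modulo J + aR by the image of multiplication by a, which
  Y spans.\<close>

lemma spans_image:
  assumes J: "ideal J R" and a: "a \<in> carrier R" and Y: "finite Y" "Y \<subseteq> carrier R"
    and aY: "\<And>x. x \<in> carrier R \<Longrightarrow> \<exists>s\<in>lspan R k Y. \<exists>j\<in>J. a \<otimes> x = s \<oplus> j"
    and Z: "spans (idl_ins R J a) Z"
  shows "spans J (Z \<union> Y)"
  unfolding spans_def
proof (intro conjI ballI)
  have Zc: "finite Z" "Z \<subseteq> carrier R" using Z by (auto simp: spans_def)
  then show "finite (Z \<union> Y)" and ZY: "Z \<union> Y \<subseteq> carrier R" using Y by auto
  fix x assume x: "x \<in> carrier R"
  obtain s j where s: "s \<in> lspan R k Z" "j \<in> idl_ins R J a" "x = s \<oplus> j" using Z x unfolding spans_def by blast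
  obtain q r where q: "q \<in> J" "r \<in> carrier R" "j = q \<oplus> a \<otimes> r" using s(2) unfolding idl_ins_def by auto
  obtain t i where t: "t \<in> lspan R k Y" "i \<in> J" "a \<otimes> r = t \<oplus> i" using aY[OF q(2)] by blast
  have c: "s \<in> carrier R" "q \<in> carrier R" "t \<in> carrier R" "i \<in> carrier R"
    using k.lspan_carrier[OF s(1) Zc(2)] k.lspan_carrier[OF t(1) Y(2)] q t idealD[OF J] by auto
  have "x = (s \<oplus> t) \<oplus> (q \<oplus> i)" unfolding s(3) q(3) t(3) using c by algebra
  moreover have "s \<oplus> t \<in> lspan R k (Z \<union> Y)"
    using k.lspan_add[OF k.lspan_mono[OF t(1)] k.lspan_mono[OF s(1)] ZY] by auto
  moreover have "q \<oplus> i \<in> J" using ideal_add[OF J q(1) t(2)] .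
  ultimately show "\<exists>s\<in>lspan R k (Z \<union> Y). \<exists>j\<in>J. x = s \<oplus> j" by metis
qed

text \<open>Only an upper bound for the colength at the next Frobenius power is needed: a nonnegative
  sequence that is decreasing up to summable errors converges.\<close>

lemma colength_recursion:
  fixes I :: "'i set"
  assumes m: "maximalideal m R" and g0: "gdecomp e0 I b Pf f"
    and g: "g \<in> carrier R" and cc: "\<And>i j. i \<in> I \<Longrightarrow> j < D \<Longrightarrow> c i j \<in> carrier R"
    and sp: "\<And>i x. i \<in> I \<Longrightarrow> x \<in> carrier R \<Longrightarrow>
        \<exists>a. (\<forall>j<D. a j \<in> carrier R) \<and> fr 1 g \<otimes> x \<ominus> (\<Oplus>j\<in>{..<D}. fr 1 (a j) \<otimes> c i j) \<in> Pf i"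
  defines "F \<equiv> fr (e0 + 1) f \<otimes> (fr (e0 + 1) g \<otimes> fr e0 f)"
  shows "cdim (fp (e0 + e + 1) m) \<le> D * cdim (fp (e0 + e) m) + lam (e0 + e + 1) (idl_ins R {\<zero>} F) m"
proof -
  have fin: "finite I" and bI: "b \<in> I \<rightarrow> carrier R" and PfI: "Pf \<in> I \<rightarrow> minp" and f: "f \<in> carrier R"
    and ind: "\<forall>a. a \<in> I \<rightarrow> carrier R \<longrightarrow> (\<Oplus>i\<in>I. fr e0 (a i) \<otimes> b i) = \<zero> \<longrightarrow> (\<forall>i\<in>I. a i \<in> Pf i)"
    and kill: "\<forall>i\<in>I. \<forall>a\<in>Pf i. fr e0 a \<otimes> b i = \<zero>"
    and gen: "\<forall>x\<in>carrier R. \<exists>a. a \<in> I \<rightarrow> carrier R \<and> fr e0 f \<otimes> x = (\<Oplus>i\<in>I. fr e0 (a i) \<otimes> b i)"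
    using g0 unfolding gdecomp_def by simp_all
  have bc: "b i \<in> carrier R" if "i \<in> I" for i using funcset_mem[OF bI that] .
  have Pp: "primeideal (Pf i) R" if "i \<in> I" for i using minp_prime[OF funcset_mem[OF PfI that]] .
  have mi: "ideal m R" using maximalideal.axioms(1)[OF m] .
  define E where "E = e0 + e"
  let ?J = "fp (E + 1) m"
  have Ji: "ideal ?J R" by (rule fp_ideal[OF mi])
  \<comment> \<open>Coordinates of y, unique only up to \<open>Pf i\<close> in position i. They are
    q0-th roots of coefficients, with q0 = p^e0.\<close>
  define Coord where "Coord y v \<longleftrightarrow> v \<in> I \<rightarrow> carrier R \<and> fr e0 f \<otimes> y = (\<Oplus>i\<in>I. fr e0 (v i) \<otimes> b i)" for y v
  \<comment> \<open>The j-th of D additive maps that raise scalars to the p-th power. Together they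
    imitate the map sending D copies of R onto R by expanding in D generators over p-th
    powers.\<close>
  define \<Psi> where "\<Psi> j v = (\<Oplus>i\<in>I. fr (e0 + 1) (v i) \<otimes> (fr e0 (c i j) \<otimes> b i))" for j v
  have \<Psi>c: "\<Psi> j v \<in> carrier R" if "v \<in> I \<rightarrow> carrier R" "j < D" for j v
    unfolding \<Psi>_def using that cc bc by (auto intro!: finsum_closed simp: Pi_def)
  have \<Psi>_add: "\<Psi> j (\<lambda>i. v i \<oplus> w i) = \<Psi> j v \<oplus> \<Psi> j w" if v: "v \<in> I \<rightarrow> carrier R" "w \<in> I \<rightarrow> carrier R" "j < D" for j v w
  proof -
    have vc: "v i \<in> carrier R" "w i \<in> carrier R" if "i \<in> I" for i using funcset_mem[OF v(1) that] funcset_mem[OF v(2) that] .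
    have "\<Psi> j (\<lambda>i. v i \<oplus> w i) = (\<Oplus>i\<in>I. fr (e0 + 1) (v i) \<otimes> (fr e0 (c i j) \<otimes> b i) \<oplus> fr (e0 + 1) (w i) \<otimes> (fr e0 (c i j) \<otimes> b i))"
      unfolding \<Psi>_def by (rule finsum_cong') (use vc cc[OF _ v(3)] bc in \<open>auto simp: fr_add l_distr\<close>)
    also have "\<dots> = \<Psi> j v \<oplus> \<Psi> j w"
      unfolding \<Psi>_def by (rule finsum_addf) (use vc cc[OF _ v(3)] bc in auto)
    finally show ?thesis .
  qed
  have \<Psi>_scal: "\<Psi> j (\<lambda>i. r \<otimes> v i) = fr (e0 + 1) r \<otimes> \<Psi> j v" if v: "v \<in> I \<rightarrow> carrier R" "r \<in> carrier R" "j < D" for j v r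
  proof -
    have vc: "v i \<in> carrier R" if "i \<in> I" for i using funcset_mem[OF v(1) that] .
    have "\<Psi> j (\<lambda>i. r \<otimes> v i) = (\<Oplus>i\<in>I. fr (e0 + 1) r \<otimes> (fr (e0 + 1) (v i) \<otimes> (fr e0 (c i j) \<otimes> b i)))"
      unfolding \<Psi>_def by (rule finsum_cong') (use vc cc[OF _ v(3)] bc v(2) in \<open>auto simp: fr_mult m_assoc\<close>)
    also have "\<dots> = fr (e0 + 1) r \<otimes> \<Psi> j v"
      unfolding \<Psi>_def by (rule finsum_rdistr[symmetric]) (use vc cc[OF _ v(3)] bc v(2) fin in auto)
    finally show ?thesis .
  qed
  have C_add: "Coord (y \<oplus> z) (\<lambda>i. v i \<oplus> w i)" if "Coord y v" "Coord z w" "y \<in> carrier R" "z \<in> carrier R" for y z v w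
  proof -
    have v: "v \<in> I \<rightarrow> carrier R" "w \<in> I \<rightarrow> carrier R" using that(1,2) unfolding Coord_def by auto
    have vc: "v i \<in> carrier R" "w i \<in> carrier R" if "i \<in> I" for i using funcset_mem[OF v(1) that] funcset_mem[OF v(2) that] .
    have "(\<Oplus>i\<in>I. fr e0 (v i \<oplus> w i) \<otimes> b i) = (\<Oplus>i\<in>I. fr e0 (v i) \<otimes> b i \<oplus> fr e0 (w i) \<otimes> b i)"
      by (rule finsum_cong') (use vc bc in \<open>auto simp: fr_add l_distr\<close>)
    also have "\<dots> = (\<Oplus>i\<in>I. fr e0 (v i) \<otimes> b i) \<oplus> (\<Oplus>i\<in>I. fr e0 (w i) \<otimes> b i)"
      by (rule finsum_addf) (use vc bc in auto)
    also have "\<dots> = fr e0 f \<otimes> (y \<oplus> z)" using that f unfolding Coord_def by (simp add: r_distr)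
    finally show ?thesis unfolding Coord_def using vc by auto
  qed
  have C_scal: "Coord (fr e0 r \<otimes> y) (\<lambda>i. r \<otimes> v i)" if "Coord y v" "y \<in> carrier R" "r \<in> carrier R" for y v r
  proof -
    have v: "v \<in> I \<rightarrow> carrier R" using that(1) unfolding Coord_def by auto
    have vc: "v i \<in> carrier R" if "i \<in> I" for i using funcset_mem[OF v that] .
    have "(\<Oplus>i\<in>I. fr e0 (r \<otimes> v i) \<otimes> b i) = (\<Oplus>i\<in>I. fr e0 r \<otimes> (fr e0 (v i) \<otimes> b i))"
      by (rule finsum_cong') (use vc bc that(3) in \<open>auto simp: fr_mult m_assoc\<close>)
    also have "\<dots> = fr e0 r \<otimes> (\<Oplus>i\<in>I. fr e0 (v i) \<otimes> b i)"
      by (rule finsum_rdistr[symmetric]) (use vc bc that(3) fin in auto)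
    also have "(\<Oplus>i\<in>I. fr e0 (v i) \<otimes> b i) = fr e0 f \<otimes> y" using that(1) unfolding Coord_def by simp
    also have "fr e0 r \<otimes> (fr e0 f \<otimes> y) = fr e0 f \<otimes> (fr e0 r \<otimes> y)" using that(2,3) f by (simp add: m_lcomm)
    finally show ?thesis unfolding Coord_def using vc that(3) by auto
  qed
  have \<Psi>_kill: "\<Psi> j v = \<zero>" if v: "\<And>i. i \<in> I \<Longrightarrow> v i \<in> Pf i" "j < D" for j v
  proof -
    have "\<Psi> j v = (\<Oplus>i\<in>I. \<zero>)" unfolding \<Psi>_def
    proof (rule finsum_cong')
      fix i assume i: "i \<in> I"
      interpret P: primeideal "Pf i" R by (rule Pp[OF i])
      have vc: "v i \<in> carrier R" using v(1)[OF i] by simp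
      have "fr 1 (v i) \<in> Pf i" using fr_prime[OF Pp[OF i] vc] v(1)[OF i] by simp
      then have z: "fr e0 (fr 1 (v i)) \<otimes> b i = \<zero>" using kill i by blast
      have "fr (e0 + 1) (v i) \<otimes> (fr e0 (c i j) \<otimes> b i) = fr e0 (c i j) \<otimes> (fr e0 (fr 1 (v i)) \<otimes> b i)"
        using vc cc[OF i v(2)] bc[OF i] by (simp only: fr_fr m_lcomm fr_closed)
      then show "fr (e0 + 1) (v i) \<otimes> (fr e0 (c i j) \<otimes> b i) = \<zero>" using z cc[OF i v(2)] by simp
    qed auto
    then show ?thesis by simp
  qed
  \<comment> \<open>Two coordinate vectors differ by entries in \<open>Pf i\<close>, and these die
    because \<open>fr e0\<close> of \<open>Pf i\<close> annihilates \<open>b i\<close>. So the value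
    depends on y alone.\<close>
  have \<Psi>_uniq: "\<Psi> j v = \<Psi> j w" if C: "Coord y v" "Coord y w" and y: "y \<in> carrier R" and j: "j < D" for j v w y
  proof -
    have v: "v \<in> I \<rightarrow> carrier R" "w \<in> I \<rightarrow> carrier R" using C unfolding Coord_def by auto
    have vc: "v i \<in> carrier R" "w i \<in> carrier R" if "i \<in> I" for i using funcset_mem[OF v(1) that] funcset_mem[OF v(2) that] .
    let ?w = "\<lambda>i. \<ominus> \<one> \<otimes> w i"
    have "Coord (y \<oplus> fr e0 (\<ominus> \<one>) \<otimes> y) (\<lambda>i. v i \<oplus> ?w i)"
      by (rule C_add[OF C(1) C_scal[OF C(2)]]) (use y in auto)
    moreover have "y \<oplus> fr e0 (\<ominus> \<one>) \<otimes> y = \<zero>" using y by (simp add: fr_uminus l_minus r_neg)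
    ultimately have C0: "(\<lambda>i. v i \<oplus> ?w i) \<in> I \<rightarrow> carrier R" "(\<Oplus>i\<in>I. fr e0 (v i \<oplus> ?w i) \<otimes> b i) = \<zero>"
      using f unfolding Coord_def by simp_all
    have P0: "v i \<oplus> ?w i \<in> Pf i" if "i \<in> I" for i using ind[rule_format, OF C0 that] .
    have "\<Psi> j (\<lambda>i. v i \<oplus> ?w i) = \<zero>" by (rule \<Psi>_kill[OF P0 j])
    then have "\<Psi> j v \<oplus> \<Psi> j ?w = \<zero>" using \<Psi>_add[OF v(1) _ j, of ?w] vc by simp
    moreover have "\<Psi> j ?w = fr (e0 + 1) (\<ominus> \<one>) \<otimes> \<Psi> j w" by (rule \<Psi>_scal[OF v(2) _ j]) simp
    ultimately have "\<Psi> j v \<oplus> \<ominus> \<Psi> j w = \<zero>" using \<Psi>c[OF v(2) j] by (simp add: fr_uminus l_minus)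
    then show ?thesis using \<Psi>c[OF v(1) j] \<Psi>c[OF v(2) j] r_right_minus_eq[of "\<Psi> j v" "\<Psi> j w"] by (simp add: a_minus_def)
  qed
  have ex_Coord: "\<exists>v. Coord y v" if "y \<in> carrier R" for y using bspec[OF gen that] unfolding Coord_def .
  obtain Z where Z: "spans (fp E m) Z" "card Z = cdim (fp E m)" using cdim_spans[OF fp_spans[OF m]] by blast
  have Zf: "finite Z" "Z \<subseteq> carrier R" using Z(1) by (auto simp: spans_def)
  have "\<forall>z\<in>Z. \<exists>v. Coord z v" using ex_Coord Zf by blast
  from bchoice[OF this] obtain \<zeta> where \<zeta>: "\<forall>z\<in>Z. Coord z (\<zeta> z)" by (elim exE)
  let ?Y = "(\<lambda>(z, j). \<Psi> j (\<zeta> z)) ` (Z \<times> {..<D})"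
  have \<zeta>c: "\<zeta> z \<in> I \<rightarrow> carrier R" if "z \<in> Z" for z using \<zeta> that unfolding Coord_def by blast
  have Yf: "finite ?Y" "?Y \<subseteq> carrier R" using Zf \<zeta>c \<Psi>c by auto
  have Ycard: "card ?Y \<le> D * cdim (fp E m)"
  proof -
    have "card ?Y \<le> card (Z \<times> {..<D})" by (rule card_image_le) (use Zf in simp)
    then show ?thesis using Z(2) by (simp add: card_cartesian_product mult.commute)
  qed
  have spanZ: "\<exists>v. Coord y v \<and> \<Psi> j v \<in> lspan R k ?Y" if "y \<in> lspan R k Z" and j: "j < D" for y j
    using that(1)
  proof (induction y rule: lspan.induct)
    case lspan_zero
    have "(\<Oplus>i\<in>I. fr e0 \<zero> \<otimes> b i) = (\<Oplus>i\<in>I. \<zero>)" by (rule finsum_cong') (use bc in auto)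
    then have "Coord \<zero> (\<lambda>i. \<zero>)" unfolding Coord_def using f by simp
    moreover have "\<zero> \<in> Pf i" if "i \<in> I" for i using ideal_zero[OF primeideal.axioms(1)[OF Pp[OF that]]] .
    then have "\<Psi> j (\<lambda>i. \<zero>) = \<zero>" using \<Psi>_kill[OF _ j, of "\<lambda>i. \<zero>"] by blast
    ultimately show ?case using lspan.lspan_zero[of R k ?Y] by (intro exI[of _ "\<lambda>i. \<zero>"]) simp
  next
    case (lspan_step s l z)
    then obtain v where v: "Coord s v" "\<Psi> j v \<in> lspan R k ?Y" by blast
    obtain d where d: "d \<in> k" "fr e0 d = l" using k_fr_root[OF lspan_step(2)] by blast
    have zc: "z \<in> carrier R" "s \<in> carrier R" using lspan_step Zf k.lspan_carrier[OF lspan_step(1) Zf(2)] by auto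
    have Cz: "Coord z (\<zeta> z)" using \<zeta> lspan_step(3) by blast
    have C: "Coord (s \<oplus> l \<otimes> z) (\<lambda>i. v i \<oplus> d \<otimes> \<zeta> z i)"
      using C_add[OF v(1) C_scal[OF Cz zc(1), of d]] d zc lspan_step(2) by simp
    have vI: "v \<in> I \<rightarrow> carrier R" using v(1) unfolding Coord_def by blast
    have dz: "(\<lambda>i. d \<otimes> \<zeta> z i) \<in> I \<rightarrow> carrier R" using d \<zeta>c[OF lspan_step(3)] by (auto simp: Pi_def)
    have "\<Psi> j (\<lambda>i. v i \<oplus> d \<otimes> \<zeta> z i) = \<Psi> j v \<oplus> fr (e0 + 1) d \<otimes> \<Psi> j (\<zeta> z)"
      using \<Psi>_add[OF vI dz j] \<Psi>_scal[OF \<zeta>c[OF lspan_step(3)] k.LD[OF d(1)] j] by simp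
    moreover have "\<Psi> j (\<zeta> z) \<in> ?Y" using lspan_step(3) j by force
    ultimately have "\<Psi> j (\<lambda>i. v i \<oplus> d \<otimes> \<zeta> z i) \<in> lspan R k ?Y"
      using v(2) k_fr[OF d(1)] by (simp add: lspan.lspan_step)
    then show ?case using C by blast
  qed
  \<comment> \<open>An exponent q0 in front of y becomes p * q0 under the map, so the Frobenius
    power of m at level E is sent into the one at level E + 1.\<close>
  have fpc: "\<exists>v. Coord y v \<and> \<Psi> j v \<in> ?J" if "y \<in> fp E m" and j: "j < D" for y j
    using that(1) unfolding fp_lspan[OF mi, of E]
  proof (induction y rule: lspan.induct)
    case lspan_zero
    have "(\<Oplus>i\<in>I. fr e0 \<zero> \<otimes> b i) = (\<Oplus>i\<in>I. \<zero>)" by (rule finsum_cong') (use bc in auto)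
    then have "Coord \<zero> (\<lambda>i. \<zero>)" unfolding Coord_def using f by simp
    moreover have "\<zero> \<in> Pf i" if "i \<in> I" for i using ideal_zero[OF primeideal.axioms(1)[OF Pp[OF that]]] .
    then have "\<Psi> j (\<lambda>i. \<zero>) = \<zero>" using \<Psi>_kill[OF _ j, of "\<lambda>i. \<zero>"] by blast
    ultimately show ?case using ideal_zero[OF Ji] by (intro exI[of _ "\<lambda>i. \<zero>"]) simp
  next
    case (lspan_step s l r)
    then obtain v where v: "Coord s v" "\<Psi> j v \<in> ?J" by blast
    obtain \<mu> where \<mu>: "\<mu> \<in> m" "l = fr E \<mu>" using lspan_step(2) by blast
    have mc: "\<mu> \<in> carrier R" using idealD[OF mi \<mu>(1)] .
    have sc: "s \<in> carrier R" using lspan_carrier_gen[OF lspan_step(1) fp_sub[OF mi]] by simp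
    obtain w where w: "Coord r w" using ex_Coord[OF lspan_step(3)] by blast
    have wI: "w \<in> I \<rightarrow> carrier R" and vI: "v \<in> I \<rightarrow> carrier R" using w v(1) unfolding Coord_def by blast+
    have ll: "l = fr e0 (fr e \<mu>)" using \<mu>(2) mc by (simp add: fr_fr E_def)
    have C: "Coord (s \<oplus> l \<otimes> r) (\<lambda>i. v i \<oplus> fr e \<mu> \<otimes> w i)"
      using C_add[OF v(1) C_scal[OF w lspan_step(3), of "fr e \<mu>"]] ll mc sc lspan_step(3) by simp
    have dz: "(\<lambda>i. fr e \<mu> \<otimes> w i) \<in> I \<rightarrow> carrier R" using mc wI by (auto simp: Pi_def)
    have "\<Psi> j (\<lambda>i. v i \<oplus> fr e \<mu> \<otimes> w i) = \<Psi> j v \<oplus> fr (e0 + 1) (fr e \<mu>) \<otimes> \<Psi> j w"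
      using \<Psi>_add[OF vI dz j] \<Psi>_scal[OF wI fr_closed[OF mc] j] by simp
    moreover have "fr (e0 + 1) (fr e \<mu>) = fr (E + 1) \<mu>" using mc by (simp add: fr_fr E_def add_ac)
    moreover have "fr (E + 1) \<mu> \<otimes> \<Psi> j w \<in> ?J" using ideal.I_r_closed[OF Ji fr_fp[OF mi \<mu>(1)] \<Psi>c[OF wI j]] .
    ultimately have "\<Psi> j (\<lambda>i. v i \<oplus> fr e \<mu> \<otimes> w i) \<in> ?J" using ideal_add[OF Ji v(2)] by simp
    then show ?case using C by blast
  qed
  \<comment> \<open>Each factor of F pays for one step: the last one for coordinates of x, the
    middle one for expanding these over p-th powers, the first one for turning the expansion
    coefficients back into coordinates of elements.\<close>
  have Fc: "F \<in> carrier R" using f g by (simp add: F_def)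
  have claim: "\<exists>s\<in>lspan R k ?Y. \<exists>t\<in>?J. F \<otimes> x = s \<oplus> t" if x: "x \<in> carrier R" for x
  proof -
    obtain a where a: "a \<in> I \<rightarrow> carrier R" "fr e0 f \<otimes> x = (\<Oplus>i\<in>I. fr e0 (a i) \<otimes> b i)" using bspec[OF gen x] by blast
    have ac: "a i \<in> carrier R" if "i \<in> I" for i using funcset_mem[OF a(1) that] .
    have "\<forall>i\<in>I. \<exists>al. (\<forall>j<D. al j \<in> carrier R) \<and> fr 1 g \<otimes> a i \<ominus> (\<Oplus>j\<in>{..<D}. fr 1 (al j) \<otimes> c i j) \<in> Pf i"
      by (intro ballI sp ac)
    from bchoice[OF this] obtain al where al: "\<forall>i\<in>I. (\<forall>j<D. al i j \<in> carrier R) \<and> fr 1 g \<otimes> a i \<ominus> (\<Oplus>j\<in>{..<D}. fr 1 (al i j) \<otimes> c i j) \<in> Pf i"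
      by (elim exE)
    have alc: "al i j \<in> carrier R" if "i \<in> I" "j < D" for i j using al that by blast
    define XX where "XX i j = fr (e0 + 1) (al i j) \<otimes> (fr e0 (c i j) \<otimes> b i)" for i j
    have XXc: "XX i j \<in> carrier R" if "i \<in> I" "j < D" for i j unfolding XX_def using alc[OF that] cc[OF that] bc[OF that(1)] by simp
    have 1: "fr (e0 + 1) g \<otimes> (fr e0 (a i) \<otimes> b i) = (\<Oplus>j\<in>{..<D}. XX i j)" if i: "i \<in> I" for i
    proof -
      let ?s = "\<Oplus>j\<in>{..<D}. fr 1 (al i j) \<otimes> c i j"
      have sc: "?s \<in> carrier R" using alc[OF i] cc[OF i] by (auto intro!: finsum_closed)
      have "fr e0 (fr 1 g \<otimes> a i \<ominus> ?s) \<otimes> b i = \<zero>" using bspec[OF bspec[OF kill i] conjunct2[OF bspec[OF al i]]] .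
      then have "(fr e0 (fr 1 g \<otimes> a i) \<ominus> fr e0 ?s) \<otimes> b i = \<zero>" using sc g ac[OF i] by (simp add: fr_minus)
      moreover have "u \<otimes> w = v \<otimes> w" if "(u \<ominus> v) \<otimes> w = \<zero>" "u \<in> carrier R" "v \<in> carrier R" "w \<in> carrier R" for u v w
      proof -
        have "u \<otimes> w \<ominus> v \<otimes> w = (u \<ominus> v) \<otimes> w" using that(2-4) by algebra
        then have "u \<otimes> w \<ominus> v \<otimes> w = \<zero>" using that(1) by simp
        then show ?thesis using that(2-4) by simp
      qed
      ultimately have "fr e0 (fr 1 g \<otimes> a i) \<otimes> b i = fr e0 ?s \<otimes> b i" using sc g ac[OF i] bc[OF i] by simp
      moreover have "fr e0 (fr 1 g \<otimes> a i) \<otimes> b i = fr (e0 + 1) g \<otimes> (fr e0 (a i) \<otimes> b i)"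
        using g ac[OF i] bc[OF i] by (simp add: fr_mult fr_fr m_assoc)
      moreover have "fr e0 ?s \<otimes> b i = (\<Oplus>j\<in>{..<D}. fr e0 (fr 1 (al i j) \<otimes> c i j)) \<otimes> b i"
        by (subst fr_finsum) (use alc[OF i] cc[OF i] in auto)
      moreover have "\<dots> = (\<Oplus>j\<in>{..<D}. fr e0 (fr 1 (al i j) \<otimes> c i j) \<otimes> b i)"
        by (rule finsum_ldistr) (use alc[OF i] cc[OF i] bc[OF i] in auto)
      moreover have "\<dots> = (\<Oplus>j\<in>{..<D}. XX i j)" unfolding XX_def
        by (rule finsum_cong') (use alc[OF i] cc[OF i] bc[OF i] in \<open>auto simp: fr_mult fr_fr m_assoc\<close>)
      ultimately show ?thesis by simp
    qed
    have 2: "fr (e0 + 1) g \<otimes> (fr e0 f \<otimes> x) = (\<Oplus>j\<in>{..<D}. \<Oplus>i\<in>I. XX i j)"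
    proof -
      have "fr (e0 + 1) g \<otimes> (fr e0 f \<otimes> x) = (\<Oplus>i\<in>I. fr (e0 + 1) g \<otimes> (fr e0 (a i) \<otimes> b i))"
        unfolding a(2) by (rule finsum_rdistr) (use fin g ac bc in auto)
      also have "\<dots> = (\<Oplus>i\<in>I. \<Oplus>j\<in>{..<D}. XX i j)"
        by (rule finsum_cong') (use 1 XXc in \<open>auto intro!: finsum_closed\<close>)
      also have "\<dots> = (\<Oplus>j\<in>{..<D}. \<Oplus>i\<in>I. XX i j)"
        by (rule finsum_swap) (use fin XXc in auto)
      finally show ?thesis .
    qed
    have XX\<Psi>: "(\<Oplus>i\<in>I. XX i j) = \<Psi> j (\<lambda>i. al i j)" for j unfolding XX_def \<Psi>_def ..
    \<comment> \<open>The vector of the \<open>al i j\<close> need not be coordinates of an element,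
      but f times it is: those of the combination of the \<open>b i\<close> with its q0-th powers.
      Reducing that element modulo the Frobenius power of m leaves only images of Z.\<close>
    have 3: "\<exists>s\<in>lspan R k ?Y. \<exists>t\<in>?J. fr (e0 + 1) f \<otimes> \<Psi> j (\<lambda>i. al i j) = s \<oplus> t" if j: "j < D" for j
    proof -
      let ?x = "\<Oplus>i\<in>I. fr e0 (al i j) \<otimes> b i"
      have xc: "?x \<in> carrier R" using alc[OF _ j] bc by (auto intro!: finsum_closed)
      have alI: "(\<lambda>i. al i j) \<in> I \<rightarrow> carrier R" using alc[OF _ j] by blast
      have "(\<Oplus>i\<in>I. fr e0 (f \<otimes> al i j) \<otimes> b i) = (\<Oplus>i\<in>I. fr e0 f \<otimes> (fr e0 (al i j) \<otimes> b i))"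
        by (rule finsum_cong') (use alc[OF _ j] bc f in \<open>auto simp: fr_mult m_assoc\<close>)
      also have "\<dots> = fr e0 f \<otimes> ?x"
        by (rule finsum_rdistr[symmetric]) (use alc[OF _ j] bc f fin in auto)
      finally have Cx: "Coord ?x (\<lambda>i. f \<otimes> al i j)" unfolding Coord_def using alc[OF _ j] f by auto
      obtain s w where sw: "s \<in> lspan R k Z" "w \<in> fp E m" "?x = s \<oplus> w" using Z(1) xc unfolding spans_def by blast
      have swc: "s \<in> carrier R" "w \<in> carrier R" using k.lspan_carrier[OF sw(1) Zf(2)] idealD[OF fp_ideal[OF mi] sw(2)] by auto
      obtain v where v: "Coord s v" "\<Psi> j v \<in> lspan R k ?Y" using spanZ[OF sw(1) j] by blast
      obtain v' where v': "Coord w v'" "\<Psi> j v' \<in> ?J" using fpc[OF sw(2) j] by blast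
      have vI: "v \<in> I \<rightarrow> carrier R" "v' \<in> I \<rightarrow> carrier R" using v(1) v'(1) unfolding Coord_def by blast+
      have "Coord ?x (\<lambda>i. v i \<oplus> v' i)" unfolding sw(3) by (rule C_add[OF v(1) v'(1) swc])
      then have "\<Psi> j (\<lambda>i. f \<otimes> al i j) = \<Psi> j (\<lambda>i. v i \<oplus> v' i)" by (rule \<Psi>_uniq[OF Cx _ xc j])
      then have "fr (e0 + 1) f \<otimes> \<Psi> j (\<lambda>i. al i j) = \<Psi> j v \<oplus> \<Psi> j v'"
        using \<Psi>_scal[OF alI f j] \<Psi>_add[OF vI j] by simp
      then show ?thesis using v(2) v'(2) by blast
    qed
    have cl: "\<exists>s\<in>lspan R k ?Y. \<exists>t\<in>?J. (\<Oplus>j\<in>A. fr (e0 + 1) f \<otimes> \<Psi> j (\<lambda>i. al i j)) = s \<oplus> t" if "finite A" "A \<subseteq> {..<D}" for A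
      using that
    proof (induction A rule: finite_induct)
      case empty
      show ?case by (rule bexI[of _ \<zero>], rule bexI[of _ \<zero>]) (use ideal_zero[OF Ji] in \<open>auto intro: lspan.lspan_zero\<close>)
    next
      case (insert j A)
      then obtain s t where st: "s \<in> lspan R k ?Y" "t \<in> ?J" "(\<Oplus>j\<in>A. fr (e0 + 1) f \<otimes> \<Psi> j (\<lambda>i. al i j)) = s \<oplus> t" by blast
      have jD: "j < D" using insert by auto
      obtain s' t' where st': "s' \<in> lspan R k ?Y" "t' \<in> ?J" "fr (e0 + 1) f \<otimes> \<Psi> j (\<lambda>i. al i j) = s' \<oplus> t'" using 3[OF jD] by blast
      have c: "s \<in> carrier R" "s' \<in> carrier R" "t \<in> carrier R" "t' \<in> carrier R"
        using k.lspan_carrier[OF st(1) Yf(2)] k.lspan_carrier[OF st'(1) Yf(2)] idealD[OF Ji st(2)] idealD[OF Ji st'(2)] by auto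
      have alj: "fr (e0 + 1) f \<otimes> \<Psi> j' (\<lambda>i. al i j') \<in> carrier R" if "j' < D" for j'
        using \<Psi>c[of "\<lambda>i. al i j'" j'] alc that f by auto
      have "(\<Oplus>j\<in>insert j A. fr (e0 + 1) f \<otimes> \<Psi> j (\<lambda>i. al i j))
         = fr (e0 + 1) f \<otimes> \<Psi> j (\<lambda>i. al i j) \<oplus> (\<Oplus>j\<in>A. fr (e0 + 1) f \<otimes> \<Psi> j (\<lambda>i. al i j))"
        by (rule finsum_insert) (use insert alj in auto)
      also have "\<dots> = (s' \<oplus> s) \<oplus> (t' \<oplus> t)" unfolding st(3) st'(3) using c by algebra
      finally have eq: "(\<Oplus>j\<in>insert j A. fr (e0 + 1) f \<otimes> \<Psi> j (\<lambda>i. al i j)) = (s' \<oplus> s) \<oplus> (t' \<oplus> t)" .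
      have "s' \<oplus> s \<in> lspan R k ?Y" using k.lspan_add[OF st(1) st'(1) Yf(2)] .
      moreover have "t' \<oplus> t \<in> ?J" using ideal_add[OF Ji st'(2) st(2)] .
      ultimately show ?case using eq by blast
    qed
    have "F \<otimes> x = fr (e0 + 1) f \<otimes> (fr (e0 + 1) g \<otimes> (fr e0 f \<otimes> x))" unfolding F_def using f g x by (simp add: m_assoc)
    also have "\<dots> = fr (e0 + 1) f \<otimes> (\<Oplus>j\<in>{..<D}. \<Psi> j (\<lambda>i. al i j))" unfolding 2 XX\<Psi> ..
    also have "\<dots> = (\<Oplus>j\<in>{..<D}. fr (e0 + 1) f \<otimes> \<Psi> j (\<lambda>i. al i j))"
      by (rule finsum_rdistr) (use f \<Psi>c alc in auto)
    finally show ?thesis using cl[of "{..<D}"] by simp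
  qed
  have Ii: "ideal (idl_ins R {\<zero>} F) R" by (rule idl_ins(1)[OF zeroideal Fc])
  obtain Z1 where Z1: "spans (idl_ins R {\<zero>} F <+>\<^bsub>R\<^esub> ?J) Z1" "card Z1 = lam (E + 1) (idl_ins R {\<zero>} F) m"
    using setadd_cdim[OF m Ii] by blast
  have "{\<zero>} <+>\<^bsub>R\<^esub> ?J = ?J" using idealD[OF Ji] by (auto simp: set_add_def')
  then have "idl_ins R {\<zero>} F <+>\<^bsub>R\<^esub> ?J \<subseteq> idl_ins R ?J F" using idl_ins_setadd[OF zeroideal Ji Fc] by simp
  from spans_mono[OF Z1(1) this] have sZ1: "spans (idl_ins R ?J F) Z1" .
  have "spans ?J (Z1 \<union> ?Y)" by (rule spans_image[OF Ji Fc Yf _ sZ1]) (rule claim)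
  then have "cdim ?J \<le> card (Z1 \<union> ?Y)" by (rule cdim_le)
  also have "\<dots> \<le> card Z1 + card ?Y" by (rule card_Un_le)
  finally show ?thesis using Z1(2) Ycard unfolding E_def by linarith
qed

text \<open>Adding C / q^n makes the sequence decreasing: two errors C / q^(n+1) fit into C / q^n
  because q is at least 2. The added term tends to zero.\<close>

lemma almost_decreasing_convergent:
  fixes a :: "nat \<Rightarrow> real" and C :: real and q :: real
  assumes a0: "\<And>n. 0 \<le> a n" and q: "q \<ge> 2" and C: "C \<ge> 0"
    and a: "\<And>n. n \<ge> N \<Longrightarrow> a (Suc n) \<le> a n + C / q ^ Suc n"
  shows "convergent a"
proof -
  define b where "b n = a (n + N) + C / q ^ (n + N)" for n
  have "decseq b"
  proof (rule decseq_SucI)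
    fix n
    have two: "2 * (C / r) = C / r + C / r" for r by simp
    have "b (Suc n) \<le> a (n + N) + 2 * (C / q ^ Suc (n + N))" unfolding two
      using a[of "n + N"] unfolding b_def add_Suc by linarith
    also have "2 * (C / q ^ Suc (n + N)) \<le> C / q ^ (n + N)"
    proof -
      have "2 * C \<le> q * C" using q C by (intro mult_right_mono) auto
      then show ?thesis using q by (simp add: field_simps)
    qed
    finally show "b (Suc n) \<le> b n" unfolding b_def by simp
  qed
  moreover have "\<forall>i. 0 \<le> b i" using a0 C q by (auto simp: b_def)
  ultimately obtain l where l: "b \<longlonglongrightarrow> l" using decseq_convergent[of b 0] by blast
  have "(\<lambda>n. C * (1 / q) ^ (n + N)) \<longlonglongrightarrow> C * 0"
    using q by (intro tendsto_mult_left LIMSEQ_ignore_initial_segment LIMSEQ_power_zero) auto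
  then have "(\<lambda>n. C / q ^ (n + N)) \<longlonglongrightarrow> 0" by (simp add: power_one_over)
  from tendsto_diff[OF l this] have "(\<lambda>n. a (n + N)) \<longlonglongrightarrow> l" unfolding b_def by simp
  then have "a \<longlonglongrightarrow> l" by (rule LIMSEQ_offset)
  then show ?thesis by (auto simp: convergent_def)
qed

text \<open>The recursion uses D = p^d generators for every residue domain, so after division by q^d
  the main term is the previous quotient. F lies in no minimal prime, hence the error is of lower
  order.\<close>

lemma colength_converges:
  assumes m: "maximalideal m R" and d: "\<And>P n. P \<in> minp \<Longrightarrow> pchain P (carrier R) n \<Longrightarrow> n \<le> d"
  shows "convergent (\<lambda>e. real (cdim (fp e m)) / real (p ^ e) ^ d)"
proof -
  obtain e0 and I :: "('a set \<times> 'a) set" and b Pf f where gd: "gdecomp e0 I b Pf f" using gdecomp_exists by blast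
  have PfI: "Pf \<in> I \<rightarrow> minp" and f: "f \<in> carrier R" "\<forall>P\<in>minp. f \<notin> P" using gd unfolding gdecomp_def by simp_all
  let ?D = "p ^ d"
  have "\<forall>P\<in>minp. \<exists>u. u \<in> carrier R - P \<and> (\<forall>Q\<in>minp - {P}. u \<in> Q)"
    by (intro ballI minp_separate[unfolded Bex_def])
  from bchoice[OF this] obtain u where u0: "\<forall>P\<in>minp. u P \<in> carrier R - P \<and> (\<forall>Q\<in>minp - {P}. u P \<in> Q)" by (elim exE)
  note u = bspec[OF u0]
  have "\<forall>P\<in>minp. \<exists>Bf. finite (fst Bf) \<and> fst Bf \<subseteq> carrier R \<and> card (fst Bf) \<le> ?D \<and> snd Bf \<in> carrier R - P
    \<and> (\<forall>x\<in>carrier R. \<exists>u\<in>lspan R (frs 1) (fst Bf). \<exists>i\<in>P. fr 1 (snd Bf) \<otimes> x = u \<oplus> i)"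
  proof
    fix P assume P: "P \<in> minp"
    have dP: "n \<le> d" if "pchain P (carrier R) n" for n using d[OF P that] .
    have "\<exists>B f. finite B \<and> B \<subseteq> carrier R \<and> card B \<le> ?D \<and> f \<in> carrier R - P
    \<and> (\<forall>x\<in>carrier R. \<exists>u\<in>lspan R (frs 1) B. \<exists>i\<in>P. fr 1 f \<otimes> x = u \<oplus> i)"
      by (rule frobenius_rank[OF minp_prime[OF P] dP])
    then obtain B f where "finite B \<and> B \<subseteq> carrier R \<and> card B \<le> ?D \<and> f \<in> carrier R - P
    \<and> (\<forall>x\<in>carrier R. \<exists>u\<in>lspan R (frs 1) B. \<exists>i\<in>P. fr 1 f \<otimes> x = u \<oplus> i)" by (elim exE)
    then show "\<exists>Bf. finite (fst Bf) \<and> fst Bf \<subseteq> carrier R \<and> card (fst Bf) \<le> ?D \<and> snd Bf \<in> carrier R - P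
    \<and> (\<forall>x\<in>carrier R. \<exists>u\<in>lspan R (frs 1) (fst Bf). \<exists>i\<in>P. fr 1 (snd Bf) \<otimes> x = u \<oplus> i)"
      by (intro exI[of _ "(B, f)"]) simp
  qed
  from bchoice[OF this] obtain Bf where Bf: "\<forall>P\<in>minp. finite (fst (Bf P)) \<and> fst (Bf P) \<subseteq> carrier R \<and> card (fst (Bf P)) \<le> ?D
    \<and> snd (Bf P) \<in> carrier R - P
    \<and> (\<forall>x\<in>carrier R. \<exists>u\<in>lspan R (frs 1) (fst (Bf P)). \<exists>i\<in>P. fr 1 (snd (Bf P)) \<otimes> x = u \<oplus> i)" by (elim exE)
  define B where "B P = fst (Bf P)" for P
  define h where "h P = snd (Bf P)" for P
  have B: "finite (B P)" "B P \<subseteq> carrier R" "card (B P) \<le> ?D" "h P \<in> carrier R - P" if "P \<in> minp" for P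
    using bspec[OF Bf that] unfolding B_def h_def by simp_all
  have Bsp: "\<exists>u\<in>lspan R (frs 1) (B P). \<exists>i\<in>P. fr 1 (h P) \<otimes> x = u \<oplus> i" if "P \<in> minp" "x \<in> carrier R" for P x
    using bspec[OF Bf that(1)] that(2) unfolding B_def h_def by simp
  have "\<forall>P\<in>minp. \<exists>c. (\<forall>j<?D. c j \<in> carrier R) \<and> B P \<subseteq> c ` {..<?D}"
  proof
    fix P assume P: "P \<in> minp"
    obtain c where c: "bij_betw c {..<card (B P)} (B P)" using ex_bij_betw_nat_finite[OF B(1)[OF P]] by (auto simp: atLeast0LessThan)
    \<comment> \<open>Padding with \<zero> to exactly p^d generators, so that all minimal primes
      share one index range.\<close>
    let ?c = "\<lambda>j. if j < card (B P) then c j else \<zero>"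
    have "?c j \<in> carrier R" for j using bij_betwE[OF c] B(2)[OF P] by auto
    moreover have "B P \<subseteq> ?c ` {..<?D}"
    proof
      fix y assume "y \<in> B P"
      then obtain j where "j < card (B P)" "y = c j" using c unfolding bij_betw_def by auto
      then show "y \<in> ?c ` {..<?D}" using B(3)[OF P] by (intro image_eqI[of _ _ j]) auto
    qed
    ultimately show "\<exists>c. (\<forall>j<?D. c j \<in> carrier R) \<and> B P \<subseteq> c ` {..<?D}"
      by (intro exI[of _ ?c] conjI allI impI)
  qed
  from bchoice[OF this] obtain c where c: "\<forall>P\<in>minp. (\<forall>j<?D. c P j \<in> carrier R) \<and> B P \<subseteq> c P ` {..<?D}" by (elim exE)
  \<comment> \<open>A single denominator for all minimal primes: modulo P it is
    \<open>u P * h P\<close>, and it lies in none of them.\<close>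
  define g where "g = (\<Oplus>P\<in>minp. u P \<otimes> h P)"
  have gc: "g \<in> carrier R" unfolding g_def
  proof (rule finsum_closed, rule funcsetI)
    fix P assume P: "P \<in> minp"
    show "u P \<otimes> h P \<in> carrier R" using u[OF P] B(4)[OF P] by simp
  qed
  have gP1: "g \<ominus> u P \<otimes> h P \<in> P" if "P \<in> minp" for P
    unfolding g_def by (rule minp_glue(1)[OF u B(4) that])
  have gP2: "g \<notin> P" if "P \<in> minp" for P
    unfolding g_def by (rule minp_glue(2)[OF u B(4) that])
  note gP = gP1 gP2
  have sp: "\<exists>a. (\<forall>j<?D. a j \<in> carrier R) \<and> fr 1 g \<otimes> x \<ominus> (\<Oplus>j\<in>{..<?D}. fr 1 (a j) \<otimes> c P j) \<in> P"
    if P: "P \<in> minp" and x: "x \<in> carrier R" for P x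
  proof -
    interpret P: primeideal P R by (rule minp_prime[OF P])
    interpret F: scalars R "frs 1" by (rule frs_scalars)
    have uc: "u P \<in> carrier R" "h P \<in> carrier R" using u[OF P] B(4)[OF P] by auto
    obtain v i where v: "v \<in> lspan R (frs 1) (B P)" "i \<in> P" "fr 1 (h P) \<otimes> x = v \<oplus> i" using Bsp[OF P x] by blast
    have vc: "v \<in> carrier R" "i \<in> carrier R" using F.lspan_carrier[OF v(1) B(2)[OF P]] v(2) by auto
    have uv: "fr 1 (u P) \<otimes> v \<in> lspan R (frs 1) (B P)" using F.lspan_scal[OF v(1) B(2)[OF P] frsI[OF uc(1)]] .
    have cP: "c P \<in> {..<?D} \<rightarrow> carrier R" "B P \<subseteq> c P ` {..<?D}" using bspec[OF c P] by auto
    obtain t where t: "t \<in> {..<?D} \<rightarrow> frs 1" "fr 1 (u P) \<otimes> v = (\<Oplus>j\<in>{..<?D}. t j \<otimes> c P j)"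
      using lspan_repr_family[OF finite_lessThan cP uv F.L_carrier F.L_zero F.L_add] by blast
    have "\<forall>j\<in>{..<?D}. \<exists>a. a \<in> carrier R \<and> t j = fr 1 a" using t(1) unfolding frs_def by blast
    from bchoice[OF this] obtain a where a: "\<forall>j\<in>{..<?D}. a j \<in> carrier R \<and> t j = fr 1 (a j)" by (elim exE)
    have e: "(\<Oplus>j\<in>{..<?D}. fr 1 (a j) \<otimes> c P j) = fr 1 (u P) \<otimes> v" unfolding t(2)
      by (rule finsum_cong') (use a cP(1) in \<open>auto simp: Pi_def\<close>)
    have y1: "fr 1 (g \<ominus> u P \<otimes> h P) \<in> P" using fr_prime[OF minp_prime[OF P]] gP(1)[OF P] by simp
    have "fr 1 g \<otimes> x \<ominus> fr 1 (u P) \<otimes> v = fr 1 (g \<ominus> u P \<otimes> h P) \<otimes> x \<oplus> fr 1 (u P) \<otimes> i"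
    proof -
      have e1: "v = fr 1 (h P) \<otimes> x \<ominus> i" using v(3) vc by algebra
      have e2: "fr 1 (g \<ominus> u P \<otimes> h P) = fr 1 g \<ominus> fr 1 (u P) \<otimes> fr 1 (h P)" using gc uc by (simp add: fr_minus fr_mult)
      have "G \<otimes> x \<ominus> U \<otimes> (H \<otimes> x \<ominus> i) = (G \<ominus> U \<otimes> H) \<otimes> x \<oplus> U \<otimes> i"
        if "G \<in> carrier R" "U \<in> carrier R" "H \<in> carrier R" for G U H using that x vc(2) by algebra
      then show ?thesis unfolding e1 e2 using gc uc by simp
    qed
    moreover have "fr 1 (g \<ominus> u P \<otimes> h P) \<otimes> x \<oplus> fr 1 (u P) \<otimes> i \<in> P"
      by (rule P.a_closed[OF P.I_r_closed[OF y1 x] P.I_l_closed[OF v(2)]]) (use uc in simp)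
    ultimately show ?thesis using a e by (intro exI[of _ a]) auto
  qed
  define F where "F = fr (e0 + 1) f \<otimes> (fr (e0 + 1) g \<otimes> fr e0 f)"
  have FP: "F \<notin> P" if P: "P \<in> minp" for P
  proof -
    interpret P: primeideal P R by (rule minp_prime[OF P])
    have "fr (e0 + 1) f \<notin> P" "fr (e0 + 1) g \<notin> P" "fr e0 f \<notin> P"
      using fr_prime[OF minp_prime[OF P] f(1)] fr_prime[OF minp_prime[OF P] gc] bspec[OF f(2) P] gP(2)[OF P] by simp_all
    then show ?thesis unfolding F_def using P.I_prime[of "fr (e0+1) g" "fr e0 f"] P.I_prime[of "fr (e0+1) f" "fr (e0 + 1) g \<otimes> fr e0 f"] f(1) gc by auto
  qed
  have Fc: "F \<in> carrier R" using f(1) gc by (simp add: F_def)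
  have rec: "cdim (fp (e0 + e + 1) m) \<le> ?D * cdim (fp (e0 + e) m) + lam (e0 + e + 1) (idl_ins R {\<zero>} F) m" for e
    unfolding F_def
  proof (rule colength_recursion[OF m gd gc, of _ "\<lambda>i. c (Pf i)"])
    show "c (Pf i) j \<in> carrier R" if "i \<in> I" "j < ?D" for i j
      using bspec[OF c funcset_mem[OF PfI that(1)]] that(2) by blast
    show "\<exists>a. (\<forall>j<?D. a j \<in> carrier R) \<and> fr 1 g \<otimes> x \<ominus> (\<Oplus>j\<in>{..<?D}. fr 1 (a j) \<otimes> c (Pf i) j) \<in> Pf i"
      if "i \<in> I" "x \<in> carrier R" for i x using sp[OF funcset_mem[OF PfI that(1)] that(2)] .
  qed
  have Ii: "ideal (idl_ins R {\<zero>} F) R" by (rule idl_ins(1)[OF zeroideal Fc])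
  have Fin: "F \<in> idl_ins R {\<zero>} F" by (rule idl_ins(3)[OF zeroideal Fc])
  \<comment> \<open>A minimal prime below a chain above F is strictly smaller than its first member,
    which contains F, so the chain extends by one.\<close>
  have "n < d" if n: "pchain (idl_ins R {\<zero>} F) m n" for n
  proof -
    obtain ch where ch: "\<forall>i\<le>n. primeideal (ch i) R" "\<forall>i<n. ch i \<subset> ch (Suc i)" "idl_ins R {\<zero>} F \<subseteq> ch 0" "ch n \<subseteq> m"
      using n unfolding pchain_def by blast
    obtain P where P: "P \<in> minp" "P \<subseteq> ch 0" using minimal_primes(2)[of "ch 0"] ch(1) by blast
    have "P \<subset> ch 0" using P FP[OF P(1)] Fin ch(3) by blast
    moreover have "pchain (ch 0) (carrier R) n" unfolding pchain_def
      by (rule exI[of _ ch]) (use ch idealD[OF primeideal.axioms(1)] in auto)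
    ultimately have "pchain P (carrier R) (Suc n)" using pchain_Suc[OF minp_prime[OF P(1)]] by blast
    then show ?thesis using d[OF P(1)] by fastforce
  qed
  then obtain C where C: "\<And>e. p ^ e * lam e (idl_ins R {\<zero>} F) m \<le> C * (p ^ e) ^ d" using lam_bound[OF m Ii] by blast
  show ?thesis
  proof (rule almost_decreasing_convergent[where N = e0 and C = "real C" and q = "real p"])
    show "0 \<le> real (cdim (fp n m)) / real (p ^ n) ^ d" for n by simp
    show "2 \<le> real p" using p_gt_1 by simp
    show "0 \<le> real C" by simp
    fix n assume "n \<ge> e0"
    then obtain e where e: "n = e0 + e" using le_Suc_ex by blast
    let ?L = "real (lam (Suc n) (idl_ins R {\<zero>} F) m)" and ?q = "real p ^ Suc n"
    have q0: "?q > 0" using p_pos by simp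
    have "real (cdim (fp (Suc n) m)) \<le> real (?D * cdim (fp n m) + lam (Suc n) (idl_ins R {\<zero>} F) m)"
      using rec[of e] unfolding e by (simp only: of_nat_le_iff) simp
    then have 1: "real (cdim (fp (Suc n) m)) \<le> real p ^ d * real (cdim (fp n m)) + ?L" by simp
    have "real (p ^ Suc n * lam (Suc n) (idl_ins R {\<zero>} F) m) \<le> real (C * (p ^ Suc n) ^ d)"
      using C[of "Suc n"] by (simp only: of_nat_le_iff)
    then have "?q * ?L \<le> real C * ?q ^ d" by simp
    moreover have "L / r ^ d \<le> c / r" if "r * L \<le> c * r ^ d" "r > 0" for L r c :: real
      using that by (simp add: field_simps)
    ultimately have 2: "?L / ?q ^ d \<le> real C / ?q" using q0 by blast
    have "real (cdim (fp (Suc n) m)) / ?q ^ d \<le> (real p ^ d * real (cdim (fp n m)) + ?L) / ?q ^ d"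
      using 1 q0 by (intro divide_right_mono) auto
    also have "\<dots> = real p ^ d * real (cdim (fp n m)) / ?q ^ d + ?L / ?q ^ d" by (rule add_divide_distrib)
    also have "real p ^ d * real (cdim (fp n m)) / ?q ^ d = real (cdim (fp n m)) / (real p ^ n) ^ d"
      using p_pos by (simp add: power_mult_distrib)
    finally show "real (cdim (fp (Suc n) m)) / real (p ^ Suc n) ^ d \<le> real (cdim (fp n m)) / real (p ^ n) ^ d + real C / real p ^ Suc n"
      using 2 by simp
  qed
qed

end

section \<open>Localization at a prime ideal\<close>

lemma chain_map:
  assumes F: "\<And>x. x \<in> A \<Longrightarrow> F x \<in> B" "\<And>x y. x \<in> A \<Longrightarrow> y \<in> A \<Longrightarrow> x \<subset> y \<Longrightarrow> F x \<subset> F y"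
    and c: "\<forall>i\<le>n. c i \<in> A" "\<forall>i<n. c i \<subset> c (Suc i)"
  shows "\<exists>c'. (\<forall>i\<le>n. c' i \<in> B) \<and> (\<forall>i<n. c' i \<subset> c' (Suc i))"
proof (rule exI[of _ "\<lambda>i. F (c i)"], intro conjI allI impI)
  show "F (c i) \<in> B" if "i \<le> n" for i using F(1) c(1) that by blast
  show "F (c i) \<subset> F (c (Suc i))" if "i < n" for i
    using F(2)[of "c i" "c (Suc i)"] c that by auto
qed

text \<open>Strictly monotone maps in both directions transport chains of every length. This is
  applied to contraction and extension of primes, for localizations and for quotients.\<close>

lemma chain_transfer:
  assumes "\<And>x. x \<in> A \<Longrightarrow> F x \<in> B" "\<And>x y. x \<in> A \<Longrightarrow> y \<in> A \<Longrightarrow> x \<subset> y \<Longrightarrow> F x \<subset> F y"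
    and "\<And>x. x \<in> B \<Longrightarrow> G x \<in> A" "\<And>x y. x \<in> B \<Longrightarrow> y \<in> B \<Longrightarrow> x \<subset> y \<Longrightarrow> G x \<subset> G y"
  shows "{n::nat. \<exists>c. (\<forall>i\<le>n. c i \<in> A) \<and> (\<forall>i<n. c i \<subset> c (Suc i))}
       = {n. \<exists>c. (\<forall>i\<le>n. c i \<in> B) \<and> (\<forall>i<n. c i \<subset> c (Suc i))}"
proof (rule Set.set_eqI, rule iffI)
  fix n :: nat
  assume "n \<in> {n. \<exists>c. (\<forall>i\<le>n. c i \<in> A) \<and> (\<forall>i<n. c i \<subset> c (Suc i))}"
  then obtain c where c: "\<forall>i\<le>n. c i \<in> A" "\<forall>i<n. c i \<subset> c (Suc i)" by blast
  have "\<exists>c. (\<forall>i\<le>n. c i \<in> B) \<and> (\<forall>i<n. c i \<subset> c (Suc i))" by (rule chain_map[OF assms(1,2) c])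
  then show "n \<in> {n. \<exists>c. (\<forall>i\<le>n. c i \<in> B) \<and> (\<forall>i<n. c i \<subset> c (Suc i))}" by simp
next
  fix n :: nat
  assume "n \<in> {n. \<exists>c. (\<forall>i\<le>n. c i \<in> B) \<and> (\<forall>i<n. c i \<subset> c (Suc i))}"
  then obtain c where c: "\<forall>i\<le>n. c i \<in> B" "\<forall>i<n. c i \<subset> c (Suc i)" by blast
  have "\<exists>c. (\<forall>i\<le>n. c i \<in> A) \<and> (\<forall>i<n. c i \<subset> c (Suc i))" by (rule chain_map[OF assms(3,4) c])
  then show "n \<in> {n. \<exists>c. (\<forall>i\<le>n. c i \<in> A) \<and> (\<forall>i<n. c i \<subset> c (Suc i))}" by simp
qed

context primeideal
begin

abbreviation "M \<equiv> carrier R - I"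
abbreviation "cls a s \<equiv> loc_class R I a s"
abbreviation "A \<equiv> localization R I"

lemma M_one: "\<one> \<in> M" using one_imp_carrier I_notcarr by auto

lemma M_mult: "s \<in> M \<Longrightarrow> t \<in> M \<Longrightarrow> s \<otimes> t \<in> M" using I_prime[of s t] by auto

lemma loc_equiv: "equiv (carrier R \<times> M) (loc_rel R I)"
proof (rule equivI)
  show "loc_rel R I \<subseteq> (carrier R \<times> M) \<times> carrier R \<times> M" by (auto simp: loc_rel_def)
  show "refl_on (carrier R \<times> M) (loc_rel R I)"
  proof (rule refl_onI)
    fix x assume "x \<in> carrier R \<times> M"
    then obtain a s where x: "x = (a, s)" "a \<in> carrier R" "s \<in> M" by blast
    have "\<one> \<otimes> (a \<otimes> s \<ominus> a \<otimes> s) = \<zero>" using x(2,3) by (simp add: a_minus_def r_neg)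
    then show "(x, x) \<in> loc_rel R I" unfolding loc_rel_def x(1) using x(2,3) M_one by blast
  qed
  show "sym (loc_rel R I)"
  proof (rule symI)
    fix x y assume "(x, y) \<in> loc_rel R I"
    then obtain a s b t u where e: "x = (a, s)" "y = (b, t)" "a \<in> carrier R" "b \<in> carrier R" "s \<in> M" "t \<in> M" "u \<in> M"
      "u \<otimes> (a \<otimes> t \<ominus> b \<otimes> s) = \<zero>" unfolding loc_rel_def by auto
    have c: "s \<in> carrier R" "t \<in> carrier R" "u \<in> carrier R" using e by auto
    have "u \<otimes> (b \<otimes> s \<ominus> a \<otimes> t) = \<ominus> (u \<otimes> (a \<otimes> t \<ominus> b \<otimes> s))" using e(3,4) c by algebra
    then have "u \<otimes> (b \<otimes> s \<ominus> a \<otimes> t) = \<zero>" using e(8) by simp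
    then show "(y, x) \<in> loc_rel R I" unfolding loc_rel_def using e by blast
  qed
  show "trans (loc_rel R I)"
  proof (rule transI)
    fix x y z assume "(x, y) \<in> loc_rel R I" "(y, z) \<in> loc_rel R I"
    then obtain a s b t u d w v where e: "x = (a, s)" "y = (b, t)" "z = (d, w)" "a \<in> carrier R" "b \<in> carrier R" "d \<in> carrier R"
      "s \<in> M" "t \<in> M" "w \<in> M" "u \<in> M" "v \<in> M"
      "u \<otimes> (a \<otimes> t \<ominus> b \<otimes> s) = \<zero>" "v \<otimes> (b \<otimes> w \<ominus> d \<otimes> t) = \<zero>" unfolding loc_rel_def by auto
    have c: "s \<in> carrier R" "t \<in> carrier R" "u \<in> carrier R" "w \<in> carrier R" "v \<in> carrier R" using e by auto
    have "((u \<otimes> v) \<otimes> t) \<otimes> (a \<otimes> w \<ominus> d \<otimes> s) = (v \<otimes> w) \<otimes> (u \<otimes> (a \<otimes> t \<ominus> b \<otimes> s)) \<oplus> (u \<otimes> s) \<otimes> (v \<otimes> (b \<otimes> w \<ominus> d \<otimes> t))"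
      using e(4-6) c by algebra
    then have "((u \<otimes> v) \<otimes> t) \<otimes> (a \<otimes> w \<ominus> d \<otimes> s) = \<zero>" unfolding e(12,13) using c by simp
    moreover have "(u \<otimes> v) \<otimes> t \<in> M" using e M_mult by blast
    ultimately show "(x, z) \<in> loc_rel R I" unfolding loc_rel_def using e by blast
  qed
qed

lemma cls_eq_iff:
  assumes "a \<in> carrier R" "b \<in> carrier R" "s \<in> M" "t \<in> M"
  shows "cls a s = cls b t \<longleftrightarrow> (\<exists>u\<in>M. u \<otimes> (a \<otimes> t \<ominus> b \<otimes> s) = \<zero>)"
proof -
  have "cls a s = cls b t \<longleftrightarrow> ((a, s), (b, t)) \<in> loc_rel R I"
    unfolding loc_class_def by (rule eq_equiv_class_iff[OF loc_equiv]) (use assms in auto)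
  also have "\<dots> \<longleftrightarrow> (\<exists>u\<in>M. u \<otimes> (a \<otimes> t \<ominus> b \<otimes> s) = \<zero>)" unfolding loc_rel_def using assms by auto
  finally show ?thesis .
qed

lemma cls_eqI:
  assumes "a \<in> carrier R" "b \<in> carrier R" "s \<in> M" "t \<in> M" "a \<otimes> t = b \<otimes> s"
  shows "cls a s = cls b t"
proof -
  have "\<one> \<otimes> (a \<otimes> t \<ominus> b \<otimes> s) = \<zero>" using assms by (simp add: a_minus_def r_neg)
  then show ?thesis using cls_eq_iff[OF assms(1-4)] M_one by blast
qed

text \<open>The operations on classes use representatives chosen by \<open>SOME\<close>; this gives
  the chosen pair and the fact that it represents the same class.\<close>

lemma cls_rep:
  assumes "a \<in> carrier R" "s \<in> M"
  shows "\<exists>a' s'. (SOME x. x \<in> cls a s) = (a', s') \<and> a' \<in> carrier R \<and> s' \<in> M \<and> cls a' s' = cls a s"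
proof -
  have as: "(a, s) \<in> carrier R \<times> M" using assms by simp
  have "(a, s) \<in> cls a s" unfolding loc_class_def by (rule equiv_class_self[OF loc_equiv as])
  then have "(SOME x. x \<in> cls a s) \<in> cls a s" by (rule someI[of "\<lambda>x. x \<in> cls a s"])
  then have r: "((a, s), SOME x. x \<in> cls a s) \<in> loc_rel R I" unfolding loc_class_def by simp
  obtain a' s' where e: "(SOME x. x \<in> cls a s) = (a', s')" by fastforce
  have "((a, s), (a', s')) \<in> loc_rel R I" using r e by simp
  then have "cls a s = cls a' s'" unfolding loc_class_def by (rule equiv_class_eq[OF loc_equiv])
  moreover have "a' \<in> carrier R" "s' \<in> M" using r e unfolding loc_rel_def by auto
  ultimately show ?thesis using e by blast
qed

lemma loc_carrier: "carrier A = {cls a s | a s. a \<in> carrier R \<and> s \<in> M}"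
  unfolding localization_def loc_class_def quotient_def by auto

lemma cls_in [simp]: "a \<in> carrier R \<Longrightarrow> s \<in> M \<Longrightarrow> cls a s \<in> carrier A"
  unfolding loc_carrier by blast

lemma loc_cases: assumes "x \<in> carrier A" obtains a s where "x = cls a s" "a \<in> carrier R" "s \<in> M"
  using assms unfolding loc_carrier by blast

lemma loc_mult_cls:
  assumes "a \<in> carrier R" "b \<in> carrier R" "s \<in> M" "t \<in> M"
  shows "cls a s \<otimes>\<^bsub>A\<^esub> cls b t = cls (a \<otimes> b) (s \<otimes> t)"
proof -
  obtain a' s' where 1: "(SOME x. x \<in> cls a s) = (a', s')" "a' \<in> carrier R" "s' \<in> M" "cls a' s' = cls a s"
    using cls_rep[OF assms(1,3)] by (elim exE conjE)
  obtain b' t' where 2: "(SOME x. x \<in> cls b t) = (b', t')" "b' \<in> carrier R" "t' \<in> M" "cls b' t' = cls b t"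
    using cls_rep[OF assms(2,4)] by (elim exE conjE)
  obtain u where u: "u \<in> M" "u \<otimes> (a' \<otimes> s \<ominus> a \<otimes> s') = \<zero>"
    using iffD1[OF cls_eq_iff[OF 1(2) assms(1) 1(3) assms(3)] 1(4)] by (elim bexE)
  obtain v where v: "v \<in> M" "v \<otimes> (b' \<otimes> t \<ominus> b \<otimes> t') = \<zero>"
    using iffD1[OF cls_eq_iff[OF 2(2) assms(2) 2(3) assms(4)] 2(4)] by (elim bexE)
  have c: "s \<in> carrier R" "t \<in> carrier R" "s' \<in> carrier R" "t' \<in> carrier R" "u \<in> carrier R" "v \<in> carrier R" using assms 1 2 u v by auto
  have "(u \<otimes> v) \<otimes> ((a' \<otimes> b') \<otimes> (s \<otimes> t) \<ominus> (a \<otimes> b) \<otimes> (s' \<otimes> t'))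
     = ((v \<otimes> b') \<otimes> t) \<otimes> (u \<otimes> (a' \<otimes> s \<ominus> a \<otimes> s')) \<oplus> ((u \<otimes> a) \<otimes> s') \<otimes> (v \<otimes> (b' \<otimes> t \<ominus> b \<otimes> t'))"
    using c assms(1,2) 1(2) 2(2) by algebra
  then have "(u \<otimes> v) \<otimes> ((a' \<otimes> b') \<otimes> (s \<otimes> t) \<ominus> (a \<otimes> b) \<otimes> (s' \<otimes> t')) = \<zero>"
    unfolding u(2) v(2) using c assms(1) 2(2) by simp
  then have "cls (a' \<otimes> b') (s' \<otimes> t') = cls (a \<otimes> b) (s \<otimes> t)"
    using cls_eq_iff[of "a' \<otimes> b'" "a \<otimes> b" "s' \<otimes> t'" "s \<otimes> t"] M_mult[OF u(1) v(1)] M_mult[OF 1(3) 2(3)] M_mult[OF assms(3,4)] assms(1,2) 1(2) 2(2) by blast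
  then show ?thesis by (simp add: localization_def loc_mult_def 1(1) 2(1))
qed

lemma loc_add_cls:
  assumes "a \<in> carrier R" "b \<in> carrier R" "s \<in> M" "t \<in> M"
  shows "cls a s \<oplus>\<^bsub>A\<^esub> cls b t = cls (a \<otimes> t \<oplus> b \<otimes> s) (s \<otimes> t)"
proof -
  obtain a' s' where 1: "(SOME x. x \<in> cls a s) = (a', s')" "a' \<in> carrier R" "s' \<in> M" "cls a' s' = cls a s"
    using cls_rep[OF assms(1,3)] by (elim exE conjE)
  obtain b' t' where 2: "(SOME x. x \<in> cls b t) = (b', t')" "b' \<in> carrier R" "t' \<in> M" "cls b' t' = cls b t"
    using cls_rep[OF assms(2,4)] by (elim exE conjE)
  obtain u where u: "u \<in> M" "u \<otimes> (a' \<otimes> s \<ominus> a \<otimes> s') = \<zero>"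
    using iffD1[OF cls_eq_iff[OF 1(2) assms(1) 1(3) assms(3)] 1(4)] by (elim bexE)
  obtain v where v: "v \<in> M" "v \<otimes> (b' \<otimes> t \<ominus> b \<otimes> t') = \<zero>"
    using iffD1[OF cls_eq_iff[OF 2(2) assms(2) 2(3) assms(4)] 2(4)] by (elim bexE)
  have c: "s \<in> carrier R" "t \<in> carrier R" "s' \<in> carrier R" "t' \<in> carrier R" "u \<in> carrier R" "v \<in> carrier R" using assms 1 2 u v by auto
  have "(u \<otimes> v) \<otimes> ((a' \<otimes> t' \<oplus> b' \<otimes> s') \<otimes> (s \<otimes> t) \<ominus> (a \<otimes> t \<oplus> b \<otimes> s) \<otimes> (s' \<otimes> t'))
     = ((v \<otimes> t) \<otimes> t') \<otimes> (u \<otimes> (a' \<otimes> s \<ominus> a \<otimes> s')) \<oplus> ((u \<otimes> s) \<otimes> s') \<otimes> (v \<otimes> (b' \<otimes> t \<ominus> b \<otimes> t'))"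
    using c assms(1,2) 1(2) 2(2) by algebra
  then have "(u \<otimes> v) \<otimes> ((a' \<otimes> t' \<oplus> b' \<otimes> s') \<otimes> (s \<otimes> t) \<ominus> (a \<otimes> t \<oplus> b \<otimes> s) \<otimes> (s' \<otimes> t')) = \<zero>"
    unfolding u(2) v(2) using c by simp
  then have "cls (a' \<otimes> t' \<oplus> b' \<otimes> s') (s' \<otimes> t') = cls (a \<otimes> t \<oplus> b \<otimes> s) (s \<otimes> t)"
    using cls_eq_iff[of "a' \<otimes> t' \<oplus> b' \<otimes> s'" "a \<otimes> t \<oplus> b \<otimes> s" "s' \<otimes> t'" "s \<otimes> t"]
      M_mult[OF u(1) v(1)] M_mult[OF 1(3) 2(3)] M_mult[OF assms(3,4)] assms(1,2) 1(2) 2(2) c by blast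
  then show ?thesis by (simp add: localization_def loc_add_def 1(1) 2(1))
qed

lemma loc_one: "\<one>\<^bsub>A\<^esub> = cls \<one> \<one>" and loc_zero: "\<zero>\<^bsub>A\<^esub> = cls \<zero> \<one>"
  by (simp_all add: localization_def)

lemma loc_cring: "cring A"
proof (rule cringI)
  note MR = M_mult M_one
  show "abelian_group A"
  proof (rule abelian_groupI)
    fix x y assume "x \<in> carrier A" "y \<in> carrier A"
    then obtain a s b t where e: "x = cls a s" "y = cls b t" "a \<in> carrier R" "b \<in> carrier R" "s \<in> M" "t \<in> M"
      by (elim loc_cases)
    have c: "s \<in> carrier R" "t \<in> carrier R" using e by auto
    show "x \<oplus>\<^bsub>A\<^esub> y \<in> carrier A" unfolding e(1,2) loc_add_cls[OF e(3-6)] by (rule cls_in) (use e c M_mult in auto)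
    show "x \<oplus>\<^bsub>A\<^esub> y = y \<oplus>\<^bsub>A\<^esub> x" unfolding e(1,2) loc_add_cls[OF e(3-6)] loc_add_cls[OF e(4,3,6,5)]
      using c e(3,4) by (simp add: a_comm m_comm)
  next
    show "\<zero>\<^bsub>A\<^esub> \<in> carrier A" unfolding loc_zero by (rule cls_in) (use M_one in auto)
  next
    fix x y z assume "x \<in> carrier A" "y \<in> carrier A" "z \<in> carrier A"
    then obtain a s b t d w where e: "x = cls a s" "y = cls b t" "z = cls d w" "a \<in> carrier R" "b \<in> carrier R" "d \<in> carrier R" "s \<in> M" "t \<in> M" "w \<in> M"
      by (elim loc_cases)
    have c: "s \<in> carrier R" "t \<in> carrier R" "w \<in> carrier R" using e by auto
    have 1: "(x \<oplus>\<^bsub>A\<^esub> y) \<oplus>\<^bsub>A\<^esub> z = cls ((a \<otimes> t \<oplus> b \<otimes> s) \<otimes> w \<oplus> d \<otimes> (s \<otimes> t)) ((s \<otimes> t) \<otimes> w)"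
      unfolding e(1-3) loc_add_cls[OF e(4,5,7,8)] by (rule loc_add_cls) (use e c M_mult in auto)
    have 2: "x \<oplus>\<^bsub>A\<^esub> (y \<oplus>\<^bsub>A\<^esub> z) = cls (a \<otimes> (t \<otimes> w) \<oplus> (b \<otimes> w \<oplus> d \<otimes> t) \<otimes> s) (s \<otimes> (t \<otimes> w))"
      unfolding e(1-3) loc_add_cls[OF e(5,6,8,9)] by (rule loc_add_cls) (use e c M_mult in auto)
    have "(a \<otimes> t \<oplus> b \<otimes> s) \<otimes> w \<oplus> d \<otimes> (s \<otimes> t) = a \<otimes> (t \<otimes> w) \<oplus> (b \<otimes> w \<oplus> d \<otimes> t) \<otimes> s" using e(4-6) c by algebra
    moreover have "(s \<otimes> t) \<otimes> w = s \<otimes> (t \<otimes> w)" using c by (simp add: m_assoc)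
    ultimately show "(x \<oplus>\<^bsub>A\<^esub> y) \<oplus>\<^bsub>A\<^esub> z = x \<oplus>\<^bsub>A\<^esub> (y \<oplus>\<^bsub>A\<^esub> z)" unfolding 1 2 by simp
  next
    fix x assume "x \<in> carrier A"
    then obtain a s where e: "x = cls a s" "a \<in> carrier R" "s \<in> M" by (elim loc_cases)
    have c: "s \<in> carrier R" using e by auto
    show "\<zero>\<^bsub>A\<^esub> \<oplus>\<^bsub>A\<^esub> x = x" unfolding e(1) loc_zero using loc_add_cls[OF zero_closed e(2) M_one e(3)] e(2) c by simp
    have "cls (\<ominus> a) s \<oplus>\<^bsub>A\<^esub> cls a s = cls (\<ominus> a \<otimes> s \<oplus> a \<otimes> s) (s \<otimes> s)" by (rule loc_add_cls) (use e in auto)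
    also have "\<dots> = cls \<zero> \<one>" by (rule cls_eqI) (use e c M_mult M_one in \<open>auto simp: l_minus l_neg\<close>)
    finally show "\<exists>y\<in>carrier A. y \<oplus>\<^bsub>A\<^esub> x = \<zero>\<^bsub>A\<^esub>" unfolding e(1) loc_zero using cls_in[of "\<ominus> a" s] e by blast
  qed
  show "comm_monoid A"
  proof (rule comm_monoidI)
    fix x y assume "x \<in> carrier A" "y \<in> carrier A"
    then obtain a s b t where e: "x = cls a s" "y = cls b t" "a \<in> carrier R" "b \<in> carrier R" "s \<in> M" "t \<in> M"
      by (elim loc_cases)
    have c: "s \<in> carrier R" "t \<in> carrier R" using e by auto
    show "x \<otimes>\<^bsub>A\<^esub> y \<in> carrier A" unfolding e(1,2) loc_mult_cls[OF e(3-6)] by (rule cls_in) (use e c M_mult in auto)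
    show "x \<otimes>\<^bsub>A\<^esub> y = y \<otimes>\<^bsub>A\<^esub> x" unfolding e(1,2) loc_mult_cls[OF e(3-6)] loc_mult_cls[OF e(4,3,6,5)]
      using c e(3,4) by (simp add: m_comm)
  next
    show "\<one>\<^bsub>A\<^esub> \<in> carrier A" unfolding loc_one by (rule cls_in) (use M_one in auto)
  next
    fix x y z assume "x \<in> carrier A" "y \<in> carrier A" "z \<in> carrier A"
    then obtain a s b t d w where e: "x = cls a s" "y = cls b t" "z = cls d w" "a \<in> carrier R" "b \<in> carrier R" "d \<in> carrier R" "s \<in> M" "t \<in> M" "w \<in> M"
      by (elim loc_cases)
    have c: "s \<in> carrier R" "t \<in> carrier R" "w \<in> carrier R" using e by auto
    have 1: "(x \<otimes>\<^bsub>A\<^esub> y) \<otimes>\<^bsub>A\<^esub> z = cls ((a \<otimes> b) \<otimes> d) ((s \<otimes> t) \<otimes> w)"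
      unfolding e(1-3) loc_mult_cls[OF e(4,5,7,8)] by (rule loc_mult_cls) (use e c M_mult in auto)
    have 2: "x \<otimes>\<^bsub>A\<^esub> (y \<otimes>\<^bsub>A\<^esub> z) = cls (a \<otimes> (b \<otimes> d)) (s \<otimes> (t \<otimes> w))"
      unfolding e(1-3) loc_mult_cls[OF e(5,6,8,9)] by (rule loc_mult_cls) (use e c M_mult in auto)
    show "(x \<otimes>\<^bsub>A\<^esub> y) \<otimes>\<^bsub>A\<^esub> z = x \<otimes>\<^bsub>A\<^esub> (y \<otimes>\<^bsub>A\<^esub> z)" unfolding 1 2 using c e(4-6) by (simp add: m_assoc)
  next
    fix x assume "x \<in> carrier A"
    then obtain a s where e: "x = cls a s" "a \<in> carrier R" "s \<in> M" by (elim loc_cases)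
    show "\<one>\<^bsub>A\<^esub> \<otimes>\<^bsub>A\<^esub> x = x" unfolding e(1) loc_one using loc_mult_cls[OF one_closed e(2) M_one e(3)] e by simp
  qed
  fix x y z assume "x \<in> carrier A" "y \<in> carrier A" "z \<in> carrier A"
  then obtain a s b t d w where e: "x = cls a s" "y = cls b t" "z = cls d w" "a \<in> carrier R" "b \<in> carrier R" "d \<in> carrier R" "s \<in> M" "t \<in> M" "w \<in> M"
    by (elim loc_cases)
  have c: "s \<in> carrier R" "t \<in> carrier R" "w \<in> carrier R" using e by auto
  have 1: "(x \<oplus>\<^bsub>A\<^esub> y) \<otimes>\<^bsub>A\<^esub> z = cls ((a \<otimes> t \<oplus> b \<otimes> s) \<otimes> d) ((s \<otimes> t) \<otimes> w)"
    unfolding e(1-3) loc_add_cls[OF e(4,5,7,8)] by (rule loc_mult_cls) (use e c M_mult in auto)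
  have 2: "x \<otimes>\<^bsub>A\<^esub> z \<oplus>\<^bsub>A\<^esub> y \<otimes>\<^bsub>A\<^esub> z = cls ((a \<otimes> d) \<otimes> (t \<otimes> w) \<oplus> (b \<otimes> d) \<otimes> (s \<otimes> w)) ((s \<otimes> w) \<otimes> (t \<otimes> w))"
    unfolding e(1-3) loc_mult_cls[OF e(4,6,7,9)] loc_mult_cls[OF e(5,6,8,9)] by (rule loc_add_cls) (use e c M_mult in auto)
  show "(x \<oplus>\<^bsub>A\<^esub> y) \<otimes>\<^bsub>A\<^esub> z = x \<otimes>\<^bsub>A\<^esub> z \<oplus>\<^bsub>A\<^esub> y \<otimes>\<^bsub>A\<^esub> z" unfolding 1 2
  proof (rule cls_eqI)
    show "((a \<otimes> t \<oplus> b \<otimes> s) \<otimes> d) \<otimes> ((s \<otimes> w) \<otimes> (t \<otimes> w)) = ((a \<otimes> d) \<otimes> (t \<otimes> w) \<oplus> (b \<otimes> d) \<otimes> (s \<otimes> w)) \<otimes> ((s \<otimes> t) \<otimes> w)"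
      using e(4-6) c by algebra
  qed (use e c M_mult in auto)
qed

lemma loc_hom: "ring_hom_ring R A (\<lambda>a. cls a \<one>)"
proof (rule ring_hom_ringI[OF ring_axioms cring.axioms(1)[OF loc_cring]])
  show "cls a \<one> \<in> carrier A" if "a \<in> carrier R" for a using that M_one by simp
  show "cls (a \<otimes> b) \<one> = cls a \<one> \<otimes>\<^bsub>A\<^esub> cls b \<one>" if "a \<in> carrier R" "b \<in> carrier R" for a b
    using loc_mult_cls[OF that M_one M_one] by simp
  show "cls (a \<oplus> b) \<one> = cls a \<one> \<oplus>\<^bsub>A\<^esub> cls b \<one>" if "a \<in> carrier R" "b \<in> carrier R" for a b
    using loc_add_cls[OF that M_one M_one] that by simp
  show "cls \<one> \<one> = \<one>\<^bsub>A\<^esub>" by (simp add: loc_one)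
qed

section \<open>Contraction and extension of ideals\<close>

definition ct :: "('a \<times> 'a) set set \<Rightarrow> 'a set" where "ct J = {a \<in> carrier R. cls a \<one> \<in> J}"

definition ex :: "'a set \<Rightarrow> ('a \<times> 'a) set set" where "ex Q = {cls a s | a s. a \<in> Q \<and> s \<in> M}"

text \<open>The ideals that are recovered by contracting their extension.\<close>

definition sat :: "'a set \<Rightarrow> bool" where "sat Q \<longleftrightarrow> (\<forall>s\<in>M. \<forall>a\<in>carrier R. s \<otimes> a \<in> Q \<longrightarrow> a \<in> Q)"

lemma ct_ideal: "ideal J A \<Longrightarrow> ideal (ct J) R"
  unfolding ct_def using ring_hom_ring.ideal_vimage[OF loc_hom] .

lemma cls_ct:
  assumes J: "ideal J A" and a: "a \<in> carrier R" "s \<in> M" shows "cls a s \<in> J \<longleftrightarrow> a \<in> ct J"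
proof -
  have s: "s \<in> carrier R" using a by auto
  have 1: "cls a \<one> = cls s \<one> \<otimes>\<^bsub>A\<^esub> cls a s"
    unfolding loc_mult_cls[OF s a(1) M_one a(2)] by (rule cls_eqI) (use a s M_one M_mult in \<open>auto simp: m_ac\<close>)
  have 2: "cls a s = cls \<one> s \<otimes>\<^bsub>A\<^esub> cls a \<one>"
    unfolding loc_mult_cls[OF one_closed a(1) a(2) M_one] using a s by simp
  show ?thesis
  proof
    assume "cls a s \<in> J"
    then have "cls a \<one> \<in> J" unfolding 1 using ideal.I_l_closed[OF J] cls_in[OF s M_one] by blast
    then show "a \<in> ct J" using a by (simp add: ct_def)
  next
    assume "a \<in> ct J"
    then have "cls a \<one> \<in> J" by (simp add: ct_def)
    then show "cls a s \<in> J" unfolding 2 using ideal.I_l_closed[OF J] cls_in[OF one_closed a(2)] by blast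
  qed
qed

lemma ex_ct: assumes J: "ideal J A" shows "ex (ct J) = J"
proof
  show "ex (ct J) \<subseteq> J"
  proof
    fix x assume "x \<in> ex (ct J)"
    then obtain a s where e: "x = cls a s" "a \<in> ct J" "s \<in> M" unfolding ex_def by blast
    then have "a \<in> carrier R" by (simp add: ct_def)
    then show "x \<in> J" using cls_ct[OF J _ e(3)] e by simp
  qed
  show "J \<subseteq> ex (ct J)"
  proof
    fix x assume x: "x \<in> J"
    then have "x \<in> carrier A" using ideal.Icarr[OF J] by blast
    then obtain a s where e: "x = cls a s" "a \<in> carrier R" "s \<in> M" by (elim loc_cases)
    then have "a \<in> ct J" using cls_ct[OF J e(2,3)] x by simp
    then show "x \<in> ex (ct J)" unfolding ex_def using e by blast
  qed
qed

lemma ct_sat: assumes J: "ideal J A" shows "sat (ct J)"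
  unfolding sat_def
proof (intro ballI impI)
  fix s a assume s: "s \<in> M" "a \<in> carrier R" "s \<otimes> a \<in> ct J"
  have sc: "s \<in> carrier R" using s by auto
  have "cls a \<one> = cls (s \<otimes> a) s" by (rule cls_eqI) (use s sc M_one in \<open>auto simp: m_ac\<close>)
  moreover have "cls (s \<otimes> a) s \<in> J" using cls_ct[OF J _ s(1), of "s \<otimes> a"] s sc by simp
  ultimately show "a \<in> ct J" using s by (simp add: ct_def)
qed

lemma ct_strict: "ideal J A \<Longrightarrow> ideal J' A \<Longrightarrow> J \<subset> J' \<Longrightarrow> ct J \<subset> ct J'"
proof -
  assume J: "ideal J A" "ideal J' A" "J \<subset> J'"
  have "ct J \<subseteq> ct J'" using J(3) by (auto simp: ct_def)
  moreover have "ct J \<noteq> ct J'"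
  proof
    assume "ct J = ct J'"
    then have "ex (ct J) = ex (ct J')" by (rule arg_cong)
    then show False unfolding ex_ct[OF J(1)] ex_ct[OF J(2)] using J(3) by blast
  qed
  ultimately show ?thesis by blast
qed

lemma ex_ideal: assumes Q: "ideal Q R" shows "ideal (ex Q) A"
proof (rule cring.ideal_setI[OF loc_cring])
  have Qc: "a \<in> carrier R" if "a \<in> Q" for a using idealD[OF Q that] .
  show "ex Q \<subseteq> carrier A" using Qc by (auto simp: ex_def)
  show "\<zero>\<^bsub>A\<^esub> \<in> ex Q" unfolding loc_zero ex_def using ideal_zero[OF Q] M_one by blast
  show "x \<oplus>\<^bsub>A\<^esub> y \<in> ex Q" if "x \<in> ex Q" "y \<in> ex Q" for x y
  proof -
    obtain a s b t where e: "x = cls a s" "y = cls b t" "a \<in> Q" "b \<in> Q" "s \<in> M" "t \<in> M" using \<open>x \<in> ex Q\<close> \<open>y \<in> ex Q\<close> unfolding ex_def by blast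
    have "x \<oplus>\<^bsub>A\<^esub> y = cls (a \<otimes> t \<oplus> b \<otimes> s) (s \<otimes> t)" unfolding e(1,2) by (rule loc_add_cls) (use e Qc in auto)
    moreover have "a \<otimes> t \<oplus> b \<otimes> s \<in> Q" using ideal_add[OF Q] ideal.I_r_closed[OF Q] e by auto
    ultimately show ?thesis unfolding ex_def using M_mult[OF e(5,6)] by blast
  qed
  show "r \<otimes>\<^bsub>A\<^esub> x \<in> ex Q" if "x \<in> ex Q" "r \<in> carrier A" for x r
  proof -
    obtain a s where e: "x = cls a s" "a \<in> Q" "s \<in> M" using \<open>x \<in> ex Q\<close> unfolding ex_def by blast
    obtain b t where f: "r = cls b t" "b \<in> carrier R" "t \<in> M" using loc_cases[OF \<open>r \<in> carrier A\<close>] by blast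
    have "r \<otimes>\<^bsub>A\<^esub> x = cls (b \<otimes> a) (t \<otimes> s)" unfolding e(1) f(1) by (rule loc_mult_cls) (use e f Qc in auto)
    moreover have "b \<otimes> a \<in> Q" using ideal.I_l_closed[OF Q e(2) f(2)] .
    ultimately show ?thesis unfolding ex_def using M_mult[OF f(3) e(3)] by blast
  qed
qed

lemma ct_ex: assumes Q: "ideal Q R" "sat Q" shows "ct (ex Q) = Q"
proof
  have Qc: "a \<in> carrier R" if "a \<in> Q" for a using idealD[OF Q(1) that] .
  show "Q \<subseteq> ct (ex Q)" using Qc M_one by (auto simp: ct_def ex_def)
  show "ct (ex Q) \<subseteq> Q"
  proof
    fix a assume "a \<in> ct (ex Q)"
    then obtain b t where e: "a \<in> carrier R" "cls a \<one> = cls b t" "b \<in> Q" "t \<in> M" unfolding ct_def ex_def by blast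
    have tc: "t \<in> carrier R" using e by auto
    obtain u where u: "u \<in> M" "u \<otimes> (a \<otimes> t \<ominus> b \<otimes> \<one>) = \<zero>" using e(2) cls_eq_iff[OF e(1) Qc[OF e(3)] M_one e(4)] by blast
    have uc: "u \<in> carrier R" using u by auto
    have "(u \<otimes> t) \<otimes> a = u \<otimes> (a \<otimes> t \<ominus> b \<otimes> \<one>) \<oplus> u \<otimes> b" using uc tc e(1) Qc[OF e(3)] by algebra
    then have "(u \<otimes> t) \<otimes> a = u \<otimes> b" unfolding u(2) using uc Qc[OF e(3)] by simp
    then have "(u \<otimes> t) \<otimes> a \<in> Q" using ideal.I_l_closed[OF Q(1) e(3) uc] by simp
    then show "a \<in> Q" using Q(2) M_mult[OF u(1) e(4)] e(1) unfolding sat_def by blast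
  qed
qed

lemma ex_strict: "ideal Q R \<Longrightarrow> sat Q \<Longrightarrow> ideal Q' R \<Longrightarrow> sat Q' \<Longrightarrow> Q \<subset> Q' \<Longrightarrow> ex Q \<subset> ex Q'"
proof -
  assume Q: "ideal Q R" "sat Q" "ideal Q' R" "sat Q'" "Q \<subset> Q'"
  have "ex Q \<subseteq> ex Q'" using Q(5) by (auto simp: ex_def)
  moreover have "ex Q \<noteq> ex Q'"
  proof
    assume "ex Q = ex Q'"
    then have "ct (ex Q) = ct (ex Q')" by (rule arg_cong)
    then show False unfolding ct_ex[OF Q(1,2)] ct_ex[OF Q(3,4)] using Q(5) by blast
  qed
  ultimately show ?thesis by blast
qed

lemma ct_prime: assumes J: "primeideal J A" shows "primeideal (ct J) R" "ct J \<subseteq> I"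
proof -
  interpret J: primeideal J A by (rule J)
  show "primeideal (ct J) R" unfolding ct_def by (rule ring_hom_ring.primeideal_vimage[OF loc_hom is_cring J])
  show "ct J \<subseteq> I"
  proof
    fix s assume s: "s \<in> ct J"
    show "s \<in> I"
    proof (rule ccontr)
      assume "s \<notin> I"
      then have sM: "s \<in> M" using s by (simp add: ct_def)
      have "s \<otimes> \<one> \<in> ct J" using s by (simp add: ct_def)
      then have "\<one> \<in> ct J" using ct_sat[OF J.is_ideal] sM unfolding sat_def by blast
      then have "\<one>\<^bsub>A\<^esub> \<in> J" by (simp add: ct_def loc_one)
      then show False using J.one_imp_carrier J.I_notcarr by simp
    qed
  qed
qed

lemma prime_sat: "primeideal Q R \<Longrightarrow> Q \<subseteq> I \<Longrightarrow> sat Q"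
  unfolding sat_def
proof (intro ballI impI)
  fix s a assume "primeideal Q R" "Q \<subseteq> I" "s \<in> M" "a \<in> carrier R" "s \<otimes> a \<in> Q"
  then show "a \<in> Q" using primeideal.I_prime[of Q R s a] by blast
qed

lemma ex_prime: assumes Q: "primeideal Q R" "Q \<subseteq> I" shows "primeideal (ex Q) A"
proof -
  have Qi: "ideal Q R" using primeideal.axioms(1)[OF Q(1)] .
  have ce: "ct (ex Q) = Q" by (rule ct_ex[OF Qi prime_sat[OF Q]])
  note E = ex_ideal[OF Qi]
  show ?thesis
  proof (rule primeidealI[OF E loc_cring])
    show "carrier A \<noteq> ex Q"
    proof
      assume "carrier A = ex Q"
      then have "\<one> \<in> ct (ex Q)" using cls_in[OF one_closed M_one] by (simp add: ct_def)
      then show False unfolding ce using Q(2) M_one by blast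
    qed
    fix x y assume xy: "x \<in> carrier A" "y \<in> carrier A" "x \<otimes>\<^bsub>A\<^esub> y \<in> ex Q"
    then obtain a s b t where e: "x = cls a s" "y = cls b t" "a \<in> carrier R" "b \<in> carrier R" "s \<in> M" "t \<in> M"
      by (elim loc_cases)
    have "cls (a \<otimes> b) (s \<otimes> t) \<in> ex Q" using xy(3) unfolding e(1,2) loc_mult_cls[OF e(3-6)] .
    then have "a \<otimes> b \<in> Q" using cls_ct[OF E _ M_mult[OF e(5,6)], of "a \<otimes> b"] e ce by simp
    then have "a \<in> Q \<or> b \<in> Q" using primeideal.I_prime[OF Q(1)] e by blast
    then show "x \<in> ex Q \<or> y \<in> ex Q" unfolding e(1,2) using cls_ct[OF E e(3,5)] cls_ct[OF E e(4,6)] ce by simp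
  qed
qed

lemma krull_dim_loc:
  "krull_dim A = Sup {n. \<exists>c. (\<forall>i\<le>n. primeideal (c i) R \<and> c i \<subseteq> I) \<and> (\<forall>i<n. c i \<subset> c (Suc i))}"
proof -
  have "{n. \<exists>c. (\<forall>i\<le>n. c i \<in> {J. primeideal J A}) \<and> (\<forall>i<n. c i \<subset> c (Suc i))}
     = {n. \<exists>c. (\<forall>i\<le>n. c i \<in> {Q. primeideal Q R \<and> Q \<subseteq> I}) \<and> (\<forall>i<n. c i \<subset> c (Suc i))}"
  proof (rule chain_transfer[where F = ct and G = ex])
    show "ct J \<in> {Q. primeideal Q R \<and> Q \<subseteq> I}" if "J \<in> {J. primeideal J A}" for J using that ct_prime by blast
    show "ex Q \<in> {J. primeideal J A}" if "Q \<in> {Q. primeideal Q R \<and> Q \<subseteq> I}" for Q using that ex_prime by blast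
    show "ct J \<subset> ct J'" if "J \<in> {J. primeideal J A}" "J' \<in> {J. primeideal J A}" "J \<subset> J'" for J J'
      using that ct_strict primeideal.axioms(1) by blast
    show "ex Q \<subset> ex Q'" if Q: "Q \<in> {Q. primeideal Q R \<and> Q \<subseteq> I}" "Q' \<in> {Q. primeideal Q R \<and> Q \<subseteq> I}" "Q \<subset> Q'" for Q Q'
      using Q ex_strict[of Q Q'] prime_sat[of Q] prime_sat[of Q'] primeideal.axioms(1) by blast
  qed
  then show ?thesis unfolding krull_dim_def by simp
qed

lemma genideal_loc:
  assumes T: "T \<subseteq> carrier R" shows "genideal A ((\<lambda>a. cls a \<one>) ` T) = ex (Idl T)"
proof -
  interpret A: cring A by (rule loc_cring)
  have Tc: "(\<lambda>a. cls a \<one>) ` T \<subseteq> carrier A" using T M_one by auto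
  have G: "ideal (genideal A ((\<lambda>a. cls a \<one>) ` T)) A" by (rule A.genideal_ideal[OF Tc])
  show ?thesis
  proof
    show "genideal A ((\<lambda>a. cls a \<one>) ` T) \<subseteq> ex (Idl T)"
      by (rule A.genideal_minimal[OF ex_ideal[OF genideal_ideal[OF T]]])
        (use genideal_self[OF T] M_one in \<open>auto simp: ex_def\<close>)
    have "T \<subseteq> ct (genideal A ((\<lambda>a. cls a \<one>) ` T))" using T A.genideal_self[OF Tc] by (auto simp: ct_def)
    then have "Idl T \<subseteq> ct (genideal A ((\<lambda>a. cls a \<one>) ` T))" by (rule genideal_minimal[OF ct_ideal[OF G]])
    then have "ex (Idl T) \<subseteq> ex (ct (genideal A ((\<lambda>a. cls a \<one>) ` T)))" by (auto simp: ex_def)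
    then show "ex (Idl T) \<subseteq> genideal A ((\<lambda>a. cls a \<one>) ` T)" using ex_ct[OF G] by simp
  qed
qed

lemma loc_ext_eq: assumes "ideal Q R" shows "loc_ext R I Q = ex Q"
proof -
  have Qc: "Q \<subseteq> carrier R" using idealD[OF assms] by blast
  have "Idl Q = Q" using genideal_minimal[OF assms subset_refl] genideal_self[OF Qc] by blast
  then show ?thesis unfolding loc_ext_def genideal_loc[OF Qc] by simp
qed

lemma cls_pow: "a \<in> carrier R \<Longrightarrow> s \<in> M \<Longrightarrow> cls a s [^]\<^bsub>A\<^esub> (n::nat) = cls (a [^] n) (s [^] n) \<and> s [^] n \<in> M"
proof (induction n)
  case 0
  interpret A: cring A by (rule loc_cring)
  show ?case using M_one by (simp add: loc_one)
next
  case (Suc n)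
  interpret A: cring A by (rule loc_cring)
  have "s [^] n \<in> M" "cls a s [^]\<^bsub>A\<^esub> n = cls (a [^] n) (s [^] n)" using Suc by auto
  then show ?case using loc_mult_cls[of "a [^] n" a "s [^] n" s] M_mult[of "s [^] n" s] Suc.prems by simp
qed

lemma frob_power_loc:
  assumes Q: "ideal Q R" shows "frob_power A (ex Q) q = ex (Idl ((\<lambda>a. a [^] q) ` Q))"
proof -
  interpret A: cring A by (rule loc_cring)
  have Qc: "a \<in> carrier R" if "a \<in> Q" for a using idealD[OF Q that] .
  have Tc: "(\<lambda>a. a [^] q) ` Q \<subseteq> carrier R" using Qc by auto
  have Ec: "(\<lambda>i. i [^]\<^bsub>A\<^esub> q) ` ex Q \<subseteq> carrier A" using A.nat_pow_closed A.idealD[OF ex_ideal[OF Q]] by blast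
  have "frob_power A (ex Q) q = genideal A ((\<lambda>a. cls a \<one>) ` ((\<lambda>a. a [^] q) ` Q))" (is "_ = ?G")
  proof
    have Gc: "(\<lambda>a. cls a \<one>) ` ((\<lambda>a. a [^] q) ` Q) \<subseteq> carrier A" using Tc M_one by auto
    note G = A.genideal_ideal[OF Gc]
    show "frob_power A (ex Q) q \<subseteq> ?G" unfolding frob_power_def
    proof (rule A.genideal_minimal[OF G], rule subsetI)
      fix x assume "x \<in> (\<lambda>i. i [^]\<^bsub>A\<^esub> q) ` ex Q"
      then obtain a s where e: "a \<in> Q" "s \<in> M" "x = cls a s [^]\<^bsub>A\<^esub> q" unfolding ex_def by blast
      have p: "x = cls (a [^] q) (s [^] q)" "s [^] q \<in> M" using cls_pow[OF Qc[OF e(1)] e(2), of q] e(3) by auto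
      have "cls (a [^] q) \<one> \<in> ?G" using A.genideal_self[OF Gc] e(1) by blast
      then have "a [^] q \<in> ct ?G" using Qc[OF e(1)] by (simp add: ct_def)
      then show "x \<in> ?G" unfolding p(1) using cls_ct[OF G _ p(2)] Qc[OF e(1)] by simp
    qed
    have "(\<lambda>a. cls a \<one>) ` ((\<lambda>a. a [^] q) ` Q) \<subseteq> (\<lambda>i. i [^]\<^bsub>A\<^esub> q) ` ex Q"
    proof
      fix x assume "x \<in> (\<lambda>a. cls a \<one>) ` ((\<lambda>a. a [^] q) ` Q)"
      then obtain a where a: "a \<in> Q" "x = cls (a [^] q) \<one>" by blast
      have "x = cls a \<one> [^]\<^bsub>A\<^esub> q" using cls_pow[OF Qc[OF a(1)] M_one, of q] a(2) by simp
      moreover have "cls a \<one> \<in> ex Q" unfolding ex_def using a(1) M_one by blast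
      ultimately show "x \<in> (\<lambda>i. i [^]\<^bsub>A\<^esub> q) ` ex Q" by blast
    qed
    then have "(\<lambda>a. cls a \<one>) ` ((\<lambda>a. a [^] q) ` Q) \<subseteq> frob_power A (ex Q) q"
      unfolding frob_power_def using A.genideal_self[OF Ec] by blast
    then show "?G \<subseteq> frob_power A (ex Q) q"
      unfolding frob_power_def by (rule A.genideal_minimal[OF A.genideal_ideal[OF Ec]])
  qed
  then show ?thesis unfolding genideal_loc[OF Tc] .
qed

text \<open>When every ideal above Q is saturated, extension and contraction are inverse to each
  other there, so strict chains correspond and the length can be read off in R.\<close>

lemma quot_length_loc:
  assumes Q: "ideal Q R" and sat: "\<And>J. ideal J R \<Longrightarrow> Q \<subseteq> J \<Longrightarrow> sat J"
  shows "quot_length A (ex Q) = Sup {n. \<exists>c :: nat \<Rightarrow> 'a set. c 0 = Q \<and> c n = carrier R \<and> (\<forall>i\<le>n. ideal (c i) R) \<and> (\<forall>i<n. c i \<subset> c (Suc i))}"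
proof -
  have exR: "ex (carrier R) = carrier A" by (auto simp: ex_def loc_carrier)
  have ctA: "ct (carrier A) = carrier R" using M_one by (auto simp: ct_def)
  have ceQ: "ct (ex Q) = Q" by (rule ct_ex[OF Q sat[OF Q subset_refl]])
  have up: "Q \<subseteq> c i" if "c 0 = Q" "\<forall>i<n. c i \<subset> c (Suc i)" "i \<le> n" for c :: "nat \<Rightarrow> 'a set" and n i
    using chain_increasing[OF that(2,3)] that(1) by blast
  have "(\<exists>c. c 0 = ex Q \<and> c n = carrier A \<and> (\<forall>i\<le>n. ideal (c i) A) \<and> (\<forall>i<n. c i \<subset> c (Suc i)))
    \<longleftrightarrow> (\<exists>c :: nat \<Rightarrow> 'a set. c 0 = Q \<and> c n = carrier R \<and> (\<forall>i\<le>n. ideal (c i) R) \<and> (\<forall>i<n. c i \<subset> c (Suc i)))" for n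
  proof
    assume "\<exists>c. c 0 = ex Q \<and> c n = carrier A \<and> (\<forall>i\<le>n. ideal (c i) A) \<and> (\<forall>i<n. c i \<subset> c (Suc i))"
    then obtain c where c: "c 0 = ex Q" "c n = carrier A" "\<forall>i\<le>n. ideal (c i) A" "\<forall>i<n. c i \<subset> c (Suc i)" by (elim exE conjE)
    show "\<exists>c :: nat \<Rightarrow> 'a set. c 0 = Q \<and> c n = carrier R \<and> (\<forall>i\<le>n. ideal (c i) R) \<and> (\<forall>i<n. c i \<subset> c (Suc i))"
    proof (rule exI[of _ "\<lambda>i. ct (c i)"], intro conjI allI impI)
      show "ct (c 0) = Q" using c(1) ceQ by simp
      show "ct (c n) = carrier R" using c(2) ctA by simp
      show "ideal (ct (c i)) R" if "i \<le> n" for i using ct_ideal c(3) that by blast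
      show "ct (c i) \<subset> ct (c (Suc i))" if "i < n" for i using ct_strict[of "c i" "c (Suc i)"] c(3,4) that by simp
    qed
  next
    assume "\<exists>c :: nat \<Rightarrow> 'a set. c 0 = Q \<and> c n = carrier R \<and> (\<forall>i\<le>n. ideal (c i) R) \<and> (\<forall>i<n. c i \<subset> c (Suc i))"
    then obtain c :: "nat \<Rightarrow> 'a set" where c: "c 0 = Q" "c n = carrier R" "\<forall>i\<le>n. ideal (c i) R" "\<forall>i<n. c i \<subset> c (Suc i)" by (elim exE conjE)
    have s: "sat (c i)" "ideal (c i) R" if "i \<le> n" for i using sat[of "c i"] up[OF c(1,4) that] c(3) that by auto
    show "\<exists>c. c 0 = ex Q \<and> c n = carrier A \<and> (\<forall>i\<le>n. ideal (c i) A) \<and> (\<forall>i<n. c i \<subset> c (Suc i))"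
    proof (rule exI[of _ "\<lambda>i. ex (c i)"], intro conjI allI impI)
      show "ex (c 0) = ex Q" using c(1) by simp
      show "ex (c n) = carrier A" using c(2) exR by simp
      show "ideal (ex (c i)) A" if "i \<le> n" for i using ex_ideal s(2)[OF that] by blast
      show "ex (c i) \<subset> ex (c (Suc i))" if "i < n" for i using ex_strict[of "c i" "c (Suc i)"] s[of i] s[of "Suc i"] c(4) that by simp
    qed
  qed
  then show ?thesis unfolding quot_length_def by simp
qed

lemma krull_dim_quot:
  "krull_dim (R Quot I) = Sup {n. \<exists>c. (\<forall>i\<le>n. primeideal (c i) R \<and> I \<subseteq> c i) \<and> (\<forall>i<n. c i \<subset> c (Suc i))}"
proof -
  interpret H: ring_hom_ring R "R Quot I" "(+>) I" by (rule rcos_ring_hom_ring)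
  have qc: "cring (R Quot I)" by (rule quotient_is_cring[OF is_cring])
  define pre where "pre J = {r \<in> carrier R. I +> r \<in> J}" for J
  define im where "im Q = (+>) I ` Q" for Q
  have carr: "carrier (R Quot I) = (+>) I ` carrier R"
    unfolding FactRing_def A_RCOSETS_def' by auto
  have im_iff: "I +> a \<in> im Q \<longleftrightarrow> a \<in> Q" if Q: "ideal Q R" "I \<subseteq> Q" and a: "a \<in> carrier R" for a Q
  proof
    assume "I +> a \<in> im Q"
    then obtain q where q: "q \<in> Q" "I +> a = I +> q" unfolding im_def by blast
    have qc: "q \<in> carrier R" using idealD[OF Q(1) q(1)] .
    have "a \<ominus> q \<in> I" using quotient_eq_iff_same_a_r_cos[OF is_ideal a qc] q(2) by blast
    then have "a \<ominus> q \<oplus> q \<in> Q" using ideal_add[OF Q(1) _ q(1)] Q(2) by blast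
    moreover have "a \<ominus> q \<oplus> q = a" using a qc by algebra
    ultimately show "a \<in> Q" by simp
  qed (auto simp: im_def)
  have im_pre: "im (pre J) = J" if "ideal J (R Quot I)" for J
    using ideal.Icarr[OF that] carr by (fastforce simp: im_def pre_def)
  have "{n. \<exists>c. (\<forall>i\<le>n. c i \<in> {J. primeideal J (R Quot I)}) \<and> (\<forall>i<n. c i \<subset> c (Suc i))}
     = {n. \<exists>c. (\<forall>i\<le>n. c i \<in> {Q. primeideal Q R \<and> I \<subseteq> Q}) \<and> (\<forall>i<n. c i \<subset> c (Suc i))}"
  proof (rule chain_transfer[where F = pre and G = im])
    fix J assume "J \<in> {J. primeideal J (R Quot I)}"
    then have J: "primeideal J (R Quot I)" by simp
    have "primeideal (pre J) R" unfolding pre_def by (rule H.primeideal_vimage[OF is_cring J])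
    moreover have "I \<subseteq> pre J"
    proof
      fix a assume a: "a \<in> I"
      have Ia: "I +> a = I" using a by (rule a_rcos_const)
      have "\<zero>\<^bsub>R Quot I\<^esub> \<in> J" by (rule additive_subgroup.zero_closed[OF ideal.axioms(1)[OF primeideal.axioms(1)[OF J]]])
      then have "I +> a \<in> J" unfolding Ia by (simp only: FactRing_def ring.simps)
      then show "a \<in> pre J" unfolding pre_def using Icarr[OF a] by blast
    qed
    ultimately show "pre J \<in> {Q. primeideal Q R \<and> I \<subseteq> Q}" by simp
  next
    fix J J' assume J: "J \<in> {J. primeideal J (R Quot I)}" "J' \<in> {J. primeideal J (R Quot I)}" "J \<subset> J'"
    have "pre J \<subseteq> pre J'" using J(3) by (auto simp: pre_def)
    moreover have "pre J \<noteq> pre J'"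
    proof
      have Ji: "ideal J (R Quot I)" "ideal J' (R Quot I)" using J(1,2) primeideal.axioms(1) by auto
      assume "pre J = pre J'"
      then have "im (pre J) = im (pre J')" by (rule arg_cong)
      then show False unfolding im_pre[OF Ji(1)] im_pre[OF Ji(2)] using J(3) by blast
    qed
    ultimately show "pre J \<subset> pre J'" by blast
  next
    fix Q assume "Q \<in> {Q. primeideal Q R \<and> I \<subseteq> Q}"
    then have Q: "primeideal Q R" "I \<subseteq> Q" by auto
    have Qi: "ideal Q R" using primeideal.axioms(1)[OF Q(1)] .
    have "ideal (im Q) (R Quot I)" unfolding im_def using ring_ideal_imp_quot_ideal[OF is_ideal Qi] .
    then have "primeideal (im Q) (R Quot I)"
    proof (rule primeidealI[OF _ qc])
      show "carrier (R Quot I) \<noteq> im Q"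
      proof
        assume "carrier (R Quot I) = im Q"
        then have "I +> \<one> \<in> im Q" using carr by blast
        then have "\<one> \<in> Q" using im_iff[OF Qi Q(2)] by blast
        then show False using ideal.one_imp_carrier[OF Qi] primeideal.I_notcarr[OF Q(1)] by simp
      qed
      fix x y assume xy: "x \<in> carrier (R Quot I)" "y \<in> carrier (R Quot I)" "x \<otimes>\<^bsub>R Quot I\<^esub> y \<in> im Q"
      obtain a where a: "a \<in> carrier R" "x = I +> a" using xy(1) unfolding carr image_iff by (elim bexE)
      obtain b where b: "b \<in> carrier R" "y = I +> b" using xy(2) unfolding carr image_iff by (elim bexE)
      note ab = a(1) b(1) a(2) b(2)
      have "I +> (a \<otimes> b) \<in> im Q" using xy(3) unfolding ab(3,4) H.hom_mult[OF ab(1,2)] .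
      then have "a \<otimes> b \<in> Q" using im_iff[OF Qi Q(2) m_closed[OF ab(1,2)]] by (rule iffD1[rotated])
      then have "a \<in> Q \<or> b \<in> Q" using primeideal.I_prime[OF Q(1)] ab by blast
      then show "x \<in> im Q \<or> y \<in> im Q" unfolding ab(3,4) im_def by blast
    qed
    then show "im Q \<in> {J. primeideal J (R Quot I)}" by simp
  next
    fix Q Q' assume Q: "Q \<in> {Q. primeideal Q R \<and> I \<subseteq> Q}" "Q' \<in> {Q. primeideal Q R \<and> I \<subseteq> Q}" "Q \<subset> Q'"
    have Qi: "ideal Q R" "ideal Q' R" using Q primeideal.axioms(1) by blast+
    obtain a where a: "a \<in> Q'" "a \<notin> Q" using Q(3) by blast
    have "I \<subseteq> Q" using Q(1) by simp
    then have "I +> a \<notin> im Q" using im_iff[OF Qi(1) _ idealD[OF Qi(2) a(1)]] a(2) by simp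
    moreover have "I +> a \<in> im Q'" unfolding im_def using a(1) by (rule imageI)
    moreover have "im Q \<subseteq> im Q'" unfolding im_def using Q(3) by (intro image_mono) simp
    ultimately show "im Q \<subset> im Q'" by auto
  qed
  then show ?thesis unfolding krull_dim_def by simp
qed

end

section \<open>Hilbert--Kunz multiplicities as limits of vector space dimensions\<close>

context affine_alg
begin

lemma maximal_spans:
  assumes m: "maximalideal m R" shows "spans m {\<one>}"
  unfolding spans_def
proof (intro conjI ballI)
  interpret m: maximalideal m R by fact
  fix x assume x: "x \<in> carrier R"
  obtain c where c: "c \<in> k" "x \<ominus> c \<in> m" using maximal_residue[OF m x] by auto
  have "\<one> \<in> lspan R k {\<one>}" by (rule k.lspan_incl) auto
  then have "c \<otimes> \<one> \<in> lspan R k {\<one>}" using c by (intro k.lspan_scal) auto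
  moreover have "x = c \<otimes> \<one> \<oplus> (x \<ominus> c)" using x k.LD[OF c(1)] by algebra
  ultimately show "\<exists>s\<in>lspan R k {\<one>}. \<exists>j\<in>m. x = s \<oplus> j" using c by blast
qed auto

text \<open>If some \<mu> in m does not move y into J, multiply y by the highest power of \<mu>
  keeping it outside J; powers of \<mu> do reach J, as m^[q] lies in J. The colon ideal J : y grows
  strictly, so Noetherian induction ends at a socle element.\<close>

lemma socle_element:
  assumes m: "maximalideal m R" and J: "ideal J R" "fp e m \<subseteq> J" "J \<noteq> carrier R"
  shows "\<exists>y\<in>carrier R. y \<notin> J \<and> (\<forall>\<mu>\<in>m. y \<otimes> \<mu> \<in> J)" (is ?socle)
proof -
  interpret m: maximalideal m R by fact
  interpret J: ideal J R by fact
  have main: "\<forall>y\<in>carrier R. y \<notin> J \<longrightarrow> Q = {r \<in> carrier R. y \<otimes> r \<in> J} \<longrightarrow> ?socle" if "ideal Q R" for Q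
    using that
  proof (induction Q rule: noeth_induct)
    case (1 Q)
    show ?case
    proof (intro ballI impI)
      fix y assume y: "y \<in> carrier R" "y \<notin> J" "Q = {r \<in> carrier R. y \<otimes> r \<in> J}"
      show ?socle
      proof (cases "\<forall>\<mu>\<in>m. y \<otimes> \<mu> \<in> J")
        case True
        then show ?thesis using y by blast
      next
        case False
        then obtain \<mu> where \<mu>: "\<mu> \<in> m" "y \<otimes> \<mu> \<notin> J" by blast
        have mc: "\<mu> \<in> carrier R" using \<mu> m.Icarr by simp
        define j where "j = (LEAST j::nat. y \<otimes> \<mu> [^] j \<in> J)"
        have "fr e \<mu> \<in> J" using fr_fp[OF m.is_ideal \<mu>(1)] J(2) by blast
        then have "y \<otimes> \<mu> [^] (p ^ e) \<in> J" using y(1) J.I_l_closed by (simp add: fr_def)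
        then have jJ: "y \<otimes> \<mu> [^] j \<in> J" unfolding j_def by (rule LeastI)
        have "j \<noteq> 0" using jJ y by (metis nat_pow_0 r_one)
        then obtain i where i: "j = Suc i" using not0_implies_Suc by blast
        have iJ: "y \<otimes> \<mu> [^] i \<notin> J" using not_less_Least[of i "\<lambda>j. y \<otimes> \<mu> [^] j \<in> J"] i j_def by simp
        let ?y = "y \<otimes> \<mu> [^] i"
        have yc: "?y \<in> carrier R" using y mc by simp
        have "\<mu> \<in> {r \<in> carrier R. ?y \<otimes> r \<in> J}" using jJ i mc y(1) by (simp add: m_assoc)
        moreover have "\<mu> \<notin> Q" using y \<mu> by simp
        moreover have "Q \<subseteq> {r \<in> carrier R. ?y \<otimes> r \<in> J}"
        proof
          fix r assume "r \<in> Q"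
          then have r: "r \<in> carrier R" "y \<otimes> r \<in> J" using y by auto
          have "?y \<otimes> r = \<mu> [^] i \<otimes> (y \<otimes> r)" using r(1) y(1) mc by (simp add: m_ac)
          then show "r \<in> {r \<in> carrier R. ?y \<otimes> r \<in> J}" using r J.I_l_closed[OF r(2), of "\<mu> [^] i"] mc by simp
        qed
        ultimately have "Q \<subset> {r \<in> carrier R. ?y \<otimes> r \<in> J}" by blast
        from 1(2)[OF idl_quot(1)[OF J(1) yc] this] show ?thesis using yc iJ by blast
      qed
    qed
  qed
  have "\<one> \<notin> J" using J.one_imp_carrier J(3) by blast
  then show ?thesis using main[OF idl_quot(1)[OF J(1), of \<one>]] by blast
qed

text \<open>Adding a socle element lowers the codimension by exactly one because the residue field
  is k, which builds a chain of length \<open>cdim J\<close>. No chain is longer, since every strict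
  inclusion lowers the codimension.\<close>

lemma cdim_length:
  assumes m: "maximalideal m R" and J: "ideal J R" "fp e m \<subseteq> J"
  shows "Sup {n. \<exists>c :: nat \<Rightarrow> 'a set. c 0 = J \<and> c n = carrier R \<and> (\<forall>i\<le>n. ideal (c i) R) \<and> (\<forall>i<n. c i \<subset> c (Suc i))} = cdim J"
    (is "Sup {n. \<exists>c. ?chain c J n} = _")
proof (rule cSup_eq_maximum)
  interpret m: maximalideal m R by fact
  have ex: "\<exists>c. ?chain c J (cdim J)" using J
  proof (induction "cdim J" arbitrary: J rule: less_induct)
    case less
    note sp = spans_mono[OF fp_spans[OF m] less.prems(2)]
    show ?case
    proof (cases "J = carrier R")
      case True
      have "spans J {}" unfolding spans_def True
        by (auto intro!: bexI[OF _ lspan.lspan_zero])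
      then have "cdim J = 0" using cdim_le by fastforce
      then show ?thesis using True less.prems by (intro exI[of _ "\<lambda>_. J"]) auto
    next
      case False
      obtain y where y: "y \<in> carrier R" "y \<notin> J" "\<forall>\<mu>\<in>m. y \<otimes> \<mu> \<in> J"
        using socle_element[OF m less.prems False] by blast
      let ?J = "idl_ins R J y"
      note I = idl_ins[OF less.prems(1) y(1)]
      have sub: "J \<subset> ?J" using I y by blast
      have lt: "cdim ?J < cdim J" by (rule cdim_strict[OF less.prems(1) I(1) sub sp])
      \<comment> \<open>For a socle element y the colon ideal contains m, which has codimension at
        most one.\<close>
      have "cdim J \<le> cdim ?J + cdim m"
        by (rule cdim_colon[OF less.prems(1) y(1) spans_mono[OF sp I(2)] maximal_spans[OF m]]) (use y(3) m.Icarr in auto)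
      moreover have "cdim m \<le> 1" using cdim_le[OF maximal_spans[OF m]] by simp
      ultimately have eq: "cdim J = Suc (cdim ?J)" using lt by simp
      have fJ: "fp e m \<subseteq> ?J" using less.prems I by blast
      obtain c where c: "c 0 = ?J" "c (cdim ?J) = carrier R" "\<forall>i\<le>cdim ?J. ideal (c i) R" "\<forall>i<cdim ?J. c i \<subset> c (Suc i)"
        using less.hyps[OF lt I(1) fJ] by (elim exE conjE)
      let ?c = "\<lambda>i. if i = 0 then J else c (i - 1)"
      have "?c i \<subset> ?c (Suc i)" if "i < cdim J" for i
      proof (cases i)
        case 0
        then show ?thesis using sub c(1) by simp
      next
        case (Suc j)
        then show ?thesis using c(4)[rule_format, of j] that eq by simp
      qed
      moreover have "ideal (?c i) R" if "i \<le> cdim J" for i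
        using that eq c(3)[rule_format, of "i - 1"] less.prems(1) by auto
      ultimately show ?thesis using c(2) eq by (intro exI[of _ ?c]) simp
    qed
  qed
  then show "cdim J \<in> {n. \<exists>c. ?chain c J n}" by blast
  fix n assume "n \<in> {n. \<exists>c. ?chain c J n}"
  then obtain c where c: "c 0 = J" "c n = carrier R" "\<forall>i\<le>n. ideal (c i) R" "\<forall>i<n. c i \<subset> c (Suc i)"
    by (elim CollectE exE conjE)
  have "J \<subseteq> c i \<and> cdim (c i) + i \<le> cdim J" if "i \<le> n" for i
    using that
  proof (induction i)
    case (Suc i)
    then have s: "c i \<subset> c (Suc i)" "J \<subseteq> c i" using c(4) by auto
    have "fp e m \<subseteq> c i" using s J by blast
    then have "cdim (c (Suc i)) < cdim (c i)"
      using cdim_strict[OF _ _ s(1) spans_mono[OF fp_spans[OF m]], of e] c(3) Suc.prems by simp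
    then show ?case using Suc s by auto
  qed (use c in simp)
  then show "n \<le> cdim J" using le_add2 le_trans by blast
qed

text \<open>Elements outside m are units modulo m^[q], so all ideals above m^[q] are saturated, and
  length in the local ring is codimension in R.\<close>

lemma quot_length_frob:
  assumes m: "maximalideal m R"
  shows "quot_length (localization R m) (frob_power (localization R m) (loc_ext R m m) (p ^ e)) = cdim (fp e m)"
proof -
  interpret m: maximalideal m R by fact
  interpret mp: primeideal m R by (rule maximalideal_prime[OF m])
  have "frob_power (localization R m) (loc_ext R m m) (p ^ e) = mp.ex (fp e m)"
    unfolding mp.loc_ext_eq[OF m.is_ideal] mp.frob_power_loc[OF m.is_ideal] fp_def fr_def ..
  moreover have "mp.sat J" if J: "ideal J R" "fp e m \<subseteq> J" for J
    unfolding mp.sat_def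
  proof (intro ballI impI)
    interpret J: ideal J R by (rule J)
    fix s a assume sa: "s \<in> carrier R - m" "a \<in> carrier R" "s \<otimes> a \<in> J"
    then obtain t where t: "t \<in> carrier R" "s \<otimes> t \<ominus> \<one> \<in> fp e m" using fp_unit[OF m, of s e] by blast
    have sc: "s \<in> carrier R" using sa by simp
    have "t \<otimes> (s \<otimes> a) \<ominus> a \<otimes> (s \<otimes> t \<ominus> \<one>) \<in> J"
      by (rule ideal_minus[OF J(1)]) (use t sa J J.I_l_closed in auto)
    moreover have "t \<otimes> (s \<otimes> a) \<ominus> a \<otimes> (s \<otimes> t \<ominus> \<one>) = a" using sc sa(2) t(1) by algebra
    ultimately show "a \<in> J" by simp
  qed
  ultimately show ?thesis
    using mp.quot_length_loc[OF fp_ideal[OF m.is_ideal]] cdim_length[OF m fp_ideal[OF m.is_ideal] subset_refl] by simp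
qed

text \<open>The supremum in \<open>krull_dim\<close> is attained because
  \<open>pchain_bounded\<close> makes the set of chain lengths finite.\<close>

lemma krull_dim_quot_prime:
  assumes P: "primeideal P R"
  shows "pchain P (carrier R) (krull_dim (R Quot P))" "pchain P (carrier R) n \<Longrightarrow> n \<le> krull_dim (R Quot P)"
proof -
  interpret P: primeideal P R by fact
  have up: "P \<subseteq> c i" if "P \<subseteq> c 0" "\<forall>i<n. c i \<subset> c (Suc i)" "i \<le> n" for c :: "nat \<Rightarrow> 'a set" and n i
    using chain_increasing[OF that(2,3)] that(1) by blast
  have "(\<exists>c. (\<forall>i\<le>n. primeideal (c i) R \<and> P \<subseteq> c i) \<and> (\<forall>i<n. c i \<subset> c (Suc i))) \<longleftrightarrow> pchain P (carrier R) n" for n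
  proof
    assume "\<exists>c. (\<forall>i\<le>n. primeideal (c i) R \<and> P \<subseteq> c i) \<and> (\<forall>i<n. c i \<subset> c (Suc i))"
    then obtain c where c: "\<forall>i\<le>n. primeideal (c i) R \<and> P \<subseteq> c i" "\<forall>i<n. c i \<subset> c (Suc i)" by (elim exE conjE)
    have "c n \<subseteq> carrier R" using c(1) idealD[OF primeideal.axioms(1)] by blast
    then show "pchain P (carrier R) n" unfolding pchain_def using c by (intro exI[of _ c]) auto
  next
    assume "pchain P (carrier R) n"
    then obtain c where c: "\<forall>i\<le>n. primeideal (c i) R" "\<forall>i<n. c i \<subset> c (Suc i)" "P \<subseteq> c 0"
      unfolding pchain_def by (elim exE conjE)
    then show "\<exists>c. (\<forall>i\<le>n. primeideal (c i) R \<and> P \<subseteq> c i) \<and> (\<forall>i<n. c i \<subset> c (Suc i))"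
      using up[OF c(3,2)] by (intro exI[of _ c]) auto
  qed
  then have eq: "krull_dim (R Quot P) = Sup {n. pchain P (carrier R) n}" unfolding P.krull_dim_quot by simp
  have "{n. pchain P (carrier R) n} \<subseteq> {..card S}" using pchain_bounded[OF P] by auto
  then have fin: "finite {n. pchain P (carrier R) n}" using finite_subset by blast
  have "0 \<in> {n. pchain P (carrier R) n}" using pchain_0[OF P subset_refl] P.Icarr by blast
  then have ne: "{n. pchain P (carrier R) n} \<noteq> {}" by blast
  have eq': "krull_dim (R Quot P) = Max {n. pchain P (carrier R) n}" unfolding eq using cSup_eq_Max[OF fin ne] .
  show "pchain P (carrier R) (krull_dim (R Quot P))" unfolding eq' using Max_in[OF fin ne] by simp
  show "n \<le> krull_dim (R Quot P)" if "pchain P (carrier R) n" unfolding eq' using Max_ge[OF fin] that by simp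
qed

end

locale equidim_alg = affine_alg R p k S for R (structure) and p k S +
  assumes equidim: "equidimensional R"
begin

definition rdim :: nat where "rdim = krull_dim (R Quot (SOME P. minimal_prime R P))"

lemma rdim_minp: assumes "P \<in> minp" shows "krull_dim (R Quot P) = rdim"
proof -
  have "minimal_prime R (SOME P. minimal_prime R P)" by (rule someI[of _ P]) (use assms in simp)
  then show ?thesis using equidim assms unfolding equidimensional_def rdim_def by blast
qed

text \<open>\<open>local_chain\<close> finds a chain of length \<open>rdim\<close> from a minimal
  prime inside m. Conversely any chain in m lies above a minimal prime and is bounded by its
  dimension.\<close>

lemma krull_dim_max:
  assumes m: "maximalideal m R" shows "krull_dim (localization R m) = rdim"
  unfolding primeideal.krull_dim_loc[OF maximalideal_prime[OF m]]
proof (rule cSup_eq_maximum)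
  have mp: "primeideal m R" by (rule maximalideal_prime[OF m])
  let ?A = "{n. \<exists>c. (\<forall>i\<le>n. primeideal (c i) R \<and> c i \<subseteq> m) \<and> (\<forall>i<n. c i \<subset> c (Suc i))}"
  obtain P where P: "P \<in> minp" "P \<subseteq> m" using minimal_primes(2)[OF mp] by blast
  have "pchain P m rdim" using local_chain[OF m minp_prime[OF P(1)] P(2) krull_dim_quot_prime(1)[OF minp_prime[OF P(1)]]]
    rdim_minp[OF P(1)] by simp
  then obtain c where c: "\<forall>i\<le>rdim. primeideal (c i) R" "\<forall>i<rdim. c i \<subset> c (Suc i)" "c rdim \<subseteq> m"
    unfolding pchain_def by (elim exE conjE)
  have "c i \<subseteq> m" if "i \<le> rdim" for i
    using that
  proof (induction rule: inc_induct)
    case (step i)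
    then show ?case using c(2)[rule_format, of i] by auto
  qed (use c in simp)
  then show "rdim \<in> ?A" using c by blast
  fix n assume "n \<in> ?A"
  then obtain c where c: "\<forall>i\<le>n. primeideal (c i) R \<and> c i \<subseteq> m" "\<forall>i<n. c i \<subset> c (Suc i)" by (elim CollectE exE conjE)
  obtain Q where Q: "Q \<in> minp" "Q \<subseteq> c 0" using minimal_primes(2)[of "c 0"] c(1) by blast
  have "c n \<subseteq> carrier R" using c(1) idealD[OF primeideal.axioms(1)] by blast
  then have "pchain Q (carrier R) n" unfolding pchain_def using c Q(2) by (intro exI[of _ c]) auto
  then show "n \<le> rdim" using krull_dim_quot_prime(2)[OF minp_prime[OF Q(1)]] rdim_minp[OF Q(1)] by simp
qed

text \<open>Convergence has to be known before the \<open>lim\<close> in \<open>hk_mult\<close> can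
  be used as a limit.\<close>

lemma ehk_limit:
  assumes m: "maximalideal m R"
  shows "(\<lambda>e. real (cdim (fp e m)) / real (p ^ e) ^ rdim) \<longlonglongrightarrow> ehk_at R p m"
proof -
  have "convergent (\<lambda>e. real (cdim (fp e m)) / real (p ^ e) ^ rdim)"
    by (rule colength_converges[OF m]) (use krull_dim_quot_prime(2) minp_prime rdim_minp in metis)
  then show ?thesis
    unfolding ehk_at_def hk_mult_def quot_length_frob[OF m] krull_dim_max[OF m] by (simp add: convergent_LIMSEQ_iff)
qed

text \<open>With I = 0, a basis Z at m generates R over q-th powers once s is inverted. At another
  point n outside the zero set of s, the scalars become constants and s a unit modulo n^[q], so the
  same Z spans there.\<close>

lemma colength_semicontinuous:
  assumes m: "maximalideal m R"
  shows "\<exists>s\<in>carrier R - m. \<forall>n. maximalideal n R \<and> s \<notin> n \<longrightarrow> cdim (fp e n) \<le> cdim (fp e m)"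
proof -
  interpret m: maximalideal m R by fact
  obtain Z where Z: "spans (fp e m) Z" "card Z = cdim (fp e m)" using cdim_spans[OF fp_spans[OF m]] by blast
  have Zc: "finite Z" "Z \<subseteq> carrier R" using Z by (auto simp: spans_def)
  have sp: "spans ({\<zero>} <+>\<^bsub>R\<^esub> fp e m) Z"
    by (rule spans_mono[OF Z(1)]) (use idealD[OF fp_ideal[OF m.is_ideal]] in \<open>auto intro!: setaddI\<close>)
  obtain s where s: "s \<in> carrier R - m" "\<forall>x\<in>carrier R. \<exists>u\<in>lspan R (frs e) Z. \<exists>i\<in>{\<zero>}. fr e s \<otimes> x = u \<oplus> i"
    using semicontinuity[OF m zeroideal sp] by blast
  have "cdim (fp e n) \<le> cdim (fp e m)" if n: "maximalideal n R" "s \<notin> n" for n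
  proof -
    interpret n: maximalideal n R by (rule n)
    interpret F: ideal "fp e n" R by (rule fp_ideal[OF n.is_ideal])
    have np: "primeideal n R" by (rule maximalideal_prime[OF n(1)])
    \<comment> \<open>Each q-th power coefficient is replaced by the q-th power of its residue at n,
      with an error in n^[q].\<close>
    have red: "\<exists>v\<in>lspan R k Z. \<exists>j\<in>fp e n. u = v \<oplus> j" if "u \<in> lspan R (frs e) Z" for u
      using that
    proof (induction u rule: lspan.induct)
      case lspan_zero
      show ?case using lspan.lspan_zero F.zero_closed by (metis r_zero zero_closed)
    next
      case (lspan_step u l x)
      then obtain v j where v: "v \<in> lspan R k Z" "j \<in> fp e n" "u = v \<oplus> j" by blast
      obtain a where a: "a \<in> carrier R" "l = fr e a" using lspan_step by (auto simp: frs_def)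
      obtain c where c: "c \<in> k" "a \<ominus> c \<in> n" using maximal_residue[OF n(1) a(1)] by blast
      have xc: "x \<in> carrier R" using lspan_step Zc by auto
      have vc: "v \<in> carrier R" "j \<in> carrier R" using k.lspan_carrier[OF v(1) Zc(2)] F.Icarr[OF v(2)] by auto
      have ck: "fr e c \<in> k" using k_fr c by simp
      have "fr e (a \<ominus> c) \<in> fp e n" using fr_fp[OF n.is_ideal c(2)] .
      then have "fr e a \<ominus> fr e c \<in> fp e n" using a c by (simp add: fr_minus)
      then have jj: "j \<oplus> (fr e a \<ominus> fr e c) \<otimes> x \<in> fp e n" using v xc F.I_r_closed by simp
      have id: "(v \<oplus> j) \<oplus> l' \<otimes> x = (v \<oplus> c' \<otimes> x) \<oplus> (j \<oplus> (l' \<ominus> c') \<otimes> x)" if "l' \<in> carrier R" "c' \<in> carrier R" for l' c'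
        using that vc xc by algebra
      have "v \<oplus> fr e c \<otimes> x \<in> lspan R k Z" using v(1) ck lspan_step by (auto intro: lspan.lspan_step)
      then show ?case using jj id[of "fr e a" "fr e c"] a c v(3) by (intro bexI[OF _ jj] bexI) auto
    qed
    have fs: "fr e s \<notin> n" using fr_prime[OF np] s n(2) by blast
    obtain t where t: "t \<in> carrier R" "fr e s \<otimes> t \<ominus> \<one> \<in> fp e n" using fp_unit[OF n(1) _ fs] s by blast
    have "spans (fp e n) Z" unfolding spans_def
    proof (intro conjI ballI Zc)
      fix x assume x: "x \<in> carrier R"
      have sc: "fr e s \<in> carrier R" using s by simp
      obtain u where u: "u \<in> lspan R (frs e) Z" "fr e s \<otimes> (t \<otimes> x) = u \<oplus> \<zero>" using s(2) t x by blast
      obtain v j where v: "v \<in> lspan R k Z" "j \<in> fp e n" "u = v \<oplus> j" using red[OF u(1)] by blast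
      have vc: "v \<in> carrier R" "j \<in> carrier R" using k.lspan_carrier[OF v(1) Zc(2)] F.Icarr[OF v(2)] by auto
      have "x = (fr e s \<otimes> (t \<otimes> x)) \<ominus> (fr e s \<otimes> t \<ominus> \<one>) \<otimes> x" using sc t(1) x by algebra
      also have "\<dots> = v \<oplus> (j \<ominus> (fr e s \<otimes> t \<ominus> \<one>) \<otimes> x)" unfolding u(2) v(3) using vc sc t(1) x by algebra
      finally have "x = v \<oplus> (j \<ominus> (fr e s \<otimes> t \<ominus> \<one>) \<otimes> x)" .
      moreover have "j \<ominus> (fr e s \<otimes> t \<ominus> \<one>) \<otimes> x \<in> fp e n"
        by (rule ideal_minus[OF F.is_ideal]) (use v t x F.I_r_closed in auto)
      ultimately show "\<exists>s\<in>lspan R k Z. \<exists>j\<in>fp e n. x = s \<oplus> j" using v by blast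
    qed
    then show ?thesis using cdim_le Z(2) by metis
  qed
  then show ?thesis using s(1) by blast
qed

end

section \<open>The singular locus\<close>

text \<open>Denominators are units, so generators of the maximal ideal can be taken from I. That
  they generate locally means that each x in I lands in their ideal after multiplication by some t
  outside I.\<close>

lemma (in primeideal) regular_local_loc:
  "regular_local A (loc_ext R I I) \<longleftrightarrow>
    (\<exists>F. finite F \<and> F \<subseteq> I \<and> card F \<le> krull_dim A \<and> (\<forall>x\<in>I. \<exists>t\<in>M. t \<otimes> x \<in> Idl F))"
proof
  interpret A: cring A by (rule loc_cring)
  assume "regular_local A (loc_ext R I I)"
  then obtain G where G: "finite G" "G \<subseteq> carrier A" "card G \<le> krull_dim A" "genideal A G = ex I"
    unfolding regular_local_def loc_ext_eq[OF is_ideal] by blast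
  have "G \<subseteq> ex I" using A.genideal_self[OF G(2)] G(4) by simp
  then have "\<forall>g\<in>G. \<exists>f. f \<in> I \<and> (\<exists>s\<in>M. g = cls f s)" unfolding ex_def by blast
  then obtain f where f: "\<forall>g\<in>G. f g \<in> I \<and> (\<exists>s\<in>M. g = cls (f g) s)" by (drule_tac bchoice) (elim exE)
  let ?F = "f ` G"
  have FI: "?F \<subseteq> I" using f by auto
  then have Fc: "?F \<subseteq> carrier R" using a_subset by blast
  have iF: "ideal (Idl ?F) R" by (rule genideal_ideal[OF Fc])
  have "genideal A G \<subseteq> ex (Idl ?F)"
  proof (rule A.genideal_minimal[OF ex_ideal[OF iF]], rule subsetI)
    fix g assume g: "g \<in> G"
    then obtain s where "s \<in> M" "g = cls (f g) s" using f by blast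
    moreover have "f g \<in> Idl ?F" using genideal_self[OF Fc] g by blast
    ultimately show "g \<in> ex (Idl ?F)" unfolding ex_def by blast
  qed
  then have sub: "ex I \<subseteq> ex (Idl ?F)" using G by simp
  have "\<exists>t\<in>M. t \<otimes> x \<in> Idl ?F" if x: "x \<in> I" for x
  proof -
    have xc: "x \<in> carrier R" using x Icarr by simp
    have "cls x \<one> \<in> ex I" unfolding ex_def using x M_one by blast
    then obtain g s where g: "cls x \<one> = cls g s" "g \<in> Idl ?F" "s \<in> M" using sub unfolding ex_def by blast
    have gc: "g \<in> carrier R" using idealD[OF iF g(2)] .
    obtain u where u: "u \<in> M" "u \<otimes> (x \<otimes> s \<ominus> g \<otimes> \<one>) = \<zero>"
      using g(1) cls_eq_iff[OF xc gc M_one g(3)] by blast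
    have uc: "u \<in> carrier R" "s \<in> carrier R" using u g by auto
    have "(u \<otimes> s) \<otimes> x = u \<otimes> (x \<otimes> s \<ominus> g \<otimes> \<one>) \<oplus> u \<otimes> g" using uc gc xc by algebra
    then have "(u \<otimes> s) \<otimes> x \<in> Idl ?F" using u(2) uc gc ideal.I_l_closed[OF iF g(2)] by simp
    then show ?thesis using M_mult[OF u(1) g(3)] by blast
  qed
  moreover have "card ?F \<le> krull_dim A" using card_image_le[OF G(1), of f] G(3) by simp
  ultimately show "\<exists>F. finite F \<and> F \<subseteq> I \<and> card F \<le> krull_dim A \<and> (\<forall>x\<in>I. \<exists>t\<in>M. t \<otimes> x \<in> Idl F)"
    using G(1) FI by (intro exI[of _ ?F]) auto
next
  assume "\<exists>F. finite F \<and> F \<subseteq> I \<and> card F \<le> krull_dim A \<and> (\<forall>x\<in>I. \<exists>t\<in>M. t \<otimes> x \<in> Idl F)"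
  then obtain F where F: "finite F" "F \<subseteq> I" "card F \<le> krull_dim A" "\<forall>x\<in>I. \<exists>t\<in>M. t \<otimes> x \<in> Idl F" by (elim exE conjE)
  have Fc: "F \<subseteq> carrier R" using F(2) a_subset by blast
  let ?G = "(\<lambda>a. cls a \<one>) ` F"
  have "ex (Idl F) = ex I"
  proof
    show "ex (Idl F) \<subseteq> ex I" unfolding ex_def using genideal_minimal[OF is_ideal F(2)] by blast
    show "ex I \<subseteq> ex (Idl F)"
    proof
      fix z assume "z \<in> ex I"
      then obtain x s where z: "z = cls x s" "x \<in> I" "s \<in> M" unfolding ex_def by blast
      obtain t where t: "t \<in> M" "t \<otimes> x \<in> Idl F" using F(4) z by blast
      have "cls x s = cls (t \<otimes> x) (t \<otimes> s)"
        by (rule cls_eqI) (use t z Icarr M_mult in \<open>auto simp: m_ac\<close>)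
      then show "z \<in> ex (Idl F)" unfolding ex_def using z t M_mult[OF t(1) z(3)] by blast
    qed
  qed
  then have "genideal A ?G = loc_ext R I I" using genideal_loc[OF Fc] loc_ext_eq[OF is_ideal] by simp
  moreover have "?G \<subseteq> carrier A" using Fc M_one by auto
  moreover have "card ?G \<le> krull_dim A" using card_image_le[OF F(1), of "\<lambda>a. cls a \<one>"] F(3) by simp
  ultimately show "regular_local A (loc_ext R I I)" unfolding regular_local_def using F(1) by blast
qed

section \<open>First-order Taylor expansions at closed points\<close>

context affine_alg
begin

text \<open>The function x centred at the closed point b, i.e. x minus its value there. The value is
  unique since k meets b only in \<zero>.\<close>

definition ep :: "'a set \<Rightarrow> 'a \<Rightarrow> 'a" where "ep b x = x \<ominus> (SOME c. c \<in> k \<and> x \<ominus> c \<in> b)"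

definition lc :: "'a set \<Rightarrow> 'a set \<Rightarrow> ('a \<Rightarrow> 'a) \<Rightarrow> 'a" where "lc b T v = (\<Oplus>x\<in>T. v x \<otimes> ep b x)"

text \<open>The ideal b^2, with both factors of each product taken from b.\<close>

abbreviation sq :: "'a set \<Rightarrow> 'a set" where "sq b \<equiv> lspan R b b"

text \<open>\<open>v\<close> is a gradient of \<open>f\<close>: the first order Taylor expansion of \<open>f\<close> at every closed point
  has linear part \<open>v\<close>.\<close>

definition grad :: "'a \<Rightarrow> ('a \<Rightarrow> 'a) \<Rightarrow> bool" where
  "grad f v \<longleftrightarrow> (\<forall>x. v x \<in> carrier R) \<and>
     (\<forall>b. maximalideal b R \<longrightarrow> (\<exists>c\<in>k. \<exists>q\<in>sq b. f = c \<oplus> lc b S v \<oplus> q))"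

lemma ep:
  assumes "maximalideal b R" "x \<in> carrier R"
  shows "ep b x \<in> b" "ep b x \<in> carrier R" "\<exists>c\<in>k. x = c \<oplus> ep b x"
proof -
  interpret b: maximalideal b R by fact
  let ?c = "SOME c. c \<in> k \<and> x \<ominus> c \<in> b"
  have "\<exists>c. c \<in> k \<and> x \<ominus> c \<in> b" using maximal_residue[OF assms] by blast
  from someI_ex[OF this] have c: "?c \<in> k" "x \<ominus> ?c \<in> b" by auto
  show "ep b x \<in> b" unfolding ep_def by (rule c)
  then show "ep b x \<in> carrier R" by (rule b.Icarr)
  have "x = c' \<oplus> (x \<ominus> c')" if "c' \<in> carrier R" for c' using that assms(2) by algebra
  from this[OF k.LD[OF c(1)]] show "\<exists>c\<in>k. x = c \<oplus> ep b x" unfolding ep_def using c(1) by blast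
qed

context
  fixes b assumes b: "maximalideal b R"
begin

interpretation b: maximalideal b R by (rule b)

lemma b_prime: "primeideal b R" by (rule maximalideal_prime[OF b])

lemma sq_ideal: "ideal (sq b) R"
proof (rule ideal_setI)
  have bc: "b \<subseteq> carrier R" using b.Icarr by auto
  show "sq b \<subseteq> carrier R" using lspan_carrier_gen[OF _ bc bc] by blast
  show "\<zero> \<in> sq b" by (rule lspan.lspan_zero)
  show "x \<oplus> y \<in> sq b" if "x \<in> sq b" "y \<in> sq b" for x y using lspan_add_gen[OF that(2,1) bc bc] by simp
  show "r \<otimes> x \<in> sq b" if "x \<in> sq b" "r \<in> carrier R" for x r
    using that(1)
  proof (induction x rule: lspan.induct)
    case (lspan_step s l x)
    then have "s \<in> carrier R" "l \<in> carrier R" "x \<in> carrier R" using lspan_carrier_gen[OF _ bc bc] b.Icarr by auto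
    then have "r \<otimes> (s \<oplus> l \<otimes> x) = r \<otimes> s \<oplus> (r \<otimes> l) \<otimes> x" using that by (simp add: r_distr m_assoc)
    then show ?case using lspan_step that b.I_l_closed by (simp add: lspan.lspan_step)
  qed (use that in \<open>simp add: lspan.lspan_zero\<close>)
qed

lemma sq_prod: "x \<in> b \<Longrightarrow> y \<in> b \<Longrightarrow> x \<otimes> y \<in> sq b"
  using lspan.lspan_step[OF lspan.lspan_zero, of x b y b R] b.Icarr by simp

lemma sq_sub: "q \<in> sq b \<Longrightarrow> q \<in> b"
  by (induction q rule: lspan.induct) (use b.I_l_closed b.Icarr in auto)

lemma sq_carrier: "q \<in> sq b \<Longrightarrow> q \<in> carrier R" using sq_sub b.Icarr by blast

lemma ep_S [simp]: "x \<in> S \<Longrightarrow> ep b x \<in> b" "x \<in> S \<Longrightarrow> ep b x \<in> carrier R" using ep(1,2)[OF b] by auto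

lemma lc_closed:
  assumes "T \<subseteq> S" "\<And>x. v x \<in> carrier R" shows "lc b T v \<in> b" "lc b T v \<in> carrier R"
proof -
  show "lc b T v \<in> b" unfolding lc_def
    by (rule ideal_finsum[OF b.is_ideal]) (use assms finite_subset[OF assms(1)] b.I_l_closed in auto)
  then show "lc b T v \<in> carrier R" by (rule b.Icarr)
qed

lemma lc_add:
  assumes "T \<subseteq> S" "\<And>x. v x \<in> carrier R" "\<And>x. w x \<in> carrier R"
  shows "lc b T (\<lambda>x. v x \<oplus> w x) = lc b T v \<oplus> lc b T w"
proof -
  have "lc b T (\<lambda>x. v x \<oplus> w x) = (\<Oplus>x\<in>T. v x \<otimes> ep b x \<oplus> w x \<otimes> ep b x)"
    unfolding lc_def by (rule finsum_cong') (use assms in \<open>auto simp: l_distr subset_iff\<close>)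
  also have "\<dots> = lc b T v \<oplus> lc b T w"
    unfolding lc_def by (rule finsum_addf) (use assms in \<open>auto simp: subset_iff\<close>)
  finally show ?thesis .
qed

lemma lc_scal:
  assumes "T \<subseteq> S" "\<And>x. v x \<in> carrier R" "r \<in> carrier R"
  shows "lc b T (\<lambda>x. r \<otimes> v x) = r \<otimes> lc b T v"
proof -
  have "lc b T (\<lambda>x. r \<otimes> v x) = (\<Oplus>x\<in>T. r \<otimes> (v x \<otimes> ep b x))"
    unfolding lc_def by (rule finsum_cong') (use assms in \<open>auto simp: m_assoc subset_iff\<close>)
  also have "\<dots> = r \<otimes> lc b T v"
    unfolding lc_def by (rule finsum_rdistr[symmetric]) (use assms finite_subset[OF assms(1)] in \<open>auto simp: subset_iff\<close>)
  finally show ?thesis .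
qed

lemma lc_split:
  assumes "T \<subseteq> S" "\<And>x. v x \<in> carrier R"
  shows "lc b S v = lc b T v \<oplus> lc b (S - T) v"
proof -
  have "lc b (T \<union> (S - T)) v = lc b T v \<oplus> lc b (S - T) v"
    unfolding lc_def by (rule finsum_Un_disjoint) (use assms finite_subset[OF assms(1)] in \<open>auto simp: subset_iff\<close>)
  moreover have "T \<union> (S - T) = S" using assms(1) by blast
  ultimately show ?thesis by simp
qed

lemma lc_cong:
  assumes "T \<subseteq> S" "\<And>x. v x \<in> carrier R" "\<And>x. x \<in> T \<Longrightarrow> v x = w x" shows "lc b T v = lc b T w"
  unfolding lc_def
  by (rule finsum_cong') (use assms in \<open>auto simp: subset_iff assms(3)[symmetric]\<close>)

lemma lc_zero: assumes "T \<subseteq> S" shows "lc b T (\<lambda>_. \<zero>) = \<zero>"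
proof -
  have "lc b T (\<lambda>_. \<zero>) = (\<Oplus>x\<in>T. \<zero>)" unfolding lc_def by (rule finsum_cong') (use assms in \<open>auto simp: subset_iff\<close>)
  then show ?thesis by simp
qed

lemma lc_restrict:
  assumes "T \<subseteq> S" "\<And>x. v x \<in> carrier R"
  shows "lc b S (\<lambda>x. if x \<in> T then v x else \<zero>) = lc b T v"
proof -
  have "lc b S (\<lambda>x. if x \<in> T then v x else \<zero>)
     = lc b T (\<lambda>x. if x \<in> T then v x else \<zero>) \<oplus> lc b (S - T) (\<lambda>x. if x \<in> T then v x else \<zero>)"
    by (rule lc_split) (use assms in auto)
  moreover have "lc b T (\<lambda>x. if x \<in> T then v x else \<zero>) = lc b T v" by (rule lc_cong) (use assms in auto)
  moreover have "lc b (S - T) (\<lambda>x. if x \<in> T then v x else \<zero>) = lc b (S - T) (\<lambda>_. \<zero>)" by (rule lc_cong) (use assms in auto)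
  ultimately show ?thesis using lc_zero lc_closed(2) assms by simp
qed

lemma lc_delta:
  assumes "T \<subseteq> S" "y \<in> T" "s \<in> carrier R"
  shows "lc b T (\<lambda>x. if x = y then s else \<zero>) = s \<otimes> ep b y"
proof -
  have "lc b T (\<lambda>x. if x = y then s else \<zero>) = (\<Oplus>x\<in>T. if x = y then s \<otimes> ep b x else \<zero>)"
    unfolding lc_def by (rule finsum_cong') (use assms in \<open>auto simp: subset_iff\<close>)
  also have "\<dots> = s \<otimes> ep b y"
    using add.finprod_singleton_swap[of y T "\<lambda>x. s \<otimes> ep b x"] finite_subset[OF assms(1)] assms by (auto simp: subset_iff)
  finally show ?thesis .
qed

lemma max_rep: assumes x: "x \<in> b" shows "\<exists>v. (\<forall>x. v x \<in> carrier R) \<and> x = lc b S v"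
proof -
  have gen: "\<exists>c\<in>k. \<exists>v. (\<forall>x. v x \<in> carrier R) \<and> f = c \<oplus> lc b S v" if "f \<in> carrier R" for f
    using that
  proof (induction f rule: affine_induct)
    case (k c)
    then show ?case by (intro bexI[of _ c] exI[of _ "\<lambda>_. \<zero>"]) (auto simp: lc_zero)
  next
    case (S x)
    then obtain c where c: "c \<in> k" "x = c \<oplus> ep b x" using ep(3)[OF b, of x] by auto
    have "lc b S (\<lambda>z. if z = x then \<one> else \<zero>) = ep b x" using lc_delta[of S x \<one>] S by simp
    then show ?case using c by (intro bexI[OF _ c(1)] exI[of _ "\<lambda>z. if z = x then \<one> else \<zero>"]) auto
  next
    case (add x y)
    then obtain c v c' v' where e: "c \<in> k" "\<forall>x. v x \<in> carrier R" "x = c \<oplus> lc b S v"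
      "c' \<in> k" "\<forall>x. v' x \<in> carrier R" "y = c' \<oplus> lc b S v'" by blast
    have "(c \<oplus> l) \<oplus> (c' \<oplus> l') = (c \<oplus> c') \<oplus> (l \<oplus> l')" if "l \<in> carrier R" "l' \<in> carrier R" for l l'
      using that k.LD[OF e(1)] k.LD[OF e(4)] by algebra
    from this[of "lc b S v" "lc b S v'"] have "x \<oplus> y = (c \<oplus> c') \<oplus> lc b S (\<lambda>x. v x \<oplus> v' x)"
      unfolding e(3,6) using lc_add[of S v v'] lc_closed e(2,5) by auto
    then show ?case using e by (intro bexI[of _ "c \<oplus> c'"] exI[of _ "\<lambda>x. v x \<oplus> v' x"]) auto
  next
    case (uminus x)
    then obtain c v where e: "c \<in> k" "\<forall>x. v x \<in> carrier R" "x = c \<oplus> lc b S v" by blast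
    have "\<ominus> (c \<oplus> l) = (\<ominus> c) \<oplus> (\<ominus> \<one>) \<otimes> l" if "l \<in> carrier R" for l
      using that k.LD[OF e(1)] by algebra
    from this[of "lc b S v"] have "\<ominus> x = \<ominus> c \<oplus> lc b S (\<lambda>x. (\<ominus> \<one>) \<otimes> v x)"
      unfolding e(3) using lc_scal[of S v "\<ominus> \<one>"] lc_closed e(2) by auto
    then show ?case using e by (intro bexI[of _ "\<ominus> c"] exI[of _ "\<lambda>x. (\<ominus> \<one>) \<otimes> v x"]) auto
  next
    case (mult x y)
    then obtain c v c' v' where e: "c \<in> k" "\<forall>x. v x \<in> carrier R" "x = c \<oplus> lc b S v"
      "c' \<in> k" "\<forall>x. v' x \<in> carrier R" "y = c' \<oplus> lc b S v'" by blast
    have "(c \<oplus> l) \<otimes> (c' \<oplus> l') = c \<otimes> c' \<oplus> ((c' \<oplus> l') \<otimes> l \<oplus> c \<otimes> l')" if "l \<in> carrier R" "l' \<in> carrier R" for l l'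
      using that k.LD[OF e(1)] k.LD[OF e(4)] by algebra
    from this[of "lc b S v" "lc b S v'"] have "x \<otimes> y = c \<otimes> c' \<oplus> (y \<otimes> lc b S v \<oplus> c \<otimes> lc b S v')"
      using e lc_closed by auto
    also have "y \<otimes> lc b S v \<oplus> c \<otimes> lc b S v' = lc b S (\<lambda>x. y \<otimes> v x \<oplus> c \<otimes> v' x)"
      using lc_add[of S "\<lambda>x. y \<otimes> v x" "\<lambda>x. c \<otimes> v' x"] lc_scal[of S v y] lc_scal[of S v' c] e mult(2) by auto
    finally show ?case using e mult(2) by (intro bexI[of _ "c \<otimes> c'"] exI[of _ "\<lambda>x. y \<otimes> v x \<oplus> c \<otimes> v' x"]) auto
  qed
  obtain c w where w: "c \<in> k" "\<forall>x. w x \<in> carrier R" "x = c \<oplus> lc b S w" using gen[OF b.Icarr[OF x]] by blast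
  have L: "lc b S w \<in> b" "lc b S w \<in> carrier R" using lc_closed w by auto
  have "(c \<oplus> l) \<ominus> l = c" if "l \<in> carrier R" for l using that k.LD[OF w(1)] by algebra
  then have "x \<ominus> lc b S w = c" using w(3) L by simp
  then have "c \<in> b" using ideal_minus[OF b.is_ideal x L(1)] by simp
  then have "c = \<zero>" using k_notin_prime[OF b_prime w(1)] by simp
  then show ?thesis using w L by auto
qed

text \<open>The second factor of each product is expanded in centred coordinates by
  \<open>max_rep\<close>; the first stays in the coefficients, which therefore lie in b.\<close>

lemma sq_rep: "q \<in> sq b \<Longrightarrow> \<exists>v. (\<forall>x. v x \<in> b) \<and> q = lc b S v"
proof (induction q rule: lspan.induct)
  case lspan_zero
  show ?case by (intro exI[of _ "\<lambda>_. \<zero>"]) (auto simp: lc_zero)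
next
  case (lspan_step s l x)
  then obtain v where v: "\<forall>x. v x \<in> b" "s = lc b S v" by blast
  have lcar: "l \<in> carrier R" using lspan_step b.Icarr by auto
  obtain w where w: "\<forall>x. w x \<in> carrier R" "x = lc b S w" using max_rep[OF lspan_step(3)] by blast
  have "s \<oplus> l \<otimes> x = lc b S (\<lambda>x. v x \<oplus> l \<otimes> w x)"
    unfolding v(2) w(2) using lc_add[of S v "\<lambda>x. l \<otimes> w x"] lc_scal[of S w l] v(1) w(1) b.Icarr lcar by auto
  then show ?case using v w lspan_step(2) b.I_r_closed by (intro exI[of _ "\<lambda>x. v x \<oplus> l \<otimes> w x"]) auto
qed

end

lemma gradE:
  assumes "grad f v" "maximalideal b R"
  obtains c q where "c \<in> k" "q \<in> sq b" "f = c \<oplus> lc b S v \<oplus> q" "lc b S v \<in> b" "lc b S v \<in> carrier R" "q \<in> carrier R"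
proof -
  obtain c q where "c \<in> k" "q \<in> sq b" "f = c \<oplus> lc b S v \<oplus> q" using assms unfolding grad_def by blast
  then show ?thesis using that lc_closed[OF assms(2) subset_refl, of v] sq_carrier[OF assms(2)] assms(1) unfolding grad_def by blast
qed

lemma gradD: "grad f v \<Longrightarrow> v x \<in> carrier R" by (simp add: grad_def)

text \<open>Moving the base point from a to b changes each centred coordinate by a constant, so a
  form with constant coefficients changes only by a constant.\<close>

lemma grad_linear:
  assumes a: "maximalideal a R" and \<gamma>: "\<And>x. \<gamma> x \<in> k" shows "grad (lc a S \<gamma>) \<gamma>"
  unfolding grad_def
proof (intro conjI allI impI)
  fix b assume b: "maximalideal b R"
  have "\<exists>c\<in>k. lc a T \<gamma> = c \<oplus> lc b T \<gamma>" if "T \<subseteq> S" for T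
    using finite_subset[OF that S_finite] that
  proof (induction T rule: finite_induct)
    case empty
    show ?case by (intro bexI[of _ \<zero>]) (auto simp: lc_def)
  next
    case (insert x T)
    then obtain c where c: "c \<in> k" "lc a T \<gamma> = c \<oplus> lc b T \<gamma>" by blast
    have x: "x \<in> S" "x \<in> carrier R" and T: "T \<subseteq> S" using insert by auto
    obtain c1 where c1: "c1 \<in> k" "x = c1 \<oplus> ep a x" using ep(3)[OF a x(2)] by blast
    obtain c2 where c2: "c2 \<in> k" "x = c2 \<oplus> ep b x" using ep(3)[OF b x(2)] by blast
    have ins: "lc b' (insert x T) \<gamma> = \<gamma> x \<otimes> ep b' x \<oplus> lc b' T \<gamma>" if b': "maximalideal b' R" for b'
      unfolding lc_def by (rule finsum_insert) (use insert ep(2)[OF b'] \<gamma> in auto)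
    have cancel: "(c' \<oplus> e) \<ominus> c' = e" if "e \<in> carrier R" "c' \<in> k" for e c' using that(1) k.LD[OF that(2)] by algebra
    have e1: "ep a x = x \<ominus> c1" using cancel[OF ep(2)[OF a x(2)] c1(1)] c1(2) by simp
    have e2: "ep b x = x \<ominus> c2" using cancel[OF ep(2)[OF b x(2)] c2(1)] c2(2) by simp
    have "g \<otimes> (y \<ominus> c1) \<oplus> (c \<oplus> l) = (c \<oplus> g \<otimes> (c2 \<ominus> c1)) \<oplus> (g \<otimes> (y \<ominus> c2) \<oplus> l)"
      if "g \<in> carrier R" "l \<in> carrier R" "y \<in> carrier R" for g l y
      using that k.LD[OF c1(1)] k.LD[OF c2(1)] k.LD[OF c(1)] by algebra
    from this[of "\<gamma> x" "lc b T \<gamma>" x]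
    have "lc a (insert x T) \<gamma> = (c \<oplus> \<gamma> x \<otimes> (c2 \<ominus> c1)) \<oplus> lc b (insert x T) \<gamma>"
      unfolding ins[OF a] ins[OF b] c(2) e1 e2 using lc_closed(2)[OF b T] \<gamma> x by simp
    moreover have "c \<oplus> \<gamma> x \<otimes> (c2 \<ominus> c1) \<in> k" using c c1 c2 \<gamma> by (simp add: a_minus_def)
    ultimately show ?case by blast
  qed
  then obtain c where c: "c \<in> k" "lc a S \<gamma> = c \<oplus> lc b S \<gamma>" by blast
  have "lc a S \<gamma> = c \<oplus> lc b S \<gamma> \<oplus> \<zero>" using c lc_closed(2)[OF b subset_refl, of \<gamma>] \<gamma> by simp
  then show "\<exists>c\<in>k. \<exists>q\<in>sq b. lc a S \<gamma> = c \<oplus> lc b S \<gamma> \<oplus> q" using c(1) lspan.lspan_zero by blast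
qed (use \<gamma> in auto)

lemma grad_add:
  assumes f: "grad f v" "grad g w" shows "grad (f \<oplus> g) (\<lambda>x. v x \<oplus> w x)"
  unfolding grad_def
proof (intro conjI allI impI)
  show "v x \<oplus> w x \<in> carrier R" for x using gradD f by auto
  fix b assume b: "maximalideal b R"
  obtain c q where 1: "c \<in> k" "q \<in> sq b" "f = c \<oplus> lc b S v \<oplus> q" "lc b S v \<in> b" "lc b S v \<in> carrier R" "q \<in> carrier R"
    by (rule gradE[OF f(1) b])
  obtain c' q' where 2: "c' \<in> k" "q' \<in> sq b" "g = c' \<oplus> lc b S w \<oplus> q'" "lc b S w \<in> b" "lc b S w \<in> carrier R" "q' \<in> carrier R"
    by (rule gradE[OF f(2) b])
  have "c \<oplus> l \<oplus> q \<oplus> (c' \<oplus> l' \<oplus> q') = (c \<oplus> c') \<oplus> (l \<oplus> l') \<oplus> (q \<oplus> q')" if "l \<in> carrier R" "l' \<in> carrier R" for l l'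
    using that k.LD[OF 1(1)] k.LD[OF 2(1)] 1(6) 2(6) by algebra
  from this[OF 1(5) 2(5)] have "f \<oplus> g = (c \<oplus> c') \<oplus> lc b S (\<lambda>x. v x \<oplus> w x) \<oplus> (q \<oplus> q')"
    using 1(3) 2(3) lc_add[OF b subset_refl, of v w] gradD f by simp
  moreover have "c \<oplus> c' \<in> k" "q \<oplus> q' \<in> sq b" using 1 2 ideal_add[OF sq_ideal[OF b]] by auto
  ultimately show "\<exists>c\<in>k. \<exists>q\<in>sq b. f \<oplus> g = c \<oplus> lc b S (\<lambda>x. v x \<oplus> w x) \<oplus> q" by blast
qed

text \<open>The Leibniz rule. The functions f and g stand in for their values at b; the difference
  involves products of two elements of b and goes into the quadratic remainder.\<close>

lemma grad_mult:
  assumes f: "grad f v" "grad g w" "f \<in> carrier R" "g \<in> carrier R" shows "grad (f \<otimes> g) (\<lambda>x. f \<otimes> w x \<oplus> g \<otimes> v x)"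
  unfolding grad_def
proof (intro conjI allI impI)
  show "f \<otimes> w x \<oplus> g \<otimes> v x \<in> carrier R" for x using gradD f by auto
  fix b assume b: "maximalideal b R"
  obtain c q where 1: "c \<in> k" "q \<in> sq b" "f = c \<oplus> lc b S v \<oplus> q" "lc b S v \<in> b" "lc b S v \<in> carrier R" "q \<in> carrier R"
    by (rule gradE[OF f(1) b])
  obtain c' q' where 2: "c' \<in> k" "q' \<in> sq b" "g = c' \<oplus> lc b S w \<oplus> q'" "lc b S w \<in> b" "lc b S w \<in> carrier R" "q' \<in> carrier R"
    by (rule gradE[OF f(2) b])
  let ?q = "c \<otimes> q' \<oplus> c' \<otimes> q \<oplus> q \<otimes> q' \<ominus> lc b S v \<otimes> lc b S w"
  have "f = c \<oplus> l \<oplus> q \<Longrightarrow> g = c' \<oplus> l' \<oplus> q' \<Longrightarrow>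
      f \<otimes> g = c \<otimes> c' \<oplus> (f \<otimes> l' \<oplus> g \<otimes> l) \<oplus> (c \<otimes> q' \<oplus> c' \<otimes> q \<oplus> q \<otimes> q' \<ominus> l \<otimes> l')"
    if "l \<in> carrier R" "l' \<in> carrier R" for l l'
    using that k.LD[OF 1(1)] k.LD[OF 2(1)] 1(6) 2(6) f(3,4) by algebra
  from this[OF 1(5) 2(5) 1(3) 2(3)]
  have "f \<otimes> g = c \<otimes> c' \<oplus> (f \<otimes> lc b S w \<oplus> g \<otimes> lc b S v) \<oplus> ?q" .
  also have "f \<otimes> lc b S w \<oplus> g \<otimes> lc b S v = lc b S (\<lambda>x. f \<otimes> w x \<oplus> g \<otimes> v x)"
    using lc_add[OF b subset_refl, of "\<lambda>x. f \<otimes> w x" "\<lambda>x. g \<otimes> v x"] lc_scal[OF b subset_refl, of w f]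
      lc_scal[OF b subset_refl, of v g] gradD[OF f(1)] gradD[OF f(2)] f(3,4) by simp
  finally have "f \<otimes> g = c \<otimes> c' \<oplus> lc b S (\<lambda>x. f \<otimes> w x \<oplus> g \<otimes> v x) \<oplus> ?q" .
  moreover have "?q \<in> sq b"
    using 1 2 ideal.I_l_closed[OF sq_ideal[OF b]] sq_prod[OF b]
    by (intro ideal_minus[OF sq_ideal[OF b]] ideal_add[OF sq_ideal[OF b]]) auto
  moreover have "c \<otimes> c' \<in> k" using 1 2 by simp
  ultimately show "\<exists>c\<in>k. \<exists>q\<in>sq b. f \<otimes> g = c \<oplus> lc b S (\<lambda>x. f \<otimes> w x \<oplus> g \<otimes> v x) \<oplus> q" by blast
qed

lemma grad_const: assumes c: "c \<in> k" shows "grad c (\<lambda>_. \<zero>)"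
  unfolding grad_def
proof (intro conjI allI impI)
  fix b assume b: "maximalideal b R"
  have "c = c \<oplus> lc b S (\<lambda>_. \<zero>) \<oplus> \<zero>" using lc_zero[OF b subset_refl] c by simp
  then show "\<exists>c'\<in>k. \<exists>q\<in>sq b. c = c' \<oplus> lc b S (\<lambda>_. \<zero>) \<oplus> q" using c lspan.lspan_zero by blast
qed auto

lemma grad_exists: "f \<in> carrier R \<Longrightarrow> \<exists>v. grad f v"
proof (induction f rule: affine_induct)
  case (S x)
  have "grad x (\<lambda>z. if z = x then \<one> else \<zero>)" unfolding grad_def
  proof (intro conjI allI impI)
    fix b assume b: "maximalideal b R"
    obtain c where c: "c \<in> k" "x = c \<oplus> ep b x" using ep(3)[OF b, of x] S by auto
    have "lc b S (\<lambda>z. if z = x then \<one> else \<zero>) = ep b x" using lc_delta[OF b subset_refl S, of \<one>] ep(2)[OF b, of x] S by simp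
    then have "x = c \<oplus> lc b S (\<lambda>z. if z = x then \<one> else \<zero>) \<oplus> \<zero>" using c S by simp
    then show "\<exists>c\<in>k. \<exists>q\<in>sq b. x = c \<oplus> lc b S (\<lambda>z. if z = x then \<one> else \<zero>) \<oplus> q"
      using c(1) lspan.lspan_zero by blast
  qed simp
  then show ?case by blast
next
  case (uminus x)
  then obtain v where "grad x v" by blast
  then have "grad ((\<ominus> \<one>) \<otimes> x) (\<lambda>z. (\<ominus> \<one>) \<otimes> v z \<oplus> x \<otimes> \<zero>)"
    by (intro grad_mult grad_const) (use uminus in auto)
  then show ?case using uminus by (auto simp: l_minus)
qed (use grad_const grad_add grad_mult in blast)+

text \<open>By the Leibniz rule a product of two elements of a has a gradient with all entries in
  a.\<close>

lemma grad_sq: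
  assumes a: "maximalideal a R" and q: "q \<in> sq a" shows "\<exists>v. grad q v \<and> (\<forall>x. v x \<in> a)"
  using q
proof (induction q rule: lspan.induct)
  interpret a: maximalideal a R by (rule a)
  case lspan_zero
  show ?case using grad_const[OF k.L_zero] by (intro exI[of _ "\<lambda>_. \<zero>"]) auto
next
  interpret a: maximalideal a R by (rule a)
  case (lspan_step s l x)
  then obtain v where v: "grad s v" "\<forall>x. v x \<in> a" by blast
  have c: "l \<in> carrier R" "x \<in> carrier R" using lspan_step a.Icarr by auto
  obtain w w' where w: "grad l w" "grad x w'" using grad_exists c by metis
  have "grad (s \<oplus> l \<otimes> x) (\<lambda>z. v z \<oplus> (l \<otimes> w' z \<oplus> x \<otimes> w z))" by (rule grad_add[OF v(1) grad_mult[OF w c]])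
  moreover have "v z \<oplus> (l \<otimes> w' z \<oplus> x \<otimes> w z) \<in> a" for z
    using v lspan_step(2,3) a.I_r_closed gradD[OF w(1)] gradD[OF w(2)] by simp
  ultimately show ?case by (intro exI[of _ "\<lambda>z. v z \<oplus> (l \<otimes> w' z \<oplus> x \<otimes> w z)"]) simp
qed

end

section \<open>Openness of the regular locus\<close>

context affine_alg
begin

text \<open>F spans the cotangent space a modulo a^2 over k, since coefficients outside a become
  nonzero constants. The centred coordinates span it too, so a basis is selected among them, and the
  exchange lemma bounds its size by that of F.\<close>

lemma cotangent_basis:
  assumes a: "maximalideal a R" and F: "finite F" "F \<subseteq> a" "\<forall>x\<in>a. \<exists>t\<in>carrier R - a. t \<otimes> x \<in> Idl F"
  shows "\<exists>I\<subseteq>S. card I \<le> card F \<and>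
     (\<forall>y\<in>S. \<exists>c. (\<forall>x. c x \<in> k) \<and> (\<exists>q\<in>sq a. ep a y = lc a I c \<oplus> q))"
proof -
  interpret a: maximalideal a R by (rule a)
  interpret Q: ideal "sq a" R by (rule sq_ideal[OF a])
  interpret K: lin_ctx R k "{\<zero>}" "sq a" by (rule k_ctx_ideal[OF Q.is_ideal])
  have Fc: "F \<subseteq> carrier R" using F(2) a.Icarr by blast
  have Idl: "\<exists>s\<in>lspan R k F. \<exists>q\<in>sq a. g = s \<oplus> q" if "g \<in> Idl F" for g
    using that unfolding Idl_lspan[OF Fc]
  proof (induction g rule: lspan.induct)
    case lspan_zero
    show ?case using lspan.lspan_zero[of R k F] Q.zero_closed by (metis r_zero zero_closed)
  next
    case (lspan_step g f r)
    then obtain s q where s: "s \<in> lspan R k F" "q \<in> sq a" "g = s \<oplus> q" by blast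
    obtain c where c: "c \<in> k" "r \<ominus> c \<in> a" using maximal_residue[OF a] lspan_step by blast
    have cc: "s \<in> carrier R" "q \<in> carrier R" "f \<in> carrier R" using k.lspan_carrier[OF s(1) Fc] s Q.Icarr lspan_step Fc by auto
    have "f \<otimes> (r \<ominus> c) \<in> sq a" using sq_prod[OF a] lspan_step F c by blast
    then have "q \<oplus> f \<otimes> (r \<ominus> c) \<in> sq a" using s by simp
    moreover have "s \<oplus> c \<otimes> f \<in> lspan R k F" using s c lspan_step by (auto intro: lspan.lspan_step)
    moreover have "g \<oplus> f \<otimes> r = (s \<oplus> c \<otimes> f) \<oplus> (q \<oplus> f \<otimes> (r \<ominus> c))"
      unfolding s(3) using cc lspan_step(3) k.LD[OF c(1)] by algebra
    ultimately show ?case by blast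
  qed
  have epF: "ep a x \<in> K.cl F" if x: "x \<in> S" for x
  proof -
    have e: "ep a x \<in> a" "ep a x \<in> carrier R" using ep[OF a, of x] x by auto
    obtain t where t: "t \<in> carrier R" "t \<notin> a" "t \<otimes> ep a x \<in> Idl F" using F(3) e by blast
    obtain s q where s: "s \<in> lspan R k F" "q \<in> sq a" "t \<otimes> ep a x = s \<oplus> q" using Idl[OF t(3)] by blast
    obtain c where c: "c \<in> k" "t \<ominus> c \<in> a" using maximal_residue[OF a t(1)] by blast
    have c0: "c \<noteq> \<zero>" using c t by (auto simp: a_minus_def)
    have "q \<ominus> (t \<ominus> c) \<otimes> ep a x \<in> sq a"
      by (rule ideal_minus[OF Q.is_ideal s(2) sq_prod[OF a c(2) e(1)]])
    moreover have "c \<otimes> ep a x = t \<otimes> ep a x \<ominus> (t \<ominus> c) \<otimes> ep a x" using k.LD[OF c(1)] t(1) e(2) by algebra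
    then have "c \<otimes> ep a x = s \<oplus> (q \<ominus> (t \<ominus> c) \<otimes> ep a x)"
      unfolding s(3) using k.lspan_carrier[OF s(1) Fc] Q.Icarr[OF s(2)] k.LD[OF c(1)] t(1) e(2) by algebra
    ultimately show ?thesis unfolding K.cl_def using c c0 s(1) e(2) by blast
  qed
  have ec: "ep a ` S \<subseteq> carrier R" using ep(2)[OF a] by auto
  obtain B where B: "B \<subseteq> ep a ` S" "K.indep B" "ep a ` S \<subseteq> K.cl B" using K.basis_exists[OF _ ec] by auto
  have BF: "card B \<le> card F" by (rule K.steinitz[OF B(2) F(1) Fc]) (use B(1) epF in blast)
  obtain I where I: "I \<subseteq> S" "inj_on (ep a) I" "B = ep a ` I" using B(1) subset_image_inj by metis
  have Ie: "ep a x \<in> carrier R" if "x \<in> I" for x using ep(2)[OF a] I that by auto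
  have fI: "finite I" using I finite_subset S_finite by blast
  have Bc: "finite B" "B \<subseteq> carrier R" using B(2) by (auto simp: K.indep_def)
  have "\<exists>c. (\<forall>x. c x \<in> k) \<and> (\<exists>q\<in>sq a. ep a y = lc a I c \<oplus> q)" if y: "y \<in> S" for y
  proof -
    have "ep a y \<in> K.cl B" using B(3) y by blast
    then obtain s q where s: "s \<in> lspan R k B" "q \<in> sq a" "ep a y = s \<oplus> q" using kcl[OF Q.is_ideal Bc(2)] by blast
    obtain c where c: "c \<in> B \<rightarrow> k" "s = (\<Oplus>x\<in>B. c x \<otimes> x)" using k.lspan_repr[OF Bc s(1)] by blast
    let ?c = "\<lambda>x. if x \<in> I then c (ep a x) else \<zero>"
    have "s = (\<Oplus>x\<in>I. c (ep a x) \<otimes> ep a x)"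
      unfolding c(2) I(3) by (rule finsum_reindex[OF _ I(2)]) (use c(1) Ie I(3) in \<open>auto simp: Pi_def\<close>)
    also have "\<dots> = lc a I ?c" unfolding lc_def by (rule finsum_cong') (use c(1) Ie I(3) in \<open>auto simp: Pi_def\<close>)
    finally have "s = lc a I ?c" .
    moreover have "\<forall>x. ?c x \<in> k" using c(1) I(3) by (auto simp: Pi_def)
    ultimately show ?thesis using s by (intro exI[of _ ?c]) blast
  qed
  moreover have "card I \<le> card F" using BF I(2,3) card_image[OF I(2)] by simp
  ultimately show ?thesis using I(1) by blast
qed

text \<open>A substitute for a row of the Jacobian matrix when no presentation of R is at hand. The
  element q = \<open>ep a y\<close> - \<open>lc a I c\<close> of a^2 has two gradients: the constant
  one of the linear form, and one with entries in a. Their difference is a linear relation modulo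
  b^2 at every closed point b.\<close>

lemma jacobian_row:
  assumes a: "maximalideal a R" and I: "I \<subseteq> S" and y: "y \<in> S - I"
    and c: "\<And>x. c x \<in> k" "q \<in> sq a" "ep a y = lc a I c \<oplus> q"
  shows "\<exists>w. (\<forall>x. w x \<in> carrier R) \<and> w y \<notin> a \<and> (\<forall>x\<in>S - I - {y}. w x \<in> a) \<and>
     (\<forall>b. maximalideal b R \<longrightarrow> lc b S w \<in> sq b)"
proof -
  interpret a: maximalideal a R by (rule a)
  let ?\<gamma> = "\<lambda>x. if x = y then \<one> else if x \<in> I then \<ominus> c x else \<zero>"
  have \<gamma>k: "?\<gamma> x \<in> k" for x using c(1) by simp
  have \<gamma>c: "?\<gamma> x \<in> carrier R" for x using k.LD[OF \<gamma>k] .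
  have L: "lc a I c \<in> carrier R" using lc_closed(2)[OF a I] c(1) by simp
  have qc: "q \<in> carrier R" using sq_carrier[OF a c(2)] .
  have "lc a I ?\<gamma> = lc a I (\<lambda>x. (\<ominus> \<one>) \<otimes> c x)"
    by (rule lc_cong[OF a I \<gamma>c]) (use y c(1) in \<open>auto simp: l_minus\<close>)
  also have "\<dots> = (\<ominus> \<one>) \<otimes> lc a I c" by (rule lc_scal[OF a I]) (use c(1) in auto)
  also have "\<dots> = \<ominus> lc a I c" using L by (simp add: l_minus)
  finally have 1: "lc a I ?\<gamma> = \<ominus> lc a I c" .
  have "lc a (S - I) ?\<gamma> = lc a (S - I) (\<lambda>x. if x = y then \<one> else \<zero>)" by (rule lc_cong[OF a _ \<gamma>c]) auto
  also have "\<dots> = \<one> \<otimes> ep a y" by (rule lc_delta[OF a]) (use y in auto)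
  also have "\<dots> = lc a I c \<oplus> q" using c(3) L qc by simp
  finally have "lc a S ?\<gamma> = \<ominus> lc a I c \<oplus> (lc a I c \<oplus> q)" using lc_split[OF a I \<gamma>c] 1 by simp
  also have "\<dots> = q" using L qc by (simp add: r_neg1)
  finally have \<gamma>q: "lc a S ?\<gamma> = q" .
  obtain v where v: "grad q v" "\<forall>x. v x \<in> a" using grad_sq[OF a c(2)] by blast
  have vc: "v x \<in> carrier R" for x using gradD[OF v(1)] .
  let ?w = "\<lambda>x. ?\<gamma> x \<oplus> (\<ominus> \<one>) \<otimes> v x"
  have wc: "?w x \<in> carrier R" for x using \<gamma>c vc by simp
  have "lc b S ?w \<in> sq b" if b: "maximalideal b R" for b
  proof -
    interpret b: maximalideal b R by (rule b)
    interpret Q: ideal "sq b" R by (rule sq_ideal[OF b])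
    have g: "grad q ?\<gamma>" using grad_linear[OF a, of ?\<gamma>] \<gamma>k \<gamma>q by simp
    obtain c1 q1 where 1: "c1 \<in> k" "q1 \<in> sq b" "q = c1 \<oplus> lc b S ?\<gamma> \<oplus> q1" "lc b S ?\<gamma> \<in> b" "lc b S ?\<gamma> \<in> carrier R" "q1 \<in> carrier R"
      by (rule gradE[OF g b])
    obtain c2 q2 where 2: "c2 \<in> k" "q2 \<in> sq b" "q = c2 \<oplus> lc b S v \<oplus> q2" "lc b S v \<in> b" "lc b S v \<in> carrier R" "q2 \<in> carrier R"
      by (rule gradE[OF v(1) b])
    have id: "l \<oplus> (\<ominus> \<one>) \<otimes> l' = ((c1 \<oplus> l \<oplus> q1) \<ominus> (c2 \<oplus> l' \<oplus> q2)) \<oplus> (c2 \<ominus> c1) \<oplus> (q2 \<ominus> q1)" if "l \<in> carrier R" "l' \<in> carrier R" for l l'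
      using that k.LD[OF 1(1)] k.LD[OF 2(1)] 1(6) 2(6) by algebra
    have cc: "c2 \<ominus> c1 \<in> carrier R" "q2 \<ominus> q1 \<in> carrier R" using k.LD[OF 1(1)] k.LD[OF 2(1)] 1(6) 2(6) by auto
    have "lc b S ?w = lc b S ?\<gamma> \<oplus> lc b S (\<lambda>x. (\<ominus> \<one>) \<otimes> v x)" by (rule lc_add[OF b subset_refl \<gamma>c]) (use vc in simp)
    also have "\<dots> = lc b S ?\<gamma> \<oplus> (\<ominus> \<one>) \<otimes> lc b S v" using lc_scal[OF b subset_refl vc, of "\<ominus> \<one>"] by simp
    also have "\<dots> = (q \<ominus> q) \<oplus> (c2 \<ominus> c1) \<oplus> (q2 \<ominus> q1)" using id[OF 1(5) 2(5)] unfolding 1(3)[symmetric] 2(3)[symmetric] .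
    also have "\<dots> = (c2 \<ominus> c1) \<oplus> (q2 \<ominus> q1)" using qc cc by (simp add: a_minus_def r_neg)
    finally have w: "lc b S ?w = (c2 \<ominus> c1) \<oplus> (q2 \<ominus> q1)" .
    have q21: "q2 \<ominus> q1 \<in> sq b" using ideal_minus[OF Q.is_ideal 2(2) 1(2)] .
    have "lc b S ?w \<ominus> (q2 \<ominus> q1) \<in> b"
      by (rule ideal_minus[OF b.is_ideal lc_closed(1)[OF b subset_refl wc] sq_sub[OF b q21]])
    moreover have "(c' \<oplus> q') \<ominus> q' = c'" if "c' \<in> carrier R" "q' \<in> carrier R" for c' q' using that by algebra
    \<comment> \<open>Subtracting the two expansions leaves a constant lying in b, hence
      zero.\<close>
    ultimately have "c2 \<ominus> c1 \<in> b" unfolding w using cc by simp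
    moreover have "c2 \<ominus> c1 \<in> k" using 1 2 by (simp add: a_minus_def)
    ultimately have "c2 \<ominus> c1 = \<zero>" using k_notin_prime[OF maximalideal_prime[OF b]] by blast
    then show ?thesis unfolding w using q21 cc by simp
  qed
  moreover have "?w y \<notin> a"
  proof
    assume "?w y \<in> a"
    then have "?w y \<oplus> v y \<in> a" using v(2) by simp
    moreover have "?w y \<oplus> v y = \<one>" using vc[of y] by (simp add: l_minus a_assoc l_neg)
    ultimately show False using a.one_imp_carrier a.I_notcarr by simp
  qed
  moreover have "?w x \<in> a" if "x \<in> S - I - {y}" for x
    using that v(2) a.I_l_closed by simp
  ultimately show ?thesis using wc by (intro exI[of _ ?w]) blast
qed

text \<open>Nakayama's lemma is used twice. At a, it expresses the coordinates outside I by those in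
  I modulo b^2, for all b avoiding one s; at each such b it then removes b^2. The coordinates in I
  keep generating, with the same bound on their number.\<close>

lemma regular_open:
  assumes a: "maximalideal a R" and F: "finite F" "F \<subseteq> a" "\<forall>x\<in>a. \<exists>t\<in>carrier R - a. t \<otimes> x \<in> Idl F"
  shows "\<exists>s\<in>carrier R - a. \<forall>b. maximalideal b R \<and> s \<notin> b \<longrightarrow>
    (\<exists>G. finite G \<and> G \<subseteq> b \<and> card G \<le> card F \<and> (\<forall>x\<in>b. \<exists>t\<in>carrier R - b. t \<otimes> x \<in> Idl G))"
proof -
  interpret a: maximalideal a R by (rule a)
  have ap: "primeideal a R" by (rule maximalideal_prime[OF a])
  obtain I where I: "I \<subseteq> S" "card I \<le> card F"
    and rep: "\<forall>y\<in>S. \<exists>c. (\<forall>x. c x \<in> k) \<and> (\<exists>q\<in>sq a. ep a y = lc a I c \<oplus> q)"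
    using cotangent_basis[OF assms] by (elim exE conjE)
  let ?Y = "S - I"
  have Y: "finite ?Y" "?Y \<subseteq> S" by auto
  \<comment> \<open>The ideal generated by b^2 and the centred coordinates from I.\<close>
  define E where "E b = {x. \<exists>w q. (\<forall>x. w x \<in> carrier R) \<and> q \<in> sq b \<and> x = lc b I w \<oplus> q}" for b
  have EI: "lc b I w \<oplus> q \<in> E b" if "\<And>x. w x \<in> carrier R" "q \<in> sq b" for b w q
    unfolding E_def using that by blast
  have Ei: "ideal (E b) R" if b: "maximalideal b R" for b
  proof (rule ideal_setI)
    interpret Q: ideal "sq b" R by (rule sq_ideal[OF b])
    show "E b \<subseteq> carrier R" unfolding E_def using lc_closed(2)[OF b I(1)] Q.Icarr by auto
    show "\<zero> \<in> E b" using EI[of "\<lambda>_. \<zero>" \<zero> b] lc_zero[OF b I(1)] by simp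
  next
    fix x y assume "x \<in> E b" "y \<in> E b"
    then obtain w q w' q' where e: "\<forall>x. w x \<in> carrier R" "q \<in> sq b" "x = lc b I w \<oplus> q"
      "\<forall>x. w' x \<in> carrier R" "q' \<in> sq b" "y = lc b I w' \<oplus> q'" unfolding E_def by blast
    interpret Q: ideal "sq b" R by (rule sq_ideal[OF b])
    have "l \<oplus> q \<oplus> (l' \<oplus> q') = (l \<oplus> l') \<oplus> (q \<oplus> q')" if "l \<in> carrier R" "l' \<in> carrier R" for l l'
      using that Q.Icarr[OF e(2)] Q.Icarr[OF e(5)] by algebra
    then have "x \<oplus> y = lc b I (\<lambda>x. w x \<oplus> w' x) \<oplus> (q \<oplus> q')"
      unfolding e(3,6) using lc_add[OF b I(1), of w w'] lc_closed(2)[OF b I(1)] e(1,4) by simp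
    then show "x \<oplus> y \<in> E b" using EI[of "\<lambda>x. w x \<oplus> w' x" "q \<oplus> q'" b] e by simp
  next
    fix x r assume "x \<in> E b" and r: "r \<in> carrier R"
    then obtain w q where e: "\<forall>x. w x \<in> carrier R" "q \<in> sq b" "x = lc b I w \<oplus> q" unfolding E_def by blast
    interpret Q: ideal "sq b" R by (rule sq_ideal[OF b])
    have "r \<otimes> x = lc b I (\<lambda>x. r \<otimes> w x) \<oplus> r \<otimes> q"
      unfolding e(3) using lc_scal[OF b I(1), of w r] lc_closed(2)[OF b I(1), of w] e r Q.Icarr[OF e(2)] by (simp add: r_distr)
    then show "r \<otimes> x \<in> E b" using EI[of "\<lambda>x. r \<otimes> w x" "r \<otimes> q" b] e r Q.I_l_closed by simp
  qed
  \<comment> \<open>Membership is required at all closed points simultaneously, so the s obtained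
    from Nakayama's lemma at a does not depend on b.\<close>
  define N where "N = {v. (\<forall>x. v x \<in> carrier R) \<and> (\<forall>b. maximalideal b R \<longrightarrow> lc b S v \<in> E b)}"
  have N: "\<exists>s\<in>carrier R - a. (\<lambda>i. if i = y then s else \<zero>) \<in> N" if y: "y \<in> ?Y" for y
  proof (rule nakayama_coordinates[OF ap Y(1) _ _ _ _ y])
    show "(\<lambda>i. v i \<oplus> w i) \<in> N" if "v \<in> N" "w \<in> N" for v w
      using that lc_add[OF _ subset_refl, of _ v w] ideal_add[OF Ei] unfolding N_def by simp
    show "(\<lambda>i. r \<otimes> v i) \<in> N" if "v \<in> N" "r \<in> carrier R" for v r
      using that lc_scal[OF _ subset_refl, of _ v r] ideal.I_l_closed[OF Ei] unfolding N_def by simp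
    show "v i \<in> carrier R" if "v \<in> N" for v i using that unfolding N_def by simp
    fix z assume z: "z \<in> ?Y"
    then obtain c q where c: "\<forall>x. c x \<in> k" "q \<in> sq a" "ep a z = lc a I c \<oplus> q" using rep by blast
    obtain w where w: "\<forall>x. w x \<in> carrier R" "w z \<notin> a" "\<forall>x\<in>?Y - {z}. w x \<in> a" "\<forall>b. maximalideal b R \<longrightarrow> lc b S w \<in> sq b"
      using jacobian_row[OF a I(1) z spec[OF c(1)] c(2,3)] by (elim exE conjE)
    let ?v = "\<lambda>x. if x \<in> ?Y then w x else \<zero>"
    have "lc b S ?v \<in> E b" if b: "maximalideal b R" for b
    proof -
      have Lc: "lc b I w \<in> carrier R" "lc b ?Y w \<in> carrier R" using lc_closed(2)[OF b] I(1) Y(2) w(1) by auto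
      have "lc b S ?v = lc b ?Y w" by (rule lc_restrict[OF b Y(2)]) (use w in auto)
      also have "lc b ?Y w = (\<ominus> \<one>) \<otimes> lc b I w \<oplus> (lc b I w \<oplus> lc b ?Y w)" using Lc by (simp add: l_minus r_neg1)
      also have "\<dots> = lc b I (\<lambda>x. (\<ominus> \<one>) \<otimes> w x) \<oplus> lc b S w"
        using lc_scal[OF b I(1), of w "\<ominus> \<one>"] lc_split[OF b I(1), of w] w(1) by simp
      finally show ?thesis using EI[of "\<lambda>x. (\<ominus> \<one>) \<otimes> w x" "lc b S w" b] w b by simp
    qed
    then have "?v \<in> N" unfolding N_def using w(1) by simp
    moreover have "?v z \<notin> a \<and> (\<forall>y'\<in>?Y - {z}. ?v y' \<in> a) \<and> (\<forall>y'. y' \<notin> ?Y \<longrightarrow> ?v y' = \<zero>)" using w z by auto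
    ultimately show "\<exists>v\<in>N. v z \<notin> a \<and> (\<forall>y'\<in>?Y - {z}. v y' \<in> a) \<and> (\<forall>y'. y' \<notin> ?Y \<longrightarrow> v y' = \<zero>)" by (rule bexI[of _ ?v, rotated])
  qed
  have Ny: "\<exists>s\<in>carrier R - a. \<forall>b. maximalideal b R \<longrightarrow> s \<otimes> ep b y \<in> E b" if y: "y \<in> ?Y" for y
  proof -
    obtain s where s: "s \<in> carrier R - a" "(\<lambda>i. if i = y then s else \<zero>) \<in> N" using N[OF y] by blast
    have "s \<otimes> ep b y \<in> E b" if b: "maximalideal b R" for b
      using s lc_delta[OF b subset_refl, of y s] y b unfolding N_def by auto
    then show ?thesis using s(1) by blast
  qed
  have "\<exists>s\<in>carrier R - a. \<forall>y\<in>?Y. \<forall>b. maximalideal b R \<longrightarrow> s \<otimes> ep b y \<in> E b"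
  proof (rule prime_common[OF ap Y(1) Ny])
    fix s t y assume h: "y \<in> ?Y" "s \<in> carrier R" "t \<in> carrier R" "\<forall>b. maximalideal b R \<longrightarrow> s \<otimes> ep b y \<in> E b"
    show "\<forall>b. maximalideal b R \<longrightarrow> t \<otimes> s \<otimes> ep b y \<in> E b"
    proof (intro allI impI)
      fix b assume b: "maximalideal b R"
      have "t \<otimes> (s \<otimes> ep b y) \<in> E b" using ideal.I_l_closed[OF Ei[OF b]] h b by blast
      then show "t \<otimes> s \<otimes> ep b y \<in> E b" using h ep(2)[OF b, of y] by (simp add: m_assoc)
    qed
  qed
  then obtain s where s: "s \<in> carrier R - a" "\<forall>y\<in>?Y. \<forall>b. maximalideal b R \<longrightarrow> s \<otimes> ep b y \<in> E b" by blast
  have "\<exists>G. finite G \<and> G \<subseteq> b \<and> card G \<le> card F \<and> (\<forall>x\<in>b. \<exists>t\<in>carrier R - b. t \<otimes> x \<in> Idl G)"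
    if b: "maximalideal b R" "s \<notin> b" for b
  proof -
    interpret b: maximalideal b R by (rule b)
    interpret Q: ideal "sq b" R by (rule sq_ideal[OF b(1)])
    have bp: "primeideal b R" by (rule maximalideal_prime[OF b(1)])
    let ?G = "ep b ` I"
    have fI: "finite I" using I finite_subset S_finite by blast
    have Gb: "?G \<subseteq> b" using ep(1)[OF b(1)] I(1) by auto
    then have Gc: "?G \<subseteq> carrier R" using b.Icarr by blast
    interpret G: ideal "Idl ?G" R by (rule genideal_ideal[OF Gc])
    have lcG: "lc b I v \<in> Idl ?G" if "\<And>x. v x \<in> carrier R" for v
      unfolding lc_def by (rule ideal_finsum[OF G.is_ideal fI]) (use that G.I_l_closed genideal_self[OF Gc] in auto)
    have epE: "ep b y \<in> E b" if y: "y \<in> ?Y" for y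
    proof -
      have e: "ep b y \<in> b" "ep b y \<in> carrier R" using ep[OF b(1), of y] y by auto
      \<comment> \<open>Away from s its residue c at b is nonzero; replacing s by c costs an element
        of b^2, and c can be inverted in k.\<close>
      obtain c where c: "c \<in> k" "s \<ominus> c \<in> b" using maximal_residue[OF b(1)] s(1) by blast
      have "c \<noteq> \<zero>" using c s(1) b(2) by (auto simp: a_minus_def)
      then obtain d where d: "d \<in> k" "c \<otimes> d = \<one>" using k_inv c by auto
      have sc: "s \<in> carrier R" using s by simp
      have "(s \<ominus> c) \<otimes> ep b y \<in> E b"
        using EI[of "\<lambda>_. \<zero>" "(s \<ominus> c) \<otimes> ep b y" b] lc_zero[OF b(1) I(1)] sq_prod[OF b(1) c(2) e(1)] e sc c by simp
      then have "s \<otimes> ep b y \<ominus> (s \<ominus> c) \<otimes> ep b y \<in> E b" using ideal_minus[OF Ei[OF b(1)]] s(2) y b(1) by blast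
      then have "d \<otimes> (s \<otimes> ep b y \<ominus> (s \<ominus> c) \<otimes> ep b y) \<in> E b" using ideal.I_l_closed[OF Ei[OF b(1)]] d by simp
      moreover have "d \<otimes> (s \<otimes> ep b y \<ominus> (s \<ominus> c) \<otimes> ep b y) = (c \<otimes> d) \<otimes> ep b y"
        using k.LD[OF c(1)] k.LD[OF d(1)] sc e(2) by algebra
      ultimately show ?thesis using d e by simp
    qed
    \<comment> \<open>The second application, now at b: an error in b^2 has coordinates in b by
      \<open>sq_rep\<close>, so the rows are again diagonal modulo the maximal ideal.\<close>
    define N' where "N' = {v. (\<forall>x. v x \<in> carrier R) \<and> lc b S v \<in> Idl ?G}"
    have N': "\<exists>t\<in>carrier R - b. (\<lambda>i. if i = y then t else \<zero>) \<in> N'" if y: "y \<in> ?Y" for y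
    proof (rule nakayama_coordinates[OF bp Y(1) _ _ _ _ y])
      show "(\<lambda>i. v i \<oplus> w i) \<in> N'" if "v \<in> N'" "w \<in> N'" for v w
        using that lc_add[OF b(1) subset_refl, of v w] unfolding N'_def by simp
      show "(\<lambda>i. r \<otimes> v i) \<in> N'" if "v \<in> N'" "r \<in> carrier R" for v r
        using that lc_scal[OF b(1) subset_refl, of v r] G.I_l_closed unfolding N'_def by simp
      show "v i \<in> carrier R" if "v \<in> N'" for v i using that unfolding N'_def by simp
      fix z assume z: "z \<in> ?Y"
      obtain w q where w: "\<forall>x. w x \<in> carrier R" "q \<in> sq b" "ep b z = lc b I w \<oplus> q" using epE[OF z] unfolding E_def by blast
      obtain v where v: "\<forall>x. v x \<in> b" "q = lc b S v" using sq_rep[OF b(1) w(2)] by blast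
      have vc: "v x \<in> carrier R" for x using v(1) b.Icarr by blast
      let ?\<delta> = "\<lambda>x. if x = z then \<one> else \<zero>"
      let ?u = "\<lambda>x. ?\<delta> x \<oplus> (\<ominus> \<one>) \<otimes> v x"
      let ?v = "\<lambda>x. if x \<in> ?Y then ?u x else \<zero>"
      have uc: "?u x \<in> carrier R" for x using vc by simp
      have L: "lc b I w \<in> carrier R" "lc b I v \<in> carrier R" "lc b ?Y v \<in> carrier R"
        using lc_closed(2)[OF b(1)] I(1) Y(2) w(1) vc by auto
      have "lc b S ?v = lc b ?Y ?u" by (rule lc_restrict[OF b(1) Y(2) uc])
      also have "\<dots> = lc b ?Y ?\<delta> \<oplus> lc b ?Y (\<lambda>x. (\<ominus> \<one>) \<otimes> v x)"
        by (rule lc_add[OF b(1) Y(2)]) (use vc in auto)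
      also have "lc b ?Y ?\<delta> = ep b z" using lc_delta[OF b(1) Y(2) z, of \<one>] ep(2)[OF b(1), of z] z by simp
      also have "\<dots> = lc b I w \<oplus> (lc b I v \<oplus> lc b ?Y v)" using w(3) v(2) lc_split[OF b(1) I(1) vc] by simp
      also have "lc b ?Y (\<lambda>x. (\<ominus> \<one>) \<otimes> v x) = (\<ominus> \<one>) \<otimes> lc b ?Y v" by (rule lc_scal[OF b(1) Y(2) vc]) simp
      also have "lc b I w \<oplus> (lc b I v \<oplus> lc b ?Y v) \<oplus> (\<ominus> \<one>) \<otimes> lc b ?Y v = lc b I w \<oplus> lc b I v"
        using L by (simp add: l_minus a_assoc r_neg)
      finally have "lc b S ?v \<in> Idl ?G" using lcG w(1) vc by simp
      then have "?v \<in> N'" unfolding N'_def using uc by simp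
      moreover have "?u z \<notin> b"
      proof
        assume "?u z \<in> b"
        then have "?u z \<oplus> v z \<in> b" using v(1) by simp
        moreover have "?u z \<oplus> v z = \<one>" using vc[of z] by (simp add: l_minus a_assoc l_neg)
        ultimately show False using b.one_imp_carrier b.I_notcarr by simp
      qed
      then have "?v z \<notin> b \<and> (\<forall>y'\<in>?Y - {z}. ?v y' \<in> b) \<and> (\<forall>y'. y' \<notin> ?Y \<longrightarrow> ?v y' = \<zero>)"
        using z v(1) b.I_l_closed by simp
      ultimately show "\<exists>v\<in>N'. v z \<notin> b \<and> (\<forall>y'\<in>?Y - {z}. v y' \<in> b) \<and> (\<forall>y'. y' \<notin> ?Y \<longrightarrow> v y' = \<zero>)" by (rule bexI[of _ ?v, rotated])
    qed
    have Gy: "\<exists>t\<in>carrier R - b. t \<otimes> ep b y \<in> Idl ?G" if y: "y \<in> S" for y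
    proof (cases "y \<in> I")
      case True
      have "ep b y \<in> Idl ?G" using genideal_self[OF Gc] True by blast
      moreover have "\<one> \<in> carrier R - b" using b.one_imp_carrier b.I_notcarr by auto
      ultimately show ?thesis using G.I_l_closed by blast
    next
      case False
      then obtain t where t: "t \<in> carrier R - b" "(\<lambda>i. if i = y then t else \<zero>) \<in> N'" using N'[of y] y by blast
      have "t \<otimes> ep b y \<in> Idl ?G" using t(2) lc_delta[OF b(1) subset_refl y, of t] t(1) unfolding N'_def by simp
      then show ?thesis using t(1) by blast
    qed
    have "\<exists>t\<in>carrier R - b. \<forall>y\<in>S. t \<otimes> ep b y \<in> Idl ?G"
      by (rule prime_common[OF bp S_finite Gy]) (use G.I_l_closed ep(2)[OF b(1)] in \<open>auto simp: m_assoc\<close>)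
    then obtain t where t: "t \<in> carrier R - b" "\<forall>y\<in>S. t \<otimes> ep b y \<in> Idl ?G" by blast
    have "t \<otimes> x \<in> Idl ?G" if x: "x \<in> b" for x
    proof -
      obtain v where v: "\<forall>x. v x \<in> carrier R" "x = lc b S v" using max_rep[OF b(1) x] by blast
      have "t \<otimes> x = lc b S (\<lambda>x. t \<otimes> v x)" using v lc_scal[OF b(1) subset_refl, of v t] t(1) by simp
      also have "\<dots> = (\<Oplus>x\<in>S. v x \<otimes> (t \<otimes> ep b x))"
        unfolding lc_def by (rule finsum_cong') (use v(1) t(1) ep(2)[OF b(1)] in \<open>auto simp: m_ac\<close>)
      also have "\<dots> \<in> Idl ?G" by (rule ideal_finsum[OF G.is_ideal S_finite]) (use t(2) v(1) G.I_l_closed in auto)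
      finally show ?thesis .
    qed
    moreover have "card ?G \<le> card F" using card_image_le[OF fI, of "ep b"] I(2) by simp
    ultimately show ?thesis using Gb fI t(1) by (intro exI[of _ ?G]) blast
  qed
  then show ?thesis using s(1) by blast
qed

end

text \<open>All local rings have dimension \<open>rdim\<close>, so the permitted number of
  generators is the same at every point and \<open>regular_open\<close> preserves regularity
  nearby.\<close>

lemma (in equidim_alg) Sing_closed: "zclosed R (Sing R)"
proof -
  let ?reg = "\<lambda>m. regular_local (localization R m) (loc_ext R m m)"
  have iff: "?reg m \<longleftrightarrow> (\<exists>F. finite F \<and> F \<subseteq> m \<and> card F \<le> rdim \<and> (\<forall>x\<in>m. \<exists>t\<in>carrier R - m. t \<otimes> x \<in> Idl F))"
    if m: "maximalideal m R" for m
    using primeideal.regular_local_loc[OF maximalideal_prime[OF m]] krull_dim_max[OF m] by simp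
  \<comment> \<open>The functions whose nonvanishing locus consists of regular points; their common
    zeros are exactly the singular points.\<close>
  let ?T = "{s \<in> carrier R. \<forall>b. maximalideal b R \<and> s \<notin> b \<longrightarrow> ?reg b}"
  have "?T \<subseteq> m" if m: "maximalideal m R" "\<not> ?reg m" for m
  proof
    fix s assume "s \<in> ?T"
    then have "\<forall>b. maximalideal b R \<and> s \<notin> b \<longrightarrow> ?reg b" by simp
    from spec[OF this, of m] show "s \<in> m" using m by simp
  qed
  moreover have "\<not> ?T \<subseteq> m" if m: "maximalideal m R" "?reg m" for m
  proof -
    obtain F where F: "finite F" "F \<subseteq> m" "card F \<le> rdim" "\<forall>x\<in>m. \<exists>t\<in>carrier R - m. t \<otimes> x \<in> Idl F"
      using m(2) unfolding iff[OF m(1)] by (elim exE conjE)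
    obtain s where s: "s \<in> carrier R - m" "\<forall>b. maximalideal b R \<and> s \<notin> b \<longrightarrow>
      (\<exists>G. finite G \<and> G \<subseteq> b \<and> card G \<le> card F \<and> (\<forall>x\<in>b. \<exists>t\<in>carrier R - b. t \<otimes> x \<in> Idl G))"
      using regular_open[OF m(1) F(1,2,4)] by (elim bexE)
    have "?reg b" if b: "maximalideal b R" "s \<notin> b" for b
    proof -
      obtain G where "finite G" "G \<subseteq> b" "card G \<le> card F" "\<forall>x\<in>b. \<exists>t\<in>carrier R - b. t \<otimes> x \<in> Idl G"
        using mp[OF spec[OF s(2), of b] conjI[OF b]] by (elim exE conjE)
      then show ?thesis unfolding iff[OF b(1)] using F(3) by (intro exI[of _ G] conjI) auto
    qed
    then have "s \<in> ?T" using s(1) by simp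
    then show ?thesis using s(1) by (meson DiffD2 subsetD)
  qed
  ultimately have "\<not> ?reg m \<longleftrightarrow> ?T \<subseteq> m" if "maximalideal m R" for m using that by meson
  then have "Sing R = {m \<in> MaxSpec R. ?T \<subseteq> m}" unfolding Sing_def MaxSpec_def mem_Collect_eq by (intro Collect_cong conj_cong refl) simp
  then show ?thesis unfolding zclosed_def by (intro exI[of _ ?T]) simp
qed

section \<open>Dense upper semi-continuity\<close>

text \<open>Closedness of C turns W into the set of closed points above a prime, where
  \<open>maximal_avoiding\<close> supplies points outside countably many hypersurfaces. Both C =
  \<open>MaxSpec R\<close> and C = \<open>Sing R\<close> are instances.\<close>

lemma (in equidim_alg) component_dense_usc:
  assumes C: "zclosed R C" and W: "irr_component (zclosed R) C W"
  shows "dense_usc_on (zclosed R) W (ehk_at R p)"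
proof -
  obtain T where T: "T \<subseteq> carrier R" "C = {m \<in> MaxSpec R. T \<subseteq> m}" using C unfolding zclosed_def by blast
  have WC: "W \<subseteq> C" and irr: "irreducible_set (zclosed R) W"
    and mx: "\<And>W'. W' \<subseteq> C \<Longrightarrow> irreducible_set (zclosed R) W' \<Longrightarrow> W \<subseteq> W' \<Longrightarrow> W' = W"
    using W unfolding irr_component_def by auto
  have Wmax: "maximalideal m R" if "m \<in> W" for m using that WC T(2) by (auto simp: MaxSpec_def)
  have Wi: "ideal m R" if "m \<in> W" for m using maximalideal.axioms(1)[OF Wmax[OF that]] .
  obtain m0 where m0: "m0 \<in> W" using irr unfolding irreducible_set_def by blast
  let ?V = "\<lambda>I. {m \<in> MaxSpec R. I \<subseteq> m}"
  have zV: "zclosed R (?V I)" if "I \<subseteq> carrier R" for I using that unfolding zclosed_def by blast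
  have dich: "W \<subseteq> Z1 \<or> W \<subseteq> Z2" if "zclosed R Z1" "zclosed R Z2" "W \<subseteq> Z1 \<union> Z2" for Z1 Z2
    using irr that unfolding irreducible_set_def by blast
  define P where "P = \<Inter>W"
  have PW: "P \<subseteq> m" if "m \<in> W" for m using that unfolding P_def by blast
  have PI: "x \<in> P" if "\<And>m. m \<in> W \<Longrightarrow> x \<in> m" for x using that unfolding P_def by blast
  have Pc: "P \<subseteq> carrier R" using PW[OF m0] idealD[OF Wi[OF m0]] by blast
  have Pi: "ideal P R"
  proof (rule ideal_setI[OF Pc])
    show "\<zero> \<in> P" using PI ideal_zero[OF Wi] by blast
    show "x \<oplus> y \<in> P" if "x \<in> P" "y \<in> P" for x y using that PI ideal_add[OF Wi] PW by blast
    show "r \<otimes> x \<in> P" if "x \<in> P" "r \<in> carrier R" for x r using that PI ideal.I_l_closed[OF Wi] PW by blast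
  qed
  have Pp: "primeideal P R"
  proof (rule primeidealI[OF Pi is_cring])
    show "carrier R \<noteq> P" using PW[OF m0] ideal.Icarr[OF Wi[OF m0]] maximalideal.I_notcarr[OF Wmax[OF m0]] by blast
    fix x y assume xy: "x \<in> carrier R" "y \<in> carrier R" "x \<otimes> y \<in> P"
    have "W \<subseteq> ?V {x} \<union> ?V {y}"
    proof
      fix m assume m: "m \<in> W"
      interpret m: primeideal m R by (rule maximalideal_prime[OF Wmax[OF m]])
      have "x \<in> m \<or> y \<in> m" using m.I_prime xy PW[OF m] by blast
      then show "m \<in> ?V {x} \<union> ?V {y}" using Wmax[OF m] by (auto simp: MaxSpec_def)
    qed
    then have "W \<subseteq> ?V {x} \<or> W \<subseteq> ?V {y}" using dich[OF zV[of "{x}"] zV[of "{y}"]] xy(1,2) by blast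
    then show "x \<in> P \<or> y \<in> P" unfolding P_def by blast
  qed
  have sub: "?V P \<subseteq> Z" if Z: "zclosed R Z" "W \<subseteq> Z" for Z
  proof -
    obtain Q where Q: "Z = ?V Q" using Z unfolding zclosed_def by blast
    have "Q \<subseteq> P" unfolding P_def using Z(2) Q by blast
    then show ?thesis unfolding Q by blast
  qed
  have WV: "W \<subseteq> ?V P" using PW Wmax by (auto simp: MaxSpec_def)
  have "irreducible_set (zclosed R) (?V P)"
    unfolding irreducible_set_def
  proof (intro conjI allI impI)
    show "?V P \<noteq> {}" using WV m0 by blast
    fix Z1 Z2 assume Z: "zclosed R Z1 \<and> zclosed R Z2 \<and> ?V P \<subseteq> Z1 \<union> Z2"
    then have "W \<subseteq> Z1 \<or> W \<subseteq> Z2" using dich[of Z1 Z2] subset_trans[OF WV] by simp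
    then show "?V P \<subseteq> Z1 \<or> ?V P \<subseteq> Z2" using sub Z by blast
  qed
  \<comment> \<open>W was only known to be a maximal irreducible subset. The zero set of P is
    irreducible, contains W and stays inside the closed set C, so the two agree.\<close>
  then have eq: "?V P = W" using mx[OF sub[OF C WC] _ WV] by blast
  show ?thesis unfolding dense_usc_on_def
  proof
    fix x assume x: "x \<in> W"
    \<comment> \<open>One hypersurface for each Frobenius exponent, none passing through x:
      countably many conditions.\<close>
    have "\<forall>e. \<exists>s. s \<in> carrier R - x \<and> (\<forall>n. maximalideal n R \<and> s \<notin> n \<longrightarrow> cdim (fp e n) \<le> cdim (fp e x))"
      using colength_semicontinuous[OF Wmax[OF x]] by blast
    from choice[OF this] obtain s where
      s: "\<forall>e. s e \<in> carrier R - x \<and> (\<forall>n. maximalideal n R \<and> s e \<notin> n \<longrightarrow> cdim (fp e n) \<le> cdim (fp e x))" by (elim exE)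
    let ?U = "{y \<in> W. \<forall>e. s e \<notin> y}"
    have "dense_in (zclosed R) W ?U" unfolding dense_in_def
    proof (intro conjI allI impI)
      fix Z assume Z: "zclosed R Z \<and> ?U \<subseteq> Z"
      then obtain Q where Q: "Q \<subseteq> carrier R" "Z = ?V Q" unfolding zclosed_def by blast
      have "Q \<subseteq> P"
      proof
        fix t assume t: "t \<in> Q"
        show "t \<in> P"
        proof (rule ccontr)
          assume tP: "t \<notin> P"
          \<comment> \<open>Adding t to the countable family yields a point of U at which t does not
            vanish, hence outside Z.\<close>
          let ?A = "insert t (range s)"
          have "?A \<inter> P = {}" using s PW[OF x] tP by auto
          moreover have "?A \<subseteq> carrier R" using s t Q(1) by auto
          ultimately obtain n where n: "maximalideal n R" "P \<subseteq> n" "?A \<inter> n = {}"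
            using maximal_avoiding[OF Pp, of ?A] by auto
          then have "n \<in> ?U" using eq by (auto simp: MaxSpec_def)
          then show False using Z Q(2) t n(3) by blast
        qed
      qed
      then show "W \<subseteq> Z" using Q(2) WV by blast
    qed auto
    moreover have "x \<in> ?U" using x s by simp
    moreover have "ehk_at R p y \<le> ehk_at R p x" if y: "y \<in> ?U" for y
    proof (rule LIMSEQ_le[OF ehk_limit ehk_limit])
      show "maximalideal y R" "maximalideal x R" using Wmax x y by auto
      have "cdim (fp e y) \<le> cdim (fp e x)" for e using s Wmax y by simp
      then show "\<exists>N. \<forall>e\<ge>N. real (cdim (fp e y)) / real (p ^ e) ^ rdim \<le> real (cdim (fp e x)) / real (p ^ e) ^ rdim"
        by (intro exI[of _ 0] allI impI divide_right_mono) auto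
    qed
    ultimately show "\<exists>U. dense_in (zclosed R) W U \<and> x \<in> U \<and> (\<forall>y\<in>U. ehk_at R p y \<le> ehk_at R p x)" by blast
  qed
qed

section \<open>Passage from the field K to its image in R\<close>

lemma (in algebraically_closed) poly_root:
  assumes "set bs \<subseteq> carrier L" "b \<in> carrier L" "b \<noteq> \<zero>" "bs \<noteq> []"
  shows "\<exists>x\<in>carrier L. eval (b # bs) x = \<zero>"
proof -
  have P: "b # bs \<in> carrier (poly_ring L)" using assms by (simp add: univ_poly_carrier[symmetric] polynomial_def)
  have "size (roots (b # bs)) = length bs" using roots_over_carrier[OF P] by (simp add: splitted_def)
  then have "roots (b # bs) \<noteq> {#}" using assms(4) by auto
  then obtain x where "x \<in># roots (b # bs)" by blast
  then have "is_root (b # bs) x" using roots_mem_iff_is_root[OF P] by simp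
  then show ?thesis unfolding is_root_def by blast
qed

text \<open>\<open>eval\<close> reads the leading coefficient first, \<open>horner\<close> the
  constant term; hence the \<open>rev\<close>.\<close>

lemma (in ring_hom_cring) horner_hom:
  assumes c: "c \<in> carrier R" and bs: "set bs \<subseteq> carrier R"
  shows "horner S (map h bs) (h c) = h (R.eval (rev bs) c)"
  using bs
proof (induction bs)
  case (Cons b bs)
  then have "R.eval (rev bs @ [b]) c = R.eval (rev bs) c \<otimes> c \<oplus> b"
    by (intro R.eval_append_aux) (use c in auto)
  moreover have "R.eval (rev bs) c \<in> carrier R" using Cons c R.eval_in_carrier by simp
  ultimately show ?case using Cons c by (simp add: S.m_comm S.a_comm)
qed simp

lemma (in cring) horner_snoc_zero:
  assumes "set as \<subseteq> carrier R" "y \<in> carrier R" shows "horner R (as @ [\<zero>]) y = horner R as y"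
  using assms by (induction as) auto

text \<open>Zero coefficients at the top are stripped from the end of the list. With a nonzero top
  coefficient the polynomial is either constant or of positive degree, and then has a root in the
  closed field.\<close>

lemma (in algebraically_closed) horner_root_or_constant:
  assumes hom: "ring_hom_cring L R h" and bs: "set bs \<subseteq> carrier L"
  shows "(\<exists>d\<in>h ` carrier L. horner R (map h bs) d = \<zero>\<^bsub>R\<^esub>) \<or>
    (\<exists>a\<in>h ` carrier L. a \<noteq> \<zero>\<^bsub>R\<^esub> \<and> (\<forall>y\<in>carrier R. horner R (map h bs) y = a))"
  using bs
proof (induction bs rule: rev_induct)
  case Nil
  then show ?case by auto
next
  case (snoc b bs)
  interpret h: ring_hom_cring L R h by (rule hom)
  have c: "set bs \<subseteq> carrier L" "b \<in> carrier L" "set (map h bs) \<subseteq> carrier R" using snoc by auto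
  show ?case
  proof (cases "b = \<zero>")
    case True
    then have "horner R (map h (bs @ [b])) y = horner R (map h bs) y" if "y \<in> carrier R" for y
      using h.S.horner_snoc_zero[OF c(3) that] by simp
    then show ?thesis using snoc.IH[OF c(1)] by auto
  next
    case b: False
    show ?thesis
    proof (cases "bs = []")
      case True
      have "\<forall>y\<in>carrier R. horner R (map h (bs @ [b])) y = h b" using True c(2) by simp
      then show ?thesis
      proof (cases "h b = \<zero>\<^bsub>R\<^esub>")
        case True
        then show ?thesis using \<open>\<forall>y\<in>_. _\<close> by auto
      qed (use c(2) in blast)
    next
      case False
      then obtain x where x: "x \<in> carrier L" "eval (b # rev bs) x = \<zero>" using poly_root[of "rev bs" b] b c by auto
      have "horner R (map h (bs @ [b])) (h x) = h (eval (rev (bs @ [b])) x)"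
        by (rule h.horner_hom[OF x(1)]) (use c in auto)
      then show ?thesis using x by auto
    qed
  qed
qed

text \<open>If p = a * b, one of the multiples of \<one> by a and b vanishes in the field, so by
  minimality that factor is at least p.\<close>

lemma (in field) char_prime:
  assumes "p > 0" "[p] \<cdot> \<one> = \<zero>" "\<forall>n. 0 < n \<and> n < p \<longrightarrow> [n] \<cdot> \<one> \<noteq> \<zero>"
  shows "Factorial_Ring.prime (p :: nat)"
  unfolding prime_nat_iff
proof (intro conjI allI impI)
  show "1 < p"
  proof (rule ccontr)
    assume "\<not> 1 < p"
    then have "p = 1" using assms(1) by simp
    then show False using assms(2) one_not_zero by simp
  qed
  fix a assume "a dvd p"
  then obtain b where b: "p = a * b" by blast
  have "([a] \<cdot> \<one>) \<otimes> ([b] \<cdot> \<one>) = [p] \<cdot> \<one>"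
    by (simp add: add_pow_ldistr add_pow_rdistr b add.nat_pow_pow mult.commute)
  then have "[a] \<cdot> \<one> = \<zero> \<or> [b] \<cdot> \<one> = \<zero>" using integral[of "[a] \<cdot> \<one>" "[b] \<cdot> \<one>"] assms(2) by simp
  moreover have pos: "0 < a" "0 < b" using b assms(1) by auto
  ultimately have "p \<le> a \<or> p \<le> b" using assms(3) not_less by blast
  then show "a = 1 \<or> a = p"
  proof
    assume "p \<le> a"
    then show ?thesis using b pos by (simp add: le_antisym)
  next
    assume "p \<le> b"
    then have "a * b \<le> 1 * b" using b by simp
    then show ?thesis using pos by simp
  qed
qed

lemma (in ring_hom_cring) hom_add_pow_one: "h ([(n::nat)] \<cdot> \<one>) = [n] \<cdot>\<^bsub>S\<^esub> \<one>\<^bsub>S\<^esub>"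
proof (induction n)
  case (Suc n)
  have "[Suc n] \<cdot> \<one> = [n] \<cdot> \<one> \<oplus> \<one>" "[Suc n] \<cdot>\<^bsub>S\<^esub> \<one>\<^bsub>S\<^esub> = [n] \<cdot>\<^bsub>S\<^esub> \<one>\<^bsub>S\<^esub> \<oplus>\<^bsub>S\<^esub> \<one>\<^bsub>S\<^esub>"
    by simp_all
  then show ?case using Suc hom_add[of "[n] \<cdot> \<one>" \<one>] by simp
qed simp

theorem theorem2p6:
  fixes K :: "('k, 'c) ring_scheme" and R :: "('a, 'b) ring_scheme"
    and \<phi> :: "'k \<Rightarrow> 'a" and p :: nat
  assumes "algebraically_closed K"
    and "\<not> countable (carrier K)"
    and "p > 0" and "add_pow K p \<one>\<^bsub>K\<^esub> = \<zero>\<^bsub>K\<^esub>"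
    and "\<forall>n. 0 < n \<and> n < p \<longrightarrow> add_pow K n \<one>\<^bsub>K\<^esub> \<noteq> \<zero>\<^bsub>K\<^esub>"
    and "cring R"
    and "finite_type_alg K R \<phi>"
    and "equidimensional R"
  shows "(\<forall>W. irr_component (zclosed R) (MaxSpec R) W \<longrightarrow> dense_usc_on (zclosed R) W (ehk_at R p))
       \<and> (\<forall>W. irr_component (zclosed R) (Sing R) W \<longrightarrow> dense_usc_on (zclosed R) W (ehk_at R p))"
proof (cases "\<one>\<^bsub>R\<^esub> = \<zero>\<^bsub>R\<^esub>")
  case True
  interpret R: cring R by (rule assms)
  \<comment> \<open>The zero ring is treated apart, because \<open>affine_alg\<close> contains
    \<one> \<noteq> \<zero>; it has no maximal ideals.\<close>
  have "MaxSpec R = {}"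
  proof (rule equals0I)
    fix m assume "m \<in> MaxSpec R"
    then interpret maximalideal m R by (simp add: MaxSpec_def)
    show False using one_imp_carrier True I_notcarr by simp
  qed
  then show ?thesis unfolding irr_component_def irreducible_set_def Sing_def by blast
next
  case False
  interpret K: algebraically_closed K by (rule assms)
  interpret R: cring R by (rule assms)
  obtain S where hom: "\<phi> \<in> ring_hom K R" and S: "finite S" "S \<subseteq> carrier R" "generate_ring R (\<phi> ` carrier K \<union> S) = carrier R"
    using assms(7) unfolding finite_type_alg_def by blast
  interpret h: ring_hom_cring K R \<phi>
    by (rule ring_hom_cringI[OF K.is_cring R.is_cring hom])
  let ?k = "\<phi> ` carrier K"
  have inv: "\<exists>d\<in>carrier K. c \<otimes>\<^bsub>K\<^esub> d = \<one>\<^bsub>K\<^esub>" if "c \<in> carrier K" "c \<noteq> \<zero>\<^bsub>K\<^esub>" for c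
    using that K.field_Units K.Units_r_inv_ex by blast
  \<comment> \<open>Injectivity carries uncountability from K over to its image in R.\<close>
  have inj: "inj_on \<phi> (carrier K)"
  proof (rule ring_hom_ring.trivial_ker_imp_inj[OF ring_hom_ringI2[OF K.ring_axioms R.ring_axioms hom]], rule ccontr)
    assume "a_kernel K R \<phi> \<noteq> {\<zero>\<^bsub>K\<^esub>}"
    then obtain c where c: "c \<in> carrier K" "c \<noteq> \<zero>\<^bsub>K\<^esub>" "\<phi> c = \<zero>\<^bsub>R\<^esub>"
      unfolding a_kernel_def' using h.hom_zero by blast
    obtain d where d: "d \<in> carrier K" "c \<otimes>\<^bsub>K\<^esub> d = \<one>\<^bsub>K\<^esub>" using inv c by blast
    have "\<one>\<^bsub>R\<^esub> = \<phi> c \<otimes>\<^bsub>R\<^esub> \<phi> d" using d c h.hom_mult h.hom_one by metis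
    then show False using False c d by simp
  qed
  interpret equidim_alg R p ?k S
  proof
    show "Factorial_Ring.prime p" by (rule K.char_prime[OF assms(3-5)])
    show "add_pow R p \<one>\<^bsub>R\<^esub> = \<zero>\<^bsub>R\<^esub>" using h.hom_add_pow_one[of p] assms(4) by simp
    show "\<one>\<^bsub>R\<^esub> \<in> ?k" using h.hom_one by (metis K.one_closed imageI)
    show "a \<oplus>\<^bsub>R\<^esub> b \<in> ?k" "a \<otimes>\<^bsub>R\<^esub> b \<in> ?k" if ab: "a \<in> ?k" "b \<in> ?k" for a b
    proof -
      obtain x y where "a = \<phi> x" "b = \<phi> y" "x \<in> carrier K" "y \<in> carrier K" using ab by blast
      then show "a \<oplus>\<^bsub>R\<^esub> b \<in> ?k" "a \<otimes>\<^bsub>R\<^esub> b \<in> ?k"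
        using h.hom_add[of x y] h.hom_mult[of x y] by (metis K.add.m_closed K.m_closed imageI)+
    qed
    show "\<ominus>\<^bsub>R\<^esub> a \<in> ?k" if "a \<in> ?k" for a
      using that h.hom_a_inv by (metis (no_types, lifting) K.a_inv_closed image_iff)
    show "\<exists>d\<in>?k. c \<otimes>\<^bsub>R\<^esub> d = \<one>\<^bsub>R\<^esub>" if c: "c \<in> ?k" "c \<noteq> \<zero>\<^bsub>R\<^esub>" for c
    proof -
      obtain x where x: "c = \<phi> x" "x \<in> carrier K" using c by blast
      have "x \<noteq> \<zero>\<^bsub>K\<^esub>" using c(2) x(1) h.hom_zero by metis
      then obtain y where y: "y \<in> carrier K" "x \<otimes>\<^bsub>K\<^esub> y = \<one>\<^bsub>K\<^esub>" using inv[OF x(2)] by auto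
      have "c \<otimes>\<^bsub>R\<^esub> \<phi> y = \<one>\<^bsub>R\<^esub>" using x y h.hom_mult[of x y] h.hom_one by simp
      then show ?thesis using y by blast
    qed
    show "(\<exists>d\<in>?k. horner R as d = \<zero>\<^bsub>R\<^esub>) \<or> (\<exists>a\<in>?k. a \<noteq> \<zero>\<^bsub>R\<^esub> \<and> (\<forall>y\<in>carrier R. horner R as y = a))"
      if as: "set as \<subseteq> ?k" for as
    proof -
      have "as \<in> lists ?k" using as by auto
      then have "as \<in> map \<phi> ` lists (carrier K)" by (simp add: lists_image)
      then obtain bs where bs: "as = map \<phi> bs" "set bs \<subseteq> carrier K" by auto
      show ?thesis unfolding bs(1) by (rule K.horner_root_or_constant[OF h.ring_hom_cring_axioms bs(2)])
    qed
    show "uncountable ?k" using assms(2) countable_image_inj_on[OF _ inj] by blast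
    show "?k \<subseteq> carrier R" by auto
  qed (use False S assms(8) in auto)
  \<comment> \<open>The whole spectrum is closed, cut out by the empty set, so both claims become
    instances of \<open>component_dense_usc\<close>.\<close>
  have "MaxSpec R = {m \<in> MaxSpec R. {} \<subseteq> m}" by simp
  then have "zclosed R (MaxSpec R)" unfolding zclosed_def by blast
  then show ?thesis using component_dense_usc Sing_closed by blast
qed

end
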